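(* For $(a,b)$ equal to $(1/12,5/12)$, $(1/12,7/12)$, $(1/8,3/8)$, $(1/8,5/8)$, $(1/6,1/3)$, $(1/6,2/3)$, $(1/4,1/4)$, $(1/4,3/4)$, let $N=1,1,2,2,3,3,4,4$ respectively. Let $f(t)={}_2F_1(a,b;1;t)$ and $F(t_1,t_2)=f(t_1)f(t_2)(1-t_1)^{(a+b)/2}(1-t_2)^{(a+b)/2}$, which (as a function of $x=t_1+t_2-2$, $y=(1-t_1)(1-t_2)$) solves the system $$D_x^2F+2D_xD_yF-\frac1{x+y+1}D_xF+\frac{x}{x+y+1}D_yF+\frac{(2ab-a-b)x}{2(x+y+1)}F=0,$$ $$D_y^2F+\frac{2y}{x^2}D_xD_yF+\frac{y^2}{x^2(x+y+1)}D_xF+\frac{y-x-x^2}{x(x+y+1)}D_yF-\frac{(a+b)(a+b-2)(x^2+x)+(a-b)^2xy-(4ab-2a-2b)y}{4x(x+y+1)}F=0.$$ Then in each case there is a modular function $t(\tau)$ on $\Gamma_0(N)^*$ such that, with $t_j=t(\tau_j)$, the function $F(t_1,t_2)$ is a modular form (of two variables) of weight $(1,1)$ on $\Gamma_0(N)^*\times\Gamma_0(N)^*$ (possibly with a character).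
   Context: $D_x=x\,\partial/\partial x$, $D_y=y\,\partial/\partial y$. $\Gamma_0(N)^*$ is the subgroup of $SL_2(\mathbb R)$ generated by $\Gamma_0(N)$ and the Atkin–Lehner involution $w_N=\frac1{\sqrt N}\begin{pmatrix}0&-1\\N&0\end{pmatrix}$ (so $\Gamma_0(1)^*=SL_2(\mathbb Z)$). A modular form (of two variables) of weight $(k_1,k_2)$ on $\Gamma_1\times\Gamma_2$ with character $\chi$ is a function $F$ meromorphic on $\mathbb H^*\times\mathbb H^*$ ($\mathbb H^*=\mathbb H\cup\mathbb Q\cup\{\infty\}$) with $F(\gamma_1\tau_1,\gamma_2\tau_2)=\chi(\gamma_1,\gamma_2)(c_1\tau_1+d_1)^{k_1}(c_2\tau_2+d_2)^{k_2}F(\tau_1,\tau_2)$ for all $\gamma_j=\begin{pmatrix}a_j&b_j\\c_j&d_j\end{pmatrix}\in\Gamma_j$; a modular function (of one variable) on $\Gamma$ is a meromorphic $\Gamma$-invariant function on $\mathbb H^*$.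
   Formalization: F(t_1,t_2) is taken as two-valued: its square is meromorphic and F obeys the weight (1,1) law, with its character, only up to sign; F itself has square-root branching at elliptic points (e.g. F^2=(E_6/E_4)(τ_1)(E_6/E_4)(τ_2) for N=1). The function t is required to be nonconstant. *)

theory Defs
  imports
    "HOL-Complex_Analysis.Complex_Analysis"
    "HOL-Algebra.Generated_Groups"
begin

section \<open>Holomorphic and meromorphic functions of two complex variables\<close>

text \<open>Complex differentiability at every point of \<open>S\<close>; only used for open \<open>S\<close>.\<close>

definition holomorphic2_on :: "(complex \<times> complex \<Rightarrow> complex) \<Rightarrow> (complex \<times> complex) set \<Rightarrow> bool"
    (infixl \<open>(holomorphic2'_on)\<close> 50) where
  "f holomorphic2_on S \<longleftrightarrow>
     (\<forall>p\<in>S. \<exists>A B. (f has_derivative (\<lambda>(h, k). A * h + B * k)) (at p))"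

definition D\<^sub>x :: "(complex \<times> complex \<Rightarrow> complex) \<Rightarrow> complex \<times> complex \<Rightarrow> complex" where
  "D\<^sub>x \<Psi> = (\<lambda>(x, y). x * deriv (\<lambda>u. \<Psi> (u, y)) x)"

definition D\<^sub>y :: "(complex \<times> complex \<Rightarrow> complex) \<Rightarrow> complex \<times> complex \<Rightarrow> complex" where
  "D\<^sub>y \<Psi> = (\<lambda>(x, y). y * deriv (\<lambda>v. \<Psi> (x, v)) y)"


section \<open>The groups\<close>

definition SL2R :: "(real^2^2) monoid" where
  "SL2R = \<lparr>carrier = {A. det A = 1}, mult = (**), one = mat 1\<rparr>"

definition Gamma0 :: "nat \<Rightarrow> (real^2^2) set" where
  "Gamma0 N = {A. det A = 1 \<and> (\<forall>i j. A $ i $ j \<in> \<int>) \<and> (\<exists>k::int. A $ 2 $ 1 = of_int k * real N)}"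

definition atkin_lehner :: "nat \<Rightarrow> real^2^2" where
  "atkin_lehner N = vector [vector [0, - 1 / sqrt (real N)], vector [real N / sqrt (real N), 0]]"

definition Gamma0_star :: "nat \<Rightarrow> (real^2^2) set" where
  "Gamma0_star N = generate SL2R (insert (atkin_lehner N) (Gamma0 N))"

definition upper_half :: "complex set" where
  "upper_half = {\<tau>. Im \<tau> > 0}"

definition moebius :: "real^2^2 \<Rightarrow> complex \<Rightarrow> complex" where
  "moebius A \<tau> = (of_real (A $ 1 $ 1) * \<tau> + of_real (A $ 1 $ 2)) /
                 (of_real (A $ 2 $ 1) * \<tau> + of_real (A $ 2 $ 2))"

definition aut_factor :: "real^2^2 \<Rightarrow> complex \<Rightarrow> complex" where
  "aut_factor A \<tau> = of_real (A $ 2 $ 1) * \<tau> + of_real (A $ 2 $ 2)"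

definition q_param :: "nat \<Rightarrow> complex \<Rightarrow> complex" where
  "q_param M z = exp (2 * of_real pi * \<i> * z / of_nat M)"


section \<open>Modular functions of one variable\<close>

text \<open>
  The cusps are the points \<open>\<sigma> \<infinity>\<close> with \<open>\<sigma>\<close> in \<open>SL\<^sub>2(\<int>)\<close>, which is \<^term>\<open>Gamma0 1\<close>. A function is
  meromorphic at \<open>\<sigma> \<infinity>\<close> if, after composition with \<open>\<sigma>\<close>, it is a meromorphic function of
  \<open>exp (2 \<pi> \<i> z / M)\<close> for some width \<open>M\<close>. The library value of a nicely meromorphic function
  at a pole is 0, so that invariance can be stated pointwise.
\<close>

definition modular_function :: "(real^2^2) set \<Rightarrow> (complex \<Rightarrow> complex) \<Rightarrow> bool" where
  "modular_function \<Gamma> t \<longleftrightarrow>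
     t nicely_meromorphic_on upper_half \<and>
     (\<forall>\<gamma>\<in>\<Gamma>. \<forall>\<tau>\<in>upper_half. t (moebius \<gamma> \<tau>) = t \<tau>) \<and>
     (\<forall>\<sigma>\<in>Gamma0 1. \<exists>M>0. \<exists>g Y. g meromorphic_on {0} \<and>
        (\<forall>z. Im z > Y \<and> z \<in> upper_half \<longrightarrow> t (moebius \<sigma> z) = g (q_param M z)))"


section \<open>Modular forms of two variables\<close>

text \<open>
  A chart is a triple \<open>(\<kappa>, u, j)\<close> describing a neighbourhood of a point of
  \<open>\<H>\<^sup>* = \<H> \<union> \<rat> \<union> {\<infinity>}\<close> by means of a variable \<open>z\<close> in \<open>\<H>\<close>: the point described is \<open>\<kappa> z\<close>, the local
  parameter (which vanishes at the point of \<open>\<H>\<^sup>*\<close> in question) is \<open>u z\<close>, and \<open>j z\<close> is the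
  automorphy factor to be divided out. At a cusp the parameter is \<open>exp (2 \<pi> \<i> z / M)\<close>.
\<close>

definition charts :: "nat \<Rightarrow> ((complex \<Rightarrow> complex) \<times> (complex \<Rightarrow> complex) \<times> (complex \<Rightarrow> complex)) set" where
  "charts M = {(\<lambda>z. z, \<lambda>z. z - P, \<lambda>z. 1) | P. P \<in> upper_half} \<union>
              {(moebius \<sigma>, q_param M, aut_factor \<sigma>) | \<sigma>. \<sigma> \<in> Gamma0 1}"

text \<open>
  Meromorphic on \<open>\<H>\<^sup>* \<times> \<H>\<^sup>*\<close>, for a form of weight \<open>(k1, k2)\<close>: near each pair of points it is a quotient
  of two functions holomorphic in the two local parameters. Values on the zero set of the
  denominator are irrelevant.
\<close>

definition meromorphic2_star :: "int \<Rightarrow> int \<Rightarrow> (complex \<times> complex \<Rightarrow> complex) \<Rightarrow> bool" where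
  "meromorphic2_star k1 k2 \<Phi> \<longleftrightarrow>
     (\<exists>M>0. \<forall>(\<kappa>1, u1, j1)\<in>charts M. \<forall>(\<kappa>2, u2, j2)\<in>charts M.
        \<exists>W g h. open W \<and> connected W \<and> (0, 0) \<in> W \<and>
          g holomorphic2_on W \<and> h holomorphic2_on W \<and> (\<exists>w\<in>W. h w \<noteq> 0) \<and>
          (\<forall>z1\<in>upper_half. \<forall>z2\<in>upper_half.
             (u1 z1, u2 z2) \<in> W \<and> h (u1 z1, u2 z2) \<noteq> 0 \<longrightarrow>
             \<Phi> (\<kappa>1 z1, \<kappa>2 z2) =
               j1 z1 powi k1 * j2 z2 powi k2 * (g (u1 z1, u2 z2) / h (u1 z1, u2 z2))))"

text \<open>
  A character on \<open>\<Gamma>1 \<times> \<Gamma>2\<close>, taken up to \<open>m\<close>-th roots of unity; for \<open>m = 1\<close> this is a homomorphism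
  to the multiplicative group of the complex numbers.
\<close>

definition character_mod :: "nat \<Rightarrow> (real^2^2) set \<Rightarrow> (real^2^2) set \<Rightarrow> (real^2^2 \<Rightarrow> real^2^2 \<Rightarrow> complex) \<Rightarrow> bool" where
  "character_mod m \<Gamma>1 \<Gamma>2 \<nu> \<longleftrightarrow>
     (\<forall>\<gamma>1\<in>\<Gamma>1. \<forall>\<gamma>2\<in>\<Gamma>2. \<nu> \<gamma>1 \<gamma>2 \<noteq> 0) \<and>
     (\<forall>\<gamma>1\<in>\<Gamma>1. \<forall>\<gamma>2\<in>\<Gamma>2. \<forall>\<delta>1\<in>\<Gamma>1. \<forall>\<delta>2\<in>\<Gamma>2. \<exists>\<zeta>. \<zeta> ^ m = 1 \<and>
        \<nu> (\<gamma>1 ** \<delta>1) (\<gamma>2 ** \<delta>2) = \<zeta> * \<nu> \<gamma>1 \<gamma>2 * \<nu> \<delta>1 \<delta>2)"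

text \<open>
  Modular forms are allowed to be \<open>m\<close>-valued, as is necessary for forms such as \<open>E\<^sub>4\<^bsup>1/4\<^esup>\<close>. Such a form \<open>F\<close>
  is given by its single-valued power \<open>\<Phi> = F ^ m\<close>, which has to be meromorphic on \<open>\<H>\<^sup>* \<times> \<H>\<^sup>*\<close>. The
  branches of \<open>F\<close> are the local holomorphic solutions \<open>\<phi>\<close> of \<open>\<phi> ^ m = \<Phi>\<close>, and it is for these that the
  transformation law of weight \<open>(k1, k2)\<close> is required: if \<open>\<phi>\<close> is a branch on \<open>U\<close> and \<open>\<psi>\<close> is a branch on
  the translate of \<open>U\<close>, the law holds up to the root of unity \<open>\<zeta>\<close> coming from the choice of the two
  branches. For \<open>m = 1\<close> there is one branch, \<open>\<zeta> = 1\<close>, and this is the usual notion of a meromorphic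
  modular form of two variables with character \<open>\<nu>\<close>.
\<close>

definition modular_form2 ::
  "nat \<Rightarrow> int \<Rightarrow> int \<Rightarrow> (real^2^2) set \<Rightarrow> (real^2^2) set \<Rightarrow> (real^2^2 \<Rightarrow> real^2^2 \<Rightarrow> complex) \<Rightarrow>
   (complex \<times> complex \<Rightarrow> complex) \<Rightarrow> bool" where
  "modular_form2 m k1 k2 \<Gamma>1 \<Gamma>2 \<nu> \<Phi> \<longleftrightarrow>
     m > 0 \<and>
     meromorphic2_star (int m * k1) (int m * k2) \<Phi> \<and>
     character_mod m \<Gamma>1 \<Gamma>2 \<nu> \<and>
     (\<forall>\<gamma>1\<in>\<Gamma>1. \<forall>\<gamma>2\<in>\<Gamma>2. \<forall>U \<phi> \<psi>.
        let \<gamma>U = map_prod (moebius \<gamma>1) (moebius \<gamma>2) ` U in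
        open U \<and> connected U \<and> U \<subseteq> upper_half \<times> upper_half \<and>
        \<phi> holomorphic2_on U \<and> (\<forall>p\<in>U. \<phi> p ^ m = \<Phi> p) \<and>
        \<psi> holomorphic2_on \<gamma>U \<and> (\<forall>p\<in>\<gamma>U. \<psi> p ^ m = \<Phi> p) \<longrightarrow>
        (\<exists>\<zeta>. \<zeta> ^ m = 1 \<and>
           (\<forall>(\<tau>1, \<tau>2)\<in>U.
              \<psi> (moebius \<gamma>1 \<tau>1, moebius \<gamma>2 \<tau>2) =
                \<zeta> * \<nu> \<gamma>1 \<gamma>2 * aut_factor \<gamma>1 \<tau>1 powi k1 * aut_factor \<gamma>2 \<tau>2 powi k2 * \<phi> (\<tau>1, \<tau>2))))"


section \<open>The hypergeometric function and the differential system\<close>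

text \<open>All of the following are meant for arguments in the unit disc; on it \<open>1 - t\<close> has positive real
  part, so that the principal power is holomorphic.\<close>

definition hyp_f :: "complex \<Rightarrow> complex \<Rightarrow> complex \<Rightarrow> complex" where
  "hyp_f a b t = eval_fps (fps_hypergeo [a, b] [1] 1) t"

definition hyp_F :: "complex \<Rightarrow> complex \<Rightarrow> complex \<Rightarrow> complex \<Rightarrow> complex" where
  "hyp_F a b t1 t2 =
     hyp_f a b t1 * hyp_f a b t2 * (1 - t1) powr ((a + b) / 2) * (1 - t2) powr ((a + b) / 2)"

text \<open>The function \<open>F\<close> in the variables \<open>x = t1 + t2 - 2\<close> and \<open>y = (1 - t1) * (1 - t2)\<close>. By symmetry
  the choice of the square root is irrelevant.\<close>

definition hyp_F_xy :: "complex \<Rightarrow> complex \<Rightarrow> complex \<times> complex \<Rightarrow> complex" where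
  "hyp_F_xy a b = (\<lambda>(x, y). let d = csqrt (x\<^sup>2 - 4 * y) in hyp_F a b (1 + (x + d) / 2) (1 + (x - d) / 2))"

lemma hyp_F_xy:
  "hyp_F_xy a b (t1 + t2 - 2, (1 - t1) * (1 - t2)) = hyp_F a b t1 t2"
proof -
  define d where "d = csqrt ((t1 + t2 - 2)\<^sup>2 - 4 * ((1 - t1) * (1 - t2)))"
  have "d\<^sup>2 = (t1 - t2)\<^sup>2"
    unfolding d_def power2_csqrt by (simp add: power2_eq_square algebra_simps)
  hence "d = t1 - t2 \<or> d = t2 - t1"
    by (metis minus_diff_eq power2_eq_iff)
  moreover have "hyp_F_xy a b (t1 + t2 - 2, (1 - t1) * (1 - t2)) =
      hyp_F a b (1 + (t1 + t2 - 2 + d) / 2) (1 + (t1 + t2 - 2 - d) / 2)"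
    by (simp add: hyp_F_xy_def d_def Let_def)
  moreover have "1 + (t1 + t2 - 2 + (t1 - t2)) / 2 = t1" "1 + (t1 + t2 - 2 - (t1 - t2)) / 2 = t2"
    "1 + (t1 + t2 - 2 + (t2 - t1)) / 2 = t2" "1 + (t1 + t2 - 2 - (t2 - t1)) / 2 = t1"
    by (simp_all add: field_simps)
  moreover have "hyp_F a b t2 t1 = hyp_F a b t1 t2"
    by (simp add: hyp_F_def mult_ac)
  ultimately show ?thesis
    by metis
qed

definition xy_domain :: "(complex \<times> complex) set" where
  "xy_domain = {(t1 + t2 - 2, (1 - t1) * (1 - t2)) | t1 t2. norm t1 < 1 \<and> norm t2 < 1}"

text \<open>Here \<open>x + y + 1 = t1 * t2\<close>, and \<open>x \<noteq> 0\<close> on the whole domain.\<close>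

definition solves_system :: "complex \<Rightarrow> complex \<Rightarrow> (complex \<times> complex \<Rightarrow> complex) \<Rightarrow> bool" where
  "solves_system a b \<Psi> \<longleftrightarrow>
     \<Psi> holomorphic2_on xy_domain \<and>
     (\<forall>(x, y)\<in>xy_domain. x + y + 1 \<noteq> 0 \<longrightarrow>
        D\<^sub>x (D\<^sub>x \<Psi>) (x, y) + 2 * D\<^sub>x (D\<^sub>y \<Psi>) (x, y)
          - 1 / (x + y + 1) * D\<^sub>x \<Psi> (x, y)
          + x / (x + y + 1) * D\<^sub>y \<Psi> (x, y)
          + (2 * a * b - a - b) * x / (2 * (x + y + 1)) * \<Psi> (x, y) = 0 \<and>
        D\<^sub>y (D\<^sub>y \<Psi>) (x, y) + 2 * y / x\<^sup>2 * D\<^sub>x (D\<^sub>y \<Psi>) (x, y)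
          + y\<^sup>2 / (x\<^sup>2 * (x + y + 1)) * D\<^sub>x \<Psi> (x, y)
          + (y - x - x\<^sup>2) / (x * (x + y + 1)) * D\<^sub>y \<Psi> (x, y)
          - ((a + b) * (a + b - 2) * (x\<^sup>2 + x) + (a - b)\<^sup>2 * x * y
               - (4 * a * b - 2 * a - 2 * b) * y) / (4 * x * (x + y + 1)) * \<Psi> (x, y) = 0)"

end

theory Submission
  imports Defs
begin

text \<open>
  In the coordinates \<open>t1, t2\<close> the system is equivalent to the ordinary differential equation of
  \<open>f t * (1 - t) powr ((a + b) / 2)\<close> in each variable.

  Let first \<open>a + b = 1 / 2\<close>. For \<open>N = 2, 3, 4\<close> let \<open>u\<close> and \<open>v\<close> be the combinations of the Eisenstein
  series \<open>E\<^sub>4 (n \<tau>)\<close>, \<open>n dvd N\<close>, on which \<open>w\<^sub>N\<close> acts by \<open>+1\<close> and \<open>-1\<close>, and take \<open>t = (u\<^sup>2 - v\<^sup>2) / u\<^sup>2\<close>; for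
  \<open>N = 1\<close> take \<open>u = E\<^sub>4\<close> and \<open>t = (E\<^sub>4\<^sup>3 - E\<^sub>6\<^sup>2) / E\<^sub>4\<^sup>3\<close>. With \<open>\<theta> = q d/dq\<close>, comparison of a few
  coefficients, which suffices for forms of bounded weight, shows \<open>(\<theta> t)\<^sup>2 = t\<^sup>2 u (1 - t)\<close> and
  \<open>4 u \<theta>\<^sup>2 u - 5 (\<theta> u)\<^sup>2 = 16 a b t u\<^sup>3\<close>. These identities say that the fourth root of \<open>u\<close>, as a function
  of \<open>t\<close>, solves the hypergeometric equation, so that \<open>u = f(t)\<^sup>4\<close> and
  \<open>f(t)\<^sup>2 (1 - t) powr (a + b) = \<theta> t / t\<close> near the cusp. The logarithmic derivative on the right is a
  meromorphic form of weight 2 for any modular function \<open>t\<close>, hence \<open>F\<^sup>2\<close> is a form of weight \<open>(2, 2)\<close>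
  with trivial character. Pfaff's transformation carries this over from \<open>(a, b)\<close> and \<open>t\<close> to
  \<open>(a, 1 - b)\<close> and \<open>t / (t - 1)\<close>.
\<close>

section \<open>The differential system in symmetric coordinates\<close>

text \<open>The series \<open>f\<close> lives in the unit disc, so F makes sense only near the cusp,
  and a fourth root of \<open>u\<close> is not single-valued on the half-plane. What continues is
  the logarithmic derivative: \<open>\<Phi>\<close> is a product of two of them, and F continues as
  a branch of its square root. Hence m = 2, with a sign in place of a nontrivial character.

  The vanishing criterion moves points into a fundamental domain of the group generated by \<tau> +
  1 and the Fricke involution. That domain has lowest height sqrt (1/N - 1/4), which is positive for
  N = 1, 2, 3 but 0 for N = 4, where the cusp 1/2 remains. Level 4 is therefore rescaled to the
  theta group inside the full modular group.

  The Eisenstein series enter with unknown leading coefficients \<alpha> and \<beta>. The first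
  identities are proved with these as parameters, and their next coefficients force 240 and -504.

  In the differential system the obstacle is the discriminant x^2 = 4 y, where t1 and t2 are no
  longer coordinates; the equations reach it by continuity of the second derivatives.\<close>

definition separately_holomorphic_on ::
  "(complex \<times> complex \<Rightarrow> complex) \<Rightarrow> (complex \<times> complex) set \<Rightarrow> bool"
    (infixl \<open>(separately'_holomorphic'_on)\<close> 50) where
  "f separately_holomorphic_on S \<longleftrightarrow>
     (\<forall>(x, y)\<in>S. (\<lambda>u. f (u, y)) field_differentiable at x \<and> (\<lambda>v. f (x, v)) field_differentiable at y)"

section \<open>Partial derivatives of separately holomorphic functions\<close>

lemma open_prod_cballE:
  fixes S :: "(complex \<times> complex) set"
  assumes "open S" "(x, y) \<in> S"
  obtains r where "r > 0" "cball x r \<times> cball y r \<subseteq> S"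
proof -
  obtain A B where AB: "open A" "open B" "x \<in> A" "y \<in> B" "A \<times> B \<subseteq> S"
    using open_prod_elim[OF assms] by (metis mem_Sigma_iff)
  then obtain r1 r2 where "r1 > 0" "cball x r1 \<subseteq> A" "r2 > 0" "cball y r2 \<subseteq> B"
    by (meson open_contains_cball)
  hence "cball x (min r1 r2) \<times> cball y (min r1 r2) \<subseteq> A \<times> B" "min r1 r2 > 0"
    by auto
  hence "cball x (min r1 r2) \<times> cball y (min r1 r2) \<subseteq> S" "min r1 r2 > 0"
    using AB by blast+
  thus ?thesis using that by blast
qed

lemma separately_holomorphic_onD:
  assumes "f separately_holomorphic_on S" "A \<times> B \<subseteq> S" "open A" "open B"
  shows "y \<in> B \<Longrightarrow> (\<lambda>u. f (u, y)) holomorphic_on A" "x \<in> A \<Longrightarrow> (\<lambda>v. f (x, v)) holomorphic_on B"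
proof -
  have "(\<lambda>u. f (u, y)) field_differentiable at x \<and> (\<lambda>v. f (x, v)) field_differentiable at y"
    if "x \<in> A" "y \<in> B" for x y
    using assms(1,2) that unfolding separately_holomorphic_on_def by blast
  thus "y \<in> B \<Longrightarrow> (\<lambda>u. f (u, y)) holomorphic_on A" "x \<in> A \<Longrightarrow> (\<lambda>v. f (x, v)) holomorphic_on B"
    unfolding holomorphic_on_def by (simp_all add: field_differentiable_at_within)
qed

lemma separately_holomorphic_swap:
  "f separately_holomorphic_on S \<longleftrightarrow> (f \<circ> prod.swap) separately_holomorphic_on (prod.swap ` S)"
  by (auto simp: separately_holomorphic_on_def)

lemma continuous_on_swap_iff:
  fixes f :: "complex \<times> complex \<Rightarrow> complex"
  shows "continuous_on (prod.swap ` S) (f \<circ> prod.swap) \<longleftrightarrow> continuous_on S f"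
proof
  assume "continuous_on S f"
  hence "continuous_on (prod.swap ` prod.swap ` S) f" by (simp add: image_image)
  thus "continuous_on (prod.swap ` S) (f \<circ> prod.swap)"
    by (rule continuous_on_compose[OF continuous_on_swap])
next
  assume *: "continuous_on (prod.swap ` S) (f \<circ> prod.swap)"
  have "continuous_on S ((f \<circ> prod.swap) \<circ> prod.swap)"
    by (rule continuous_on_compose[OF continuous_on_swap *])
  thus "continuous_on S f" by (simp add: comp_assoc)
qed

lemma open_swap_image:
  fixes S :: "(complex \<times> complex) set"
  assumes "open S" shows "open (prod.swap ` S)"
proof -
  have "prod.swap ` S = prod.swap -` S" by (auto simp: image_iff prod.swap_def intro!: bexI[rotated])
  thus ?thesis using assms by (auto intro!: open_vimage continuous_on_swap)
qed

text \<open>Two comparisons meet at \<open>(x, y0)\<close>. Along the fixed slice \<open>y0\<close>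
  the derivative of a holomorphic function is continuous; moving in \<open>y\<close> is controlled
  by Cauchy's estimate for \<open>f (u, y) - f (u, y0)\<close>, which is small by uniform continuity
  of \<open>f\<close>.\<close>

lemma partial_deriv_continuous:
  assumes S: "open S" and f: "f separately_holomorphic_on S" and c: "continuous_on S f"
  shows "continuous_on S (\<lambda>(x, y). deriv (\<lambda>u. f (u, y)) x)"
  unfolding continuous_on_iff
proof (intro ballI allI impI)
  fix p0 :: "complex \<times> complex" and e :: real
  assume p0: "p0 \<in> S" and e: "e > 0"
  obtain x0 y0 where p0_eq: "p0 = (x0, y0)" by force
  have p: "(x0, y0) \<in> S" using p0 by (simp add: p0_eq)
  obtain r where r: "r > 0" "cball x0 r \<times> cball y0 r \<subseteq> S"
    using open_prod_cballE[OF S p] by blast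
  have sub: "ball x0 r \<times> ball y0 r \<subseteq> S"
    using r by (meson Sigma_mono ball_subset_cball order_trans)
  define d where "d = (\<lambda>x y. deriv (\<lambda>u. f (u, y)) x)"
  have hol: "(\<lambda>u. f (u, y)) holomorphic_on ball x0 r" if "y \<in> ball y0 r" for y
    by (rule separately_holomorphic_onD(1)[OF f sub open_ball open_ball that])
  have "(\<lambda>x. d x y0) holomorphic_on ball x0 r"
    unfolding d_def by (intro holomorphic_deriv hol open_ball) (use r in simp)
  hence "continuous_on (ball x0 r) (\<lambda>x. d x y0)"
    by (rule holomorphic_on_imp_continuous_on)
  hence "isCont (\<lambda>x. d x y0) x0"
    using r(1) by (simp add: continuous_on_eq_continuous_at)
  then obtain \<delta>1 where \<delta>1: "\<delta>1 > 0" "\<And>x. dist x x0 < \<delta>1 \<Longrightarrow> dist (d x y0) (d x0 y0) < e / 2"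
    using e unfolding continuous_at_eps_delta by (meson half_gt_zero)
  have "uniformly_continuous_on (cball x0 r \<times> cball y0 r) f"
    by (intro compact_uniformly_continuous continuous_on_subset[OF c] r compact_Times compact_cball)
  \<comment> \<open>Cauchy's estimate on the radius \<open>r / 2\<close> turns this bound into
    \<open>e / 4\<close>, leaving room for the \<open>e / 2\<close> of the other comparison.\<close>
  moreover have "e * r / 8 > 0" using e r by simp
  ultimately obtain \<delta>2 where \<delta>2: "\<delta>2 > 0" "\<And>p q. p \<in> cball x0 r \<times> cball y0 r \<Longrightarrow>
      q \<in> cball x0 r \<times> cball y0 r \<Longrightarrow> dist q p < \<delta>2 \<Longrightarrow> dist (f q) (f p) < e * r / 8"
    unfolding uniformly_continuous_on_def by meson
  define \<delta> where "\<delta> = min (min \<delta>1 \<delta>2) (r / 2)"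
  show "\<exists>d'>0. \<forall>p'\<in>S. dist p' p0 < d' \<longrightarrow>
          dist (case p' of (x, y) \<Rightarrow> deriv (\<lambda>u. f (u, y)) x)
               (case p0 of (x, y) \<Rightarrow> deriv (\<lambda>u. f (u, y)) x) < e"
    unfolding p0_eq
  proof (intro exI[of _ \<delta>] conjI ballI impI)
    fix p' assume "dist p' (x0, y0) < \<delta>"
    obtain x y where p': "p' = (x, y)" by force
    have dx: "dist x x0 < \<delta>" "dist y y0 < \<delta>"
      using \<open>dist p' (x0, y0) < \<delta>\<close> dist_fst_le[of p' "(x0,y0)"] dist_snd_le[of p' "(x0,y0)"]
      by (auto simp: p')
    have mem: "w \<in> ball x0 r" if "w \<in> cball x (r/2)" for w
      using dx that dist_triangle[of x0 w x] by (auto simp: \<delta>_def dist_commute)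
    from mem have sub: "cball x (r/2) \<subseteq> ball x0 r" by blast
    have subc: "cball x (r/2) \<times> {y'} \<subseteq> S" if "y' \<in> ball y0 r" for y'
      using sub \<open>ball x0 r \<times> ball y0 r \<subseteq> S\<close> that by blast
    have y: "y \<in> ball y0 r" using dx r by (auto simp: \<delta>_def dist_commute)
    have y0: "y0 \<in> ball y0 r" using r by simp
    have "norm ((deriv ^^ 1) (\<lambda>u. f (u, y) - f (u, y0)) x) \<le> fact 1 * (e * r / 8) / (r/2) ^ 1"
    proof (rule Cauchy_higher_deriv_bound[where y = 0])
      show "(\<lambda>u. f (u, y) - f (u, y0)) holomorphic_on ball x (r/2)"
        using hol[OF y] hol[OF y0] sub ball_subset_cball[of x "r/2"]
        by (intro holomorphic_on_diff) (blast intro: holomorphic_on_subset)+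
      have "continuous_on (cball x (r/2)) (\<lambda>u. f (u, y'))" if "y' \<in> ball y0 r" for y'
      proof (rule continuous_on_compose2[OF c])
        show "(\<lambda>u. (u, y')) ` cball x (r/2) \<subseteq> S" using subc[OF that] by blast
      qed (intro continuous_intros)
      thus "continuous_on (cball x (r/2)) (\<lambda>u. f (u, y) - f (u, y0))"
        using y y0 by (intro continuous_on_diff)
      fix w assume "w \<in> ball x (r/2)"
      hence "w \<in> cball x0 r" using mem[of w] by (simp add: less_imp_le)
      hence "dist (f (w, y)) (f (w, y0)) < e * r / 8"
        using y y0 dx by (intro \<delta>2) (auto simp: dist_Pair_Pair \<delta>_def)
      thus "f (w, y) - f (w, y0) \<in> ball 0 (e * r / 8)" by (simp add: dist_norm norm_minus_commute)
    qed (use r in auto)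
    moreover have "deriv (\<lambda>u. f (u, y) - f (u, y0)) x = d x y - d x y0"
      unfolding d_def using sub r hol[OF y] hol[OF y0]
      by (intro deriv_diff) (auto intro!: holomorphic_on_imp_differentiable_at[of _ "ball x0 r"])
    ultimately have "dist (d x y) (d x y0) \<le> e / 4"
      using r by (simp add: dist_norm)
    moreover have "dist (d x y0) (d x0 y0) < e / 2"
      using dx by (intro \<delta>1) (simp add: \<delta>_def)
    ultimately have "dist (d x y) (d x0 y0) < e"
      using dist_triangle[of "d x y" "d x0 y0" "d x y0"] e by linarith
    thus "dist (case p' of (x, y) \<Rightarrow> deriv (\<lambda>u. f (u, y)) x)
               (case (x0, y0) of (x, y) \<Rightarrow> deriv (\<lambda>u. f (u, y)) x) < e"
      by (simp add: p' d_def)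
  qed (use \<delta>1 \<delta>2 r in \<open>auto simp: \<delta>_def\<close>)
qed

text \<open>In the second variable the derivative is a locally uniform limit of difference
  quotients, each of which is holomorphic there; the uniformity comes from the joint continuity of
  the derivative.\<close>

lemma partial_deriv_separately_holomorphic:
  assumes S: "open S" and f: "f separately_holomorphic_on S" and c: "continuous_on S f"
  shows "(\<lambda>(x, y). deriv (\<lambda>u. f (u, y)) x) separately_holomorphic_on S"
  unfolding separately_holomorphic_on_def
proof safe
  fix x0 y0 :: complex
  assume p: "(x0, y0) \<in> S"
  obtain r where r: "r > 0" "cball x0 r \<times> cball y0 r \<subseteq> S"
    using open_prod_cballE[OF S p] by blast
  have sub: "ball x0 r \<times> ball y0 r \<subseteq> S"
    using r by (meson Sigma_mono ball_subset_cball order_trans)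
  define d where "d = (\<lambda>x y. deriv (\<lambda>u. f (u, y)) x)"
  have hol: "(\<lambda>u. f (u, y)) holomorphic_on ball x0 r" if "y \<in> ball y0 r" for y
    by (rule separately_holomorphic_onD(1)[OF f sub open_ball open_ball that])
  have hol2: "(\<lambda>v. f (x, v)) holomorphic_on ball y0 r" if "x \<in> ball x0 r" for x
    by (rule separately_holomorphic_onD(2)[OF f sub open_ball open_ball that])
  have der: "((\<lambda>u. f (u, y)) has_field_derivative d x y) (at x)" if "x \<in> ball x0 r" "y \<in> ball y0 r" for x y
    unfolding d_def by (rule holomorphic_derivI[OF hol[OF that(2)]]) (use that in auto)
  show "deriv (\<lambda>u. f (u, y0)) field_differentiable at x0"
  proof -
    have "(\<lambda>x. d x y0) holomorphic_on ball x0 r"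
      unfolding d_def by (intro holomorphic_deriv hol open_ball) (use r in simp)
    thus ?thesis
      using r unfolding d_def by (auto intro: holomorphic_on_imp_differentiable_at)
  qed
  have cd: "continuous_on S (\<lambda>(x, y). d x y)"
    unfolding d_def by (rule partial_deriv_continuous[OF assms])
  define \<rho> where "\<rho> = r / 2"
  have \<rho>: "\<rho> > 0" "\<rho> < r" using r by (auto simp: \<rho>_def)
  have "(\<lambda>y. d x0 y) holomorphic_on ball y0 \<rho>"
  proof (rule holomorphic_uniform_sequence)
    define h where "h = (\<lambda>n. of_real (\<rho> / real (Suc n)) :: complex)"
    have nh: "norm (h n) = \<rho> / real (Suc n)" for n using \<rho> unfolding h_def norm_of_real by simp
    have h0: "h n \<noteq> 0" for n using \<rho> unfolding h_def of_real_eq_0_iff by simp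
    show "(\<lambda>y. (f (x0 + h n, y) - f (x0, y)) / h n) holomorphic_on ball y0 \<rho>" for n
    proof -
      have "norm (h n) \<le> \<rho>" using \<rho> by (simp add: nh field_simps)
      hence "x0 + h n \<in> ball x0 r" "x0 \<in> ball x0 r" using \<rho> r by (auto simp: dist_norm)
      from this[THEN hol2] show ?thesis
        using h0 \<rho> by (intro holomorphic_intros) (auto intro: holomorphic_on_subset)
    qed
    fix y assume y: "y \<in> ball y0 \<rho>"
    obtain \<epsilon> where \<epsilon>: "\<epsilon> > 0" "cball y \<epsilon> \<subseteq> ball y0 \<rho>"
      using y open_contains_cball_eq[OF open_ball] by blast
    have "uniform_limit (cball y \<epsilon>) (\<lambda>n y. (f (x0 + h n, y) - f (x0, y)) / h n) (d x0) sequentially"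
      unfolding uniform_limit_iff
    proof safe
      fix e :: real assume e: "e > 0"
      have "uniformly_continuous_on (cball x0 \<rho> \<times> cball y0 \<rho>) (\<lambda>(x, y). d x y)"
      proof (intro compact_uniformly_continuous continuous_on_subset[OF cd] compact_Times compact_cball)
        have "cball x0 \<rho> \<subseteq> ball x0 r" "cball y0 \<rho> \<subseteq> ball y0 r" using \<rho> by auto
        thus "cball x0 \<rho> \<times> cball y0 \<rho> \<subseteq> S" using sub by (meson Sigma_mono order_trans)
      qed
      then obtain \<delta> where \<delta>: "\<delta> > 0" "\<And>p q. p \<in> cball x0 \<rho> \<times> cball y0 \<rho> \<Longrightarrow>
          q \<in> cball x0 \<rho> \<times> cball y0 \<rho> \<Longrightarrow> dist q p < \<delta> \<Longrightarrow>
          dist (case q of (x, y) \<Rightarrow> d x y) (case p of (x, y) \<Rightarrow> d x y) < e / 2"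
        using e unfolding uniformly_continuous_on_def by (meson half_gt_zero)
      obtain M where M: "\<rho> / \<delta> < real M" using reals_Archimedean2 by blast
      have *: "dist ((f (x0 + h n, z) - f (x0, z)) / h n) (d x0 z) < e"
        if n: "n \<ge> M" and y: "z \<in> ball y0 \<rho>" for n z
      proof -
        have small: "norm (h n) < \<delta>" "norm (h n) \<le> \<rho>"
        proof -
          have "\<rho> < \<delta> * real (Suc n)" using M n \<delta> by (simp add: field_simps)
            (smt (verit) mult_left_mono of_nat_mono)
          thus "norm (h n) < \<delta>" by (simp add: nh field_simps)
          show "norm (h n) \<le> \<rho>" using \<rho> by (simp add: nh field_simps)
        qed
        define B where "B = cball x0 (norm (h n))"
        have B: "B \<subseteq> cball x0 \<rho>" "B \<subseteq> ball x0 r" using small \<rho> by (auto simp: B_def)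
        \<comment> \<open>Mean value inequality for \<open>f (x, z) - x * d x0 z\<close>, whose
          derivative \<open>d x z - d x0 z\<close> is small on the disc of radius
          \<open>norm (h n)\<close>.\<close>
        have "norm ((f (x0 + h n, z) - (x0 + h n) * d x0 z) - (f (x0, z) - x0 * d x0 z))
                 \<le> (e / 2) * norm ((x0 + h n) - x0)"
        proof (rule field_differentiable_bound[where f' = "\<lambda>x. d x z - d x0 z" and S = B])
          show "convex B" by (simp add: B_def)
          show "x0 + h n \<in> B" "x0 \<in> B" by (auto simp: B_def dist_norm)
          fix x assume x: "x \<in> B"
          have "z \<in> ball y0 r" "x \<in> ball x0 r" using y \<rho> x B by auto
          from der[OF this(2,1)]
          show "((\<lambda>x. f (x, z) - x * d x0 z) has_field_derivative d x z - d x0 z) (at x within B)"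
            by (auto intro!: derivative_eq_intros intro: has_field_derivative_at_within)
          have "dist (case (x, z) of (x, y) \<Rightarrow> d x y) (case (x0, z) of (x, y) \<Rightarrow> d x y) < e / 2"
            using x B y \<rho> small by (intro \<delta>) (auto simp: dist_Pair_Pair B_def dist_commute)
          thus "norm (d x z - d x0 z) \<le> e / 2" by (simp add: dist_norm)
        qed
        hence "norm (f (x0 + h n, z) - f (x0, z) - h n * d x0 z) \<le> (e / 2) * norm (h n)"
          by (simp add: algebra_simps)
        moreover have "(f (x0 + h n, z) - f (x0, z)) / h n - d x0 z =
            (f (x0 + h n, z) - f (x0, z) - h n * d x0 z) / h n"
          using h0 by (simp add: field_simps)
        ultimately have "norm ((f (x0 + h n, z) - f (x0, z)) / h n - d x0 z) \<le> e / 2"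
          using h0[of n] by (simp add: norm_divide divide_le_eq)
        thus ?thesis using e by (simp add: dist_norm)
      qed
      thus "\<forall>\<^sub>F n in sequentially. \<forall>x\<in>cball y \<epsilon>. dist ((f (x0 + h n, x) - f (x0, x)) / h n) (d x0 x) < e"
        using \<epsilon> unfolding eventually_sequentially by (intro exI[of _ M]) (use * in blast)
    qed
    thus "\<exists>da>0. cball y da \<subseteq> ball y0 \<rho> \<and>
            uniform_limit (cball y da) (\<lambda>n y. (f (x0 + h n, y) - f (x0, y)) / h n) (d x0) sequentially"
      using \<epsilon> by blast
  qed auto
  thus "(\<lambda>v. deriv (\<lambda>u. f (u, v)) x0) field_differentiable at y0"
    using \<rho> unfolding d_def by (auto intro: holomorphic_on_imp_differentiable_at)
qed

text \<open>This combination reproduces itself under \<open>D\<^sub>x\<close> and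
  \<open>D\<^sub>y\<close>, so that the second derivatives in the system are continuous too.\<close>

definition holomorphic_pair :: "(complex \<times> complex) set \<Rightarrow> (complex \<times> complex \<Rightarrow> complex) \<Rightarrow> bool" where
  "holomorphic_pair S f \<longleftrightarrow> continuous_on S f \<and> f separately_holomorphic_on S"

lemma holomorphic_pair_Dx:
  assumes "open S" "holomorphic_pair S f"
  shows "holomorphic_pair S (D\<^sub>x f)"
proof -
  have 1: "continuous_on S (\<lambda>(x, y). deriv (\<lambda>u. f (u, y)) x)"
    "(\<lambda>(x, y). deriv (\<lambda>u. f (u, y)) x) separately_holomorphic_on S"
    using assms by (auto simp: holomorphic_pair_def intro: partial_deriv_continuous
        partial_deriv_separately_holomorphic)
  have "continuous_on S (\<lambda>p. fst p * (case p of (x, y) \<Rightarrow> deriv (\<lambda>u. f (u, y)) x))"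
    by (intro continuous_intros 1)
  moreover have "D\<^sub>x f = (\<lambda>p. fst p * (case p of (x, y) \<Rightarrow> deriv (\<lambda>u. f (u, y)) x))"
    by (auto simp: D\<^sub>x_def fun_eq_iff)
  moreover have "D\<^sub>x f separately_holomorphic_on S"
    using 1(2) unfolding separately_holomorphic_on_def D\<^sub>x_def
    by (auto intro!: field_differentiable_mult)
  ultimately show ?thesis by (simp add: holomorphic_pair_def)
qed

lemma holomorphic_pair_swap:
  "holomorphic_pair S f \<longleftrightarrow> holomorphic_pair (prod.swap ` S) (f \<circ> prod.swap)"
  unfolding holomorphic_pair_def using separately_holomorphic_swap continuous_on_swap_iff by metis

lemma holomorphic_pair_Dy:
  assumes "open S" "holomorphic_pair S f"
  shows "holomorphic_pair S (D\<^sub>y f)"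
proof -
  have "D\<^sub>y f \<circ> prod.swap = D\<^sub>x (f \<circ> prod.swap)"
    by (auto simp: D\<^sub>x_def D\<^sub>y_def fun_eq_iff)
  thus ?thesis
    using assms holomorphic_pair_Dx[of "prod.swap ` S" "f \<circ> prod.swap"]
    by (metis holomorphic_pair_swap open_swap_image)
qed

text \<open>Differentiability at a point follows if one partial derivative exists there while the
  other exists nearby and is continuous at the point; the continuity is the earlier result for the
  swapped function.\<close>

lemma holomorphic_pair_imp_holomorphic2:
  assumes S: "open S" and f: "holomorphic_pair S f"
  shows "f holomorphic2_on S"
  unfolding holomorphic2_on_def
proof safe
  fix x0 y0 assume p: "(x0, y0) \<in> S"
  obtain r where r: "r > 0" "cball x0 r \<times> cball y0 r \<subseteq> S"
    using open_prod_cballE[OF S p] by blast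
  have sub: "ball x0 r \<times> ball y0 r \<subseteq> S" using r by force
  define A where "A = deriv (\<lambda>u. f (u, y0)) x0"
  define B where "B = (\<lambda>x y. deriv (\<lambda>v. f (x, v)) y)"
  have fs: "f separately_holomorphic_on S" "continuous_on S f" using f by (auto simp: holomorphic_pair_def)
  have "continuous_on (prod.swap ` S) (\<lambda>(x, y). deriv (\<lambda>u. (f \<circ> prod.swap) (u, y)) x)"
    by (intro partial_deriv_continuous open_swap_image S)
       (simp_all only: continuous_on_swap_iff fs flip: separately_holomorphic_swap)
  moreover have "(\<lambda>(x, y). deriv (\<lambda>u. (f \<circ> prod.swap) (u, y)) x) = (\<lambda>(x, y). B x y) \<circ> prod.swap"
    by (auto simp: B_def fun_eq_iff)
  ultimately have cB: "continuous_on S (\<lambda>(x, y). B x y)"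
    by (metis continuous_on_swap_iff)
  have "((\<lambda>(x, y). f (x, y)) has_derivative (\<lambda>(h, k). A * h + blinfun_apply (blinfun_mult_right (B x0 y0)) k))
          (at (x0, y0) within ball x0 r \<times> ball y0 r)"
  proof (rule has_derivative_partialsI)
    show "((\<lambda>x. f (x, y0)) has_derivative (\<lambda>h. A * h)) (at x0 within ball x0 r)"
      using fs p unfolding A_def separately_holomorphic_on_def
      by (auto intro!: has_derivative_at_withinI field_differentiable_derivI[unfolded has_field_derivative_def])
    fix x y assume xy: "x \<in> ball x0 r" "y \<in> ball y0 r"
    hence "(x, y) \<in> S" using sub by auto
    thus "((\<lambda>y. f (x, y)) has_derivative blinfun_apply (blinfun_mult_right (B x y))) (at y within ball y0 r)"
      using fs unfolding B_def separately_holomorphic_on_def blinfun_mult_right.rep_eq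
      by (auto intro!: has_derivative_at_withinI field_differentiable_derivI[unfolded has_field_derivative_def])
  next
    have "continuous_on S (\<lambda>p. blinfun_mult_right (case p of (x, y) \<Rightarrow> B x y))"
      by (intro bounded_linear.continuous_on[OF bounded_linear_blinfun_mult_right] cB)
    hence "continuous (at (x0, y0)) (\<lambda>p. blinfun_mult_right (case p of (x, y) \<Rightarrow> B x y))"
      using S p by (simp add: continuous_on_eq_continuous_at)
    thus "continuous (at (x0, y0) within ball x0 r \<times> ball y0 r) (\<lambda>(x, y). blinfun_mult_right (B x y))"
      unfolding case_prod_unfold by (rule continuous_at_imp_continuous_at_within)
  qed (use r in auto)
  moreover have "at (x0, y0) within ball x0 r \<times> ball y0 r = at (x0, y0)"
    using r by (intro at_within_open open_Times) auto
  ultimately have "(f has_derivative (\<lambda>(h, k). A * h + B x0 y0 * k)) (at (x0, y0))"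
    by (simp add: case_prod_unfold blinfun_mult_right.rep_eq)
  thus "\<exists>A B. (f has_derivative (\<lambda>(h, k). A * h + B * k)) (at (x0, y0))" by (intro exI)
qed

section \<open>Symmetric functions of two roots and their discriminant\<close>

definition symmetric_xy :: "(complex \<Rightarrow> complex) \<Rightarrow> complex \<times> complex \<Rightarrow> complex" where
  "symmetric_xy h = (\<lambda>(x, y). let d = csqrt (x\<^sup>2 - 4 * y) in h (1 + (x + d) / 2) * h (1 + (x - d) / 2))"

text \<open>Changing the sign of the root only exchanges the two factors, so \<open>csqrt\<close>
  may be replaced by whichever branch is regular near the point at hand.\<close>

lemma symmetric_xy_eq:
  assumes "s\<^sup>2 = x\<^sup>2 - 4 * y"
  shows "symmetric_xy h (x, y) = h (1 + (x + s) / 2) * h (1 + (x - s) / 2)"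
proof -
  have "csqrt (x\<^sup>2 - 4 * y) ^ 2 = s ^ 2" using assms by simp
  hence "csqrt (x\<^sup>2 - 4 * y) = s \<or> csqrt (x\<^sup>2 - 4 * y) = - s" by (simp only: power2_eq_iff)
  thus ?thesis by (auto simp: symmetric_xy_def Let_def)
qed

lemma xy_domain_iff:
  assumes "s\<^sup>2 = x\<^sup>2 - 4 * y"
  shows "(x, y) \<in> xy_domain \<longleftrightarrow> norm (1 + (x + s) / 2) < 1 \<and> norm (1 + (x - s) / 2) < 1"
proof
  assume "(x, y) \<in> xy_domain"
  then obtain t1 t2 where t: "x = t1 + t2 - 2" "y = (1 - t1) * (1 - t2)" "norm t1 < 1" "norm t2 < 1"
    by (auto simp: xy_domain_def)
  have "s\<^sup>2 = (t1 - t2)\<^sup>2"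
    unfolding assms t by (simp add: power2_eq_square algebra_simps)
  hence "s = t1 - t2 \<or> s = t2 - t1" by (metis minus_diff_eq power2_eq_iff)
  moreover have "1 + (t1 + t2 - 2 + (t1 - t2)) / 2 = t1" "1 + (t1 + t2 - 2 - (t1 - t2)) / 2 = t2"
    "1 + (t1 + t2 - 2 + (t2 - t1)) / 2 = t2" "1 + (t1 + t2 - 2 - (t2 - t1)) / 2 = t1"
    by (simp_all add: field_simps)
  ultimately show "norm (1 + (x + s) / 2) < 1 \<and> norm (1 + (x - s) / 2) < 1"
    using t by metis
next
  assume *: "norm (1 + (x + s) / 2) < 1 \<and> norm (1 + (x - s) / 2) < 1"
  have "x = (1 + (x + s) / 2) + (1 + (x - s) / 2) - 2" by (simp add: field_simps)
  moreover have "(1 - (1 + (x + s) / 2)) * (1 - (1 + (x - s) / 2)) = (x\<^sup>2 - s\<^sup>2) / 4"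
    by (simp add: power2_eq_square field_simps)
  hence "y = (1 - (1 + (x + s) / 2)) * (1 - (1 + (x - s) / 2))" by (simp add: assms)
  ultimately show "(x, y) \<in> xy_domain"
    using * unfolding xy_domain_def by blast
qed

text \<open>\<open>csqrt\<close> jumps across the negative axis. Away from the discriminant,
  dividing by the value at \<open>p0\<close> before taking the root moves the cut away; on the
  discriminant the root tends to 0 whatever its sign.\<close>

lemma discriminant_root:
  fixes p0 :: "complex \<times> complex"
  obtains s :: "complex \<times> complex \<Rightarrow> complex" where
    "\<And>p. (s p)\<^sup>2 = (fst p)\<^sup>2 - 4 * snd p" "isCont s p0"
proof (cases "(fst p0)\<^sup>2 - 4 * snd p0 = 0")
  case True
  have "((\<lambda>p. csqrt ((fst p)\<^sup>2 - 4 * snd p)) \<longlongrightarrow> 0) (at p0)"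
  proof (rule tendsto_norm_zero_cancel)
    have "((\<lambda>p. sqrt (norm ((fst p)\<^sup>2 - 4 * snd p))) \<longlongrightarrow> sqrt (norm ((fst p0)\<^sup>2 - 4 * snd p0))) (at p0)"
      by (intro tendsto_intros)
    thus "((\<lambda>p. norm (csqrt ((fst p)\<^sup>2 - 4 * snd p))) \<longlongrightarrow> 0) (at p0)"
      by (simp only: True norm_csqrt norm_zero real_sqrt_zero)
  qed
  thus ?thesis
    by (intro that[of "\<lambda>p. csqrt ((fst p)\<^sup>2 - 4 * snd p)"]) (auto simp: isCont_def True)
next
  case False
  define d where "d = (fst p0)\<^sup>2 - 4 * snd p0"
  have "isCont (\<lambda>p. csqrt d * csqrt (((fst p)\<^sup>2 - 4 * snd p) / d)) p0"
    using False by (intro continuous_intros isCont_csqrt') (auto simp: d_def)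
  thus ?thesis
    using False by (intro that[of "\<lambda>p. csqrt d * csqrt (((fst p)\<^sup>2 - 4 * snd p) / d)"])
      (auto simp: d_def power_mult_distrib)
qed

text \<open>Membership is a pair of strict inequalities for the two roots, and by symmetry these may
  be formed with a branch that is continuous at the point.\<close>

lemma open_xy_domain: "open xy_domain"
proof (subst open_subopen, safe)
  fix x y assume p: "(x, y) \<in> xy_domain"
  obtain s where s: "\<And>p. (s p)\<^sup>2 = (fst p)\<^sup>2 - 4 * snd p" "isCont s (x, y)"
    using discriminant_root by blast
  have dom: "p \<in> xy_domain \<longleftrightarrow> norm (1 + (fst p + s p) / 2) < 1 \<and> norm (1 + (fst p - s p) / 2) < 1" for p
    using xy_domain_iff[OF s(1)[of p]] by simp
  have lim: "(s \<longlongrightarrow> s (x, y)) (nhds (x, y))"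
    using s(2) by (simp add: isCont_def tendsto_at_iff_tendsto_nhds)
  have "((\<lambda>p. norm (1 + (fst p + s p) / 2)) \<longlongrightarrow> norm (1 + (fst (x, y) + s (x, y)) / 2)) (nhds (x, y))"
    "((\<lambda>p. norm (1 + (fst p - s p) / 2)) \<longlongrightarrow> norm (1 + (fst (x, y) - s (x, y)) / 2)) (nhds (x, y))"
    by (intro tendsto_intros lim filterlim_ident; simp)+
  hence "\<forall>\<^sub>F p in nhds (x, y). norm (1 + (fst p + s p) / 2) < 1"
    "\<forall>\<^sub>F p in nhds (x, y). norm (1 + (fst p - s p) / 2) < 1"
    using p unfolding dom by (auto elim!: order_tendstoD)
  hence "\<forall>\<^sub>F p in nhds (x, y). p \<in> xy_domain"
    by eventually_elim (simp add: dom)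
  thus "\<exists>T. open T \<and> (x, y) \<in> T \<and> T \<subseteq> xy_domain"
    unfolding eventually_nhds by blast
qed

lemma continuous_on_symmetric_xy:
  assumes h: "h holomorphic_on ball 0 1"
  shows "continuous_on xy_domain (symmetric_xy h)"
proof -
  have "isCont (symmetric_xy h) p0" if p0: "p0 \<in> xy_domain" for p0
  proof -
    obtain s where s: "\<And>p. (s p)\<^sup>2 = (fst p)\<^sup>2 - 4 * snd p" "isCont s p0"
      using discriminant_root by blast
    have eq: "symmetric_xy h = (\<lambda>p. h (1 + (fst p + s p) / 2) * h (1 + (fst p - s p) / 2))"
      using symmetric_xy_eq[OF s(1)] by (auto simp: fun_eq_iff)
    have c: "isCont h z" if "norm z < 1" for z
      using h that by (auto simp: holomorphic_on_imp_continuous_on continuous_on_eq_continuous_at[symmetric]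
          intro: continuous_on_interior[OF holomorphic_on_imp_continuous_on[OF h]])
    have n: "norm (1 + (fst p0 + s p0) / 2) < 1" "norm (1 + (fst p0 - s p0) / 2) < 1"
      using xy_domain_iff[OF s(1)[of p0]] p0 by simp_all
    have "isCont (\<lambda>p. 1 + (fst p + s p) / 2) p0" "isCont (\<lambda>p. 1 + (fst p - s p) / 2) p0"
      by (intro continuous_intros s(2) | simp)+
    from isCont_o2[OF this(1) c[OF n(1)]] isCont_o2[OF this(2) c[OF n(2)]]
    show ?thesis unfolding eq by (intro continuous_intros)
  qed
  thus ?thesis by (simp add: continuous_at_imp_continuous_on)
qed

lemma D_Pair:
  "D\<^sub>x f (x, y) = x * deriv (\<lambda>u. f (u, y)) x" "D\<^sub>y f (x, y) = y * deriv (\<lambda>v. f (x, v)) y"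
  by (simp_all add: D\<^sub>x_def D\<^sub>y_def)

text \<open>Away from the discriminant \<open>x\<^sup>2 = 4 y\<close> the roots \<open>r1, r2\<close> are local coordinates.\<close>

locale discriminant_chart =
  fixes d :: complex
  assumes d: "d \<noteq> 0"
begin

text \<open>A square root of the discriminant whose cut is the ray opposite to \<open>d\<close>; on
  \<open>dom\<close> it is holomorphic in each variable and nonzero.\<close>

definition s :: "complex \<times> complex \<Rightarrow> complex" where
  "s p = csqrt d * csqrt (((fst p)\<^sup>2 - 4 * snd p) / d)"

definition dom :: "(complex \<times> complex) set" where
  "dom = {p. ((fst p)\<^sup>2 - 4 * snd p) / d \<notin> \<real>\<^sub>\<le>\<^sub>0} \<inter> xy_domain"

definition r1 :: "complex \<times> complex \<Rightarrow> complex" where "r1 p = 1 + (fst p + s p) / 2"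
definition r2 :: "complex \<times> complex \<Rightarrow> complex" where "r2 p = 1 + (fst p - s p) / 2"

lemma s_squared: "(s p)\<^sup>2 = (fst p)\<^sup>2 - 4 * snd p"
  using d by (simp add: s_def power_mult_distrib)

lemma s_nonzero: "p \<in> dom \<Longrightarrow> s p \<noteq> 0"
  using d by (auto simp: s_def dom_def)

lemma open_dom: "open dom"
proof -
  have "open ((\<lambda>p::complex \<times> complex. ((fst p)\<^sup>2 - 4 * snd p) / d) -` (- \<real>\<^sub>\<le>\<^sub>0))"
    using d by (intro open_vimage continuous_intros) (auto simp: open_Compl)
  thus ?thesis
    unfolding dom_def using open_xy_domain by (auto simp: vimage_def intro!: open_Int)
qed

lemma norm_roots: "p \<in> dom \<Longrightarrow> norm (r1 p) < 1" "p \<in> dom \<Longrightarrow> norm (r2 p) < 1"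
  using xy_domain_iff[OF s_squared[of p]] by (auto simp: dom_def r1_def r2_def)

lemma roots_eq:
  "fst p = r1 p + r2 p - 2" "s p = r1 p - r2 p" "snd p = (1 - r1 p) * (1 - r2 p)"
proof -
  show "fst p = r1 p + r2 p - 2" "s p = r1 p - r2 p"
    by (simp_all add: r1_def r2_def field_simps)
  have "(1 - r1 p) * (1 - r2 p) = ((fst p)\<^sup>2 - (s p)\<^sup>2) / 4"
    by (simp add: r1_def r2_def power2_eq_square field_simps)
  thus "snd p = (1 - r1 p) * (1 - r2 p)" by (simp add: s_squared)
qed

lemma symmetric_xy_roots: "symmetric_xy h p = h (r1 p) * h (r2 p)"
  using symmetric_xy_eq[OF s_squared[of p], of h] by (simp add: r1_def r2_def)

lemma s_derivs:
  assumes "(x, y) \<in> dom"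
  shows "((\<lambda>u. s (u, y)) has_field_derivative x / s (x, y)) (at x)"
    "((\<lambda>v. s (x, v)) has_field_derivative - 2 / s (x, y)) (at y)"
proof -
  have w: "(x\<^sup>2 - 4 * y) / d \<notin> \<real>\<^sub>\<le>\<^sub>0" using assms by (simp add: dom_def)
  have n: "csqrt d \<noteq> 0" "csqrt ((x\<^sup>2 - 4 * y) / d) \<noteq> 0" using d w by auto
  have dd: "d = csqrt d * csqrt d" by (metis power2_csqrt power2_eq_square)
  have "((\<lambda>u. s (u, y)) has_field_derivative csqrt d * (2 * x / d / (2 * csqrt ((x\<^sup>2 - 4 * y) / d)))) (at x)"
    unfolding s_def using w by (auto intro!: derivative_eq_intros simp: field_simps)
  also have "csqrt d * (2 * x / d / (2 * csqrt ((x\<^sup>2 - 4 * y) / d))) = x / s (x, y)"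
    using n by (subst (2) dd) (simp add: s_def field_simps)
  finally show "((\<lambda>u. s (u, y)) has_field_derivative x / s (x, y)) (at x)" .
  have "((\<lambda>v. s (x, v)) has_field_derivative csqrt d * (- 4 / d / (2 * csqrt ((x\<^sup>2 - 4 * y) / d)))) (at y)"
    unfolding s_def using w by (auto intro!: derivative_eq_intros simp: field_simps)
  also have "csqrt d * (- 4 / d / (2 * csqrt ((x\<^sup>2 - 4 * y) / d))) = - 2 / s (x, y)"
    using n by (subst (2) dd) (simp add: s_def field_simps)
  finally show "((\<lambda>v. s (x, v)) has_field_derivative - 2 / s (x, y)) (at y)" .
qed

lemma root_derivs:
  assumes "(x, y) \<in> dom"
  shows "((\<lambda>u. r1 (u, y)) has_field_derivative (r1 (x, y) - 1) / s (x, y)) (at x)"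
    "((\<lambda>u. r2 (u, y)) has_field_derivative (1 - r2 (x, y)) / s (x, y)) (at x)"
    "((\<lambda>v. r1 (x, v)) has_field_derivative - 1 / s (x, y)) (at y)"
    "((\<lambda>v. r2 (x, v)) has_field_derivative 1 / s (x, y)) (at y)"
  unfolding r1_def r2_def using s_nonzero[OF assms]
  by (auto intro!: derivative_eq_intros s_derivs[OF assms] simp: field_simps)

definition P :: "(complex \<Rightarrow> complex) \<Rightarrow> (complex \<Rightarrow> complex) \<Rightarrow> complex \<times> complex \<Rightarrow> complex" where
  "P f g p = f (r1 p) * g (r2 p)"

lemma P_derivs:
  assumes p: "(x, y) \<in> dom"
    and f: "\<And>t. norm t < 1 \<Longrightarrow> (f has_field_derivative f' t) (at t)"
    and g: "\<And>t. norm t < 1 \<Longrightarrow> (g has_field_derivative g' t) (at t)"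
  shows "((\<lambda>u. P f g (u, y)) has_field_derivative
           ((r1 (x, y) - 1) * P f' g (x, y) + (1 - r2 (x, y)) * P f g' (x, y)) / s (x, y)) (at x)"
    "((\<lambda>v. P f g (x, v)) has_field_derivative (P f g' (x, y) - P f' g (x, y)) / s (x, y)) (at y)"
proof -
  show "((\<lambda>u. P f g (u, y)) has_field_derivative
           ((r1 (x, y) - 1) * P f' g (x, y) + (1 - r2 (x, y)) * P f g' (x, y)) / s (x, y)) (at x)"
    unfolding P_def using s_nonzero[OF p]
    by (auto intro!: derivative_eq_intros DERIV_chain2[where f = f, OF f[OF norm_roots(1)[OF p]] root_derivs(1)[OF p]]
        DERIV_chain2[where f = g, OF g[OF norm_roots(2)[OF p]] root_derivs(2)[OF p]] simp: field_simps)
  show "((\<lambda>v. P f g (x, v)) has_field_derivative (P f g' (x, y) - P f' g (x, y)) / s (x, y)) (at y)"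
    unfolding P_def using s_nonzero[OF p]
    by (auto intro!: derivative_eq_intros DERIV_chain2[where f = f, OF f[OF norm_roots(1)[OF p]] root_derivs(3)[OF p]]
        DERIV_chain2[where f = g, OF g[OF norm_roots(2)[OF p]] root_derivs(4)[OF p]] simp: field_simps)
qed

text \<open>The formulas for the first derivatives hold only on \<open>dom\<close>; as
  \<open>dom\<close> is open, they may be differentiated once more.\<close>

lemma deriv_slice_cong:
  assumes "(x, y) \<in> dom" "\<And>p. p \<in> dom \<Longrightarrow> f p = g p"
  shows "deriv (\<lambda>u. f (u, y)) x = deriv (\<lambda>u. g (u, y)) x" "deriv (\<lambda>v. f (x, v)) y = deriv (\<lambda>v. g (x, v)) y"
proof -
  have "\<forall>\<^sub>F u in nhds x. (u, y) \<in> dom" "\<forall>\<^sub>F v in nhds y. (x, v) \<in> dom"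
    using eventually_nhds_in_open[OF open_vimage[OF open_dom], of "\<lambda>u. (u, y)" x]
      eventually_nhds_in_open[OF open_vimage[OF open_dom], of "\<lambda>v. (x, v)" y] assms(1)
    by (simp_all add: continuous_intros)
  thus "deriv (\<lambda>u. f (u, y)) x = deriv (\<lambda>u. g (u, y)) x" "deriv (\<lambda>v. f (x, v)) y = deriv (\<lambda>v. g (x, v)) y"
    by (auto intro!: deriv_cong_ev elim!: eventually_mono simp: assms(2))
qed

context
  fixes h h1 h2 :: "complex \<Rightarrow> complex"
  assumes h: "\<And>t. norm t < 1 \<Longrightarrow> (h has_field_derivative h1 t) (at t)"
    and h1: "\<And>t. norm t < 1 \<Longrightarrow> (h1 has_field_derivative h2 t) (at t)"
begin

lemma Dx_symmetric_xy:
  assumes "p \<in> dom"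
  shows "D\<^sub>x (symmetric_xy h) p = fst p / s p * (P (\<lambda>t. (t - 1) * h1 t) h p - P h (\<lambda>t. (t - 1) * h1 t) p)"
proof -
  obtain x y where p: "p = (x, y)" by force
  have "symmetric_xy h = P h h" by (auto simp: fun_eq_iff P_def symmetric_xy_roots)
  thus ?thesis
    using DERIV_imp_deriv[OF P_derivs(1)[OF assms[unfolded p] h h]]
    by (simp add: p D\<^sub>x_def P_def field_simps)
qed

lemma Dy_symmetric_xy:
  assumes "p \<in> dom"
  shows "D\<^sub>y (symmetric_xy h) p = snd p / s p * (P h h1 p - P h1 h p)"
proof -
  obtain x y where p: "p = (x, y)" by force
  have "symmetric_xy h = P h h" by (auto simp: fun_eq_iff P_def symmetric_xy_roots)
  thus ?thesis
    using DERIV_imp_deriv[OF P_derivs(2)[OF assms[unfolded p] h h]]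
    by (simp add: p D\<^sub>y_def P_def field_simps)
qed

text \<open>When \<open>x\<close> varies, both roots move in proportion to their distance from 1,
  with opposite signs; \<open>k\<close> is the corresponding derivative \<open>(t - 1) d/dt\<close>
  of \<open>h\<close>.\<close>

abbreviation "k \<equiv> (\<lambda>t. (t - 1) * h1 t)"
abbreviation "k1 \<equiv> (\<lambda>t. h1 t + (t - 1) * h2 t)"

lemma k_deriv: "norm t < 1 \<Longrightarrow> (k has_field_derivative k1 t) (at t)"
  by (auto intro!: derivative_eq_intros h1)

lemma second_derivs:
  assumes p: "p \<in> dom"
  shows "D\<^sub>x (D\<^sub>x (symmetric_xy h)) p = fst p * ((1 / s p - (fst p)\<^sup>2 / s p ^ 3) * (P k h p - P h k p)
      + fst p / s p * (((r1 p - 1) * P k1 h p + (1 - r2 p) * P k h1 p) / s p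
         - ((r1 p - 1) * P h1 k p + (1 - r2 p) * P h k1 p) / s p))"
    and "D\<^sub>x (D\<^sub>y (symmetric_xy h)) p = fst p * (- snd p * fst p / s p ^ 3 * (P h h1 p - P h1 h p)
      + snd p / s p * (((r1 p - 1) * P h1 h1 p + (1 - r2 p) * P h h2 p) / s p
         - ((r1 p - 1) * P h2 h p + (1 - r2 p) * P h1 h1 p) / s p))"
    and "D\<^sub>y (D\<^sub>y (symmetric_xy h)) p = snd p * ((1 / s p + 2 * snd p / s p ^ 3) * (P h h1 p - P h1 h p)
      + snd p / s p * ((P h h2 p - P h1 h1 p) / s p - (P h1 h1 p - P h2 h p) / s p))"
proof -
  obtain x y where pxy: "p = (x, y)" by force
  note p = p[unfolded pxy]
  have s0: "s (x, y) \<noteq> 0" by (rule s_nonzero[OF p])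
  have "((\<lambda>u. u / s (u, y)) has_field_derivative (1 / s (x, y) - x\<^sup>2 / s (x, y) ^ 3)) (at x)"
    using s0 by (auto intro!: derivative_eq_intros s_derivs[OF p] simp: field_simps power2_eq_square power3_eq_cube)
  from DERIV_mult[OF this DERIV_diff[OF P_derivs(1)[OF p k_deriv h] P_derivs(1)[OF p h k_deriv]]]
  have 1: "((\<lambda>u. u / s (u, y) * (P k h (u, y) - P h k (u, y))) has_field_derivative
     ((1 / s (x, y) - x\<^sup>2 / s (x, y) ^ 3) * (P k h (x, y) - P h k (x, y))
      + x / s (x, y) * (((r1 (x, y) - 1) * P k1 h (x, y) + (1 - r2 (x, y)) * P k h1 (x, y)) / s (x, y)
         - ((r1 (x, y) - 1) * P h1 k (x, y) + (1 - r2 (x, y)) * P h k1 (x, y)) / s (x, y)))) (at x)"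
    by (simp add: algebra_simps)
  show "D\<^sub>x (D\<^sub>x (symmetric_xy h)) p = fst p * ((1 / s p - (fst p)\<^sup>2 / s p ^ 3) * (P k h p - P h k p)
      + fst p / s p * (((r1 p - 1) * P k1 h p + (1 - r2 p) * P k h1 p) / s p
         - ((r1 p - 1) * P h1 k p + (1 - r2 p) * P h k1 p) / s p))"
    using deriv_slice_cong(1)[where f = "D\<^sub>x (symmetric_xy h)" and g = "\<lambda>p. fst p / s p * (P k h p - P h k p)", OF p Dx_symmetric_xy]
    by (simp only: pxy D_Pair fst_conv snd_conv DERIV_imp_deriv[OF 1])
  have "((\<lambda>u. y / s (u, y)) has_field_derivative (- y * x / s (x, y) ^ 3)) (at x)"
    using s0 by (auto intro!: derivative_eq_intros s_derivs[OF p] simp: field_simps power2_eq_square power3_eq_cube)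
  from DERIV_mult[OF this DERIV_diff[OF P_derivs(1)[OF p h h1] P_derivs(1)[OF p h1 h]]]
  have 2: "((\<lambda>u. y / s (u, y) * (P h h1 (u, y) - P h1 h (u, y))) has_field_derivative
     (- y * x / s (x, y) ^ 3 * (P h h1 (x, y) - P h1 h (x, y))
      + y / s (x, y) * (((r1 (x, y) - 1) * P h1 h1 (x, y) + (1 - r2 (x, y)) * P h h2 (x, y)) / s (x, y)
         - ((r1 (x, y) - 1) * P h2 h (x, y) + (1 - r2 (x, y)) * P h1 h1 (x, y)) / s (x, y)))) (at x)"
    by (simp add: algebra_simps)
  show "D\<^sub>x (D\<^sub>y (symmetric_xy h)) p = fst p * (- snd p * fst p / s p ^ 3 * (P h h1 p - P h1 h p)
      + snd p / s p * (((r1 p - 1) * P h1 h1 p + (1 - r2 p) * P h h2 p) / s p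
         - ((r1 p - 1) * P h2 h p + (1 - r2 p) * P h1 h1 p) / s p))"
    using deriv_slice_cong(1)[where f = "D\<^sub>y (symmetric_xy h)" and g = "\<lambda>p. snd p / s p * (P h h1 p - P h1 h p)", OF p Dy_symmetric_xy]
    by (simp only: pxy D_Pair fst_conv snd_conv DERIV_imp_deriv[OF 2])
  have "((\<lambda>v. v / s (x, v)) has_field_derivative (1 / s (x, y) + 2 * y / s (x, y) ^ 3)) (at y)"
    using s0 by (auto intro!: derivative_eq_intros s_derivs[OF p] simp: field_simps power2_eq_square power3_eq_cube)
  from DERIV_mult[OF this DERIV_diff[OF P_derivs(2)[OF p h h1] P_derivs(2)[OF p h1 h]]]
  have 3: "((\<lambda>v. v / s (x, v) * (P h h1 (x, v) - P h1 h (x, v))) has_field_derivative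
     ((1 / s (x, y) + 2 * y / s (x, y) ^ 3) * (P h h1 (x, y) - P h1 h (x, y))
      + y / s (x, y) * ((P h h2 (x, y) - P h1 h1 (x, y)) / s (x, y) - (P h1 h1 (x, y) - P h2 h (x, y)) / s (x, y)))) (at y)"
    by (simp add: algebra_simps)
  show "D\<^sub>y (D\<^sub>y (symmetric_xy h)) p = snd p * ((1 / s p + 2 * snd p / s p ^ 3) * (P h h1 p - P h1 h p)
      + snd p / s p * ((P h h2 p - P h1 h1 p) / s p - (P h1 h1 p - P h2 h p) / s p))"
    using deriv_slice_cong(2)[where f = "D\<^sub>y (symmetric_xy h)" and g = "\<lambda>p. snd p / s p * (P h h1 p - P h1 h p)", OF p Dy_symmetric_xy]
    by (simp only: pxy D_Pair fst_conv snd_conv DERIV_imp_deriv[OF 3])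
qed

end

end

text \<open>Off the discriminant the chart gives differentiability. A slice with fixed
  \<open>y\<close> meets the discriminant in at most two points and a slice with fixed
  \<open>x\<close> in one; there continuity makes the singularity removable.\<close>

lemma holomorphic_pair_symmetric_xy:
  assumes h: "h holomorphic_on ball 0 1"
  shows "holomorphic_pair xy_domain (symmetric_xy h)"
proof -
  have c: "continuous_on xy_domain (symmetric_xy h)"
    by (rule continuous_on_symmetric_xy[OF h])
  have h': "(h has_field_derivative deriv h t) (at t)" if "norm t < 1" for t
    using holomorphic_derivI[OF h] that by simp
  have diff: "(\<lambda>u. symmetric_xy h (u, y)) field_differentiable at x \<and>
      (\<lambda>v. symmetric_xy h (x, v)) field_differentiable at y"
    if "(x, y) \<in> xy_domain" "x\<^sup>2 - 4 * y \<noteq> 0" for x y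
  proof -
    interpret discriminant_chart "x\<^sup>2 - 4 * y" by unfold_locales fact
    have p: "(x, y) \<in> dom" using that by (simp add: dom_def)
    have "symmetric_xy h = P h h" by (auto simp: fun_eq_iff P_def symmetric_xy_roots)
    thus ?thesis using P_derivs[OF p h' h'] unfolding field_differentiable_def by auto
  qed
  have "(\<lambda>u. symmetric_xy h (u, y)) field_differentiable at x \<and>
      (\<lambda>v. symmetric_xy h (x, v)) field_differentiable at y" if xy: "(x, y) \<in> xy_domain" for x y
  proof
    define A where "A = (\<lambda>u. (u, y)) -` xy_domain"
    have A: "open A" unfolding A_def by (intro open_vimage open_xy_domain continuous_intros)
    have "(\<lambda>u. symmetric_xy h (u, y)) holomorphic_on A"
    proof (rule no_isolated_singularity[OF _ _ A])
      show "continuous_on A (\<lambda>u. symmetric_xy h (u, y))"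
        by (rule continuous_on_compose2[OF c]) (auto simp: A_def intro!: continuous_intros)
      show "finite {csqrt (4 * y), - csqrt (4 * y)}" by simp
      show "(\<lambda>u. symmetric_xy h (u, y)) holomorphic_on A - {csqrt (4 * y), - csqrt (4 * y)}"
      proof (unfold holomorphic_on_def, rule ballI)
        fix u assume u: "u \<in> A - {csqrt (4 * y), - csqrt (4 * y)}"
        have "u\<^sup>2 \<noteq> (csqrt (4 * y))\<^sup>2" using u by (simp only: power2_eq_iff) auto
        hence "u\<^sup>2 - 4 * y \<noteq> 0" by simp
        with diff[of u y] u
        show "(\<lambda>u. symmetric_xy h (u, y)) field_differentiable at u within A - {csqrt (4 * y), - csqrt (4 * y)}"
          by (auto simp: A_def intro: field_differentiable_at_within)
      qed
    qed
    thus "(\<lambda>u. symmetric_xy h (u, y)) field_differentiable at x"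
      using A xy by (auto simp: A_def intro: holomorphic_on_imp_differentiable_at)
  next
    define A where "A = (\<lambda>v. (x, v)) -` xy_domain"
    have A: "open A" unfolding A_def by (intro open_vimage open_xy_domain continuous_intros)
    have "(\<lambda>v. symmetric_xy h (x, v)) holomorphic_on A"
    proof (rule no_isolated_singularity[OF _ _ A])
      show "continuous_on A (\<lambda>v. symmetric_xy h (x, v))"
        by (rule continuous_on_compose2[OF c]) (auto simp: A_def intro!: continuous_intros)
      show "finite {x\<^sup>2 / 4}" by simp
      show "(\<lambda>v. symmetric_xy h (x, v)) holomorphic_on A - {x\<^sup>2 / 4}"
      proof (unfold holomorphic_on_def, rule ballI)
        fix v assume v: "v \<in> A - {x\<^sup>2 / 4}"
        hence "x\<^sup>2 - 4 * v \<noteq> 0" by (auto simp: field_simps)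
        with diff[of x v] v
        show "(\<lambda>v. symmetric_xy h (x, v)) field_differentiable at v within A - {x\<^sup>2 / 4}"
          by (auto simp: A_def intro: field_differentiable_at_within)
      qed
    qed
    thus "(\<lambda>v. symmetric_xy h (x, v)) field_differentiable at y"
      using A xy by (auto simp: A_def intro: holomorphic_on_imp_differentiable_at)
  qed
  with c show ?thesis
    unfolding holomorphic_pair_def separately_holomorphic_on_def by blast
qed

text \<open>After clearing denominators, each equation of the system is a combination of the two
  ordinary equations \<open>EA\<close> and \<open>EB\<close>. The multipliers are read off from the
  coefficients of \<open>A2\<close> and \<open>B2\<close>, which occur only in the second
  derivatives.\<close>

lemma pde_algebra:
  fixes t1 t2 A A1 A2 B B1 B2 ab \<sigma> x y s :: complex
  assumes ne: "t1 \<noteq> 0" "t2 \<noteq> 0" "s \<noteq> 0" "x \<noteq> 0"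
    and x: "x = t1 + t2 - 2" and y: "y = (1 - t1) * (1 - t2)" and s: "s = t1 - t2"
    and odeA: "t1 * (1 - t1)\<^sup>2 * A2 + (1 - t1)\<^sup>2 * A1 + (\<sigma> - \<sigma>\<^sup>2 * t1 - ab * (1 - t1)) * A = 0"
    and odeB: "t2 * (1 - t2)\<^sup>2 * B2 + (1 - t2)\<^sup>2 * B1 + (\<sigma> - \<sigma>\<^sup>2 * t2 - ab * (1 - t2)) * B = 0"
    and Fx: "Fx = x / s * ((t1 - 1) * A1 * B - A * ((t2 - 1) * B1))"
    and Fy: "Fy = y / s * (A * B1 - A1 * B)"
    and Fxx: "Fxx = x * ((1 / s - x\<^sup>2 / s ^ 3) * ((t1 - 1) * A1 * B - A * ((t2 - 1) * B1))
      + x / s * (((t1 - 1) * ((A1 + (t1 - 1) * A2) * B) + (1 - t2) * ((t1 - 1) * A1 * B1)) / s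
         - ((t1 - 1) * (A1 * ((t2 - 1) * B1)) + (1 - t2) * (A * (B1 + (t2 - 1) * B2))) / s))"
    and Fxy: "Fxy = x * (- y * x / s ^ 3 * (A * B1 - A1 * B)
      + y / s * (((t1 - 1) * (A1 * B1) + (1 - t2) * (A * B2)) / s
         - ((t1 - 1) * (A2 * B) + (1 - t2) * (A1 * B1)) / s))"
    and Fyy: "Fyy = y * ((1 / s + 2 * y / s ^ 3) * (A * B1 - A1 * B)
      + y / s * ((A * B2 - A1 * B1) / s - (A1 * B1 - A2 * B) / s))"
  shows "Fxx + 2 * Fxy - 1 / (x + y + 1) * Fx + x / (x + y + 1) * Fy
           + (2 * ab - 2 * \<sigma>) * x / (2 * (x + y + 1)) * (A * B) = 0" (is "?L1 = 0")
    and "Fyy + 2 * y / x\<^sup>2 * Fxy + y\<^sup>2 / (x\<^sup>2 * (x + y + 1)) * Fx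
          + (y - x - x\<^sup>2) / (x * (x + y + 1)) * Fy
          - (2 * \<sigma> * (2 * \<sigma> - 2) * (x\<^sup>2 + x) + (4 * \<sigma>\<^sup>2 - 4 * ab) * x * y
               - (4 * ab - 4 * \<sigma>) * y) / (4 * x * (x + y + 1)) * (A * B) = 0" (is "?L2 = 0")
proof -
  define EA where "EA = t1 * (1 - t1)\<^sup>2 * A2 + (1 - t1)\<^sup>2 * A1 + (\<sigma> - \<sigma>\<^sup>2 * t1 - ab * (1 - t1)) * A"
  define EB where "EB = t2 * (1 - t2)\<^sup>2 * B2 + (1 - t2)\<^sup>2 * B1 + (\<sigma> - \<sigma>\<^sup>2 * t2 - ab * (1 - t2)) * B"
  have xy1: "x + y + 1 = t1 * t2" by (simp add: x y algebra_simps)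
  have "?L1 * (s ^ 3 * t1 * t2) = s ^ 2 * x * (t2 * EA * B - t1 * EB * A)"
    unfolding xy1 Fx Fy Fxx Fxy EA_def EB_def using ne
    apply (simp add: divide_simps)
    apply (unfold x y s)
    apply algebra
    done
  thus "?L1 = 0" using ne odeA odeB by (simp add: EA_def EB_def)
  have "?L2 * (s ^ 3 * x ^ 2 * t1 * t2) = s ^ 2 * x * ((1 - t1)\<^sup>2 * t1 * EB * A - (1 - t2)\<^sup>2 * t2 * EA * B)"
    unfolding xy1 Fx Fy Fyy Fxy EA_def EB_def using ne
    apply (simp add: divide_simps)
    apply (unfold x y s)
    apply algebra
    done
  thus "?L2 = 0" using ne odeA odeB by (simp add: EA_def EB_def)
qed

section \<open>The hypergeometric equation\<close>

definition hypergeometric_ode :: "complex \<Rightarrow> complex \<Rightarrow> complex fps \<Rightarrow> bool" where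
  "hypergeometric_ode a b G \<longleftrightarrow>
     fps_X * (1 - fps_X) * fps_deriv (fps_deriv G) + (1 - fps_const (a + b + 1) * fps_X) * fps_deriv G
       - fps_const (a * b) * G = 0"

lemma hypergeometric_ode_iff:
  "hypergeometric_ode a b G \<longleftrightarrow>
     (\<forall>n. (of_nat n + 1)\<^sup>2 * fps_nth G (Suc n) = (of_nat n + a) * (of_nat n + b) * fps_nth G n)"
proof -
  have eq: "fps_X * (1 - fps_X) * fps_deriv (fps_deriv G) + (1 - fps_const (a + b + 1) * fps_X) * fps_deriv G
       - fps_const (a * b) * G
     = fps_X * fps_deriv (fps_deriv G) - fps_X * (fps_X * fps_deriv (fps_deriv G)) + fps_deriv G
       - fps_const (a + b + 1) * (fps_X * fps_deriv G) - fps_const (a * b) * G"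
    by (simp add: algebra_simps)
  have "fps_nth (fps_X * (1 - fps_X) * fps_deriv (fps_deriv G) + (1 - fps_const (a + b + 1) * fps_X) * fps_deriv G
       - fps_const (a * b) * G) n
     = (of_nat n + 1)\<^sup>2 * fps_nth G (Suc n) - (of_nat n + a) * (of_nat n + b) * fps_nth G n" for n
  proof (cases n)
    case 0
    then show ?thesis unfolding eq by (simp add: power2_eq_square algebra_simps)
  next
    case (Suc m)
    then show ?thesis
      unfolding eq by (cases m) (simp_all add: power2_eq_square algebra_simps)
  qed
  thus ?thesis unfolding hypergeometric_ode_def fps_eq_iff by simp
qed

lemma hypergeometric_ode_fps_hypergeo: "hypergeometric_ode a b (fps_hypergeo [a, b] [1] 1)"
  unfolding hypergeometric_ode_iff
proof
  fix n
  have "fps_hypergeo [a, b] [1] 1 $ Suc n =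
     ((a + of_nat n) * (b + of_nat n)) / ((of_nat (Suc n)) * (1 + of_nat n)) * fps_hypergeo [a, b] [1] 1 $ n"
    using fps_hypergeo_rec[of "[a, b]" "[1]" "1 :: complex" n] by (simp del: fps_hypergeo_nth)
  moreover have "(of_nat n + 1 :: complex) \<noteq> 0"
    by (metis of_nat_Suc of_nat_eq_0_iff add.commute nat.distinct(1))
  ultimately show "(of_nat n + 1)\<^sup>2 * fps_hypergeo [a, b] [1] 1 $ Suc n =
      (of_nat n + a) * (of_nat n + b) * fps_hypergeo [a, b] [1] 1 $ n"
    by (simp add: power2_eq_square divide_simps add_ac mult_ac del: fps_hypergeo_nth)
qed

text \<open>The exponent 0 is double at the origin: the recursion multiplies the next coefficient by
  \<open>(n + 1)^2\<close>, which never vanishes, so the constant term determines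
  everything.\<close>

lemma hypergeometric_ode_unique:
  assumes "hypergeometric_ode a b G" "hypergeometric_ode a b G'" "fps_nth G 0 = fps_nth G' 0"
  shows "G = G'"
proof (rule fps_ext)
  fix n show "fps_nth G n = fps_nth G' n"
  proof (induction n)
    case (Suc n)
    have "(of_nat n + 1 :: complex) \<noteq> 0"
      by (metis of_nat_Suc of_nat_eq_0_iff add.commute nat.distinct(1))
    moreover have "(of_nat n + 1)\<^sup>2 * fps_nth G (Suc n) = (of_nat n + 1)\<^sup>2 * fps_nth G' (Suc n)"
      using assms Suc by (simp add: hypergeometric_ode_iff)
    ultimately show ?case by simp
  qed (rule assms)
qed

lemma norm_pochhammer_le_fact:
  assumes "0 \<le> \<alpha>" "\<alpha> \<le> 1"
  shows "norm (pochhammer (complex_of_real \<alpha>) n) \<le> fact n"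
proof (induction n)
  case (Suc n)
  have "norm (complex_of_real \<alpha> + of_nat n) \<le> real (Suc n)"
    using norm_triangle_ineq[of "complex_of_real \<alpha>" "of_nat n"] assms by simp
  from mult_mono[OF Suc this] show ?case
    by (simp add: pochhammer_Suc norm_mult mult_ac)
qed simp

text \<open>For parameters in [0, 1] the Pochhammer symbols do not exceed \<open>fact n\<close> in
  modulus, so all coefficients have modulus at most 1 and the geometric series dominates.\<close>

lemma fps_conv_radius_hypergeo:
  assumes "0 \<le> \<alpha>" "\<alpha> \<le> 1" "0 \<le> \<beta>" "\<beta> \<le> 1"
  shows "fps_conv_radius (fps_hypergeo [complex_of_real \<alpha>, complex_of_real \<beta>] [1] 1) \<ge> 1"
proof -
  have "norm (fps_hypergeo [complex_of_real \<alpha>, complex_of_real \<beta>] [1] 1 $ n) \<le> norm (1 :: complex)" for n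
  proof -
    have "norm (pochhammer (complex_of_real \<alpha>) n) * norm (pochhammer (complex_of_real \<beta>) n) \<le> fact n * fact n"
      using assms by (intro mult_mono norm_pochhammer_le_fact) auto
    moreover have "norm (pochhammer (1 :: complex) n) = fact n"
      by (simp flip: pochhammer_fact)
    ultimately show ?thesis
      by (simp add: norm_mult norm_divide divide_le_eq)
  qed
  hence bound: "norm (fps_hypergeo [complex_of_real \<alpha>, complex_of_real \<beta>] [1] 1 $ n) \<le> 1" for n by simp
  show ?thesis
    unfolding fps_conv_radius_def
  proof (rule conv_radius_geI_ex)
    fix r :: real assume r: "0 < r" "ereal r < 1"
    have "summable (\<lambda>n. fps_hypergeo [complex_of_real \<alpha>, complex_of_real \<beta>] [1] 1 $ n * of_real r ^ n)"
    proof (rule summable_comparison_test')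
      show "summable (\<lambda>n. r ^ n)" using r by (intro summable_geometric) auto
      fix n
      show "norm (fps_hypergeo [complex_of_real \<alpha>, complex_of_real \<beta>] [1] 1 $ n * of_real r ^ n) \<le> r ^ n"
        unfolding norm_mult norm_power using mult_right_mono[OF bound, of "r ^ n" n] r by simp
    qed
    thus "\<exists>z. norm z = r \<and> summable (\<lambda>n. fps_hypergeo [complex_of_real \<alpha>, complex_of_real \<beta>] [1] 1 $ n * z ^ n)"
      using r by (intro exI[of _ "of_real r"]) simp
  qed
qed

text \<open>Parametrised by convergence alone, so that it serves for \<open>(a, b)\<close> and for
  the Pfaff partner \<open>(a, 1 - b)\<close> alike.\<close>

locale gauss_hypergeometric =
  fixes a b :: complex
  assumes conv: "fps_conv_radius (fps_hypergeo [a, b] [1] 1) \<ge> 1"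
begin

definition "f0 = hyp_f a b"
definition "f1 = eval_fps (fps_deriv (fps_hypergeo [a, b] [1] 1))"
definition "f2 = eval_fps (fps_deriv (fps_deriv (fps_hypergeo [a, b] [1] 1)))"

lemma in_conv_radius:
  assumes "norm (t :: complex) < 1"
  shows "ereal (norm t) < fps_conv_radius (fps_hypergeo [a, b] [1] 1)"
    "ereal (norm t) < fps_conv_radius (fps_deriv (fps_hypergeo [a, b] [1] 1))"
    "ereal (norm t) < fps_conv_radius (fps_deriv (fps_deriv (fps_hypergeo [a, b] [1] 1)))"
proof -
  have 1: "ereal (norm t) < 1" using assms by simp
  have 2: "fps_conv_radius (fps_deriv (fps_hypergeo [a, b] [1] 1)) \<ge> 1"
    using conv fps_conv_radius_deriv order_trans by blast
  have 3: "fps_conv_radius (fps_deriv (fps_deriv (fps_hypergeo [a, b] [1] 1))) \<ge> 1"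
    using 2 fps_conv_radius_deriv order_trans by blast
  show "ereal (norm t) < fps_conv_radius (fps_hypergeo [a, b] [1] 1)"
    "ereal (norm t) < fps_conv_radius (fps_deriv (fps_hypergeo [a, b] [1] 1))"
    "ereal (norm t) < fps_conv_radius (fps_deriv (fps_deriv (fps_hypergeo [a, b] [1] 1)))"
    using less_le_trans[OF 1] conv 2 3 by blast+
qed

lemma f_derivs:
  assumes "norm t < 1"
  shows "(f0 has_field_derivative f1 t) (at t)" "(f1 has_field_derivative f2 t) (at t)"
  unfolding f0_def f1_def f2_def hyp_f_def[abs_def]
  using in_conv_radius[OF assms] by (auto intro!: has_field_derivative_eval_fps)

lemma f0_has_fps_expansion: "f0 has_fps_expansion fps_hypergeo [a, b] [1] 1"
proof -
  have "0 < fps_conv_radius (fps_hypergeo [a, b] [1] 1)"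
    using in_conv_radius(1)[of 0] by (simp add: zero_ereal_def)
  thus ?thesis unfolding f0_def hyp_f_def[abs_def] by (rule eval_fps_has_fps_expansion)
qed

lemma f_holomorphic: "f0 holomorphic_on ball 0 1"
  by (rule holomorphic_onI) (use f_derivs(1) in
      \<open>auto simp: field_differentiable_def intro: has_field_derivative_at_within\<close>)

text \<open>The formal equation gives the analytic one near 0, and the identity theorem extends it
  to the whole disc.\<close>

lemma f_ode:
  assumes "norm t < 1"
  shows "t * (1 - t) * f2 t + (1 - (a + b + 1) * t) * f1 t - a * b * f0 t = 0"
proof -
  define A where "A = (\<lambda>t. t * (1 - t) * f2 t + (1 - (a + b + 1) * t) * f1 t - a * b * f0 t)"
  have f2h: "f2 holomorphic_on ball 0 1"
    unfolding f2_def using in_conv_radius(3) by (intro holomorphic_on_eval_fps) (auto simp: eball_def)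
  have f1h: "f1 holomorphic_on ball 0 1"
    by (rule holomorphic_onI) (use f_derivs(2) in
      \<open>auto simp: field_differentiable_def intro: has_field_derivative_at_within\<close>)
  have Ah: "A holomorphic_on ball 0 1"
    unfolding A_def by (intro holomorphic_intros f2h f1h f_holomorphic)
  have pos: "0 < fps_conv_radius (fps_deriv (fps_hypergeo [a, b] [1] 1))"
    "0 < fps_conv_radius (fps_deriv (fps_deriv (fps_hypergeo [a, b] [1] 1)))"
    using in_conv_radius(2,3)[of 0] by (simp_all add: zero_ereal_def)
  have "A has_fps_expansion fps_X * (1 - fps_X) * fps_deriv (fps_deriv (fps_hypergeo [a, b] [1] 1))
     + (1 - fps_const (a + b + 1) * fps_X) * fps_deriv (fps_hypergeo [a, b] [1] 1)
     - fps_const (a * b) * fps_hypergeo [a, b] [1] 1"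
    unfolding A_def
    by (intro fps_expansion_intros f0_has_fps_expansion pos[THEN eval_fps_has_fps_expansion, folded f1_def f2_def])
  hence "A has_fps_expansion 0"
    using hypergeometric_ode_fps_hypergeo[of a b] by (simp add: hypergeometric_ode_def)
  hence "\<forall>\<^sub>F z in nhds 0. A z = 0"
    by (simp add: has_fps_expansion_0_iff)
  then obtain S where S: "open S" "0 \<in> S" "\<And>z. z \<in> S \<Longrightarrow> A z = 0"
    by (auto simp: eventually_nhds)
  have "A t = 0"
    by (rule analytic_continuation_open[of "S \<inter> ball 0 1" "ball 0 1" A "\<lambda>_. 0"])
       (use S Ah assms in auto)
  thus ?thesis by (simp add: A_def)
qed

definition "\<sigma> = (a + b) / 2"
text \<open>The one-variable factor of F; the next two are its derivatives with the power of
  \<open>1 - t\<close> pulled out.\<close>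

definition "h0 t = f0 t * (1 - t) powr \<sigma>"
definition "h1 t = (1 - t) powr \<sigma> * (f1 t - \<sigma> * f0 t / (1 - t))"
definition "h2 t = (1 - t) powr \<sigma> * (f2 t - 2 * \<sigma> * f1 t / (1 - t) + \<sigma> * (\<sigma> - 1) * f0 t / (1 - t)\<^sup>2)"

lemma one_minus_not_nonpos:
  assumes "norm (t :: complex) < 1" shows "1 - t \<notin> \<real>\<^sub>\<le>\<^sub>0" "1 - t \<noteq> 0"
proof -
  have "Re t < 1" using assms complex_Re_le_cmod[of t] by linarith
  thus "1 - t \<notin> \<real>\<^sub>\<le>\<^sub>0" "1 - t \<noteq> 0" by (auto simp: complex_nonpos_Reals_iff)
qed

lemma powr_deriv:
  assumes "norm t < 1"
  shows "((\<lambda>t. (1 - t) powr \<sigma>) has_field_derivative - \<sigma> * (1 - t) powr \<sigma> / (1 - t)) (at t)"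
  using one_minus_not_nonpos[OF assms]
  by (auto intro!: derivative_eq_intros simp: powr_diff)

lemma h_derivs:
  assumes t: "norm t < 1"
  shows "(h0 has_field_derivative h1 t) (at t)" "(h1 has_field_derivative h2 t) (at t)"
proof -
  note w = one_minus_not_nonpos(2)[OF t]
  have 1: "((\<lambda>t. f1 t - \<sigma> * f0 t / (1 - t)) has_field_derivative
      f2 t - \<sigma> * (f1 t * (1 - t) + f0 t) / (1 - t)\<^sup>2) (at t)"
    using w by (auto intro!: derivative_eq_intros f_derivs t simp: power2_eq_square field_simps)
  have h1: "h1 t = f1 t * (1 - t) powr \<sigma> + - \<sigma> * (1 - t) powr \<sigma> / (1 - t) * f0 t"
    by (simp add: h1_def field_simps)
  show "(h0 has_field_derivative h1 t) (at t)"
    unfolding h0_def[abs_def] h1 by (rule DERIV_mult[OF f_derivs(1)[OF t] powr_deriv[OF t]])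
  define p where "p = (1 - t) powr \<sigma>"
  have "h2 t = (- \<sigma> * p / (1 - t)) * (f1 t - \<sigma> * f0 t / (1 - t))
      + (f2 t - \<sigma> * (f1 t * (1 - t) + f0 t) / (1 - t)\<^sup>2) * p"
    unfolding h2_def p_def[symmetric] using w
    by (simp add: divide_simps) algebra
  thus "(h1 has_field_derivative h2 t) (at t)"
    unfolding h1_def[abs_def] using DERIV_mult[OF powr_deriv[OF t] 1] by (simp add: p_def)
qed

text \<open>With the exponent \<open>(a + b) / 2\<close> the twist of Gauss's equation removes the
  pole at 1 from the coefficient of the first derivative: up to the factor \<open>(1 - t)^2\<close>
  there remain \<open>t h'' + h'\<close> and a term without derivatives.\<close>

lemma h_ode:
  assumes t: "norm t < 1"
  shows "t * (1 - t)\<^sup>2 * h2 t + (1 - t)\<^sup>2 * h1 t + (\<sigma> - \<sigma>\<^sup>2 * t - a * b * (1 - t)) * h0 t = 0"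
proof -
  note w = one_minus_not_nonpos(2)[OF t]
  define c where "c = a * b"
  have ode: "t * (1 - t) * f2 t + (1 - (2 * \<sigma> + 1) * t) * f1 t - c * f0 t = 0"
  proof -
    have "2 * \<sigma> = a + b" by (simp add: \<sigma>_def)
    thus ?thesis using f_ode[OF t] by (simp only: c_def)
  qed
  have "t * (1 - t)\<^sup>2 * h2 t + (1 - t)\<^sup>2 * h1 t + (\<sigma> - \<sigma>\<^sup>2 * t - c * (1 - t)) * h0 t
    = (1 - t) powr \<sigma> * (1 - t) * (t * (1 - t) * f2 t + (1 - (2 * \<sigma> + 1) * t) * f1 t - c * f0 t)"
    unfolding h0_def h1_def h2_def using w
    by (simp add: divide_simps) algebra
  thus ?thesis unfolding ode by (simp add: c_def)
qed

lemma hyp_F_xy_symmetric: "hyp_F_xy a b = symmetric_xy h0"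
  by (auto simp: hyp_F_xy_def symmetric_xy_def hyp_F_def h0_def f0_def \<sigma>_def Let_def fun_eq_iff mult_ac)

text \<open>Generic points are handled in the chart. For fixed \<open>x\<close> the excluded values
  of \<open>y\<close>, on the discriminant or on \<open>x + y + 1 = 0\<close>, are isolated, and
  both left-hand sides are continuous in \<open>y\<close>, so at the remaining points of the
  discriminant they vanish as limits.\<close>

lemma solves_system_hyp_F_xy: "solves_system a b (hyp_F_xy a b)"
proof -
  define \<Psi> where "\<Psi> = symmetric_xy h0"
  have "h0 holomorphic_on ball 0 1"
    by (rule holomorphic_onI) (use h_derivs(1) in
      \<open>auto simp: field_differentiable_def intro: has_field_derivative_at_within\<close>)
  hence pair: "holomorphic_pair xy_domain \<Psi>"
    unfolding \<Psi>_def by (rule holomorphic_pair_symmetric_xy)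
  define L1 where "L1 = (\<lambda>(x, y). D\<^sub>x (D\<^sub>x \<Psi>) (x, y) + 2 * D\<^sub>x (D\<^sub>y \<Psi>) (x, y)
          - 1 / (x + y + 1) * D\<^sub>x \<Psi> (x, y)
          + x / (x + y + 1) * D\<^sub>y \<Psi> (x, y)
          + (2 * a * b - a - b) * x / (2 * (x + y + 1)) * \<Psi> (x, y))"
  define L2 where "L2 = (\<lambda>(x, y). D\<^sub>y (D\<^sub>y \<Psi>) (x, y) + 2 * y / x\<^sup>2 * D\<^sub>x (D\<^sub>y \<Psi>) (x, y)
          + y\<^sup>2 / (x\<^sup>2 * (x + y + 1)) * D\<^sub>x \<Psi> (x, y)
          + (y - x - x\<^sup>2) / (x * (x + y + 1)) * D\<^sub>y \<Psi> (x, y)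
          - ((a + b) * (a + b - 2) * (x\<^sup>2 + x) + (a - b)\<^sup>2 * x * y
               - (4 * a * b - 2 * a - 2 * b) * y) / (4 * x * (x + y + 1)) * \<Psi> (x, y))"
  have x0: "x \<noteq> 0" if xy: "(x, y) \<in> xy_domain" for x y
  proof
    assume "x = 0"
    then obtain t1 t2 :: complex where "t1 + t2 = 2" "norm t1 < 1" "norm t2 < 1"
      using xy by (auto simp: xy_domain_def)
    thus False using norm_triangle_ineq[of t1 t2] by simp
  qed
  have generic: "L1 (x, y) = 0 \<and> L2 (x, y) = 0"
    if xy: "(x, y) \<in> xy_domain" "x\<^sup>2 - 4 * y \<noteq> 0" "x + y + 1 \<noteq> 0" for x y
  proof -
    define D where "D = x\<^sup>2 - 4 * y"
    interpret discriminant_chart D by unfold_locales (use xy in \<open>simp add: D_def\<close>)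
    define p where "p = (x, y)"
    have p: "p \<in> dom" using xy d by (simp add: dom_def p_def flip: D_def)
    have n: "norm (r1 p) < 1" "norm (r2 p) < 1" using norm_roots[OF p] by auto
    have fs: "fst p = x" "snd p = y" by (simp_all add: p_def)
    have "x + y + 1 = (r1 p + r2 p - 2) + (1 - r1 p) * (1 - r2 p) + 1"
      using roots_eq[of p] unfolding fs by simp
    also have "\<dots> = r1 p * r2 p" by (simp add: algebra_simps)
    finally have "x + y + 1 = r1 p * r2 p" .
    hence ne: "r1 p \<noteq> 0" "r2 p \<noteq> 0" using xy by auto
    have eq: "x = r1 p + r2 p - 2" "y = (1 - r1 p) * (1 - r2 p)" "s p = r1 p - r2 p"
      using roots_eq[of p] unfolding fs by auto
    have \<Psi>p: "\<Psi> (x, y) = h0 (r1 p) * h0 (r2 p)"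
      using symmetric_xy_roots[of h0 p] by (simp add: \<Psi>_def p_def)
    have 1: "2 * a * b - a - b = 2 * (a * b) - 2 * \<sigma>" "(a + b) * (a + b - 2) = 2 * \<sigma> * (2 * \<sigma> - 2)"
      "(a - b)\<^sup>2 = 4 * \<sigma>\<^sup>2 - 4 * (a * b)" "4 * a * b - 2 * a - 2 * b = 4 * (a * b) - 4 * \<sigma>"
      by (simp_all add: \<sigma>_def power2_eq_square field_simps)
    note alg = pde_algebra[OF ne s_nonzero[OF p] x0[OF xy(1)] eq(1,2,3) h_ode[OF n(1)] h_ode[OF n(2)]
        Dx_symmetric_xy[OF h_derivs p, unfolded P_def fs]
        Dy_symmetric_xy[OF h_derivs p, unfolded P_def fs]
        second_derivs[OF h_derivs p, unfolded P_def fs]]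
    show ?thesis
      unfolding L1_def L2_def prod.case 1 \<Psi>p unfolding \<Psi>_def p_def[symmetric]
      by (rule conjI; rule alg; assumption)
  qed
  have op: "open xy_domain" by (rule open_xy_domain)
  have main: "L1 (x, y) = 0 \<and> L2 (x, y) = 0" if xy: "(x, y) \<in> xy_domain" "x + y + 1 \<noteq> 0" for x y
  proof -
    have c: "isCont (\<lambda>v. g (x, v)) y" if "holomorphic_pair xy_domain g" for g
    proof -
      have "continuous_on xy_domain g" using that by (simp add: holomorphic_pair_def)
      hence "isCont g (x, y)" using xy op by (simp add: continuous_on_eq_continuous_at)
      thus ?thesis by (intro isCont_o2[where f = "\<lambda>v. (x, v)" and g = g] continuous_intros)
    qed
    note cs = c[OF pair] c[OF holomorphic_pair_Dx[OF op pair]] c[OF holomorphic_pair_Dy[OF op pair]]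
      c[OF holomorphic_pair_Dx[OF op holomorphic_pair_Dx[OF op pair]]]
      c[OF holomorphic_pair_Dx[OF op holomorphic_pair_Dy[OF op pair]]]
      c[OF holomorphic_pair_Dy[OF op holomorphic_pair_Dy[OF op pair]]]
    have "isCont (\<lambda>v. L1 (x, v)) y" "isCont (\<lambda>v. L2 (x, v)) y"
      unfolding L1_def L2_def prod.case using xy x0[OF xy(1)]
      by (intro continuous_add continuous_diff continuous_mult continuous_divide continuous_power
          continuous_ident continuous_const cs; simp del: distrib_left_numeral distrib_right_numeral)+
    moreover have "\<forall>\<^sub>F v in at y. L1 (x, v) = 0 \<and> L2 (x, v) = 0"
    proof -
      define A where "A = (\<lambda>v. (x, v)) -` xy_domain"
      have A: "open A" unfolding A_def by (intro open_vimage op continuous_intros)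
      have "\<forall>\<^sub>F v in at y. v \<in> A - {y}"
        using A xy by (intro eventually_at_in_open) (auto simp: A_def)
      moreover have "\<forall>\<^sub>F v in at y. v \<noteq> x\<^sup>2 / 4"
        by (rule eventually_neq_at_within)
      moreover have "\<forall>\<^sub>F v in at y. v \<noteq> - x - 1"
        by (rule eventually_neq_at_within)
      ultimately show ?thesis
      proof eventually_elim
        case (elim v)
        show ?case
        proof (rule generic)
          show "(x, v) \<in> xy_domain" using elim by (simp add: A_def)
          show "x\<^sup>2 - 4 * v \<noteq> 0" using elim(2) by (auto simp: field_simps)
          have "v = (x + v + 1) - x - 1" by simp
          thus "x + v + 1 \<noteq> 0" using elim(3) by (metis diff_0)
        qed
      qed
    qed
    ultimately have lims: "(\<lambda>v. L1 (x, v)) \<midarrow>y\<rightarrow> L1 (x, y)" "(\<lambda>v. L2 (x, v)) \<midarrow>y\<rightarrow> L2 (x, y)"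
      "(\<lambda>v. L1 (x, v)) \<midarrow>y\<rightarrow> 0" "(\<lambda>v. L2 (x, v)) \<midarrow>y\<rightarrow> 0"
      by (simp_all add: isCont_def tendsto_eventually eventually_conj_iff)
    show ?thesis using LIM_unique[OF lims(1,3)] LIM_unique[OF lims(2,4)] by simp
  qed
  show ?thesis
    unfolding solves_system_def hyp_F_xy_symmetric \<Psi>_def[symmetric]
  proof (intro conjI ballI)
    show "\<Psi> holomorphic2_on xy_domain"
      by (rule holomorphic_pair_imp_holomorphic2[OF op pair])
    fix p assume p: "p \<in> xy_domain"
    obtain x y where pxy: "p = (x, y)" by force
    note main = main[of x y, unfolded L1_def L2_def prod.case, OF p[unfolded pxy]]
    show "case p of (x, y) \<Rightarrow> x + y + 1 \<noteq> 0 \<longrightarrow>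
        D\<^sub>x (D\<^sub>x \<Psi>) (x, y) + 2 * D\<^sub>x (D\<^sub>y \<Psi>) (x, y)
          - 1 / (x + y + 1) * D\<^sub>x \<Psi> (x, y)
          + x / (x + y + 1) * D\<^sub>y \<Psi> (x, y)
          + (2 * a * b - a - b) * x / (2 * (x + y + 1)) * \<Psi> (x, y) = 0 \<and>
        D\<^sub>y (D\<^sub>y \<Psi>) (x, y) + 2 * y / x\<^sup>2 * D\<^sub>x (D\<^sub>y \<Psi>) (x, y)
          + y\<^sup>2 / (x\<^sup>2 * (x + y + 1)) * D\<^sub>x \<Psi> (x, y)
          + (y - x - x\<^sup>2) / (x * (x + y + 1)) * D\<^sub>y \<Psi> (x, y)
          - ((a + b) * (a + b - 2) * (x\<^sup>2 + x) + (a - b)\<^sup>2 * x * y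
               - (4 * a * b - 2 * a - 2 * b) * y) / (4 * x * (x + y + 1)) * \<Psi> (x, y) = 0"
      unfolding pxy prod.case by (rule impI) (rule main)
  qed
qed

end

section \<open>Eisenstein series\<close>

text \<open>For positive \<open>k\<close> the origin contributes \<open>inverse 0 = 0\<close>, so
  the sum effectively runs over the nonzero lattice points.\<close>

definition lattice_sum :: "nat \<Rightarrow> complex \<Rightarrow> complex" where
  "lattice_sum k \<tau> = (\<Sum>\<^sub>\<infinity>(m, n). inverse ((of_int m * \<tau> + of_int n) ^ k))"

section \<open>Convergence and modularity of lattice sums\<close>

lemma summable_on_int:
  fixes f :: "int \<Rightarrow> real"
  assumes "\<And>n. f n \<ge> 0" "summable (\<lambda>n. f (int n))" "summable (\<lambda>n. f (- int n - 1))"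
  shows "f summable_on UNIV"
proof -
  have 1: "f summable_on range int"
    using assms by (subst summable_on_reindex) (auto simp: inj_on_def o_def summable_on_UNIV_nonneg_real_iff)
  have 2: "f summable_on range (\<lambda>n. - int n - 1)"
    using assms by (subst summable_on_reindex) (auto simp: inj_on_def o_def summable_on_UNIV_nonneg_real_iff)
  have "(UNIV :: int set) = range int \<union> range (\<lambda>n. - int n - 1)"
  proof -
    have "x \<in> range int \<union> range (\<lambda>n. - int n - 1)" for x :: int
    proof (cases "x \<ge> 0")
      case True thus ?thesis by (metis UnI1 nonneg_int_cases rangeI)
    next
      case False
      hence "x = - int (nat (- x - 1)) - 1" by simp
      thus ?thesis by blast
    qed
    thus ?thesis by blast
  qed
  with summable_on_union[OF 1 2] show ?thesis by simp
qed

text \<open>The integers are enumerated as \<open>n\<close> and \<open>- n - 1\<close> with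
  \<open>n\<close> natural. For a row of the lattice this is the splitting into polygamma series at
  \<open>z\<close> and at \<open>1 - z\<close>.\<close>

lemma sums_int:
  fixes f :: "int \<Rightarrow> complex"
  assumes "f summable_on UNIV"
  shows "(\<lambda>n. f (int n) + f (- int n - 1)) sums infsum f UNIV"
proof -
  have U: "(UNIV :: int set) = range int \<union> range (\<lambda>n. - int n - 1)"
  proof -
    have "x \<in> range int \<union> range (\<lambda>n. - int n - 1)" for x :: int
    proof (cases "x \<ge> 0")
      case True thus ?thesis by (metis UnI1 nonneg_int_cases rangeI)
    next
      case False
      hence "x = - int (nat (- x - 1)) - 1" by simp
      thus ?thesis by blast
    qed
    thus ?thesis by blast
  qed
  have s: "f summable_on range int" "f summable_on range (\<lambda>n. - int n - 1)"
    using summable_on_subset_banach[OF assms] by blast+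
  have inj: "inj int" "inj (\<lambda>n. - int n - 1)" by (auto simp: inj_on_def)
  have "(f has_sum infsum f (range int)) (range int)" by (rule has_sum_infsum[OF s(1)])
  hence 1: "(\<lambda>n. f (int n)) sums infsum f (range int)"
    by (intro has_sum_imp_sums) (subst (asm) has_sum_reindex, auto simp: inj o_def)
  have "(f has_sum infsum f (range (\<lambda>n. - int n - 1))) (range (\<lambda>n. - int n - 1))"
    by (rule has_sum_infsum[OF s(2)])
  hence 2: "(\<lambda>n. f (- int n - 1)) sums infsum f (range (\<lambda>n. - int n - 1))"
    by (intro has_sum_imp_sums) (subst (asm) has_sum_reindex, auto simp: inj o_def)
  have "infsum f UNIV = infsum f (range int) + infsum f (range (\<lambda>n. - int n - 1))"
    unfolding U by (intro infsum_Un_disjoint s) auto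
  thus ?thesis using sums_add[OF 1 2] by simp
qed

text \<open>Positive definiteness of the norm form with an explicit constant: \<open>n\<close> is
  written as \<open>(m Re \<tau> + n) - m Re \<tau>\<close>, and \<open>m\<close> is bounded through
  the imaginary part.\<close>

lemma norm_lattice_point_ge:
  assumes \<tau>: "Im \<tau> > 0"
  shows "real_of_int (m\<^sup>2 + n\<^sup>2) \<le> (2 + (1 + 2 * (Re \<tau>)\<^sup>2) / (Im \<tau>)\<^sup>2) * (norm (of_int m * \<tau> + of_int n))\<^sup>2"
proof -
  define x y where "x = Re \<tau>" and "y = Im \<tau>"
  have y: "y > 0" using \<tau> by (simp add: y_def)
  define M N where "M = real_of_int m" and "N = real_of_int n"
  have nrm: "(norm (of_int m * \<tau> + of_int n))\<^sup>2 = (M * x + N)\<^sup>2 + (M * y)\<^sup>2"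
    by (simp add: cmod_power2 M_def N_def x_def y_def)
  have "N\<^sup>2 \<le> 2 * (M * x + N)\<^sup>2 + 2 * (M * x)\<^sup>2"
  proof -
    have "2 * (M * x + N)\<^sup>2 + 2 * (M * x)\<^sup>2 - N\<^sup>2 = (2 * M * x + N)\<^sup>2"
      by (simp add: power2_eq_square algebra_simps)
    thus ?thesis by (smt (verit) zero_le_power2)
  qed
  hence "M\<^sup>2 + N\<^sup>2 \<le> 2 * (M * x + N)\<^sup>2 + (1 + 2 * x\<^sup>2) * M\<^sup>2"
    by (simp add: power_mult_distrib algebra_simps)
  also have "(1 + 2 * x\<^sup>2) * M\<^sup>2 = (1 + 2 * x\<^sup>2) / y\<^sup>2 * (M * y)\<^sup>2"
    using y by (simp add: power_mult_distrib)
  also have "2 * (M * x + N)\<^sup>2 + (1 + 2 * x\<^sup>2) / y\<^sup>2 * (M * y)\<^sup>2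
      \<le> (2 + (1 + 2 * x\<^sup>2) / y\<^sup>2) * ((M * x + N)\<^sup>2 + (M * y)\<^sup>2)"
  proof -
    have "0 \<le> (1 + 2 * x\<^sup>2) / y\<^sup>2 * (M * x + N)\<^sup>2 + 2 * (M * y)\<^sup>2" by simp
    thus ?thesis by (simp add: algebra_simps)
  qed
  finally show ?thesis
    unfolding nrm x_def[symmetric] y_def[symmetric] by (simp add: M_def N_def)
qed

text \<open>Away from the origin \<open>(1 + m^2) (1 + n^2) \<le> 3 (m^2 + n^2)^2\<close>, so the
  fourth power already allows comparison with a product of two convergent series in one variable;
  higher exponents only help because \<open>m^2 + n^2 \<ge> 1\<close>.\<close>

lemma lattice_summable:
  assumes \<tau>: "Im \<tau> > 0" and l: "l \<ge> 2"
  shows "(\<lambda>(m, n). inverse ((of_int m * \<tau> + of_int n) ^ (2 * l))) summable_on UNIV"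
proof -
  define K where "K = 2 + (1 + 2 * (Re \<tau>)\<^sup>2) / (Im \<tau>)\<^sup>2"
  have K: "K > 0" unfolding K_def by (simp add: add_pos_nonneg)
  define w :: "int \<Rightarrow> real" where "w = (\<lambda>n. 1 / (1 + of_int n ^ 2))"
  have w: "w n > 0" for n by (auto simp: w_def intro!: divide_pos_pos add_pos_nonneg)
  have ws: "w summable_on UNIV"
  proof (rule summable_on_int)
    have sm: "summable (\<lambda>n::nat. 2 * inverse (real (Suc n) ^ 2))"
      by (intro summable_mult) (subst summable_Suc_iff, rule inverse_power_summable, simp)
    have le: "w (int n) \<le> 2 * inverse (real (Suc n) ^ 2)" "w (- int n - 1) \<le> 2 * inverse (real (Suc n) ^ 2)" for n
    proof -
      have "real (Suc n) ^ 2 \<le> 2 * (1 + real n ^ 2)"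
        using zero_le_power2[of "real n - 1"] by (simp add: power2_eq_square algebra_simps)
      thus "w (int n) \<le> 2 * inverse (real (Suc n) ^ 2)"
        unfolding w_def by (simp add: divide_simps add_pos_nonneg del: of_nat_Suc)
      have eq: "real_of_int (- int n - 1) ^ 2 = real (Suc n) ^ 2" by (simp add: power2_eq_square algebra_simps)
      have pos: "real (Suc n) ^ 2 > 0" by simp
      have "real (Suc n) ^ 2 \<le> 2 * (1 + real (Suc n) ^ 2)" by simp
      thus "w (- int n - 1) \<le> 2 * inverse (real (Suc n) ^ 2)"
        unfolding w_def eq using pos by (simp add: divide_simps add_pos_nonneg del: of_nat_Suc)
    qed
    show "summable (\<lambda>n. w (int n))" "summable (\<lambda>n. w (- int n - 1))"
      using w by (auto intro!: summable_comparison_test'[OF sm, where N = 0] le simp: less_imp_le abs_of_pos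
          simp del: of_nat_Suc)
  qed (rule less_imp_le[OF w])
  have prod: "(\<lambda>(m, n). w m * w n) summable_on UNIV \<times> UNIV"
  proof (rule summable_on_SigmaI)
    show "((\<lambda>y. case (x, y) of (m, n) \<Rightarrow> w m * w n) has_sum w x * infsum w UNIV) UNIV" for x
      by (simp add: has_sum_cmult_right has_sum_infsum[OF ws])
    show "(\<lambda>x. w x * infsum w UNIV) summable_on UNIV"
      by (intro summable_on_cmult_left ws)
  qed (use w in \<open>auto simp: less_imp_le\<close>)
  have "(\<lambda>p. norm (case p of (m, n) \<Rightarrow> inverse ((of_int m * \<tau> + of_int n) ^ (2 * l)))) summable_on UNIV"
  proof (rule summable_on_comparison_test[of "\<lambda>p. 3 * K ^ l * (case p of (m, n) \<Rightarrow> w m * w n)"])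
    show "(\<lambda>p. 3 * K ^ l * (case p of (m, n) \<Rightarrow> w m * w n)) summable_on UNIV"
      using prod by (intro summable_on_cmult_right) simp
    fix p :: "int \<times> int"
    obtain m n where p: "p = (m, n)" by force
    show "norm (case p of (m, n) \<Rightarrow> inverse ((of_int m * \<tau> + of_int n) ^ (2 * l)))
        \<le> 3 * K ^ l * (case p of (m, n) \<Rightarrow> w m * w n)"
    proof (cases "m = 0 \<and> n = 0")
      case True
      then show ?thesis using w K l by (simp add: p less_imp_le zero_power)
    next
      case False
      define S where "S = real_of_int (m\<^sup>2 + n\<^sup>2)"
      define r where "r = (norm (of_int m * \<tau> + of_int n))\<^sup>2"
      have "m\<^sup>2 + n\<^sup>2 > 0" using False by (simp add: sum_power2_gt_zero_iff)
      hence S1: "S \<ge> 1" unfolding S_def by linarith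
      have Sr: "S \<le> K * r" using norm_lattice_point_ge[OF \<tau>, of m n] by (simp add: S_def K_def r_def)
      hence r: "r > 0" using S1 K by (smt (verit) mult_nonneg_nonpos)
      have "(1 + real_of_int m ^ 2) * (1 + real_of_int n ^ 2) \<le> 3 * S\<^sup>2"
      proof -
        have mn: "real_of_int m ^ 2 * real_of_int n ^ 2 \<le> S * S"
          unfolding S_def by (intro mult_mono) auto
        have "S * 1 \<le> S * S" "1 \<le> S * S" using S1 by (auto intro: mult_left_mono mult_mono[of 1 S 1 S, simplified])
        moreover have "(1 + real_of_int m ^ 2) * (1 + real_of_int n ^ 2) = 1 + S + real_of_int m ^ 2 * real_of_int n ^ 2"
          by (simp add: S_def algebra_simps)
        ultimately show ?thesis using mn by (simp add: power2_eq_square)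
      qed
      also have "S\<^sup>2 \<le> S ^ l" using S1 l by (intro power_increasing)
      also have "S ^ l \<le> (K * r) ^ l" using Sr S1 by (intro power_mono) auto
      finally have le: "(1 + real_of_int m ^ 2) * (1 + real_of_int n ^ 2) \<le> 3 * K ^ l * r ^ l"
        by (simp add: power_mult_distrib)
      have "norm (inverse ((of_int m * \<tau> + of_int n) ^ (2 * l))) = 1 / r ^ l"
        by (simp add: r_def norm_inverse norm_power power_mult inverse_eq_divide norm_divide)
      also have "\<dots> \<le> 3 * K ^ l * (w m * w n)"
      proof -
        have pos: "(1 + real_of_int m ^ 2) * (1 + real_of_int n ^ 2) > 0"
          by (intro mult_pos_pos add_pos_nonneg) auto
        define Q where "Q = (1 + real_of_int m ^ 2) * (1 + real_of_int n ^ 2)"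
        have w_eq: "w m * w n = 1 / Q" by (simp add: w_def Q_def)
        have "Q > 0" "Q \<le> 3 * K ^ l * r ^ l" using pos le by (auto simp: Q_def)
        thus ?thesis unfolding w_eq using r by (simp add: divide_simps)
      qed
      finally show ?thesis by (simp add: p)
    qed
  qed auto
  thus ?thesis by (rule abs_summable_summable)
qed

text \<open>A unimodular matrix permutes the row vectors \<open>(m, n)\<close>; the factor comes
  from clearing the denominator in each term.\<close>

lemma lattice_sum_modular:
  fixes a b c d :: int
  assumes det: "a * d - b * c = 1" and nz: "of_int c * \<tau> + of_int d \<noteq> 0"
  shows "lattice_sum k ((of_int a * \<tau> + of_int b) / (of_int c * \<tau> + of_int d)) =
           (of_int c * \<tau> + of_int d) ^ k * lattice_sum k \<tau>"
proof -
  define j where "j = of_int c * \<tau> + of_int d"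
  define \<phi> where "\<phi> = (\<lambda>(m, n). (m * a + n * c, m * b + n * d))"
  have bij: "bij_betw \<phi> UNIV UNIV"
  proof (rule bij_betw_byWitness[where f' = "\<lambda>(m, n). (m * d - n * c, n * a - m * b)"])
    have "(m * a + n * c) * d - (m * b + n * d) * c = m * (a * d - b * c)"
      "(m * b + n * d) * a - (m * a + n * c) * b = n * (a * d - b * c)"
      "(m * d - n * c) * a + (n * a - m * b) * c = m * (a * d - b * c)"
      "(m * d - n * c) * b + (n * a - m * b) * d = n * (a * d - b * c)" for m n
      by (simp_all add: algebra_simps)
    thus "\<forall>p\<in>UNIV. (case \<phi> p of (m, n) \<Rightarrow> (m * d - n * c, n * a - m * b)) = p"
      "\<forall>p\<in>UNIV. \<phi> (case p of (m, n) \<Rightarrow> (m * d - n * c, n * a - m * b)) = p"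
      by (auto simp: \<phi>_def det)
  qed auto
  have "lattice_sum k ((of_int a * \<tau> + of_int b) / j) =
      (\<Sum>\<^sub>\<infinity>p. j ^ k * (case \<phi> p of (m, n) \<Rightarrow> inverse ((of_int m * \<tau> + of_int n) ^ k)))"
    unfolding lattice_sum_def
  proof (rule infsum_cong)
    fix p :: "int \<times> int"
    obtain m n where p: "p = (m, n)" by force
    have eq: "of_int m * ((of_int a * \<tau> + of_int b) / j) + of_int n =
        (of_int (m * a + n * c) * \<tau> + of_int (m * b + n * d)) / j"
      using nz by (simp add: j_def field_simps)
    show "(case p of (m, n) \<Rightarrow> inverse ((of_int m * ((of_int a * \<tau> + of_int b) / j) + of_int n) ^ k)) =
        j ^ k * (case \<phi> p of (m, n) \<Rightarrow> inverse ((of_int m * \<tau> + of_int n) ^ k))"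
      unfolding p prod.case \<phi>_def eq by (simp only: power_divide divide_inverse inverse_mult_distrib
          inverse_inverse_eq power_inverse mult.commute power_mult_distrib)
  qed
  also have "\<dots> = j ^ k * (\<Sum>\<^sub>\<infinity>p. (case \<phi> p of (m, n) \<Rightarrow> inverse ((of_int m * \<tau> + of_int n) ^ k)))"
    by (rule infsum_cmult_right')
  also have "(\<Sum>\<^sub>\<infinity>p. (case \<phi> p of (m, n) \<Rightarrow> inverse ((of_int m * \<tau> + of_int n) ^ k))) = lattice_sum k \<tau>"
    unfolding lattice_sum_def by (rule infsum_reindex_bij_betw[OF bij])
  finally show ?thesis by (simp add: j_def)
qed

text \<open>Summation by rows of fixed \<open>m\<close>. Rows \<open>m\<close> and
  \<open>- m\<close> agree since the exponent is even, and the row \<open>m = 0\<close> is the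
  constant subtracted on the right.\<close>

lemma lattice_sum_rows:
  assumes \<tau>: "Im \<tau> > 0" and l: "l \<ge> 2"
    and R: "\<And>z. Im z > 0 \<Longrightarrow> (\<lambda>n. inverse ((z + of_int n) ^ (2 * l))) summable_on (UNIV :: int set) \<Longrightarrow>
              (\<Sum>\<^sub>\<infinity>n::int. inverse ((z + of_int n) ^ (2 * l))) = R z"
  shows "(\<lambda>n. 2 * R (of_nat (Suc n) * \<tau>)) sums
           (lattice_sum (2 * l) \<tau> - (\<Sum>\<^sub>\<infinity>n::int. inverse (of_int n ^ (2 * l))))"
proof -
  define f where "f = (\<lambda>(m, n). inverse ((of_int m * \<tau> + of_int n) ^ (2 * l)))"
  have f: "f summable_on UNIV \<times> UNIV" using lattice_summable[OF \<tau> l] by (simp add: f_def)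
  define g where "g = (\<lambda>m. \<Sum>\<^sub>\<infinity>n. f (m, n))"
  have g: "g summable_on UNIV" unfolding g_def
    using summable_on_Sigma_banach[of "\<lambda>m n. f (m, n)" UNIV "\<lambda>_. UNIV"] f by simp
  have tot: "lattice_sum (2 * l) \<tau> = infsum g UNIV"
    unfolding lattice_sum_def g_def using infsum_Sigma_banach[OF f] by (simp add: f_def)
  have pos: "g (int (Suc n)) = R (of_nat (Suc n) * \<tau>)" for n
  proof -
    have im: "Im (of_nat (Suc n) * \<tau>) > 0" using \<tau> by (simp del: of_nat_Suc)
    have "(\<lambda>(m, n). inverse ((of_int m * (of_nat (Suc n') * \<tau>) + of_int n) ^ (2 * l))) summable_on UNIV \<times> UNIV" for n' :: nat
      using \<tau> l by (simp add: lattice_summable del: of_nat_Suc)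
    from summable_on_SigmaD1[OF this[of n], of 1]
    have "(\<lambda>k. inverse ((of_nat (Suc n) * \<tau> + of_int k) ^ (2 * l))) summable_on UNIV" by simp
    from R[OF im this] show ?thesis by (simp add: g_def f_def)
  qed
  have neg: "g (- int n - 1) = R (of_nat (Suc n) * \<tau>)" for n
  proof -
    have "g (- int n - 1) = (\<Sum>\<^sub>\<infinity>k. f (- int n - 1, - k))"
      unfolding g_def by (rule infsum_reindex_bij_betw[symmetric, where g = uminus]) (auto intro!: bij_uminus)
    also have "\<dots> = g (int (Suc n))"
      unfolding g_def
    proof (rule infsum_cong)
      fix k :: int
      have "of_int (- int n - 1) * \<tau> + of_int (- k) = - (of_int (int (Suc n)) * \<tau> + of_int k)"
        by (simp add: algebra_simps)
      moreover have "(- z) ^ (2 * l) = z ^ (2 * l)" for z :: complex by (simp add: power_mult)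
      ultimately show "f (- int n - 1, - k) = f (int (Suc n), k)" by (simp only: f_def prod.case)
    qed
    finally show ?thesis by (simp only: pos)
  qed
  have g0: "g 0 = (\<Sum>\<^sub>\<infinity>n::int. inverse (of_int n ^ (2 * l)))" by (simp add: g_def f_def)
  have s1: "g summable_on range int" "g summable_on range (\<lambda>n. - int n - 1)"
    using summable_on_subset_banach[OF g] by blast+
  have sn: "summable (\<lambda>n. g (- int n - 1))"
  proof -
    have "(\<lambda>n. g (- int n - 1)) summable_on UNIV"
      using s1(2) by (subst (asm) summable_on_reindex) (auto simp: inj_on_def o_def)
    thus ?thesis by (rule summable_on_imp_summable)
  qed
  \<comment> \<open>Row \<open>n\<close> is paired here with row \<open>- n - 1\<close>. Below, the
    series is taken apart and reassembled with its first half shifted by one, so that row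
    \<open>n + 1\<close> meets row \<open>- n - 1\<close> and row 0 drops out.\<close>
  have "(\<lambda>n. g (int n) + g (- int n - 1)) sums lattice_sum (2 * l) \<tau>"
    unfolding tot by (rule sums_int[OF g])
  from sums_diff[OF this summable_sums[OF sn]]
  have "(\<lambda>n. g (int n)) sums (lattice_sum (2 * l) \<tau> - (\<Sum>n. g (- int n - 1)))" by simp
  hence "(\<lambda>n. g (int (Suc n))) sums (lattice_sum (2 * l) \<tau> - (\<Sum>n. g (- int n - 1)) - g 0)"
    unfolding sums_Suc_iff[where f = "\<lambda>n. g (int n)"] by (simp only: diff_add_cancel of_nat_0)
  from sums_add[OF this summable_sums[OF sn]]
  have "(\<lambda>n. g (int (Suc n)) + g (- int n - 1)) sums (lattice_sum (2 * l) \<tau> - g 0)" by simp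
  thus ?thesis by (simp only: pos neg mult_2 g0)
qed

text \<open>All terms are nonnegative reals, as the exponent is even, and \<open>n = 1\<close>
  contributes 1.\<close>

lemma power_inverse_sum_nonzero:
  assumes "l \<ge> 1"
  shows "(\<Sum>\<^sub>\<infinity>n::int. inverse (of_int n ^ (2 * l)) :: complex) \<noteq> 0"
proof -
  have s: "(\<lambda>n::int. inverse (real_of_int n ^ (2 * l))) summable_on UNIV"
  proof (rule summable_on_int)
    have 1: "summable (\<lambda>n. inverse (real n ^ (2 * l)))" using assms by (intro inverse_power_summable) simp
    thus "summable (\<lambda>n. inverse (real_of_int (int n) ^ (2 * l)))" by simp
    have "summable (\<lambda>n. inverse (real (Suc n) ^ (2 * l)))" using 1 by (subst summable_Suc_iff)
    moreover have "real_of_int (- int n - 1) ^ (2 * l) = real (Suc n) ^ (2 * l)" for n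
    proof -
      have "real_of_int (- int n - 1) = - real (Suc n)" by simp
      moreover have "(- z) ^ (2 * l) = z ^ (2 * l)" for z :: real by (simp add: power_mult)
      ultimately show ?thesis by (simp only:)
    qed
    ultimately show "summable (\<lambda>n. inverse (real_of_int (- int n - 1) ^ (2 * l)))" by simp
  qed (simp add: power_mult)
  have "sum (\<lambda>n::int. inverse (real_of_int n ^ (2 * l))) {1} \<le> (\<Sum>\<^sub>\<infinity>n::int. inverse (real_of_int n ^ (2 * l)))"
    by (intro finite_sum_le_infsum s) (auto simp: power_mult)
  hence "(\<Sum>\<^sub>\<infinity>n::int. inverse (real_of_int n ^ (2 * l))) \<noteq> 0" by simp
  moreover have "(\<Sum>\<^sub>\<infinity>n::int. inverse (of_int n ^ (2 * l)) :: complex) =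
      of_real (\<Sum>\<^sub>\<infinity>n::int. inverse (real_of_int n ^ (2 * l)))"
    using has_sum_of_real[OF has_sum_infsum[OF s], where ?'a = complex] by (intro infsumI) simp
  ultimately show ?thesis by simp
qed

section \<open>Lipschitz's formula from the reflection formula of the Gamma function\<close>

lemma not_nonpos_Int_upper:
  assumes "Im z > 0" shows "z \<notin> \<int>\<^sub>\<le>\<^sub>0" "1 - z \<notin> \<int>\<^sub>\<le>\<^sub>0"
  using assms by (auto elim!: nonpos_Ints_cases simp: complex_eq_iff)

text \<open>Logarithmic derivative of the reflection formula for \<open>rGamma\<close>.\<close>

lemma Digamma_reflection:
  fixes z :: complex
  assumes z: "Im z > 0"
  shows "Digamma (1 - z) - Digamma z = of_real pi * cot (of_real pi * z)"
proof -
  note n = not_nonpos_Int_upper[OF z]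
  have 1: "((\<lambda>z. rGamma z * rGamma (1 - z)) has_field_derivative
      rGamma z * rGamma (1 - z) * (Digamma (1 - z) - Digamma z)) (at z)"
    using n by (auto intro!: derivative_eq_intros has_field_derivative_rGamma_no_nonpos_int
        DERIV_chain2[where f = rGamma, OF has_field_derivative_rGamma_no_nonpos_int] simp: algebra_simps)
  have "((\<lambda>z. sin (of_real pi * z) / of_real pi) has_field_derivative cos (of_real pi * z)) (at z)"
    by (auto intro!: derivative_eq_intros)
  hence 2: "((\<lambda>z. rGamma z * rGamma (1 - z)) has_field_derivative cos (of_real pi * z)) (at z)"
    by (simp only: rGamma_reflection_complex)
  have "rGamma z * rGamma (1 - z) * (Digamma (1 - z) - Digamma z) = cos (of_real pi * z)"
    by (rule DERIV_unique[OF 1 2])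
  hence *: "sin (of_real pi * z) / of_real pi * (Digamma (1 - z) - Digamma z) = cos (of_real pi * z)"
    by (simp only: rGamma_reflection_complex)
  have "rGamma z * rGamma (1 - z) \<noteq> 0" using n by (simp add: rGamma_eq_zero_iff)
  hence "sin (of_real pi * z) \<noteq> 0" by (simp add: rGamma_reflection_complex)
  with * show ?thesis by (simp add: cot_def field_simps)
qed

lemma norm_exp_upper: "Im z > 0 \<Longrightarrow> norm (exp (2 * of_real pi * \<i> * z)) < 1"
  by simp

lemma Digamma_reflection_exp:
  fixes z :: complex
  assumes z: "Im z > 0"
  defines "q \<equiv> exp (2 * of_real pi * \<i> * z)"
  shows "Digamma (1 - z) - Digamma z = - of_real pi * \<i> - 2 * of_real pi * \<i> * (q / (1 - q))"
proof -
  define e where "e = exp (\<i> * (of_real pi * z))"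
  have e: "q = e ^ 2" "e \<noteq> 0" by (auto simp: e_def q_def exp_double[symmetric] mult_ac)
  have q1: "1 - q \<noteq> 0" using norm_exp_upper[OF z] unfolding q_def[symmetric] by auto
  have "cot (of_real pi * z) = ((e + inverse e) / 2) / ((e - inverse e) / (2 * \<i>))"
    by (simp add: cot_def cos_exp_eq sin_exp_eq e_def exp_minus)
  also have "\<dots> = - \<i> * ((1 + q) / (1 - q))"
  proof -
    have "e - inverse e = - (1 - q) / e" "e + inverse e = (1 + q) / e"
      using e by (simp_all add: field_simps power2_eq_square)
    thus ?thesis using e(2) q1 by (simp add: field_simps)
  qed
  also have "(1 + q) / (1 - q) = 1 + 2 * (q / (1 - q))" using q1 by (simp add: field_simps)
  finally have c: "cot (of_real pi * z) = - \<i> * (1 + 2 * (q / (1 - q)))" .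
  show ?thesis unfolding Digamma_reflection[OF z] c by (simp add: algebra_simps)
qed

lemma upper_half_deriv_unique:
  assumes eq: "\<And>z. Im z > 0 \<Longrightarrow> F z = G z"
    and "\<And>z. Im z > 0 \<Longrightarrow> (F has_field_derivative F' z) (at z)"
    and "\<And>z. Im z > 0 \<Longrightarrow> (G has_field_derivative G' z) (at z)"
    and z: "Im z > 0"
  shows "F' z = G' z"
proof -
  have "(F has_field_derivative G' z) (at z)"
    by (rule DERIV_cong_ev[THEN iffD2, OF refl _ refl assms(3)[OF z]])
       (use eventually_nhds_in_open[OF open_halfspace_Im_gt[of 0], of z] z in
         \<open>auto elim!: eventually_mono simp: eq\<close>)
  thus ?thesis using DERIV_unique assms(2)[OF z] by blast
qed

lemma exp_chain:
  assumes "\<And>q. norm q < 1 \<Longrightarrow> (f has_field_derivative f' q) (at q)"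
    and "\<And>q. norm q < 1 \<Longrightarrow> q * f' q = g q" and z: "Im z > 0"
  shows "((\<lambda>z. f (exp (2 * of_real pi * \<i> * z))) has_field_derivative
            2 * of_real pi * \<i> * g (exp (2 * of_real pi * \<i> * z))) (at z)"
proof -
  note n = norm_exp_upper[OF z]
  have "((\<lambda>z. exp (2 * of_real pi * \<i> * z)) has_field_derivative
      2 * of_real pi * \<i> * exp (2 * of_real pi * \<i> * z)) (at z)"
    by (auto intro!: derivative_eq_intros)
  from DERIV_chain2[where f = f, OF assms(1)[OF n] this] show ?thesis
    using assms(2)[OF n] by (simp add: mult_ac)
qed

text \<open>\<open>lipschitz j q = (\<Sum>n. n ^ j * q ^ n)\<close>\<close>

fun lipschitz :: "nat \<Rightarrow> complex \<Rightarrow> complex" where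
  "lipschitz 0 q = q / (1 - q)"
| "lipschitz (Suc 0) q = q / (1 - q) ^ 2"
| "lipschitz (Suc (Suc 0)) q = q * (1 + q) / (1 - q) ^ 3"
| "lipschitz (Suc (Suc (Suc 0))) q = q * (1 + 4 * q + q ^ 2) / (1 - q) ^ 4"
| "lipschitz (Suc (Suc (Suc (Suc 0)))) q = q * (1 + 11 * q + 11 * q ^ 2 + q ^ 3) / (1 - q) ^ 5"
| "lipschitz (Suc (Suc (Suc (Suc (Suc _))))) q = q * (1 + 26 * q + 66 * q ^ 2 + 26 * q ^ 3 + q ^ 4) / (1 - q) ^ 6"

lemma rational_deriv:
  fixes q :: complex
  assumes "q \<noteq> 1" "(p has_field_derivative p') (at q)"
    "q * (p' * (1 - q) + of_nat n * p q) = r"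
  shows "((\<lambda>q. p q / (1 - q) ^ n) has_field_derivative (p' * (1 - q) + of_nat n * p q) / (1 - q) ^ Suc n) (at q)"
    "q * ((p' * (1 - q) + of_nat n * p q) / (1 - q) ^ Suc n) = r / (1 - q) ^ Suc n"
proof -
  have "((\<lambda>q. (1 - q) ^ n) has_field_derivative - of_nat n * (1 - q) ^ (n - 1)) (at q)"
    by (auto intro!: derivative_eq_intros)
  from DERIV_divide[OF assms(2) this]
  have 1: "((\<lambda>q. p q / (1 - q) ^ n) has_field_derivative
     (p' * (1 - q) ^ n - p q * (- of_nat n * (1 - q) ^ (n - 1))) / ((1 - q) ^ n * (1 - q) ^ n)) (at q)"
    using assms by simp
  have "(p' * (1 - q) ^ n - p q * (- of_nat n * (1 - q) ^ (n - 1))) / ((1 - q) ^ n * (1 - q) ^ n)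
      = (p' * (1 - q) + of_nat n * p q) / (1 - q) ^ Suc n"
  proof -
    define w where "w = 1 - q"
    have "w \<noteq> 0" using assms by (simp add: w_def)
    thus ?thesis unfolding w_def[symmetric] by (cases n) (auto simp: field_simps)
  qed
  with 1 show "((\<lambda>q. p q / (1 - q) ^ n) has_field_derivative (p' * (1 - q) + of_nat n * p q) / (1 - q) ^ Suc n) (at q)"
    by simp
  show "q * ((p' * (1 - q) + of_nat n * p q) / (1 - q) ^ Suc n) = r / (1 - q) ^ Suc n"
    using assms by simp
qed

text \<open>Each step is one application of \<open>q d/dq\<close> to the closed form of the power
  series; from the third derivative on, the numerators show the Eulerian polynomials.\<close>

lemma lipschitz_deriv:
  assumes j: "j < 5" and z: "Im z > 0"
  shows "((\<lambda>z. lipschitz j (exp (2 * of_real pi * \<i> * z))) has_field_derivative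
            2 * of_real pi * \<i> * lipschitz (Suc j) (exp (2 * of_real pi * \<i> * z))) (at z)"
proof -
  have ne: "q \<noteq> 1" if "norm q < 1" for q :: complex using that by auto
  have "j = 0 \<or> j = 1 \<or> j = 2 \<or> j = 3 \<or> j = 4" using j by auto
  thus ?thesis
  proof (elim disjE)
    assume "j = 0"
    have "((\<lambda>z. (\<lambda>q. q / (1 - q)) (exp (2 * of_real pi * \<i> * z))) has_field_derivative
            2 * of_real pi * \<i> * (\<lambda>q. q / (1 - q) ^ 2) (exp (2 * of_real pi * \<i> * z))) (at z)"
    proof (rule exp_chain[where f' = "\<lambda>q. 1 / (1 - q) ^ 2", OF _ _ z])
      fix q :: complex assume "norm q < 1"
      hence "1 - q \<noteq> 0" by auto
      thus "((\<lambda>q. q / (1 - q)) has_field_derivative 1 / (1 - q) ^ 2) (at q)"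
        by (auto intro!: derivative_eq_intros simp: power2_eq_square)
    qed simp
    thus ?thesis by (simp add: \<open>j = 0\<close> power2_eq_square)
  next
    assume "j = 1"
    have "((\<lambda>z. (\<lambda>q. q / (1 - q) ^ 2) (exp (2 * of_real pi * \<i> * z))) has_field_derivative
            2 * of_real pi * \<i> * (\<lambda>q. (q * (1 + q)) / (1 - q) ^ Suc 2) (exp (2 * of_real pi * \<i> * z))) (at z)"
      by (rule exp_chain[OF rational_deriv[where p = "\<lambda>q. q" and p' = 1, OF ne] z]) (auto intro!: derivative_eq_intros simp: algebra_simps)
    thus ?thesis by (simp add: \<open>j = 1\<close> eval_nat_numeral)
  next
    assume "j = 2"
    have "((\<lambda>z. (\<lambda>q. (q * (1 + q)) / (1 - q) ^ 3) (exp (2 * of_real pi * \<i> * z))) has_field_derivative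
            2 * of_real pi * \<i> * (\<lambda>q. (q * (1 + 4 * q + q ^ 2)) / (1 - q) ^ Suc 3) (exp (2 * of_real pi * \<i> * z))) (at z)"
      by (rule exp_chain[OF rational_deriv[OF ne] z])
         (auto intro!: derivative_eq_intros simp: algebra_simps power2_eq_square)
    thus ?thesis by (simp add: \<open>j = 2\<close> eval_nat_numeral)
  next
    assume "j = 3"
    have "((\<lambda>z. (\<lambda>q. (q * (1 + 4 * q + q ^ 2)) / (1 - q) ^ 4) (exp (2 * of_real pi * \<i> * z))) has_field_derivative
            2 * of_real pi * \<i> * (\<lambda>q. (q * (1 + 11 * q + 11 * q ^ 2 + q ^ 3)) / (1 - q) ^ Suc 4) (exp (2 * of_real pi * \<i> * z))) (at z)"
      by (rule exp_chain[OF rational_deriv[OF ne] z])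
         (auto intro!: derivative_eq_intros simp: algebra_simps power2_eq_square power3_eq_cube)
    thus ?thesis by (simp add: \<open>j = 3\<close> eval_nat_numeral)
  next
    assume "j = 4"
    have "((\<lambda>z. (\<lambda>q. (q * (1 + 11 * q + 11 * q ^ 2 + q ^ 3)) / (1 - q) ^ 5) (exp (2 * of_real pi * \<i> * z))) has_field_derivative
            2 * of_real pi * \<i> * (\<lambda>q. (q * (1 + 26 * q + 66 * q ^ 2 + 26 * q ^ 3 + q ^ 4)) / (1 - q) ^ Suc 5) (exp (2 * of_real pi * \<i> * z))) (at z)"
      by (rule exp_chain[OF rational_deriv[OF ne] z])
         (auto intro!: derivative_eq_intros simp: algebra_simps power2_eq_square power3_eq_cube power4_eq_xxxx)
    thus ?thesis by (simp add: \<open>j = 4\<close> eval_nat_numeral)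
  qed
qed

text \<open>Repeated differentiation of the cotangent formula. Each derivative at
  \<open>1 - z\<close> brings a sign, which is the alternating factor.\<close>

lemma Polygamma_reflection:
  fixes z :: complex
  assumes "j < 5" "Im z > 0"
  shows "(-1) ^ Suc j * Polygamma (Suc j) (1 - z) - Polygamma (Suc j) z =
           - ((2 * of_real pi * \<i>) ^ (j + 2) * lipschitz (Suc j) (exp (2 * of_real pi * \<i> * z)))"
  using assms
proof (induction j arbitrary: z)
  case 0
  have "((\<lambda>z. Digamma (1 - z) - Digamma z) has_field_derivative
      (- Polygamma (Suc 0) (1 - z) - Polygamma (Suc 0) z)) (at z)" if "Im z > 0" for z :: complex
    using not_nonpos_Int_upper[OF that] by (auto intro!: derivative_eq_intros)
  note d1 = this
  have d2: "((\<lambda>z. - of_real pi * \<i> - 2 * of_real pi * \<i> * lipschitz 0 (exp (2 * of_real pi * \<i> * z)))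
      has_field_derivative - (2 * of_real pi * \<i> * (2 * of_real pi * \<i> * lipschitz (Suc 0) (exp (2 * of_real pi * \<i> * z))))) (at z)"
    if "Im z > 0" for z :: complex
    by (rule DERIV_cong[OF DERIV_diff[OF DERIV_const DERIV_cmult[OF lipschitz_deriv[of 0, OF _ that]]]]) simp_all
  have e: "Digamma (1 - z) - Digamma z = - of_real pi * \<i> - 2 * of_real pi * \<i> * lipschitz 0 (exp (2 * of_real pi * \<i> * z))"
    if "Im z > 0" for z :: complex
    using Digamma_reflection_exp[OF that] by simp
  have "- Polygamma (Suc 0) (1 - z) - Polygamma (Suc 0) z =
      - (2 * of_real pi * \<i> * (2 * of_real pi * \<i> * lipschitz (Suc 0) (exp (2 * of_real pi * \<i> * z))))"
    by (rule upper_half_deriv_unique[where F' = "\<lambda>z. - Polygamma (Suc 0) (1 - z) - Polygamma (Suc 0) z"],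
        erule e, erule d1, erule d2, rule 0)
  thus ?case by (simp add: power2_eq_square mult_ac)
next
  case (Suc j)
  have "((\<lambda>z. (-1) ^ Suc j * Polygamma (Suc j) (1 - z) - Polygamma (Suc j) z) has_field_derivative
      ((-1) ^ Suc (Suc j) * Polygamma (Suc (Suc j)) (1 - z) - Polygamma (Suc (Suc j)) z)) (at z)" if "Im z > 0" for z :: complex
    using not_nonpos_Int_upper[OF that] by (auto intro!: derivative_eq_intros)
  note d1 = this
  have d2: "((\<lambda>z. - ((2 * of_real pi * \<i>) ^ (j + 2) * lipschitz (Suc j) (exp (2 * of_real pi * \<i> * z))))
      has_field_derivative - ((2 * of_real pi * \<i>) ^ (j + 2) * (2 * of_real pi * \<i> *
         lipschitz (Suc (Suc j)) (exp (2 * of_real pi * \<i> * z))))) (at z)"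
    if "Im z > 0" for z :: complex
    by (rule DERIV_minus[OF DERIV_cmult[OF lipschitz_deriv[OF _ that]]]) (use Suc.prems in simp)
  have e: "(-1) ^ Suc j * Polygamma (Suc j) (1 - z) - Polygamma (Suc j) z =
           - ((2 * of_real pi * \<i>) ^ (j + 2) * lipschitz (Suc j) (exp (2 * of_real pi * \<i> * z)))"
    if "Im z > 0" for z :: complex
    using Suc.IH[OF _ that] Suc.prems by simp
  have "(-1) ^ Suc (Suc j) * Polygamma (Suc (Suc j)) (1 - z) - Polygamma (Suc (Suc j)) z =
      - ((2 * of_real pi * \<i>) ^ (j + 2) * (2 * of_real pi * \<i> *
         lipschitz (Suc (Suc j)) (exp (2 * of_real pi * \<i> * z))))"
    by (rule upper_half_deriv_unique[where F' = "\<lambda>z. (-1) ^ Suc (Suc j) * Polygamma (Suc (Suc j)) (1 - z) - Polygamma (Suc (Suc j)) z"],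
        erule e, erule d1, erule d2, rule Suc.prems)
  thus ?case by (simp add: mult_ac)
qed

text \<open>Up to a factorial, the two halves of the row are polygamma series, for
  \<open>n \<ge> 0\<close> at \<open>z\<close> and for \<open>n < 0\<close> at \<open>1 - z\<close>.
  As the exponent is even they enter with the same sign, which is the combination in the reflection
  formula.\<close>

lemma lipschitz_row:
  assumes l: "l = 2 \<or> l = 3" and z: "Im z > 0"
    and s: "(\<lambda>n. inverse ((z + of_int n) ^ (2 * l))) summable_on (UNIV :: int set)"
  shows "(\<Sum>\<^sub>\<infinity>n::int. inverse ((z + of_int n) ^ (2 * l))) =
           (2 * of_real pi * \<i>) ^ (2 * l) / fact (2 * l - 1) * lipschitz (2 * l - 1) (exp (2 * of_real pi * \<i> * z))"
proof -
  define j where "j = 2 * l - 2"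
  have j: "j < 5" "2 * l = j + 2" "even j" "2 * l - 1 = Suc j" using l by (auto simp: j_def)
  have z0: "z \<noteq> 0" "1 - z \<noteq> 0" using z by (auto simp: complex_eq_iff)
  have P: "Polygamma (Suc j) w = fact (Suc j) * (\<Sum>n. inverse ((w + of_nat n) ^ (2 * l)))" for w :: complex
    using j by (simp add: Polygamma_def)
  have s1: "(\<lambda>n. inverse ((w + of_nat n) ^ (2 * l))) sums (Polygamma (Suc j) w / fact (Suc j))" if "w \<noteq> 0" for w :: complex
  proof -
    have "2 * l \<ge> 2" using l by auto
    from summable_sums[OF Polygamma_converges'[OF that this]] show ?thesis by (simp add: P del: fact_Suc)
  qed
  have "(\<lambda>n. inverse ((z + of_int (int n)) ^ (2 * l)) + inverse ((z + of_int (- int n - 1)) ^ (2 * l))) sums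
       (Polygamma (Suc j) z / fact (Suc j) + Polygamma (Suc j) (1 - z) / fact (Suc j))"
  proof -
    have "(z + of_int (- int n - 1)) ^ (2 * l) = (1 - z + of_nat n) ^ (2 * l)" for n
    proof -
      have "z + of_int (- int n - 1) = - (1 - z + of_nat n)" by simp
      moreover have "(- w) ^ (2 * l) = w ^ (2 * l)" for w :: complex by (simp add: power_mult)
      ultimately show ?thesis by (simp only:)
    qed
    thus ?thesis using sums_add[OF s1[OF z0(1)] s1[OF z0(2)]] by simp
  qed
  with sums_int[OF s] have "(\<Sum>\<^sub>\<infinity>n::int. inverse ((z + of_int n) ^ (2 * l))) =
      Polygamma (Suc j) z / fact (Suc j) + Polygamma (Suc j) (1 - z) / fact (Suc j)"
    using sums_unique2 by blast
  moreover have "Polygamma (Suc j) z + Polygamma (Suc j) (1 - z) =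
      (2 * of_real pi * \<i>) ^ (2 * l) * lipschitz (Suc j) (exp (2 * of_real pi * \<i> * z))"
  proof -
    have "(-1 :: complex) ^ Suc j = -1" using j by simp
    with Polygamma_reflection[OF j(1) z]
    have "- Polygamma (Suc j) (1 - z) - Polygamma (Suc j) z =
        - ((2 * of_real pi * \<i>) ^ (2 * l) * lipschitz (Suc j) (exp (2 * of_real pi * \<i> * z)))"
      unfolding j(2) by (simp only: mult_minus1)
    moreover have "Polygamma (Suc j) z + Polygamma (Suc j) (1 - z) =
        - (- Polygamma (Suc j) (1 - z) - Polygamma (Suc j) z)" by simp
    ultimately show ?thesis by (simp only: minus_minus)
  qed
  ultimately show ?thesis unfolding j(4) by (simp flip: add_divide_distrib del: fact_Suc)
qed

section \<open>Expansions in q by Lambert series\<close>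

lemma lambert_series:
  assumes K: "K holomorphic_on ball 0 (1::real)" and p: "p > 0"
  shows "(\<lambda>q. \<Sum>n. q ^ n * K (q ^ (n + p))) holomorphic_on ball 0 1"
    "norm q < 1 \<Longrightarrow> summable (\<lambda>n. q ^ n * K (q ^ (n + p)))"
proof -
  \<comment> \<open>For \<open>norm q \<le> r\<close> the arguments \<open>q ^ (n + p)\<close> stay
    in the disc of radius \<open>r\<close> because \<open>p > 0\<close>, and there \<open>K\<close>
    is bounded; the factor \<open>q ^ n\<close> then gives a geometric majorant.\<close>
  have bound: "\<exists>B. \<forall>q n. norm q \<le> r \<longrightarrow> norm (q ^ n * K (q ^ (n + p))) \<le> B * r ^ n"
    if r: "0 \<le> r" "r < 1" for r :: real
  proof -
    have "compact (K ` cball 0 r)"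
      using r by (intro compact_continuous_image holomorphic_on_imp_continuous_on
          holomorphic_on_subset[OF K]) auto
    then obtain B where B: "\<And>w. w \<in> cball 0 r \<Longrightarrow> norm (K w) \<le> B"
      by (meson bounded_iff compact_imp_bounded imageI)
    have "norm (q ^ n * K (q ^ (n + p))) \<le> B * r ^ n" if q: "norm q \<le> r" for q n
    proof -
      have "norm (q ^ (n + p)) \<le> norm q ^ 1"
        unfolding norm_power using q r p by (intro power_decreasing) auto
      hence "norm (K (q ^ (n + p))) \<le> B" using q by (intro B) simp
      moreover have "norm (q ^ n) \<le> r ^ n" unfolding norm_power using q by (intro power_mono) auto
      ultimately show ?thesis
        unfolding norm_mult by (subst mult.commute, intro mult_mono) (auto intro: order_trans[OF norm_ge_zero])
    qed
    thus ?thesis by blast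
  qed
  show "norm q < 1 \<Longrightarrow> summable (\<lambda>n. q ^ n * K (q ^ (n + p)))"
  proof -
    assume q: "norm q < 1"
    obtain B where "\<And>n. norm (q ^ n * K (q ^ (n + p))) \<le> B * norm q ^ n"
      using bound[of "norm q"] q by auto
    thus ?thesis
      by (intro summable_comparison_test'[OF summable_mult[OF summable_geometric]]) (use q in auto)
  qed
  show "(\<lambda>q. \<Sum>n. q ^ n * K (q ^ (n + p))) holomorphic_on ball 0 1"
  proof (rule holomorphic_uniform_sequence[OF open_ball])
    show "(\<lambda>q. \<Sum>i<n. q ^ i * K (q ^ (i + p))) holomorphic_on ball 0 1" for n
    proof (intro holomorphic_intros)
      fix i
      have "norm (q ^ (i + p)) < 1" if "norm q < 1" for q :: complex
        using that p by (simp add: norm_power power_less_one_iff)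
      hence "K \<circ> (\<lambda>q. q ^ (i + p)) holomorphic_on ball 0 1"
        by (intro holomorphic_on_compose_gen[OF _ K] holomorphic_intros) auto
      thus "(\<lambda>q. K (q ^ (i + p))) holomorphic_on ball 0 1" by (simp add: o_def)
    qed
    fix x :: complex assume "x \<in> ball 0 1"
    then obtain d where d: "d > 0" "cball x d \<subseteq> ball 0 1" using open_contains_cball_eq[OF open_ball] by blast
    define r where "r = (1 + norm x) / 2"
    define e where "e = min d ((1 - norm x) / 2)"
    have x: "norm x < 1" using \<open>x \<in> ball 0 1\<close> by simp
    have r: "0 \<le> r" "r < 1" using x by (auto simp: r_def)
    have e: "e > 0" "cball x e \<subseteq> ball 0 1" using d x by (auto simp: e_def)
    have er: "norm q \<le> r" if "q \<in> cball x e" for q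
      using that norm_triangle_sub[of q x] by (auto simp: r_def e_def dist_norm norm_minus_commute field_simps)
    obtain B where B: "\<And>q n. norm q \<le> r \<Longrightarrow> norm (q ^ n * K (q ^ (n + p))) \<le> B * r ^ n"
      using bound[OF r] by blast
    have "uniform_limit (cball x e) (\<lambda>n q. \<Sum>i<n. q ^ i * K (q ^ (i + p))) (\<lambda>q. \<Sum>n. q ^ n * K (q ^ (n + p))) sequentially"
      by (rule Weierstrass_m_test[where M = "\<lambda>n. B * r ^ n"])
         (use B er r in \<open>auto intro!: summable_mult summable_geometric\<close>)
    thus "\<exists>d>0. cball x d \<subseteq> ball 0 1 \<and> uniform_limit (cball x d) (\<lambda>n q. \<Sum>i<n. q ^ i * K (q ^ (i + p)))
        (\<lambda>q. \<Sum>n. q ^ n * K (q ^ (n + p))) sequentially" using e by blast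
  qed
qed

text \<open>The coefficient at \<open>q^n\<close> is a divisor sum: each divisor \<open>d\<close> of
  \<open>n\<close> contributes the coefficient of \<open>K\<close> with index \<open>d - 1\<close>.
  The terms from the fifth on are divisible by \<open>q^5\<close> and enter only the
  remainder.\<close>

lemma lambert_expansion:
  assumes r: "r holomorphic_on ball 0 (1::real)"
    and K: "\<And>x. norm x < 1 \<Longrightarrow> K x = k0 + k1 * x + k2 * x ^ 2 + k3 * x ^ 3 + x ^ 4 * r x"
  obtains r' where "r' holomorphic_on ball 0 1"
    "\<And>q. norm q < 1 \<Longrightarrow> (\<lambda>n. q ^ Suc n * K (q ^ Suc n)) sums
        (k0 * q + (k1 + k0) * q ^ 2 + (k2 + k0) * q ^ 3 + (k3 + k1 + k0) * q ^ 4 + q ^ 5 * r' q)"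
proof -
  have "(\<lambda>x. k0 + k1 * x + k2 * x ^ 2 + k3 * x ^ 3 + x ^ 4 * r x) holomorphic_on ball 0 1"
    by (intro holomorphic_intros r)
  hence Kh: "K holomorphic_on ball 0 1" by (rule holomorphic_transform) (use K in auto)
  define \<Lambda> where "\<Lambda> = (\<lambda>q. \<Sum>n. q ^ n * K (q ^ (n + 5)))"
  have \<Lambda>: "\<Lambda> holomorphic_on ball 0 1" unfolding \<Lambda>_def by (rule lambert_series(1)[OF Kh]) simp
  have rp: "(\<lambda>q. r (q ^ i)) holomorphic_on ball 0 1" if "i > 0" for i
  proof -
    have "norm (q ^ i) < 1" if "norm q < 1" for q :: complex
      using that \<open>i > 0\<close> by (simp add: norm_power power_less_one_iff)
    hence "r \<circ> (\<lambda>q. q ^ i) holomorphic_on ball 0 1"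
      by (intro holomorphic_on_compose_gen[OF _ r] holomorphic_intros) auto
    thus ?thesis by (simp add: o_def)
  qed
  \<comment> \<open>What the first four terms and the tail leave beyond \<open>q^4\<close>, divided
    by \<open>q^5\<close>.\<close>
  define r' where "r' = (\<lambda>q. r q + (k2 * q + k3 * q ^ 3 + q ^ 5 * r (q ^ 2)) + (k1 * q + k2 * q ^ 4 + k3 * q ^ 7 + q ^ 10 * r (q ^ 3))
      + (k1 * q ^ 3 + k2 * q ^ 7 + k3 * q ^ 11 + q ^ 15 * r (q ^ 4)) + \<Lambda> q)"
  show ?thesis
  proof (rule that)
    show "r' holomorphic_on ball 0 1"
      unfolding r'_def by (intro holomorphic_intros r rp \<Lambda>) auto
  next
    fix q :: complex assume q: "norm q < 1"
    have qp: "norm (q ^ i) < 1" if "i > 0" for i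
      using that q by (simp add: norm_power power_less_one_iff)
    have "(\<lambda>n. q ^ 5 * (q ^ n * K (q ^ (n + 5)))) sums (q ^ 5 * \<Lambda> q)"
      unfolding \<Lambda>_def using q by (intro sums_mult summable_sums lambert_series(2)[OF Kh]) auto
    hence "(\<lambda>n. q ^ Suc (n + 4) * K (q ^ Suc (n + 4))) sums (q ^ 5 * \<Lambda> q)"
      by (simp add: power_add mult_ac eval_nat_numeral)
    hence *: "(\<lambda>n. q ^ Suc n * K (q ^ Suc n)) sums (q ^ 5 * \<Lambda> q + (\<Sum>n<4. q ^ Suc n * K (q ^ Suc n)))"
      by (subst (asm) sums_iff_shift)
    have "(\<Sum>n<4. q ^ Suc n * K (q ^ Suc n)) = q * K q + q ^ 2 * K (q ^ 2) + q ^ 3 * K (q ^ 3) + q ^ 4 * K (q ^ 4)"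
      by (simp add: eval_nat_numeral)
    also have "\<dots> = q * (k0 + k1 * q + k2 * q ^ 2 + k3 * q ^ 3 + q ^ 4 * r q)
       + q ^ 2 * (k0 + k1 * q ^ 2 + k2 * (q ^ 2) ^ 2 + k3 * (q ^ 2) ^ 3 + (q ^ 2) ^ 4 * r (q ^ 2))
       + q ^ 3 * (k0 + k1 * q ^ 3 + k2 * (q ^ 3) ^ 2 + k3 * (q ^ 3) ^ 3 + (q ^ 3) ^ 4 * r (q ^ 3))
       + q ^ 4 * (k0 + k1 * q ^ 4 + k2 * (q ^ 4) ^ 2 + k3 * (q ^ 4) ^ 3 + (q ^ 4) ^ 4 * r (q ^ 4))"
      using q by (simp only: K qp zero_less_numeral)
    finally have sum4: "(\<Sum>n<4. q ^ Suc n * K (q ^ Suc n)) = \<dots>" .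
    define A1 A2 A3 A4 A5 where "A1 = r q" and "A2 = r (q ^ 2)" and "A3 = r (q ^ 3)" and "A4 = r (q ^ 4)" and "A5 = \<Lambda> q"
    have "q ^ 5 * \<Lambda> q + (\<Sum>n<4. q ^ Suc n * K (q ^ Suc n)) =
       k0 * q + (k1 + k0) * q ^ 2 + (k2 + k0) * q ^ 3 + (k3 + k1 + k0) * q ^ 4 + q ^ 5 * r' q"
      unfolding r'_def sum4 A1_def[symmetric] A2_def[symmetric] A3_def[symmetric] A4_def[symmetric] A5_def[symmetric]
      by algebra
    with * show "(\<lambda>n. q ^ Suc n * K (q ^ Suc n)) sums
        (k0 * q + (k1 + k0) * q ^ 2 + (k2 + k0) * q ^ 3 + (k3 + k1 + k0) * q ^ 4 + q ^ 5 * r' q)" by simp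
  qed
qed

text \<open>Dividing by the row \<open>m = 0\<close>, which is twice a zeta value for even
  \<open>k\<close>, makes the constant term 1.\<close>

definition eisenstein :: "nat \<Rightarrow> complex \<Rightarrow> complex" where
  "eisenstein k \<tau> = lattice_sum k \<tau> / (\<Sum>\<^sub>\<infinity>n::int. inverse (of_int n ^ k))"

lemma eisenstein_modular:
  fixes a b c d :: int
  assumes "a * d - b * c = 1" "of_int c * \<tau> + of_int d \<noteq> 0"
  shows "eisenstein k ((of_int a * \<tau> + of_int b) / (of_int c * \<tau> + of_int d)) =
           (of_int c * \<tau> + of_int d) ^ k * eisenstein k \<tau>"
  using lattice_sum_modular[OF assms] by (simp add: eisenstein_def)

text \<open>Lipschitz's formula in every row produces a Lambert series. Here \<alpha> is
  \<open>2 (2 \<pi> \<i>)^(2 l) / ((2 l - 1)! Z)\<close> with \<open>Z\<close> the row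
  \<open>m = 0\<close>; its numerical value comes out of the differential equations.\<close>

lemma eisenstein_expansion:
  assumes l: "l = 2 \<or> l = 3"
    and r: "r holomorphic_on ball 0 (1::real)"
    and K: "\<And>x. norm x < 1 \<Longrightarrow> lipschitz (2 * l - 1) x = x * (k0 + k1 * x + k2 * x ^ 2 + k3 * x ^ 3 + x ^ 4 * r x)"
  obtains \<alpha> r' where "\<alpha> \<noteq> 0" "r' holomorphic_on ball 0 1"
    "\<And>\<tau> q. Im \<tau> > 0 \<Longrightarrow> q = exp (2 * of_real pi * \<i> * \<tau>) \<Longrightarrow>
       eisenstein (2 * l) \<tau> = 1 + \<alpha> * (k0 * q + (k1 + k0) * q ^ 2 + (k2 + k0) * q ^ 3 + (k3 + k1 + k0) * q ^ 4)
         + q ^ 5 * r' q"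
proof -
  obtain r' where r': "r' holomorphic_on ball 0 1"
    "\<And>q. norm q < 1 \<Longrightarrow> (\<lambda>n. q ^ Suc n * (k0 + k1 * q ^ Suc n + k2 * (q ^ Suc n) ^ 2 + k3 * (q ^ Suc n) ^ 3 + (q ^ Suc n) ^ 4 * r (q ^ Suc n))) sums
        (k0 * q + (k1 + k0) * q ^ 2 + (k2 + k0) * q ^ 3 + (k3 + k1 + k0) * q ^ 4 + q ^ 5 * r' q)"
    using lambert_expansion[OF r, of "\<lambda>x. k0 + k1 * x + k2 * x ^ 2 + k3 * x ^ 3 + x ^ 4 * r x"] by blast
  define c where "c = (2 * of_real pi * \<i>) ^ (2 * l) / fact (2 * l - 1)"
  define Z where "Z = (\<Sum>\<^sub>\<infinity>n::int. inverse (of_int n ^ (2 * l)) :: complex)"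
  have Z: "Z \<noteq> 0" unfolding Z_def using l by (intro power_inverse_sum_nonzero) auto
  define \<alpha> where "\<alpha> = 2 * c / Z"
  have \<alpha>: "\<alpha> \<noteq> 0" using Z by (simp add: \<alpha>_def c_def)
  show ?thesis
  proof (rule that)
    show "\<alpha> \<noteq> 0" by fact
    show "(\<lambda>q. \<alpha> * r' q) holomorphic_on ball 0 1" by (intro holomorphic_intros r')
    fix \<tau> q :: complex assume \<tau>: "Im \<tau> > 0" and q: "q = exp (2 * of_real pi * \<i> * \<tau>)"
    have nq: "norm q < 1" unfolding q by (rule norm_exp_upper[OF \<tau>])
    have "(\<lambda>n. 2 * (c * lipschitz (2 * l - 1) (exp (2 * of_real pi * \<i> * (of_nat (Suc n) * \<tau>))))) sums
           (lattice_sum (2 * l) \<tau> - Z)"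
      unfolding c_def Z_def using l by (intro lattice_sum_rows[OF \<tau>] lipschitz_row) auto
    moreover have "exp (2 * of_real pi * \<i> * (of_nat (Suc n) * \<tau>)) = q ^ Suc n" for n
      unfolding q exp_of_nat_mult[symmetric] by (simp only: mult_ac)
    moreover have "norm (q ^ Suc n) < 1" for n
      using nq unfolding norm_power by (subst power_less_one_iff) auto
    ultimately have "(\<lambda>n. 2 * (c * (q ^ Suc n * (k0 + k1 * q ^ Suc n + k2 * (q ^ Suc n) ^ 2 + k3 * (q ^ Suc n) ^ 3
        + (q ^ Suc n) ^ 4 * r (q ^ Suc n))))) sums (lattice_sum (2 * l) \<tau> - Z)"
      by (simp only: K)
    moreover have "(\<lambda>n. 2 * (c * (q ^ Suc n * (k0 + k1 * q ^ Suc n + k2 * (q ^ Suc n) ^ 2 + k3 * (q ^ Suc n) ^ 3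
        + (q ^ Suc n) ^ 4 * r (q ^ Suc n))))) sums
        (2 * (c * (k0 * q + (k1 + k0) * q ^ 2 + (k2 + k0) * q ^ 3 + (k3 + k1 + k0) * q ^ 4 + q ^ 5 * r' q)))"
      by (intro sums_mult r'(2) nq)
    ultimately have eq: "lattice_sum (2 * l) \<tau> - Z =
        2 * (c * (k0 * q + (k1 + k0) * q ^ 2 + (k2 + k0) * q ^ 3 + (k3 + k1 + k0) * q ^ 4 + q ^ 5 * r' q))"
      by (rule sums_unique2)
    have "eisenstein (2 * l) \<tau> = 1 + (lattice_sum (2 * l) \<tau> - Z) / Z"
      using Z by (simp add: eisenstein_def Z_def diff_divide_distrib)
    also have "\<dots> = 1 + \<alpha> * (k0 * q + (k1 + k0) * q ^ 2 + (k2 + k0) * q ^ 3 + (k3 + k1 + k0) * q ^ 4)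
         + q ^ 5 * (\<alpha> * r' q)"
      unfolding eq \<alpha>_def by (simp add: algebra_simps add_divide_distrib)
    finally show "eisenstein (2 * l) \<tau> = 1 + \<alpha> * (k0 * q + (k1 + k0) * q ^ 2 + (k2 + k0) * q ^ 3 + (k3 + k1 + k0) * q ^ 4)
         + q ^ 5 * (\<alpha> * r' q)" .
  qed
qed

text \<open>The integers are the sums of the cubes of the divisors of 1, 2, 3, 4.\<close>

lemma eisenstein_4_expansion:
  obtains \<alpha> r where "\<alpha> \<noteq> 0" "r holomorphic_on ball 0 1"
    "\<And>\<tau> q. Im \<tau> > 0 \<Longrightarrow> q = exp (2 * of_real pi * \<i> * \<tau>) \<Longrightarrow>
       eisenstein 4 \<tau> = 1 + \<alpha> * (q + 9 * q ^ 2 + 28 * q ^ 3 + 73 * q ^ 4) + q ^ 5 * r q"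
proof -
  \<comment> \<open>Numerator of the tail of the series of \<open>n^3 x^n\<close> from
    \<open>n = 5\<close> on, over \<open>(1 - x)^4\<close> and with \<open>x^5\<close> removed;
    hence the constant term 5^3.\<close>
  define R where "R = (\<lambda>x::complex. 125 - 284 * x + 229 * x ^ 2 - 64 * x ^ 3)"
  have hol: "(\<lambda>x. R x / (1 - x) ^ 4) holomorphic_on ball 0 (1::real)"
    unfolding R_def by (intro holomorphic_intros) auto
  have K: "lipschitz (2 * 2 - 1) x = x * (1 + 8 * x + 27 * x ^ 2 + 64 * x ^ 3
      + x ^ 4 * (R x / (1 - x) ^ 4))" if "norm x < 1" for x
  proof -
    define D where "D = (1 - x) ^ 4"
    have "1 - x \<noteq> 0" using that by auto
    hence D: "D \<noteq> 0" by (simp add: D_def)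
    have "lipschitz (2 * 2 - 1) x = x * (1 + 4 * x + x ^ 2) / D"
      by (simp add: D_def eval_nat_numeral(2,3))
    also have "x * (1 + 4 * x + x ^ 2) =
      x * ((1 + 8 * x + 27 * x ^ 2 + 64 * x ^ 3) * D + x ^ 4 * R x)" unfolding R_def D_def by algebra
    also have "\<dots> / D = x * (1 + 8 * x + 27 * x ^ 2 + 64 * x ^ 3 + x ^ 4 * (R x / D))"
      using D by (simp add: field_simps)
    finally show ?thesis by (simp only: D_def)
  qed
  show ?thesis
  proof (rule eisenstein_expansion[of 2 "\<lambda>x. R x / (1 - x) ^ 4" 1 8 27 64])
    fix \<alpha> r' assume *: "\<alpha> \<noteq> 0" "r' holomorphic_on ball 0 (1::real)"
      "\<And>\<tau> q. Im \<tau> > 0 \<Longrightarrow> q = exp (2 * of_real pi * \<i> * \<tau>) \<Longrightarrow>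
       eisenstein (2 * 2) \<tau> = 1 + \<alpha> * (1 * q + (8 + 1) * q ^ 2 + (27 + 1) * q ^ 3 + (64 + 8 + 1) * q ^ 4)
         + q ^ 5 * r' q"
    show ?thesis by (rule that[OF *(1,2)]) (use *(3) in simp)
  qed (use hol K in auto)
qed

text \<open>As in weight 4, with fifth powers of divisors; \<open>R\<close> again stands for the
  tail from \<open>n = 5\<close> on, with constant term 5^5.\<close>

lemma eisenstein_6_expansion:
  obtains \<alpha> r where "\<alpha> \<noteq> 0" "r holomorphic_on ball 0 1"
    "\<And>\<tau> q. Im \<tau> > 0 \<Longrightarrow> q = exp (2 * of_real pi * \<i> * \<tau>) \<Longrightarrow>
       eisenstein 6 \<tau> = 1 + \<alpha> * (q + 33 * q ^ 2 + 244 * q ^ 3 + 1057 * q ^ 4) + q ^ 5 * r q"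
proof -
  define R where "R = (\<lambda>x::complex. 3125 - 10974 * x + 17026 * x ^ 2 - 13934 * x ^ 3 + 5901 * x ^ 4 - 1024 * x ^ 5)"
  have hol: "(\<lambda>x. R x / (1 - x) ^ 6) holomorphic_on ball 0 (1::real)"
    unfolding R_def by (intro holomorphic_intros) auto
  have K: "lipschitz (2 * 3 - 1) x = x * (1 + 32 * x + 243 * x ^ 2 + 1024 * x ^ 3
      + x ^ 4 * (R x / (1 - x) ^ 6))" if "norm x < 1" for x
  proof -
    define D where "D = (1 - x) ^ 6"
    have "1 - x \<noteq> 0" using that by auto
    hence D: "D \<noteq> 0" by (simp add: D_def)
    have "lipschitz (2 * 3 - 1) x = x * (1 + 26 * x + 66 * x ^ 2 + 26 * x ^ 3 + x ^ 4) / D"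
      by (simp add: D_def eval_nat_numeral(2,3))
    also have "x * (1 + 26 * x + 66 * x ^ 2 + 26 * x ^ 3 + x ^ 4) =
      x * ((1 + 32 * x + 243 * x ^ 2 + 1024 * x ^ 3) * D + x ^ 4 * R x)" unfolding R_def D_def by algebra
    also have "\<dots> / D = x * (1 + 32 * x + 243 * x ^ 2 + 1024 * x ^ 3 + x ^ 4 * (R x / D))"
      using D by (simp add: field_simps)
    finally show ?thesis by (simp only: D_def)
  qed
  show ?thesis
  proof (rule eisenstein_expansion[of 3 "\<lambda>x. R x / (1 - x) ^ 6" 1 32 243 1024])
    fix \<alpha> r' assume *: "\<alpha> \<noteq> 0" "r' holomorphic_on ball 0 (1::real)"
      "\<And>\<tau> q. Im \<tau> > 0 \<Longrightarrow> q = exp (2 * of_real pi * \<i> * \<tau>) \<Longrightarrow>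
       eisenstein (2 * 3) \<tau> = 1 + \<alpha> * (1 * q + (32 + 1) * q ^ 2 + (243 + 1) * q ^ 3 + (1024 + 32 + 1) * q ^ 4)
         + q ^ 5 * r' q"
    show ?thesis by (rule that[OF *(1,2)]) (use *(3) in simp)
  qed (use hol K in auto)
qed

section \<open>A vanishing criterion for forms invariant under the Fricke involution\<close>

lemma Im_fricke:
  fixes N :: real
  shows "Im (- 1 / (of_real N * z)) = Im z / (N * (cmod z)\<^sup>2)"
proof -
  have "- 1 / (of_real N * z) = of_real (- 1 / N) * inverse z"
    by (simp add: field_simps)
  also have "Im \<dots> = Im z / (N * (cmod z)\<^sup>2)"
    by (simp only: times_complex.sel inverse_complex.sel Re_complex_of_real Im_complex_of_real)
       (simp add: cmod_power2)
  finally show ?thesis .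
qed

text \<open>After a translation to real part at most 1/2 in modulus, a point below height
  \<open>y0\<close> satisfies \<open>N (norm \<tau>)^2 \<le> N (1/4 + y0^2) < 1\<close>, so the
  involution raises it by at least the factor \<open>r\<close>. Finitely many rounds lead above
  \<open>y0\<close>. The condition on \<open>y0\<close> can be met only for N < 4.\<close>

lemma fricke_reduction:
  fixes \<phi> :: "complex \<Rightarrow> real" and N :: real
  assumes N: "N > 0"
    and T: "\<And>\<tau>. Im \<tau> > 0 \<Longrightarrow> \<phi> (\<tau> + 1) = \<phi> \<tau>"
    and S: "\<And>\<tau>. Im \<tau> > 0 \<Longrightarrow> \<phi> (- 1 / (of_real N * \<tau>)) = \<phi> \<tau>"
    and y0: "y0 > 0" "N * (1/4 + y0\<^sup>2) < 1"
    and B: "\<And>\<tau>. Im \<tau> \<ge> y0 \<Longrightarrow> \<phi> \<tau> \<le> B"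
    and \<tau>: "Im \<tau> > 0"
  shows "\<phi> \<tau> \<le> B"
proof -
  define r where "r = 1 / (N * (1/4 + y0\<^sup>2))"
  have den: "N * (1/4 + y0\<^sup>2) > 0"
    using N y0 by (simp add: add_pos_pos)
  have r: "r > 1"
    using y0 den by (simp add: r_def)
  have shift_nat: "\<phi> (\<tau> + of_nat n) = \<phi> \<tau>" if "Im \<tau> > 0" for n \<tau>
  proof (induction n)
    case (Suc n)
    have "\<phi> (\<tau> + of_nat (Suc n)) = \<phi> ((\<tau> + of_nat n) + 1)"
      by (simp add: add_ac)
    also have "\<dots> = \<phi> (\<tau> + of_nat n)"
      using that by (intro T) simp
    finally show ?case using Suc by simp
  qed simp
  have shift: "\<phi> (\<tau> + of_int n) = \<phi> \<tau>" if "Im \<tau> > 0" for n \<tau>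
  proof (cases "n \<ge> 0")
    case True
    then show ?thesis using shift_nat[OF that, of "nat n"] by (simp add: of_nat_nat)
  next
    case False
    have "\<phi> ((\<tau> + of_int n) + of_nat (nat (-n))) = \<phi> (\<tau> + of_int n)"
      using that by (intro shift_nat) simp
    then show ?thesis using False by (simp add: of_nat_nat)
  qed
  have main: "Im \<tau> > 0 \<Longrightarrow> Im \<tau> * r ^ n \<ge> y0 \<Longrightarrow> \<phi> \<tau> \<le> B" for n \<tau>
  proof (induction n arbitrary: \<tau>)
    case 0
    then show ?case using B by simp
  next
    case (Suc n)
    show ?case
    proof (cases "Im \<tau> \<ge> y0")
      case True
      then show ?thesis using B by simp
    next
      case False
      define \<sigma> where "\<sigma> = \<tau> + of_int (- round (Re \<tau>))"
      have Im\<sigma>: "Im \<sigma> = Im \<tau>" by (simp add: \<sigma>_def)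
      have "\<bar>Re \<sigma>\<bar> \<le> 1/2"
        using of_int_round_abs_le[of "Re \<tau>"] by (simp add: \<sigma>_def abs_minus_commute)
      hence "(Re \<sigma>)\<^sup>2 \<le> (1/2)\<^sup>2"
        by (metis abs_ge_zero power2_abs power_mono)
      moreover have "(Im \<tau>)\<^sup>2 \<le> y0\<^sup>2"
        using False Suc.prems by (intro power_mono) auto
      ultimately have "(cmod \<sigma>)\<^sup>2 \<le> 1/4 + y0\<^sup>2"
        unfolding cmod_power2 Im\<sigma> by (simp add: power2_eq_square)
      hence le: "N * (cmod \<sigma>)\<^sup>2 \<le> N * (1/4 + y0\<^sup>2)"
        using N by simp
      have \<sigma>0: "\<sigma> \<noteq> 0" using Im\<sigma> Suc.prems by auto
      define \<rho> where "\<rho> = - 1 / (of_real N * \<sigma>)"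
      have "Im \<rho> = Im \<sigma> / (N * (cmod \<sigma>)\<^sup>2)"
        unfolding \<rho>_def by (rule Im_fricke)
      also have "\<dots> \<ge> Im \<sigma> * r"
        unfolding r_def using le Suc.prems N \<sigma>0 den Im\<sigma>
        by (simp add: divide_left_mono)
      finally have Im\<rho>: "Im \<rho> \<ge> Im \<tau> * r" by (simp add: Im\<sigma>)
      have pos: "Im \<rho> > 0"
        using Im\<rho> Suc.prems r by (smt (verit) mult_pos_pos)
      have "y0 \<le> Im \<tau> * r * r ^ n" using Suc.prems by (simp add: mult_ac)
      also have "\<dots> \<le> Im \<rho> * r ^ n"
        using Im\<rho> r by (intro mult_right_mono) auto
      finally have "\<phi> \<rho> \<le> B" using Suc.IH pos by blast
      moreover have "\<phi> \<rho> = \<phi> \<sigma>"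
        unfolding \<rho>_def using Im\<sigma> Suc.prems by (intro S) simp
      moreover have "\<phi> \<sigma> = \<phi> \<tau>"
        unfolding \<sigma>_def using Suc.prems by (intro shift) simp
      ultimately show ?thesis by simp
    qed
  qed
  obtain n where "y0 / Im \<tau> < r ^ n"
    using real_arch_pow[OF r] by blast
  hence "Im \<tau> * r ^ n \<ge> y0"
    using \<tau> by (simp add: field_simps)
  with main \<tau> show ?thesis by blast
qed

text \<open>Equivalently, \<open>y ^ \<kappa> * exp (- c y)\<close> decreases from
  \<open>y = \<kappa> / c\<close> on.\<close>

lemma power_ratio_le_exp:
  fixes c y y' :: real
  assumes "0 < y'" "y' \<le> y" "real \<kappa> \<le> c * y'"
  shows "(y / y') ^ \<kappa> \<le> exp (c * (y - y'))"
proof -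
  have "(y / y') ^ \<kappa> \<le> exp (y / y' - 1) ^ \<kappa>"
    using assms exp_ge_add_one_self[of "y / y' - 1"] by (intro power_mono) auto
  also have "\<dots> = exp (real \<kappa> * ((y - y') / y'))"
    using assms by (simp add: exp_of_nat_mult[symmetric] field_simps)
  also have "\<dots> \<le> exp (c * y' * ((y - y') / y'))"
  proof -
    have "real \<kappa> * ((y - y') / y') \<le> c * y' * ((y - y') / y')"
      using assms by (intro mult_right_mono) auto
    thus ?thesis by (simp only: exp_le_cancel_iff)
  qed
  finally show ?thesis using assms by simp
qed

text \<open>Here \<open>2 \<kappa>\<close> is the weight and \<open>h\<close> the width, so
  \<open>\<phi>\<close>, the modulus of \<open>X\<close> times the height to the power
  \<open>\<kappa>\<close>, is invariant. The zero of order \<open>m\<close> makes it decay with rate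
  \<open>c = 2 \<pi> m / h\<close>. Comparing the heights \<open>y1 < y0\<close> by the maximum
  principle for \<open>g\<close>, its supremum \<open>M\<close> satisfies
  \<open>M \<le> M \<rho>\<close> with \<open>\<rho> < 1\<close>, so it is 0.\<close>

lemma sturm_bound:
  fixes X g :: "complex \<Rightarrow> complex" and N :: real and \<kappa> m h :: nat
  assumes N: "N > 0" and h: "h > 0" and \<kappa>: "\<kappa> > 0"
    and g: "g holomorphic_on ball 0 1"
    and X: "\<And>\<tau>. Im \<tau> > 0 \<Longrightarrow>
        X \<tau> = exp (2 * of_real pi * \<i> * \<tau> / of_nat h) ^ m * g (exp (2 * of_real pi * \<i> * \<tau> / of_nat h))"
    and T: "\<And>\<tau>. Im \<tau> > 0 \<Longrightarrow> norm (X (\<tau> + 1)) = norm (X \<tau>)"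
    and S: "\<And>\<tau>. Im \<tau> > 0 \<Longrightarrow> norm (X (- 1 / (of_real N * \<tau>))) = (N * (norm \<tau>)\<^sup>2) ^ \<kappa> * norm (X \<tau>)"
    and y0: "N * (1/4 + y0\<^sup>2) < 1" "y0 > 0" "real \<kappa> * h < 2 * pi * m * y0"
    and \<tau>: "Im \<tau> > 0"
  shows "X \<tau> = 0"
proof -
  define c where "c = 2 * pi * m / h"
  have m: "m > 0" using y0 \<kappa> h by (cases m) (auto simp: mult_less_0_iff)
  have c: "c > 0" using h m by (simp add: c_def)
  have "\<kappa> / c < y0" using y0 h m by (simp add: c_def field_simps)
  \<comment> \<open>The strict inequality in the hypothesis leaves room for a second height; the
    contraction factor comes from the gap between the two.\<close>
  then obtain y1 where y1: "\<kappa> / c < y1" "y1 < y0" using dense by blast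
  have y1': "real \<kappa> < c * y1" using y1 c by (simp add: field_simps)
  have y1pos: "y1 > 0" using y1 \<kappa> c by (smt (verit) divide_pos_pos of_nat_0_less_iff)
  define q where "q \<tau> = exp (2 * of_real pi * \<i> * \<tau> / of_nat h)" for \<tau>
  have norm_q: "norm (q \<tau>) = exp (- 2 * pi * Im \<tau> / h)" for \<tau>
    by (simp add: q_def)
  define \<phi> where "\<phi> \<tau> = norm (X \<tau>) * Im \<tau> ^ \<kappa>" for \<tau>
  have \<phi>_nonneg: "\<phi> \<tau> \<ge> 0" if "Im \<tau> > 0" for \<tau> using that by (simp add: \<phi>_def)
  have normX: "norm (X \<tau>) = exp (- c * Im \<tau>) * norm (g (q \<tau>))" if "Im \<tau> > 0" for \<tau>
  proof -
    have "norm (X \<tau>) = norm (q \<tau>) ^ m * norm (g (q \<tau>))"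
      using X[OF that] by (simp add: q_def norm_mult norm_power)
    also have "norm (q \<tau>) ^ m = exp (- c * Im \<tau>)"
      unfolding norm_q exp_of_nat_mult[symmetric] by (simp add: c_def)
    finally show ?thesis .
  qed
  have \<phi>T: "\<phi> (\<tau> + 1) = \<phi> \<tau>" if "Im \<tau> > 0" for \<tau>
    using T[OF that] by (simp add: \<phi>_def)
  have \<phi>S: "\<phi> (- 1 / (of_real N * \<tau>)) = \<phi> \<tau>" if "Im \<tau> > 0" for \<tau>
  proof -
    have "\<tau> \<noteq> 0" using that by auto
    have "Im (- 1 / (of_real N * \<tau>)) = Im \<tau> / (N * (cmod \<tau>)\<^sup>2)"
      by (rule Im_fricke)
    thus ?thesis
      unfolding \<phi>_def S[OF that] using N \<open>\<tau> \<noteq> 0\<close> by (simp add: power_divide)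
  qed
  have red: "\<phi> \<tau> \<le> B" if "\<And>\<tau>. Im \<tau> \<ge> y0 \<Longrightarrow> \<phi> \<tau> \<le> B" "Im \<tau> > 0" for B \<tau>
    by (rule fricke_reduction[OF N _ _ y0(2,1)]) (use \<phi>T \<phi>S that in auto)
  have decay: "\<phi> \<tau> \<le> C * (Im y ^ \<kappa> * exp (- c * Im y))"
    if "Im \<tau> \<ge> Im y" "Im y \<ge> y1" "norm (g (q \<tau>)) \<le> C" for \<tau> y C
  proof -
    have pos: "Im y > 0" "Im \<tau> > 0" using that y1pos by auto
    have "real \<kappa> \<le> c * Im y" using y1' that c by (smt (verit) mult_left_mono)
    hence "(Im \<tau> / Im y) ^ \<kappa> \<le> exp (c * (Im \<tau> - Im y))"
      using that pos by (intro power_ratio_le_exp) auto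
    hence "Im \<tau> ^ \<kappa> \<le> Im y ^ \<kappa> * exp (c * (Im \<tau> - Im y))"
      using pos by (simp add: power_divide field_simps)
    hence *: "exp (- c * Im \<tau>) * Im \<tau> ^ \<kappa> \<le> exp (- c * Im \<tau>) * (Im y ^ \<kappa> * exp (c * (Im \<tau> - Im y)))"
      by (intro mult_left_mono) auto
    have **: "exp (- c * Im \<tau>) * (Im y ^ \<kappa> * exp (c * (Im \<tau> - Im y))) = Im y ^ \<kappa> * exp (- c * Im y)"
      by (simp add: algebra_simps flip: exp_add)
    have "\<phi> \<tau> = norm (g (q \<tau>)) * (exp (- c * Im \<tau>) * Im \<tau> ^ \<kappa>)"
      by (simp add: \<phi>_def normX[OF pos(2)])
    also have "\<dots> \<le> C * (Im y ^ \<kappa> * exp (- c * Im y))"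
      by (rule mult_mono[OF that(3) *[unfolded **]])
         (use pos order_trans[OF norm_ge_zero that(3)] in auto)
    finally show ?thesis .
  qed
  have improve: "\<phi> \<tau> \<le> M * ((y0 / y1) ^ \<kappa> * exp (- c * (y0 - y1)))"
    if M: "\<And>\<tau>. Im \<tau> > 0 \<Longrightarrow> \<phi> \<tau> \<le> M" and \<tau>: "Im \<tau> > 0" for M \<tau>
  proof (rule red)
    fix \<tau> :: complex assume \<tau>: "Im \<tau> \<ge> y0"
    \<comment> \<open>The circle \<open>norm q = R\<close> is the image of the line at height
      \<open>y1\<close>, and the region above \<open>y0\<close> is mapped inside it.\<close>
    define R where "R = exp (- 2 * pi * y1 / h)"
    have R: "0 < R" "R < 1" using y1pos h by (auto simp: R_def)
    define C where "C = M * exp (c * y1) / y1 ^ \<kappa>"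
    have "norm (g w) \<le> C" if w: "w \<in> cball 0 R" for w
    proof (rule maximum_modulus_frontier[of g "cball 0 R"])
      show "g holomorphic_on interior (cball 0 R)" "continuous_on (closure (cball 0 R)) g"
        using R by (auto intro!: holomorphic_on_imp_continuous_on holomorphic_on_subset[OF g])
      fix z :: complex assume "z \<in> frontier (cball 0 R)"
      hence z: "norm z = R" by (simp add: frontier_cball)
      hence z0: "z \<noteq> 0" using R by auto
      define \<sigma> where "\<sigma> = Ln z * of_nat h / (2 * of_real pi * \<i>)"
      have q: "q \<sigma> = z" using z0 h by (simp add: q_def \<sigma>_def)
      have "Im \<sigma> = y1"
      proof -
        have "exp (- 2 * pi * Im \<sigma> / h) = exp (- 2 * pi * y1 / h)"
          using norm_q[of \<sigma>] by (simp only: q z R_def)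
        hence "- 2 * pi * Im \<sigma> / h = - 2 * pi * y1 / h" by (simp only: exp_inj_iff)
        thus ?thesis using h by (simp add: field_simps)
      qed
      hence "norm (X \<sigma>) = exp (- c * y1) * norm (g z)"
        using normX[of \<sigma>] q y1pos by simp
      moreover have "norm (X \<sigma>) * y1 ^ \<kappa> \<le> M"
        using M[of \<sigma>] \<open>Im \<sigma> = y1\<close> y1pos by (simp add: \<phi>_def)
      ultimately have "exp (- c * y1) * norm (g z) * y1 ^ \<kappa> * exp (c * y1) \<le> M * exp (c * y1)"
        by (intro mult_right_mono) auto
      also have "exp (- c * y1) * norm (g z) * y1 ^ \<kappa> * exp (c * y1) = norm (g z) * y1 ^ \<kappa>"
      proof -
        have "exp (- c * y1) * exp (c * y1) = 1" by (simp flip: exp_add)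
        thus ?thesis by (metis mult.commute mult.left_commute mult_1)
      qed
      finally show "norm (g z) \<le> C"
        using y1pos by (simp add: C_def field_simps)
    qed (use w in auto)
    hence "norm (g (q \<tau>)) \<le> C"
    proof -
      have "norm (q \<tau>) \<le> R" unfolding norm_q R_def using \<tau> y1 h
        by (simp add: divide_right_mono)
      thus ?thesis using \<open>\<And>w. w \<in> cball 0 R \<Longrightarrow> norm (g w) \<le> C\<close> by simp
    qed
    from decay[OF _ _ this, of "Complex 0 y0"] \<tau> y1
    have "\<phi> \<tau> \<le> C * (y0 ^ \<kappa> * exp (- c * y0))" by simp
    also have "\<dots> = M * ((y0 / y1) ^ \<kappa> * exp (- c * (y0 - y1)))"
      by (simp add: C_def power_divide field_simps flip: exp_add)
    finally show "\<phi> \<tau> \<le> M * ((y0 / y1) ^ \<kappa> * exp (- c * (y0 - y1)))" .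
  qed fact
  define \<rho> where "\<rho> = (y0 / y1) ^ \<kappa> * exp (- c * (y0 - y1))"
  have \<rho>: "\<rho> < 1"
  proof -
    have "(y0 / y1) ^ \<kappa> \<le> exp (real \<kappa> / y1 * (y0 - y1))"
      using y1 y1pos by (intro power_ratio_le_exp) auto
    also have "\<dots> < exp (c * (y0 - y1))"
    proof -
      have "real \<kappa> / y1 < c" using y1' y1pos by (simp add: field_simps)
      hence "real \<kappa> / y1 * (y0 - y1) < c * (y0 - y1)"
        using y1 by (intro mult_strict_right_mono) auto
      thus ?thesis by (simp only: exp_less_cancel_iff)
    qed
    finally have "\<rho> < exp (c * (y0 - y1)) * exp (- c * (y0 - y1))"
      unfolding \<rho>_def by (intro mult_strict_right_mono) auto
    thus ?thesis by (simp flip: exp_add)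
  qed
  \<comment> \<open>Finiteness of the supremum, without which the contraction would say
    nothing.\<close>
  have "\<exists>B. \<forall>\<tau>. Im \<tau> > 0 \<longrightarrow> \<phi> \<tau> \<le> B"
  proof -
    define R where "R = exp (- 2 * pi * y0 / h)"
    have R: "R < 1" using y0 h by (auto simp: R_def)
    have "compact (g ` cball 0 R)"
      using R by (intro compact_continuous_image holomorphic_on_imp_continuous_on
          holomorphic_on_subset[OF g]) auto
    then obtain C where C: "\<And>w. w \<in> cball 0 R \<Longrightarrow> norm (g w) \<le> C"
      by (meson bounded_iff compact_imp_bounded imageI)
    have "\<phi> \<tau> \<le> C * (y0 ^ \<kappa> * exp (- c * y0))" if "Im \<tau> \<ge> y0" for \<tau>
    proof -
      have "norm (q \<tau>) \<le> R" unfolding norm_q R_def using that h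
        by (simp add: divide_right_mono)
      hence "norm (g (q \<tau>)) \<le> C" using C by simp
      from decay[OF _ _ this, of "Complex 0 y0"] that y1 show ?thesis by simp
    qed
    from red[OF this] show ?thesis by blast
  qed
  then obtain B where B: "\<And>\<tau>. Im \<tau> > 0 \<Longrightarrow> \<phi> \<tau> \<le> B" by blast
  define M where "M = (SUP \<tau>\<in>{\<tau>. Im \<tau> > 0}. \<phi> \<tau>)"
  have bdd: "bdd_above (\<phi> ` {\<tau>. Im \<tau> > 0})" using B by (auto intro!: bdd_aboveI)
  have ne: "\<i> \<in> {\<tau>. Im \<tau> > 0}" by simp
  have M: "\<phi> \<tau> \<le> M" if "Im \<tau> > 0" for \<tau>
    unfolding M_def using that bdd by (intro cSUP_upper) auto
  have "M \<le> M * \<rho>"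
    unfolding M_def
  proof (rule cSUP_least)
    fix \<tau> assume "\<tau> \<in> {\<tau>. Im \<tau> > 0}"
    thus "\<phi> \<tau> \<le> (SUP \<tau>\<in>{\<tau>. Im \<tau> > 0}. \<phi> \<tau>) * \<rho>"
      using improve[OF M, of \<tau>] by (simp add: \<rho>_def M_def)
  qed (use ne in blast)
  moreover have "M \<ge> 0" using M[of \<i>] \<phi>_nonneg[of \<i>] by simp
  ultimately have "M = 0"
    using mult_strict_left_mono[OF \<rho>, of M] by linarith
  hence "\<phi> \<tau> \<le> 0" using M[OF \<tau>] by simp
  thus ?thesis using \<tau> by (simp add: \<phi>_def mult_le_0_iff power_le_zero_eq)
qed

section \<open>Covariant differential expressions in two forms of weight 4\<close>

definition theta :: "(complex \<Rightarrow> complex) \<Rightarrow> complex \<Rightarrow> complex" where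
  "theta f q = q * deriv f q"

lemma theta_holomorphic: "f holomorphic_on ball 0 1 \<Longrightarrow> theta f holomorphic_on ball 0 1"
  unfolding theta_def[abs_def] by (intro holomorphic_intros) auto

lemma norm_q_param: "h > 0 \<Longrightarrow> Im \<tau> > 0 \<Longrightarrow> norm (q_param h \<tau>) < 1"
  by (simp add: q_param_def)

lemma q_param_surj:
  assumes "h > 0" "norm q < 1" "q \<noteq> 0"
  obtains \<tau> where "Im \<tau> > 0" "q_param h \<tau> = q"
proof (rule that)
  define \<tau> where "\<tau> = Ln q * of_nat h / (2 * of_real pi * \<i>)"
  show "q_param h \<tau> = q" using assms by (simp add: q_param_def \<tau>_def)
  have "norm (q_param h \<tau>) < 1" using \<open>q_param h \<tau> = q\<close> assms by simp
  moreover have "norm (q_param h \<tau>) = exp (- (2 * pi * Im \<tau> / h))" by (simp add: q_param_def)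
  ultimately have "exp (- (2 * pi * Im \<tau> / h)) < 1" by simp
  hence "2 * pi * Im \<tau> / h > 0" by (simp only: exp_less_one_iff neg_less_0_iff_less)
  thus "Im \<tau> > 0" using assms by (simp add: zero_less_divide_iff zero_less_mult_iff)
qed

lemma q_param_deriv:
  assumes "f holomorphic_on ball 0 1" "h > 0" "Im \<tau> > 0"
  shows "((\<lambda>\<tau>. f (q_param h \<tau>)) has_field_derivative 2 * of_real pi * \<i> / of_nat h * theta f (q_param h \<tau>)) (at \<tau>)"
proof -
  have "(f has_field_derivative deriv f (q_param h \<tau>)) (at (q_param h \<tau>))"
    using assms norm_q_param by (intro holomorphic_derivI[OF assms(1)]) auto
  moreover have "(q_param h has_field_derivative 2 * of_real pi * \<i> / of_nat h * q_param h \<tau>) (at \<tau>)"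
    unfolding q_param_def[abs_def] using assms(2) by (auto intro!: derivative_eq_intros)
  ultimately have "((\<lambda>\<tau>. f (q_param h \<tau>)) has_field_derivative
      deriv f (q_param h \<tau>) * (2 * of_real pi * \<i> / of_nat h * q_param h \<tau>)) (at \<tau>)"
    by (rule DERIV_chain2)
  thus ?thesis by (simp add: theta_def mult_ac)
qed

text \<open>For \<open>t = 1 - v^2 / u^2\<close> one has
  \<open>(\<theta> t)^2 - t^2 u (1 - t) = v^2 Q1 / u^6\<close>. The derivatives enter through the
  Wronskian of \<open>u\<close> and \<open>v\<close>, so \<open>Q1\<close> has weight 20.\<close>

definition Q1 :: "(complex \<Rightarrow> complex) \<Rightarrow> (complex \<Rightarrow> complex) \<Rightarrow> complex \<Rightarrow> complex" where
  "Q1 u v q = 4 * (v q * theta u q - u q * theta v q)\<^sup>2 - u q * ((u q)\<^sup>2 - (v q)\<^sup>2)\<^sup>2"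

text \<open>The first two terms are a multiple of the second Rankin-Cohen bracket of
  \<open>u\<close> with itself, of weight 12; with \<open>c = 16 a b\<close> the last one is
  \<open>16 a b t u^3\<close>.\<close>

definition Q2 :: "complex \<Rightarrow> (complex \<Rightarrow> complex) \<Rightarrow> (complex \<Rightarrow> complex) \<Rightarrow> complex \<Rightarrow> complex" where
  "Q2 c u v q = 4 * u q * theta (theta u) q - 5 * (theta u q)\<^sup>2 - c * ((u q)\<^sup>2 - (v q)\<^sup>2) * u q"

lemma Q_holomorphic:
  assumes "u holomorphic_on ball 0 1" "v holomorphic_on ball 0 1"
  shows "Q1 u v holomorphic_on ball 0 1" "Q2 c u v holomorphic_on ball 0 1"
  unfolding Q1_def[abs_def] Q2_def[abs_def]
  by (intro holomorphic_intros assms theta_holomorphic)+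

text \<open>Obtained by differentiating the law of weight \<open>k\<close> along
  \<open>w' = \<kappa> / \<tau>^2\<close>; the term with \<open>G\<close> itself is what makes a
  derivative of a form only quasi-covariant.\<close>

lemma weight_derivs:
  assumes w: "\<And>\<tau>. Im \<tau> > 0 \<Longrightarrow> Im (w \<tau>) > 0"
    "\<And>\<tau>. Im \<tau> > 0 \<Longrightarrow> (w has_field_derivative \<kappa> / \<tau>\<^sup>2) (at \<tau>)"
    and F: "\<And>\<tau>. Im \<tau> > 0 \<Longrightarrow> (F has_field_derivative F1 \<tau>) (at \<tau>)"
    and G: "\<And>\<tau>. Im \<tau> > 0 \<Longrightarrow> (G has_field_derivative G1 \<tau>) (at \<tau>)"
    and eq: "\<And>\<tau>. Im \<tau> > 0 \<Longrightarrow> F (w \<tau>) = c * \<tau> ^ k * G \<tau>"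
    and \<tau>: "Im \<tau> > 0"
  shows "\<kappa> * F1 (w \<tau>) = c * (of_nat k * \<tau> ^ (k + 1) * G \<tau> + \<tau> ^ (k + 2) * G1 \<tau>)"
proof -
  have d1: "((\<lambda>\<tau>. F (w \<tau>)) has_field_derivative F1 (w \<tau>) * (\<kappa> / \<tau>\<^sup>2)) (at \<tau>)" if "Im \<tau> > 0" for \<tau>
    by (rule DERIV_chain2[OF F[OF w(1)[OF that]] w(2)[OF that]])
  have d2: "((\<lambda>\<tau>. c * \<tau> ^ k * G \<tau>) has_field_derivative c * (of_nat k * \<tau> ^ (k - 1) * G \<tau> + \<tau> ^ k * G1 \<tau>)) (at \<tau>)"
    if "Im \<tau> > 0" for \<tau>
    by (auto intro!: derivative_eq_intros G[OF that] simp: algebra_simps)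
  have "F1 (w \<tau>) * (\<kappa> / \<tau>\<^sup>2) = c * (of_nat k * \<tau> ^ (k - 1) * G \<tau> + \<tau> ^ k * G1 \<tau>)"
    by (rule upper_half_deriv_unique[where F = "\<lambda>\<tau>. F (w \<tau>)" and F' = "\<lambda>\<tau>. F1 (w \<tau>) * (\<kappa> / \<tau>\<^sup>2)"],
        erule eq, erule d1, erule d2, rule \<tau>)
  moreover have "\<tau> \<noteq> 0" using \<tau> by auto
  ultimately show ?thesis
    by (cases k) (simp_all add: field_simps power2_eq_square)
qed

lemma weight4_derivs:
  assumes w: "\<And>\<tau>. Im \<tau> > 0 \<Longrightarrow> Im (w \<tau>) > 0"
    "\<And>\<tau>. Im \<tau> > 0 \<Longrightarrow> (w has_field_derivative \<kappa> / \<tau>\<^sup>2) (at \<tau>)"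
    and hol: "f holomorphic_on ball 0 1" "g holomorphic_on ball 0 1" and h: "h > 0"
    and eq: "\<And>\<tau>. Im \<tau> > 0 \<Longrightarrow> f (q_param h (w \<tau>)) = c * \<tau> ^ 4 * g (q_param h \<tau>)"
    and \<tau>: "Im \<tau> > 0"
  defines "d \<equiv> 2 * of_real pi * \<i> / of_nat h"
  shows "\<kappa> * (d * theta f (q_param h (w \<tau>))) = c * (4 * \<tau> ^ 5 * g (q_param h \<tau>) + \<tau> ^ 6 * (d * theta g (q_param h \<tau>)))"
    "\<kappa>\<^sup>2 * (d\<^sup>2 * theta (theta f) (q_param h (w \<tau>))) =
       c * (20 * \<tau> ^ 6 * g (q_param h \<tau>) + 10 * \<tau> ^ 7 * (d * theta g (q_param h \<tau>)) + \<tau> ^ 8 * (d\<^sup>2 * theta (theta g) (q_param h \<tau>)))"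
proof -
  have F: "((\<lambda>\<tau>. f (q_param h \<tau>)) has_field_derivative d * theta f (q_param h \<tau>)) (at \<tau>)"
    "((\<lambda>\<tau>. d * theta f (q_param h \<tau>)) has_field_derivative d * (d * theta (theta f) (q_param h \<tau>))) (at \<tau>)"
    if "Im \<tau> > 0" "f holomorphic_on ball 0 1" for \<tau> f
    unfolding d_def using q_param_deriv[OF that(2) h that(1)]
      DERIV_cmult[OF q_param_deriv[OF theta_holomorphic[OF that(2)] h that(1)]] by blast+
  have 1: "\<kappa> * (d * theta f (q_param h (w \<tau>))) = c * (4 * \<tau> ^ 5 * g (q_param h \<tau>) + \<tau> ^ 6 * (d * theta g (q_param h \<tau>)))"
    if "Im \<tau> > 0" for \<tau>
    using weight_derivs[of w \<kappa> "\<lambda>\<tau>. f (q_param h \<tau>)" "\<lambda>\<tau>. d * theta f (q_param h \<tau>)"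
        "\<lambda>\<tau>. g (q_param h \<tau>)" "\<lambda>\<tau>. d * theta g (q_param h \<tau>)" c 4 \<tau>] w F hol eq that by simp
  from 1[OF \<tau>] show "\<kappa> * (d * theta f (q_param h (w \<tau>))) = c * (4 * \<tau> ^ 5 * g (q_param h \<tau>) + \<tau> ^ 6 * (d * theta g (q_param h \<tau>)))" .
  have d1: "((\<lambda>\<tau>. \<kappa> * (d * theta f (q_param h (w \<tau>)))) has_field_derivative
      \<kappa> * (d * (d * theta (theta f) (q_param h (w \<tau>))) * (\<kappa> / \<tau>\<^sup>2))) (at \<tau>)" if "Im \<tau> > 0" for \<tau>
    by (rule DERIV_cmult[OF DERIV_chain2[OF F(2)[OF w(1)[OF that] hol(1)] w(2)[OF that]]])
  have d2: "((\<lambda>\<tau>. c * (4 * \<tau> ^ 5 * g (q_param h \<tau>) + \<tau> ^ 6 * (d * theta g (q_param h \<tau>)))) has_field_derivative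
      c * (20 * \<tau> ^ 4 * g (q_param h \<tau>) + 10 * \<tau> ^ 5 * (d * theta g (q_param h \<tau>)) + \<tau> ^ 6 * (d * (d * theta (theta g) (q_param h \<tau>))))) (at \<tau>)"
    if "Im \<tau> > 0" for \<tau>
    by (rule derivative_eq_intros F[OF that hol(2)] refl)+ (simp add: algebra_simps)
  have "\<kappa> * (d * (d * theta (theta f) (q_param h (w \<tau>))) * (\<kappa> / \<tau>\<^sup>2)) =
      c * (20 * \<tau> ^ 4 * g (q_param h \<tau>) + 10 * \<tau> ^ 5 * (d * theta g (q_param h \<tau>)) + \<tau> ^ 6 * (d * (d * theta (theta g) (q_param h \<tau>))))"
    by (rule upper_half_deriv_unique[where F' = "\<lambda>\<tau>. \<kappa> * (d * (d * theta (theta f) (q_param h (w \<tau>))) * (\<kappa> / \<tau>\<^sup>2))"],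
        erule 1, erule d1, erule d2, rule \<tau>)
  moreover have "\<tau> \<noteq> 0" using \<tau> by auto
  ultimately have "\<kappa>\<^sup>2 * (d\<^sup>2 * theta (theta f) (q_param h (w \<tau>))) = \<tau>\<^sup>2 *
      (c * (20 * \<tau> ^ 4 * g (q_param h \<tau>) + 10 * \<tau> ^ 5 * (d * theta g (q_param h \<tau>)) + \<tau> ^ 6 * (d * (d * theta (theta g) (q_param h \<tau>)))))"
    by (simp add: field_simps power2_eq_square)
  thus "\<kappa>\<^sup>2 * (d\<^sup>2 * theta (theta f) (q_param h (w \<tau>))) =
       c * (20 * \<tau> ^ 6 * g (q_param h \<tau>) + 10 * \<tau> ^ 7 * (d * theta g (q_param h \<tau>)) + \<tau> ^ 8 * (d\<^sup>2 * theta (theta g) (q_param h \<tau>)))"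
    by (simp add: algebra_simps eval_nat_numeral)
qed

text \<open>The terms that spoil the covariance of \<open>theta u\<close> and
  \<open>theta (theta u)\<close> cancel in the Wronskian and in the bracket, and the sign
  \<open>s\<close> enters squared. Allowing other functions \<open>u'\<close> and \<open>v'\<close>
  on the right covers the passage to another cusp as well as the involution itself.\<close>

lemma Q_covariant:
  assumes w: "\<And>\<tau>. Im \<tau> > 0 \<Longrightarrow> Im (w \<tau>) > 0"
    "\<And>\<tau>. Im \<tau> > 0 \<Longrightarrow> (w has_field_derivative \<kappa> / \<tau>\<^sup>2) (at \<tau>)"
    and \<kappa>: "\<kappa> \<noteq> 0" and s: "s\<^sup>2 = 1"
    and hol: "u holomorphic_on ball 0 1" "v holomorphic_on ball 0 1"
      "u' holomorphic_on ball 0 1" "v' holomorphic_on ball 0 1" and h: "h > 0"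
    and u: "\<And>\<tau>. Im \<tau> > 0 \<Longrightarrow> u (q_param h (w \<tau>)) = 1 / \<kappa>\<^sup>2 * \<tau> ^ 4 * u' (q_param h \<tau>)"
    and v: "\<And>\<tau>. Im \<tau> > 0 \<Longrightarrow> v (q_param h (w \<tau>)) = s / \<kappa>\<^sup>2 * \<tau> ^ 4 * v' (q_param h \<tau>)"
    and \<tau>: "Im \<tau> > 0"
  shows "Q1 u v (q_param h (w \<tau>)) = \<tau> ^ 20 / \<kappa> ^ 10 * Q1 u' v' (q_param h \<tau>)"
    "Q2 c u v (q_param h (w \<tau>)) = \<tau> ^ 12 / \<kappa> ^ 6 * Q2 c u' v' (q_param h \<tau>)"
proof -
  define d where "d = 2 * of_real pi * \<i> / of_nat h"
  have d: "d \<noteq> 0" using h by (simp add: d_def)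
  note du = weight4_derivs[OF w hol(1,3) h u \<tau>, folded d_def]
  note dv = weight4_derivs(1)[OF w hol(2,4) h v \<tau>, folded d_def]
  define A A0 A1 A2 B B0 B1 where "A = u (q_param h (w \<tau>))" and "A0 = u' (q_param h \<tau>)" and "A1 = theta u' (q_param h \<tau>)"
    and "A2 = theta (theta u') (q_param h \<tau>)" and "B = v (q_param h (w \<tau>))" and "B0 = v' (q_param h \<tau>)"
    and "B1 = theta v' (q_param h \<tau>)"
  have 1: "theta u (q_param h (w \<tau>)) = (4 * \<tau> ^ 5 * A0 / d + \<tau> ^ 6 * A1) / \<kappa> ^ 3"
    using du(1) \<kappa> d unfolding A0_def[symmetric] A1_def[symmetric] by (simp add: field_simps eval_nat_numeral)
  have 2: "theta v (q_param h (w \<tau>)) = s * (4 * \<tau> ^ 5 * B0 / d + \<tau> ^ 6 * B1) / \<kappa> ^ 3"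
    using dv \<kappa> d unfolding B0_def[symmetric] B1_def[symmetric] by (simp add: field_simps eval_nat_numeral)
  have 3: "theta (theta u) (q_param h (w \<tau>)) = (20 * \<tau> ^ 6 * A0 / d\<^sup>2 + 10 * \<tau> ^ 7 * A1 / d + \<tau> ^ 8 * A2) / \<kappa> ^ 4"
    using du(2) \<kappa> d unfolding A0_def[symmetric] A1_def[symmetric] A2_def[symmetric]
    by (simp add: field_simps eval_nat_numeral)
  have A: "A = \<tau> ^ 4 * A0 / \<kappa>\<^sup>2" and B: "B = s * \<tau> ^ 4 * B0 / \<kappa>\<^sup>2"
    using u[OF \<tau>] v[OF \<tau>] by (simp_all add: A_def B_def A0_def B0_def)
  have W: "B * ((4 * \<tau> ^ 5 * A0 / d + \<tau> ^ 6 * A1) / \<kappa> ^ 3) - A * (s * (4 * \<tau> ^ 5 * B0 / d + \<tau> ^ 6 * B1) / \<kappa> ^ 3)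
      = s * (\<tau> ^ 10 * (B0 * A1 - A0 * B1) / \<kappa> ^ 5)"
    unfolding A B using \<kappa> d by (simp add: field_simps eval_nat_numeral)
  have D: "A\<^sup>2 - B\<^sup>2 = \<tau> ^ 8 * (A0\<^sup>2 - B0\<^sup>2) / \<kappa> ^ 4"
    unfolding A B using s by (simp add: power_mult_distrib power_divide right_diff_distrib diff_divide_distrib)
  show "Q1 u v (q_param h (w \<tau>)) = \<tau> ^ 20 / \<kappa> ^ 10 * Q1 u' v' (q_param h \<tau>)"
    unfolding Q1_def 1 2 A_def[symmetric] B_def[symmetric] W D
    unfolding A A0_def[symmetric] A1_def[symmetric] B0_def[symmetric] B1_def[symmetric]
  proof -
    define E F where "E = B0 * A1 - A0 * B1" and "F = A0\<^sup>2 - B0\<^sup>2"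
    have "(s * (\<tau> ^ 10 * E / \<kappa> ^ 5))\<^sup>2 = \<tau> ^ 20 / \<kappa> ^ 10 * E\<^sup>2"
      using s by (simp add: power_mult_distrib power_divide)
    moreover have "\<tau> ^ 4 * A0 / \<kappa>\<^sup>2 * (\<tau> ^ 8 * F / \<kappa> ^ 4)\<^sup>2 = \<tau> ^ 20 / \<kappa> ^ 10 * (A0 * F\<^sup>2)"
      using \<kappa> by (simp add: field_simps eval_nat_numeral)
    ultimately show "4 * (s * (\<tau> ^ 10 * (B0 * A1 - A0 * B1) / \<kappa> ^ 5))\<^sup>2 -
        \<tau> ^ 4 * A0 / \<kappa>\<^sup>2 * (\<tau> ^ 8 * (A0\<^sup>2 - B0\<^sup>2) / \<kappa> ^ 4)\<^sup>2 =
        \<tau> ^ 20 / \<kappa> ^ 10 * (4 * (B0 * A1 - A0 * B1)\<^sup>2 - A0 * (A0\<^sup>2 - B0\<^sup>2)\<^sup>2)"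
      unfolding E_def[symmetric] F_def[symmetric] by (simp add: right_diff_distrib)
  qed
  \<comment> \<open>Without derivatives the contributions are 80 - 80, with one derivative 40 - 40:
    this is what the coefficients 4 and 5 achieve in weight 4.\<close>
  have V: "4 * A * ((20 * \<tau> ^ 6 * A0 / d\<^sup>2 + 10 * \<tau> ^ 7 * A1 / d + \<tau> ^ 8 * A2) / \<kappa> ^ 4)
      - 5 * ((4 * \<tau> ^ 5 * A0 / d + \<tau> ^ 6 * A1) / \<kappa> ^ 3)\<^sup>2 = \<tau> ^ 12 / \<kappa> ^ 6 * (4 * A0 * A2 - 5 * A1\<^sup>2)"
    unfolding A using \<kappa> d by (simp add: field_simps eval_nat_numeral)
  show "Q2 c u v (q_param h (w \<tau>)) = \<tau> ^ 12 / \<kappa> ^ 6 * Q2 c u' v' (q_param h \<tau>)"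
    unfolding Q2_def 1 3 A_def[symmetric] B_def[symmetric] V D
    unfolding A A0_def[symmetric] A1_def[symmetric] A2_def[symmetric] B0_def[symmetric]
    using \<kappa> by (simp add: field_simps)
qed

lemma holomorphic_order_factor:
  assumes f: "f holomorphic_on ball 0 1" "f has_fps_expansion F" and F: "\<And>i. i < m \<Longrightarrow> fps_nth F i = 0"
  obtains g where "g holomorphic_on ball 0 1" "\<And>z. norm z < 1 \<Longrightarrow> f z = z ^ m * g z"
proof -
  have F': "F = fps_expansion f 0" 
    by (rule fps_expansion_unique_complex[OF f(2) has_fps_expansion_fps_expansion[OF open_ball _ f(1)]]) simp
  have conv: "fps_conv_radius F \<ge> 1"
    unfolding F' using conv_radius_fps_expansion[of f 0 1] f(1) by (simp add: eball_def ball_def one_ereal_def)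
  have ev: "eval_fps F z = f z" if "norm z < 1" for z
    unfolding F' using eval_fps_expansion'[of f 0 1 z] f(1) that by (simp add: eball_def ball_def one_ereal_def)
  have lt: "ereal (norm z) < fps_conv_radius F" if "norm z < 1" for z :: complex
    using that conv by (meson ereal_less(3) less_le_trans)
  show ?thesis
  proof (rule that)
    show "eval_fps (fps_shift m F) holomorphic_on ball 0 1"
      by (rule holomorphic_on_subset[OF holomorphic_on_eval_fps[OF order_refl]]) (auto simp: eball_def lt)
    fix z :: complex assume z: "norm z < 1"
    show "f z = z ^ m * eval_fps (fps_shift m F) z"
    proof (cases "z = 0")
      case True
      have "f 0 = fps_nth F 0" using ev[of 0] by (simp add: eval_fps_at_0)
      thus ?thesis using F[of 0] True by (cases "m = 0") (auto simp: eval_fps_at_0)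
    next
      case False
      have "m \<le> subdegree F \<or> F = 0" using F by (metis subdegree_geI)
      thus ?thesis
        using eval_fps_shift[of m F z] lt[OF z] ev[OF z] False by auto
    qed
  qed
qed

text \<open>The first factor is nonzero on a nonempty open set, where \<open>g\<close> must vanish;
  the identity theorem does the rest.\<close>

lemma holomorphic_mult_eq_0:
  assumes f: "f holomorphic_on ball 0 (1::real)" and g: "g holomorphic_on ball 0 1"
    and fg: "\<And>z. norm z < 1 \<Longrightarrow> f z * g z = 0" and z0: "norm z0 < 1" "f z0 \<noteq> 0" and z: "norm z < 1"
  shows "g z = 0"
proof -
  define S where "S = {z \<in> ball 0 1. f z \<noteq> 0}"
  have "S = ball 0 1 \<inter> f -` (- {0})" by (auto simp: S_def)
  hence "open S"
    using continuous_open_preimage[OF holomorphic_on_imp_continuous_on[OF f] open_ball, of "- {0}"]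
    by (simp add: open_Compl)
  show ?thesis
    by (rule analytic_continuation_open[of S "ball 0 1" g "\<lambda>_. 0"])
       (use \<open>open S\<close> g fg z0 z in \<open>auto simp: S_def\<close>)
qed

lemma q_param_add_1:
  "q_param 1 (\<tau> + 1) = q_param 1 \<tau>" "q_param 2 (\<tau> + 1) = - q_param 2 \<tau>"
proof -
  have "exp (2 * of_real pi * \<i> * (\<tau> + 1)) = exp (2 * of_real pi * \<i> * \<tau>)"
    by (simp add: ring_distribs exp_add)
  thus "q_param 1 (\<tau> + 1) = q_param 1 \<tau>" by (simp add: q_param_def)
  have "2 * of_real pi * \<i> * (\<tau> + 1) / 2 = 2 * of_real pi * \<i> * \<tau> / 2 + of_real pi * \<i>"
    by (simp add: field_simps)
  thus "q_param 2 (\<tau> + 1) = - q_param 2 \<tau>" by (simp add: q_param_def exp_add)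
qed

lemma Im_fricke_pos: "N > 0 \<Longrightarrow> Im \<tau> > 0 \<Longrightarrow> Im (- 1 / (of_real N * \<tau>)) > 0"
  unfolding Im_fricke by (auto intro!: divide_pos_pos mult_pos_pos)

lemma form_vanishes:
  assumes \<Xi>: "\<Xi> holomorphic_on ball 0 1" "\<Xi> has_fps_expansion S" "\<And>i. i < m \<Longrightarrow> fps_nth S i = 0"
    and N: "N > 0" and \<kappa>: "\<kappa> > 0"
    and law: "\<And>\<tau>. Im \<tau> > 0 \<Longrightarrow>
        norm (\<Xi> (q_param 1 (- 1 / (of_real N * \<tau>)))) = (N * (norm \<tau>)\<^sup>2) ^ \<kappa> * norm (\<Xi> (q_param 1 \<tau>))"
    and y0: "N * (1/4 + y0\<^sup>2) < 1" "y0 > 0" "real \<kappa> < 2 * pi * m * y0"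
    and q: "norm q < 1"
  shows "\<Xi> q = 0"
proof -
  obtain g where g: "g holomorphic_on ball 0 1" "\<And>z. norm z < 1 \<Longrightarrow> \<Xi> z = z ^ m * g z"
    using holomorphic_order_factor[OF \<Xi>] by blast
  have m: "m > 0" using y0 \<kappa> by (cases m) auto
  have zero: "\<Xi> (q_param 1 \<tau>) = 0" if "Im \<tau> > 0" for \<tau>
  proof (rule sturm_bound[where X = "\<lambda>\<tau>. \<Xi> (q_param 1 \<tau>)" and h = 1, OF N _ \<kappa> g(1) _ _ law y0(1,2) _ that])
    show "\<Xi> (q_param 1 \<tau>) = exp (2 * of_real pi * \<i> * \<tau> / of_nat 1) ^ m * g (exp (2 * of_real pi * \<i> * \<tau> / of_nat 1))"
      if "Im \<tau> > 0" for \<tau>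
      using g(2)[OF norm_q_param[OF _ that, of 1]] by (simp add: q_param_def)
  qed (use y0 q_param_add_1 in auto)
  show ?thesis
  proof (cases "q = 0")
    case True
    thus ?thesis using g(2)[of 0] m by simp
  next
    case False
    thus ?thesis using q_param_surj[of 1 q] zero q by (metis zero_less_one)
  qed
qed

text \<open>The theta group has index 3 in \<open>SL\<^sub>2(\<int>)\<close>; the bound is applied to the product of the three conjugates.\<close>

lemma theta_form_vanishes:
  assumes \<Xi>: "\<Xi> holomorphic_on ball 0 1" "\<Xi> has_fps_expansion S" "\<And>i. i < m \<Longrightarrow> fps_nth S i = 0"
    and \<Xi>2: "\<Xi>2 holomorphic_on ball 0 1" "\<And>p. norm p < 1 \<Longrightarrow> \<Xi>2 (- p) = \<Xi>2 p"
    and \<kappa>: "\<kappa> > 0"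
    and law1: "\<And>\<tau>. Im \<tau> > 0 \<Longrightarrow>
        norm (\<Xi> (q_param 2 (- 1 / \<tau>))) = ((norm \<tau>)\<^sup>2) ^ \<kappa> * norm (\<Xi> (q_param 2 \<tau>))"
    and law2: "\<And>\<tau>. Im \<tau> > 0 \<Longrightarrow>
        norm (\<Xi> (- q_param 2 (- 1 / \<tau>))) = ((norm \<tau>)\<^sup>2) ^ \<kappa> * norm (\<Xi>2 (q_param 2 \<tau>))"
    and y0: "1/4 + y0\<^sup>2 < 1" "y0 > 0" "real (3 * \<kappa>) * 2 < 2 * pi * real (2 * m) * y0"
    and q: "norm q < 1"
  shows "\<Xi> q = 0"
proof -
  obtain g where g: "g holomorphic_on ball 0 1" "\<And>z. norm z < 1 \<Longrightarrow> \<Xi> z = z ^ m * g z"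
    using holomorphic_order_factor[OF \<Xi>] by blast
  have m: "m > 0" using y0 \<kappa> by (cases m) auto
  have \<Xi>0: "\<Xi> 0 = 0" using g(2)[of 0] m by simp
  have inv: "Im (- 1 / \<tau>) > 0" if "Im \<tau> > 0" for \<tau> using Im_fricke_pos[of 1 \<tau>] that by simp
  have law3: "norm (\<Xi>2 (q_param 2 (- 1 / \<tau>))) = ((norm \<tau>)\<^sup>2) ^ \<kappa> * norm (\<Xi> (- q_param 2 \<tau>))" if \<tau>: "Im \<tau> > 0" for \<tau>
  proof -
    have "\<tau> \<noteq> 0" using \<tau> by auto
    moreover have "norm (\<Xi> (- q_param 2 (- 1 / (- 1 / \<tau>)))) = ((norm (- 1 / \<tau>))\<^sup>2) ^ \<kappa> * norm (\<Xi>2 (q_param 2 (- 1 / \<tau>)))"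
      by (rule law2[OF inv[OF \<tau>]])
    ultimately show ?thesis by (simp add: norm_divide power_divide)
  qed
  have neg: "(\<lambda>p. f (- p)) holomorphic_on ball 0 1" if "f holomorphic_on ball 0 1" for f
  proof -
    have "f \<circ> uminus holomorphic_on ball 0 1"
      by (intro holomorphic_on_compose_gen[OF _ that] holomorphic_intros) auto
    thus ?thesis by (simp add: o_def)
  qed
  \<comment> \<open>In modulus and up to automorphy factors, translation by 1 exchanges
    \<open>\<Xi> p\<close> and \<open>\<Xi> (- p)\<close> and fixes the even function
    \<open>\<Xi>2\<close>, while inversion keeps \<open>\<Xi> p\<close> and exchanges the other two.
    The product has half weight \<open>3 \<kappa>\<close> and vanishes to order \<open>2 m\<close>
    in the parameter of width 2.\<close>
  define Y where "Y = (\<lambda>p. \<Xi> p * (\<Xi> (- p) * \<Xi>2 p))"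
  have zero: "Y (q_param 2 \<tau>) = 0" if \<tau>: "Im \<tau> > 0" for \<tau>
  proof (rule sturm_bound[where X = "\<lambda>\<tau>. Y (q_param 2 \<tau>)" and h = 2 and N = 1 and m = "2 * m" and \<kappa> = "3 * \<kappa>"
        and g = "\<lambda>p. (-1) ^ m * g p * (g (- p) * \<Xi>2 p)"])
    show "(\<lambda>p. (-1) ^ m * g p * (g (- p) * \<Xi>2 p)) holomorphic_on ball 0 1"
      by (intro holomorphic_intros g \<Xi>2 neg)
    fix \<tau> :: complex assume \<tau>: "Im \<tau> > 0"
    define p where "p = q_param 2 \<tau>"
    have p: "norm p < 1" unfolding p_def using norm_q_param[OF _ \<tau>, of 2] by simp
    have "Y p = p ^ (2 * m) * ((-1) ^ m * g p * (g (- p) * \<Xi>2 p))"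
      using g(2)[OF p] g(2)[of "- p"] p
      by (simp add: Y_def power_mult power_minus[of p] power2_eq_square power_mult_distrib)
    thus "Y (q_param 2 \<tau>) = exp (2 * of_real pi * \<i> * \<tau> / of_nat 2) ^ (2 * m) * ((-1) ^ m * g (exp (2 * of_real pi * \<i> * \<tau> / of_nat 2))
        * (g (- exp (2 * of_real pi * \<i> * \<tau> / of_nat 2)) * \<Xi>2 (exp (2 * of_real pi * \<i> * \<tau> / of_nat 2))))"
      by (simp add: p_def q_param_def)
    show "norm (Y (q_param 2 (\<tau> + 1))) = norm (Y (q_param 2 \<tau>))"
      unfolding q_param_add_1 Y_def p_def[symmetric] using \<Xi>2(2)[OF p] by (simp add: norm_mult mult_ac)
    show "norm (Y (q_param 2 (- 1 / (of_real 1 * \<tau>)))) = (1 * (norm \<tau>)\<^sup>2) ^ (3 * \<kappa>) * norm (Y (q_param 2 \<tau>))"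
      using law1[OF \<tau>] law2[OF \<tau>] law3[OF \<tau>]
      by (simp add: Y_def norm_mult power_mult power3_eq_cube power_mult_distrib mult_ac)
  qed (use y0 \<kappa> \<tau> in auto)
  have Y0: "Y p = 0" if "norm p < 1" for p
  proof (cases "p = 0")
    case True thus ?thesis by (simp add: Y_def \<Xi>0)
  next
    case False thus ?thesis using q_param_surj[of 2 p] zero that by (metis zero_less_numeral)
  qed
  \<comment> \<open>If \<open>\<Xi>\<close> were not zero, dividing the vanishing product by
    \<open>\<Xi> p\<close> and by \<open>\<Xi> (- p)\<close> would leave \<open>\<Xi>2 = 0\<close>,
    and inversion would carry this back to \<open>\<Xi> (- p) = 0\<close>.\<close>
  show ?thesis
  proof (rule ccontr)
    assume nz: "\<Xi> q \<noteq> 0"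
    have 1: "\<Xi> (- p) * \<Xi>2 p = 0" if "norm p < 1" for p
      by (rule holomorphic_mult_eq_0[OF \<Xi>(1) _ _ q nz that])
         (use Y0 in \<open>auto simp: Y_def intro!: holomorphic_intros \<Xi>2 neg[OF \<Xi>(1)]\<close>)
    have 2: "\<Xi>2 p = 0" if "norm p < 1" for p
      by (rule holomorphic_mult_eq_0[where f = "\<lambda>p. \<Xi> (- p)" and g = \<Xi>2 and ?z0.0 = "- q" and z = p], rule neg[OF \<Xi>(1)], rule \<Xi>2(1), erule 1)
         (use nz q that in auto)
    have 3: "\<Xi> (- q_param 2 \<tau>) = 0" if "Im \<tau> > 0" for \<tau>
    proof -
      have "\<tau> \<noteq> 0" using that by auto
      have "norm (\<Xi> (- q_param 2 (- 1 / (- 1 / \<tau>)))) = 0"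
        unfolding law2[OF inv[OF that]] using 2[OF norm_q_param[OF _ inv[OF that]], of 2] by simp
      thus ?thesis using \<open>\<tau> \<noteq> 0\<close> by simp
    qed
    have "q \<noteq> 0" using nz \<Xi>0 by auto
    then obtain \<tau> where "Im \<tau> > 0" "q_param 2 \<tau> = - q"
      using q_param_surj[of 2 "- q"] q by (metis neg_equal_0_iff_equal norm_minus_cancel zero_less_numeral)
    with 3[of \<tau>] nz show False by simp
  qed
qed

section \<open>Comparison of coefficients\<close>

definition expands :: "(complex \<Rightarrow> complex) \<Rightarrow> complex \<Rightarrow> complex \<Rightarrow> complex \<Rightarrow> complex \<Rightarrow> bool" where
  "expands f c1 c2 c3 c4 \<longleftrightarrow> (\<exists>R. R holomorphic_on ball 0 1 \<and>
     (\<forall>q. norm q < 1 \<longrightarrow> f q = 1 + c1 * q + c2 * q ^ 2 + c3 * q ^ 3 + c4 * q ^ 4 + q ^ 5 * R q))"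

lemma expands_fps:
  assumes "expands f c1 c2 c3 c4"
  obtains A where "f holomorphic_on ball 0 1" "f has_fps_expansion A" "fps_nth A 0 = 1" "fps_nth A 1 = c1"
    "fps_nth A 2 = c2" "fps_nth A 3 = c3" "fps_nth A 4 = c4"
proof -
  obtain R where R: "R holomorphic_on ball 0 1"
    "\<And>q. norm q < 1 \<Longrightarrow> f q = 1 + c1 * q + c2 * q ^ 2 + c3 * q ^ 3 + c4 * q ^ 4 + q ^ 5 * R q"
    using assms by (auto simp: expands_def)
  have "(\<lambda>q. 1 + c1 * q + c2 * q ^ 2 + c3 * q ^ 3 + c4 * q ^ 4 + q ^ 5 * R q) holomorphic_on ball 0 1"
    by (intro holomorphic_intros R)
  hence f: "f holomorphic_on ball 0 1" by (rule holomorphic_transform) (use R in auto)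
  define B where "B = fps_expansion R 0"
  have RB: "R has_fps_expansion B" unfolding B_def by (rule has_fps_expansion_fps_expansion[OF open_ball _ R(1)]) simp
  define A where "A = 1 + fps_const c1 * fps_X + fps_const c2 * fps_X ^ 2 + fps_const c3 * fps_X ^ 3
    + fps_const c4 * fps_X ^ 4 + fps_X ^ 5 * B"
  have "(\<lambda>q. 1 + c1 * q + c2 * q ^ 2 + c3 * q ^ 3 + c4 * q ^ 4 + q ^ 5 * R q) has_fps_expansion A"
    unfolding A_def by (intro fps_expansion_intros RB)
  moreover have "\<forall>\<^sub>F q in nhds 0. 1 + c1 * q + c2 * q ^ 2 + c3 * q ^ 3 + c4 * q ^ 4 + q ^ 5 * R q = f q"
  proof -
    have "\<forall>\<^sub>F q in nhds 0. q \<in> ball (0::complex) 1" by (intro eventually_nhds_in_open) auto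
    thus ?thesis by eventually_elim (use R in auto)
  qed
  ultimately have "f has_fps_expansion A" by (subst (asm) has_fps_expansion_cong) auto
  thus ?thesis using f by (intro that[of A]) (simp_all add: A_def fps_X_power_mult_nth)
qed

lemma fps_mult_nth_small:
  fixes f g :: "complex fps"
  shows "fps_nth (f * g) 0 = fps_nth f 0 * fps_nth g 0"
    "fps_nth (f * g) 1 = fps_nth f 0 * fps_nth g 1 + fps_nth f 1 * fps_nth g 0"
    "fps_nth (f * g) 2 = fps_nth f 0 * fps_nth g 2 + fps_nth f 1 * fps_nth g 1 + fps_nth f 2 * fps_nth g 0"
    "fps_nth (f * g) 3 = fps_nth f 0 * fps_nth g 3 + fps_nth f 1 * fps_nth g 2 + fps_nth f 2 * fps_nth g 1
       + fps_nth f 3 * fps_nth g 0"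
    "fps_nth (f * g) 4 = fps_nth f 0 * fps_nth g 4 + fps_nth f 1 * fps_nth g 3 + fps_nth f 2 * fps_nth g 2
       + fps_nth f 3 * fps_nth g 1 + fps_nth f 4 * fps_nth g 0"
    "fps_nth (f * g) 5 = fps_nth f 0 * fps_nth g 5 + fps_nth f 1 * fps_nth g 4 + fps_nth f 2 * fps_nth g 3
       + fps_nth f 3 * fps_nth g 2 + fps_nth f 4 * fps_nth g 1 + fps_nth f 5 * fps_nth g 0"
  by (simp_all add: fps_mult_nth eval_nat_numeral)

definition fps_theta :: "complex fps \<Rightarrow> complex fps" where "fps_theta A = fps_X * fps_deriv A"

lemma fps_theta_nth: "fps_nth (fps_theta A) n = of_nat n * fps_nth A n"
  by (cases n) (simp_all add: fps_theta_def)

lemma theta_has_fps_expansion: "f has_fps_expansion A \<Longrightarrow> theta f has_fps_expansion fps_theta A"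
  unfolding theta_def[abs_def] fps_theta_def by (intro fps_expansion_intros)

lemma Q_has_fps_expansion:
  assumes u: "u has_fps_expansion A" and v: "v has_fps_expansion B"
  shows "Q1 u v has_fps_expansion (fps_const 4 * ((B * fps_theta A - A * fps_theta B) * (B * fps_theta A - A * fps_theta B))
           - A * ((A * A - B * B) * (A * A - B * B)))"
    "Q2 c u v has_fps_expansion (fps_const 4 * (A * fps_theta (fps_theta A)) - fps_const 5 * (fps_theta A * fps_theta A)
           - fps_const c * ((A * A - B * B) * A))"
proof -
  have "(\<lambda>q. 4 * ((v q * theta u q - u q * theta v q) * (v q * theta u q - u q * theta v q))
      - u q * ((u q * u q - v q * v q) * (u q * u q - v q * v q))) has_fps_expansion
     (fps_const 4 * ((B * fps_theta A - A * fps_theta B) * (B * fps_theta A - A * fps_theta B))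
           - A * ((A * A - B * B) * (A * A - B * B)))"
    by (intro fps_expansion_intros u v theta_has_fps_expansion)
  thus "Q1 u v has_fps_expansion (fps_const 4 * ((B * fps_theta A - A * fps_theta B) * (B * fps_theta A - A * fps_theta B))
           - A * ((A * A - B * B) * (A * A - B * B)))"
    by (simp only: Q1_def[abs_def] power2_eq_square)
  have "(\<lambda>q. 4 * (u q * theta (theta u) q) - 5 * (theta u q * theta u q) - c * ((u q * u q - v q * v q) * u q)) has_fps_expansion
     (fps_const 4 * (A * fps_theta (fps_theta A)) - fps_const 5 * (fps_theta A * fps_theta A)
           - fps_const c * ((A * A - B * B) * A))"
    by (intro fps_expansion_intros u v theta_has_fps_expansion)
  thus "Q2 c u v has_fps_expansion (fps_const 4 * (A * fps_theta (fps_theta A)) - fps_const 5 * (fps_theta A * fps_theta A)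
           - fps_const c * ((A * A - B * B) * A))"
    by (simp only: Q2_def[abs_def] power2_eq_square mult.assoc)
qed

lemma fricke_has_field_derivative:
  assumes "N > 0" "Im \<tau> > 0"
  shows "((\<lambda>\<tau>. - 1 / (of_real N * \<tau>)) has_field_derivative of_real (1 / N) / \<tau>\<^sup>2) (at \<tau>)"
proof -
  have "\<tau> \<noteq> 0" using assms by auto
  thus ?thesis using assms by (auto intro!: derivative_eq_intros simp: field_simps power2_eq_square)
qed

text \<open>The weights 20 and 12 give the half weights 10 and 6 in the two numerical
  conditions.\<close>

lemma Q_vanishes:
  assumes ex: "u has_fps_expansion A" "v has_fps_expansion B"
    and hol: "u holomorphic_on ball 0 1" "v holomorphic_on ball 0 1"
    and N: "N > 0"
    and law: "\<And>\<tau>. Im \<tau> > 0 \<Longrightarrow> u (q_param 1 (- 1 / (of_real N * \<tau>))) = of_real (N\<^sup>2) * \<tau> ^ 4 * u (q_param 1 \<tau>)"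
      "\<And>\<tau>. Im \<tau> > 0 \<Longrightarrow> v (q_param 1 (- 1 / (of_real N * \<tau>))) = - of_real (N\<^sup>2) * \<tau> ^ 4 * v (q_param 1 \<tau>)"
    and y0: "N * (1/4 + y0\<^sup>2) < 1" "y0 > 0"
  shows "\<lbrakk>10 < 2 * pi * real m * y0; \<And>i. i < m \<Longrightarrow> fps_nth (fps_const 4 * ((B * fps_theta A - A * fps_theta B) * (B * fps_theta A - A * fps_theta B))
           - A * ((A * A - B * B) * (A * A - B * B))) i = 0; norm q < 1\<rbrakk> \<Longrightarrow> Q1 u v q = 0"
    "\<lbrakk>6 < 2 * pi * real m * y0; \<And>i. i < m \<Longrightarrow> fps_nth (fps_const 4 * (A * fps_theta (fps_theta A)) - fps_const 5 * (fps_theta A * fps_theta A)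
           - fps_const c * ((A * A - B * B) * A)) i = 0; norm q < 1\<rbrakk> \<Longrightarrow> Q2 c u v q = 0"
proof -
  have cov: "Q1 u v (q_param 1 (- 1 / (of_real N * \<tau>))) = \<tau> ^ 20 / of_real (1 / N) ^ 10 * Q1 u v (q_param 1 \<tau>)"
    "Q2 c u v (q_param 1 (- 1 / (of_real N * \<tau>))) = \<tau> ^ 12 / of_real (1 / N) ^ 6 * Q2 c u v (q_param 1 \<tau>)"
    if \<tau>: "Im \<tau> > 0" for \<tau>
  proof -
    have *: "u (q_param 1 (- 1 / (of_real N * \<tau>))) = 1 / (of_real (1 / N))\<^sup>2 * \<tau> ^ 4 * u (q_param 1 \<tau>)"
      "v (q_param 1 (- 1 / (of_real N * \<tau>))) = (-1) / (of_real (1 / N))\<^sup>2 * \<tau> ^ 4 * v (q_param 1 \<tau>)"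
      if "Im \<tau> > 0" for \<tau> using law[OF that] N by (simp_all add: power_divide)
    show "Q1 u v (q_param 1 (- 1 / (of_real N * \<tau>))) = \<tau> ^ 20 / of_real (1 / N) ^ 10 * Q1 u v (q_param 1 \<tau>)"
      "Q2 c u v (q_param 1 (- 1 / (of_real N * \<tau>))) = \<tau> ^ 12 / of_real (1 / N) ^ 6 * Q2 c u v (q_param 1 \<tau>)"
      by (rule Q_covariant[where w = "\<lambda>\<tau>. - 1 / (of_real N * \<tau>)" and \<kappa> = "of_real (1 / N)" and s = "-1",
            OF Im_fricke_pos[OF N] fricke_has_field_derivative[OF N] _ _ hol hol _ * \<tau>]; use N in simp)+
  qed
  have 1: "norm (Q1 u v (q_param 1 (- 1 / (of_real N * \<tau>)))) = (N * (norm \<tau>)\<^sup>2) ^ 10 * norm (Q1 u v (q_param 1 \<tau>))"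
    "norm (Q2 c u v (q_param 1 (- 1 / (of_real N * \<tau>)))) = (N * (norm \<tau>)\<^sup>2) ^ 6 * norm (Q2 c u v (q_param 1 \<tau>))"
    if "Im \<tau> > 0" for \<tau>
    unfolding cov[OF that] using N
    by (simp_all add: norm_mult norm_divide norm_power power_mult_distrib power_divide flip: power_mult)
  show "\<lbrakk>10 < 2 * pi * real m * y0; \<And>i. i < m \<Longrightarrow> fps_nth (fps_const 4 * ((B * fps_theta A - A * fps_theta B) * (B * fps_theta A - A * fps_theta B))
           - A * ((A * A - B * B) * (A * A - B * B))) i = 0; norm q < 1\<rbrakk> \<Longrightarrow> Q1 u v q = 0"
    by (rule form_vanishes[OF Q_holomorphic(1)[OF hol] Q_has_fps_expansion(1)[OF ex] _ N _ 1(1) y0]) auto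
  show "\<lbrakk>6 < 2 * pi * real m * y0; \<And>i. i < m \<Longrightarrow> fps_nth (fps_const 4 * (A * fps_theta (fps_theta A)) - fps_const 5 * (fps_theta A * fps_theta A)
           - fps_const c * ((A * A - B * B) * A)) i = 0; norm q < 1\<rbrakk> \<Longrightarrow> Q2 c u v q = 0"
    by (rule form_vanishes[OF Q_holomorphic(2)[OF hol] Q_has_fps_expansion(2)[OF ex] _ N _ 1(2) y0]) auto
qed

section \<open>Differential equations for forms of level 1 to 4\<close>

lemma eisenstein_invert:
  assumes "Im \<tau> > 0"
  shows "eisenstein k (- 1 / \<tau>) = \<tau> ^ k * eisenstein k \<tau>"
proof -
  have "\<tau> \<noteq> 0" using assms by auto
  thus ?thesis using eisenstein_modular[of 0 0 "-1" 1 \<tau> k] by simp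
qed

lemma q_param_power: "h > 0 \<Longrightarrow> q_param h \<tau> ^ k = q_param h (of_nat k * \<tau>)"
  by (simp add: q_param_def exp_of_nat_mult[symmetric] mult_ac)

text \<open>Only the scale \<alpha> of the divisor sums is left open; the identity proved first, at
  level 2, will fix it.\<close>

locale weight_4_series =
  fixes \<alpha> :: complex and r :: "complex \<Rightarrow> complex"
  assumes \<alpha>_nonzero: "\<alpha> \<noteq> 0" and r_holomorphic: "r holomorphic_on ball 0 1"
    and eisenstein_4: "\<And>\<tau> q. Im \<tau> > 0 \<Longrightarrow> q = exp (2 * of_real pi * \<i> * \<tau>) \<Longrightarrow>
       eisenstein 4 \<tau> = 1 + \<alpha> * (q + 9 * q ^ 2 + 28 * q ^ 3 + 73 * q ^ 4) + q ^ 5 * r q"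
begin

definition \<phi> :: "complex \<Rightarrow> complex" where
  "\<phi> q = 1 + \<alpha> * (q + 9 * q ^ 2 + 28 * q ^ 3 + 73 * q ^ 4) + q ^ 5 * r q"

lemma \<phi>_holomorphic: "\<phi> holomorphic_on ball 0 1"
  unfolding \<phi>_def[abs_def] by (intro holomorphic_intros r_holomorphic)

lemma eisenstein_\<phi>: "Im \<tau> > 0 \<Longrightarrow> eisenstein 4 \<tau> = \<phi> (q_param 1 \<tau>)"
  using eisenstein_4[OF _ refl] by (simp add: \<phi>_def q_param_def)

lemma \<phi>_invert:
  assumes "Im \<tau> > 0" "k > 0"
  shows "\<phi> (q_param 1 (- 1 / (of_real k * \<tau>))) = (of_real k * \<tau>) ^ 4 * \<phi> (q_param 1 (of_real k * \<tau>))"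
proof -
  have i: "Im (of_real k * \<tau>) > 0" using assms by simp
  have "Im (- 1 / (of_real k * \<tau>)) > 0" using Im_fricke_pos[OF assms(2,1)] .
  with eisenstein_invert[OF i, of 4] show ?thesis using i by (simp add: eisenstein_\<phi>)
qed

lemma \<phi>_power_holomorphic: "k > 0 \<Longrightarrow> (\<lambda>q. \<phi> (q ^ k)) holomorphic_on ball 0 1"
proof -
  assume k: "k > 0"
  have "norm (q ^ k) < 1" if "norm q < 1" for q :: complex
    using that k by (simp add: norm_power power_less_one_iff)
  hence "\<phi> \<circ> (\<lambda>q. q ^ k) holomorphic_on ball 0 1"
    by (intro holomorphic_on_compose_gen[OF _ \<phi>_holomorphic] holomorphic_intros) auto
  thus ?thesis by (simp add: o_def)
qed

text \<open>Up to the common factor \<open>N^2 \<tau>^4\<close> the involution exchanges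
  \<open>\<phi> q\<close> with \<open>N^2 \<phi> (q^N)\<close>; sum and difference are its
  eigenvectors, scaled to constant term 1. At level 4 \<open>\<phi> (q^2)\<close> has eigenvalue +1
  too, and its coefficient -2 makes \<open>u4\<close> vanish at the cusp 1/2, as \<open>v4\<close>
  does.\<close>

definition "u2 q = (\<phi> q + 4 * \<phi> (q ^ 2)) / 5"
definition "v2 q = (4 * \<phi> (q ^ 2) - \<phi> q) / 3"
definition "u3 q = (\<phi> q + 9 * \<phi> (q ^ 3)) / 10"
definition "v3 q = (9 * \<phi> (q ^ 3) - \<phi> q) / 8"
definition "u4 q = (\<phi> q + 16 * \<phi> (q ^ 4) - 2 * \<phi> (q ^ 2)) / 15"
definition "v4 q = (16 * \<phi> (q ^ 4) - \<phi> q) / 15"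

lemma r_power_holomorphic: "k > 0 \<Longrightarrow> (\<lambda>q. r (q ^ k)) holomorphic_on ball 0 1"
proof -
  assume k: "k > 0"
  have "norm (q ^ k) < 1" if "norm q < 1" for q :: complex
    using that k by (simp add: norm_power power_less_one_iff)
  hence "r \<circ> (\<lambda>q. q ^ k) holomorphic_on ball 0 1"
    by (intro holomorphic_on_compose_gen[OF _ r_holomorphic] holomorphic_intros) auto
  thus ?thesis by (simp add: o_def)
qed

lemma linear_combination_expands:
  fixes A B C D :: complex
  assumes "A + B + C + D = 1"
  shows "expands (\<lambda>q. A * \<phi> q + B * \<phi> (q ^ 2) + C * \<phi> (q ^ 3) + D * \<phi> (q ^ 4))
     (A * \<alpha>) ((9 * A + B) * \<alpha>) ((28 * A + C) * \<alpha>) ((73 * A + 9 * B + D) * \<alpha>)"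
proof -
  define R where "R = (\<lambda>q. A * r q + B * (28 * \<alpha> * q + 73 * \<alpha> * q ^ 3 + q ^ 5 * r (q ^ 2))
     + C * (9 * \<alpha> * q + 28 * \<alpha> * q ^ 4 + 73 * \<alpha> * q ^ 7 + q ^ 10 * r (q ^ 3))
     + D * (9 * \<alpha> * q ^ 3 + 28 * \<alpha> * q ^ 7 + 73 * \<alpha> * q ^ 11 + q ^ 15 * r (q ^ 4)))"
  have "R holomorphic_on ball 0 1"
    unfolding R_def by (intro holomorphic_intros r_holomorphic r_power_holomorphic) auto
  moreover have "A * \<phi> q + B * \<phi> (q ^ 2) + C * \<phi> (q ^ 3) + D * \<phi> (q ^ 4) =
     1 + A * \<alpha> * q + (9 * A + B) * \<alpha> * q ^ 2 + (28 * A + C) * \<alpha> * q ^ 3 + (73 * A + 9 * B + D) * \<alpha> * q ^ 4 + q ^ 5 * R q" for q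
  proof -
    define r1 r2 r3 r4 where "r1 = r q" and "r2 = r (q ^ 2)" and "r3 = r (q ^ 3)" and "r4 = r (q ^ 4)"
    have D: "D = 1 - A - B - C" using assms by (simp add: algebra_simps)
    show ?thesis
      unfolding R_def \<phi>_def r1_def[symmetric] r2_def[symmetric] r3_def[symmetric] r4_def[symmetric] D
      by algebra
  qed
  ultimately show ?thesis unfolding expands_def by blast
qed

lemma forms_expand:
  "expands u2 (\<alpha> / 5) (13 * \<alpha> / 5) (28 * \<alpha> / 5) (109 * \<alpha> / 5)"
  "expands v2 (- \<alpha> / 3) (- 5 * \<alpha> / 3) (- 28 * \<alpha> / 3) (- 37 * \<alpha> / 3)"
  "expands u3 (\<alpha> / 10) (9 * \<alpha> / 10) (37 * \<alpha> / 10) (73 * \<alpha> / 10)"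
  "expands v3 (- \<alpha> / 8) (- 9 * \<alpha> / 8) (- 19 * \<alpha> / 8) (- 73 * \<alpha> / 8)"
  "expands u4 (\<alpha> / 15) (7 * \<alpha> / 15) (28 * \<alpha> / 15) (71 * \<alpha> / 15)"
  "expands v4 (- \<alpha> / 15) (- 9 * \<alpha> / 15) (- 28 * \<alpha> / 15) (- 57 * \<alpha> / 15)"
proof -
  have eqs: "u2 = (\<lambda>q. 1/5 * \<phi> q + 4/5 * \<phi> (q ^ 2) + 0 * \<phi> (q ^ 3) + 0 * \<phi> (q ^ 4))"
    "v2 = (\<lambda>q. -1/3 * \<phi> q + 4/3 * \<phi> (q ^ 2) + 0 * \<phi> (q ^ 3) + 0 * \<phi> (q ^ 4))"
    "u3 = (\<lambda>q. 1/10 * \<phi> q + 0 * \<phi> (q ^ 2) + 9/10 * \<phi> (q ^ 3) + 0 * \<phi> (q ^ 4))"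
    "v3 = (\<lambda>q. -1/8 * \<phi> q + 0 * \<phi> (q ^ 2) + 9/8 * \<phi> (q ^ 3) + 0 * \<phi> (q ^ 4))"
    "u4 = (\<lambda>q. 1/15 * \<phi> q + -2/15 * \<phi> (q ^ 2) + 0 * \<phi> (q ^ 3) + 16/15 * \<phi> (q ^ 4))"
    "v4 = (\<lambda>q. -1/15 * \<phi> q + 0 * \<phi> (q ^ 2) + 0 * \<phi> (q ^ 3) + 16/15 * \<phi> (q ^ 4))"
    by (simp_all add: u2_def[abs_def] v2_def[abs_def] u3_def[abs_def] v3_def[abs_def] u4_def[abs_def] v4_def[abs_def]
        add_divide_distrib diff_divide_distrib algebra_simps)
  show "expands u2 (\<alpha> / 5) (13 * \<alpha> / 5) (28 * \<alpha> / 5) (109 * \<alpha> / 5)"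
    using linear_combination_expands[of "1/5" "4/5" 0 0] unfolding eqs by simp
  show "expands v2 (- \<alpha> / 3) (- 5 * \<alpha> / 3) (- 28 * \<alpha> / 3) (- 37 * \<alpha> / 3)"
    using linear_combination_expands[of "-1/3" "4/3" 0 0] unfolding eqs by simp
  show "expands u3 (\<alpha> / 10) (9 * \<alpha> / 10) (37 * \<alpha> / 10) (73 * \<alpha> / 10)"
    using linear_combination_expands[of "1/10" 0 "9/10" 0] unfolding eqs by simp
  show "expands v3 (- \<alpha> / 8) (- 9 * \<alpha> / 8) (- 19 * \<alpha> / 8) (- 73 * \<alpha> / 8)"
    using linear_combination_expands[of "-1/8" 0 "9/8" 0] unfolding eqs by simp
  show "expands u4 (\<alpha> / 15) (7 * \<alpha> / 15) (28 * \<alpha> / 15) (71 * \<alpha> / 15)"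
    using linear_combination_expands[of "1/15" "-2/15" 0 "16/15"] unfolding eqs by simp
  show "expands v4 (- \<alpha> / 15) (- 9 * \<alpha> / 15) (- 28 * \<alpha> / 15) (- 57 * \<alpha> / 15)"
    using linear_combination_expands[of "-1/15" 0 0 "16/15"] unfolding eqs by simp
qed

lemma less_2_cases: "i < 2 \<Longrightarrow> i = 0 \<or> i = (1::nat)" by auto
lemma less_4_cases: "i < 4 \<Longrightarrow> i = 0 \<or> i = 1 \<or> i = 2 \<or> i = (3::nat)" by auto
lemma less_6_cases: "i < 6 \<Longrightarrow> i = 0 \<or> i = 1 \<or> i = 2 \<or> i = 3 \<or> i = 4 \<or> i = (5::nat)" by auto

lemma fricke_laws_2:
  assumes \<tau>: "Im \<tau> > 0"
  shows "u2 (q_param 1 (- 1 / (of_real 2 * \<tau>))) = of_real (2\<^sup>2) * \<tau> ^ 4 * u2 (q_param 1 \<tau>)"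
    "v2 (q_param 1 (- 1 / (of_real 2 * \<tau>))) = - of_real (2\<^sup>2) * \<tau> ^ 4 * v2 (q_param 1 \<tau>)"
proof -
  have e: "of_nat 2 * (- 1 / (of_real 2 * \<tau>)) = - 1 / (of_real 1 * \<tau>)" by simp
  show "u2 (q_param 1 (- 1 / (of_real 2 * \<tau>))) = of_real (2\<^sup>2) * \<tau> ^ 4 * u2 (q_param 1 \<tau>)"
    "v2 (q_param 1 (- 1 / (of_real 2 * \<tau>))) = - of_real (2\<^sup>2) * \<tau> ^ 4 * v2 (q_param 1 \<tau>)"
    unfolding u2_def v2_def q_param_power[OF zero_less_one] e \<phi>_invert[OF \<tau> zero_less_one] \<phi>_invert[OF \<tau> zero_less_numeral]
    by (simp_all add: field_simps)
qed

lemma fricke_laws_3: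
  assumes \<tau>: "Im \<tau> > 0"
  shows "u3 (q_param 1 (- 1 / (of_real 3 * \<tau>))) = of_real (3\<^sup>2) * \<tau> ^ 4 * u3 (q_param 1 \<tau>)"
    "v3 (q_param 1 (- 1 / (of_real 3 * \<tau>))) = - of_real (3\<^sup>2) * \<tau> ^ 4 * v3 (q_param 1 \<tau>)"
proof -
  have e: "of_nat 3 * (- 1 / (of_real 3 * \<tau>)) = - 1 / (of_real 1 * \<tau>)" by simp
  show "u3 (q_param 1 (- 1 / (of_real 3 * \<tau>))) = of_real (3\<^sup>2) * \<tau> ^ 4 * u3 (q_param 1 \<tau>)"
    "v3 (q_param 1 (- 1 / (of_real 3 * \<tau>))) = - of_real (3\<^sup>2) * \<tau> ^ 4 * v3 (q_param 1 \<tau>)"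
    unfolding u3_def v3_def q_param_power[OF zero_less_one] e \<phi>_invert[OF \<tau> zero_less_one] \<phi>_invert[OF \<tau> zero_less_numeral]
    by (simp_all add: field_simps)
qed

text \<open>The identity at level 2 needs only two coefficients and holds for any \<open>\<alpha>\<close>; its next coefficient
  then determines \<open>\<alpha>\<close>.\<close>

lemma Q2_level_2: "norm q < 1 \<Longrightarrow> Q2 (3/4) u2 v2 q = 0" and \<alpha>_eq: "\<alpha> = 240"
proof -
  obtain A where A: "u2 holomorphic_on ball 0 1" "u2 has_fps_expansion A" "fps_nth A 0 = 1" "fps_nth A 1 = \<alpha> / 5"
    "fps_nth A 2 = 13 * \<alpha> / 5" using expands_fps[OF forms_expand(1)] by metis
  obtain B where B: "v2 holomorphic_on ball 0 1" "v2 has_fps_expansion B" "fps_nth B 0 = 1" "fps_nth B 1 = - \<alpha> / 3"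
    "fps_nth B 2 = - 5 * \<alpha> / 3" using expands_fps[OF forms_expand(2)] by metis
  define S where "S = fps_const 4 * (A * fps_theta (fps_theta A)) - fps_const 5 * (fps_theta A * fps_theta A)
           - fps_const (3/4) * ((A * A - B * B) * A)"
  have "fps_nth S 0 = 0" "fps_nth S 1 = 0"
    unfolding S_def by (simp_all add: fps_mult_nth_small fps_theta_nth A(3-) B(3-) field_simps del: One_nat_def)
  hence ord: "fps_nth S i = 0" if "i < 2" for i using less_2_cases[OF that] by auto
  have zero: "Q2 (3/4) u2 v2 q = 0" if "norm q < 1" for q
  \<comment> \<open>\<open>y0\<close> has to stay below sqrt (1/2 - 1/4) = 1/2, and
    \<open>4 \<pi> y0\<close> has to exceed 6.\<close>
  proof (rule Q_vanishes(2)[OF A(2) B(2) A(1) B(1) zero_less_numeral, where ?y0.0 = "49/100" and m = 2])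
    show "(2 :: real) * (1/4 + (49/100)\<^sup>2) < 1" by (simp add: power2_eq_square)
    show "6 < 2 * pi * real 2 * (49/100)" using pi_approx(1) by simp
  qed (erule fricke_laws_2 | erule ord[unfolded S_def] | rule that | simp)+
  thus "norm q < 1 \<Longrightarrow> Q2 (3/4) u2 v2 q = 0" .
  have "Q2 (3/4) u2 v2 has_fps_expansion S" unfolding S_def by (rule Q_has_fps_expansion(2)[OF A(2) B(2)])
  moreover have "\<forall>\<^sub>F q in nhds 0. Q2 (3/4) u2 v2 q = 0"
  proof -
    have "\<forall>\<^sub>F q in nhds 0. q \<in> ball (0::complex) 1" by (intro eventually_nhds_in_open) auto
    thus ?thesis by eventually_elim (simp add: zero)
  qed
  hence "Q2 (3/4) u2 v2 has_fps_expansion 0" by (simp add: has_fps_expansion_0_iff)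
  ultimately have "S = 0" by (rule fps_expansion_unique_complex)
  hence "fps_nth S 2 = 0" by simp
  \<comment> \<open>The identity now holds to all orders; its coefficient at \<open>q^2\<close> is
    this polynomial up to a nonzero constant.\<close>
  hence "\<alpha> * (\<alpha> - 240) = 0"
    unfolding S_def
    by (simp add: fps_mult_nth_small fps_theta_nth A(3-) B(3-) del: One_nat_def)
       (simp add: field_simps power2_eq_square)
  thus "\<alpha> = 240" using \<alpha>_nonzero by simp
qed

lemma forms_expand_numeric:
  "expands u2 48 624 1344 5232" "expands v2 (- 80) (- 400) (- 2240) (- 2960)"
  "expands u3 24 216 888 1752" "expands v3 (- 30) (- 270) (- 570) (- 2190)"
  "expands u4 16 112 448 1136" "expands v4 (- 16) (- 144) (- 448) (- 912)"
  using forms_expand unfolding \<alpha>_eq by simp_all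

lemma Q1_level_2: assumes "norm q < 1" shows "Q1 u2 v2 q = 0"
proof -
  obtain A where A: "u2 holomorphic_on ball 0 1" "u2 has_fps_expansion A" "fps_nth A 0 = 1" "fps_nth A 1 = 48"
    "fps_nth A 2 = 624" "fps_nth A 3 = 1344" "fps_nth A 4 = 5232" using expands_fps[OF forms_expand_numeric(1)] by metis
  obtain B where B: "v2 holomorphic_on ball 0 1" "v2 has_fps_expansion B" "fps_nth B 0 = 1" "fps_nth B 1 = - 80"
    "fps_nth B 2 = - 400" "fps_nth B 3 = - 2240" "fps_nth B 4 = - 2960" using expands_fps[OF forms_expand_numeric(2)] by metis
  define S where "S = fps_const 4 * ((B * fps_theta A - A * fps_theta B) * (B * fps_theta A - A * fps_theta B))
           - A * ((A * A - B * B) * (A * A - B * B))"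
  \<comment> \<open>Coefficients up to \<open>q^4\<close> suffice for the order 6: the Wronskian and
    \<open>A * A - B * B\<close> vanish at 0 and occur squared, so the unknown fifth coefficients
    are multiplied by 0.\<close>
  have "fps_nth S 0 = 0" "fps_nth S 1 = 0" "fps_nth S 2 = 0" "fps_nth S 3 = 0" "fps_nth S 4 = 0" "fps_nth S 5 = 0"
    unfolding S_def by (simp_all add: fps_mult_nth_small fps_theta_nth A(3-) B(3-) del: One_nat_def)
  hence ord: "fps_nth S i = 0" if "i < 6" for i using less_6_cases[OF that] by auto
  show ?thesis
  proof (rule Q_vanishes(1)[OF A(2) B(2) A(1) B(1) zero_less_numeral, where ?y0.0 = "49/100" and m = 6])
    show "(2 :: real) * (1/4 + (49/100)\<^sup>2) < 1" by (simp add: power2_eq_square)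
    show "10 < 2 * pi * real 6 * (49/100)" using pi_approx(1) by simp
  qed (erule fricke_laws_2 | erule ord[unfolded S_def] | rule assms | simp)+
qed

text \<open>The constant is \<open>8/9 = 16 a b\<close> for \<open>(a, b) = (1/6, 1/3)\<close>, just
  as 3/4 belongs to (1/8, 3/8) at level 2 and 1 to (1/4, 1/4) at level 4.\<close>

lemma level_3: assumes q: "norm q < 1" shows "Q1 u3 v3 q = 0" "Q2 (8/9) u3 v3 q = 0"
proof -
  obtain A where A: "u3 holomorphic_on ball 0 1" "u3 has_fps_expansion A" "fps_nth A 0 = 1" "fps_nth A 1 = 24"
    "fps_nth A 2 = 216" "fps_nth A 3 = 888" "fps_nth A 4 = 1752" using expands_fps[OF forms_expand_numeric(3)] by metis
  obtain B where B: "v3 holomorphic_on ball 0 1" "v3 has_fps_expansion B" "fps_nth B 0 = 1" "fps_nth B 1 = - 30"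
    "fps_nth B 2 = - 270" "fps_nth B 3 = - 570" "fps_nth B 4 = - 2190" using expands_fps[OF forms_expand_numeric(4)] by metis
  define S where "S = fps_const 4 * ((B * fps_theta A - A * fps_theta B) * (B * fps_theta A - A * fps_theta B))
           - A * ((A * A - B * B) * (A * A - B * B))"
  have "fps_nth S 0 = 0" "fps_nth S 1 = 0" "fps_nth S 2 = 0" "fps_nth S 3 = 0" "fps_nth S 4 = 0" "fps_nth S 5 = 0"
    unfolding S_def by (simp_all add: fps_mult_nth_small fps_theta_nth A(3-) B(3-) del: One_nat_def)
  hence ord: "fps_nth S i = 0" if "i < 6" for i using less_6_cases[OF that] by auto
  show "Q1 u3 v3 q = 0"
  \<comment> \<open>The limit for \<open>y0\<close> is sqrt (1/3 - 1/4), about 0.2887.\<close>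
  proof (rule Q_vanishes(1)[OF A(2) B(2) A(1) B(1) zero_less_numeral, where ?y0.0 = "28/100" and m = 6])
    show "(3 :: real) * (1/4 + (28/100)\<^sup>2) < 1" by (simp add: power2_eq_square)
    show "10 < 2 * pi * real 6 * (28/100)" using pi_approx(1) by simp
  qed (erule fricke_laws_3 | erule ord[unfolded S_def] | rule assms | simp)+
  define S' where "S' = fps_const 4 * (A * fps_theta (fps_theta A)) - fps_const 5 * (fps_theta A * fps_theta A)
           - fps_const (8/9) * ((A * A - B * B) * A)"
  have "fps_nth S' 0 = 0" "fps_nth S' 1 = 0" "fps_nth S' 2 = 0" "fps_nth S' 3 = 0"
    unfolding S'_def by (simp_all add: fps_mult_nth_small fps_theta_nth A(3-) B(3-) del: One_nat_def)
  hence ord': "fps_nth S' i = 0" if "i < 4" for i using less_4_cases[OF that] by auto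
  show "Q2 (8/9) u3 v3 q = 0"
  proof (rule Q_vanishes(2)[OF A(2) B(2) A(1) B(1) zero_less_numeral, where ?y0.0 = "28/100" and m = 4])
    show "(3 :: real) * (1/4 + (28/100)\<^sup>2) < 1" by (simp add: power2_eq_square)
    show "6 < 2 * pi * real 4 * (28/100)" using pi_approx(1) by simp
  qed (erule fricke_laws_3 | erule ord'[unfolded S'_def] | rule assms | simp)+
qed

section \<open>Level 4 by way of the theta group\<close>

lemma \<phi>_invert':
  assumes "Im w > 0"
  shows "\<phi> (q_param 1 (- 1 / w)) = w ^ 4 * \<phi> (q_param 1 w)"
  using \<phi>_invert[OF assms, of 1] by simp

lemma q_param_2: "q_param 2 \<tau> = q_param 1 (\<tau> / 2)" "(q_param 2 \<tau>) ^ 2 = q_param 1 \<tau>"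
  "(q_param 2 \<tau>) ^ 4 = q_param 1 (2 * \<tau>)"
  by (simp_all add: q_param_def exp_of_nat_mult[symmetric] mult.assoc)

text \<open>The transforms of \<open>u4\<close> and \<open>v4\<close> at the cusp 1/2, with
  \<open>p\<close> the parameter of width 2. Both vanish at \<open>p = 0\<close>; \<open>ue\<close>
  is even and \<open>ve\<close> is odd.\<close>

definition "ue p = (\<phi> (- p) + \<phi> p - 2 * \<phi> (p ^ 2)) / 15"
definition "ve p = (\<phi> p - \<phi> (- p)) / 15"

lemma \<phi>_neg_holomorphic: "(\<lambda>p. \<phi> (- p)) holomorphic_on ball 0 1"
proof -
  have "\<phi> \<circ> uminus holomorphic_on ball 0 1"
    by (intro holomorphic_on_compose_gen[OF _ \<phi>_holomorphic] holomorphic_intros) auto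
  thus ?thesis by (simp add: o_def)
qed

lemma ue_ve_holomorphic: "ue holomorphic_on ball 0 1" "ve holomorphic_on ball 0 1"
  unfolding ue_def[abs_def] ve_def[abs_def]
  by (intro holomorphic_intros \<phi>_holomorphic \<phi>_neg_holomorphic \<phi>_power_holomorphic; simp)+

text \<open>Reading \<open>u4\<close> and \<open>v4\<close> in the parameter of width 2 replaces
  \<tau> by \<tau>/2 and turns the involution of level 4 into \<open>- 1 / \<tau>\<close>. The
  arguments \<open>p\<close>, \<open>p^2\<close>, \<open>p^4\<close> then stand for \<tau>/2,
  \<tau>, 2 \<tau>, and \<open>- p\<close> for (\<tau> + 1)/2.\<close>

lemma fricke_laws_4:
  assumes \<tau>: "Im \<tau> > 0"
  shows "u4 (q_param 2 (- 1 / \<tau>)) = \<tau> ^ 4 * u4 (q_param 2 \<tau>)"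
    "v4 (q_param 2 (- 1 / \<tau>)) = - (\<tau> ^ 4) * v4 (q_param 2 \<tau>)"
    "u4 (- q_param 2 (- 1 / \<tau>)) = \<tau> ^ 4 * ue (q_param 2 \<tau>)"
    "v4 (- q_param 2 (- 1 / \<tau>)) = \<tau> ^ 4 * ve (q_param 2 \<tau>)"
proof -
  have \<tau>0: "\<tau> \<noteq> 0" using \<tau> by auto
  define p p' where "p = q_param 2 (- 1 / \<tau>)" and "p' = q_param 2 \<tau>"
  have 1: "\<phi> p = 16 * \<tau> ^ 4 * \<phi> (p' ^ 4)"
  proof -
    have "p = q_param 1 (- 1 / (2 * \<tau>))" unfolding p_def q_param_2(1) by (simp add: mult.commute)
    thus ?thesis unfolding p'_def q_param_2(3) using \<phi>_invert'[of "2 * \<tau>"] \<tau> by (simp add: power_mult_distrib)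
  qed
  have 2: "\<phi> (p ^ 2) = \<tau> ^ 4 * \<phi> (p' ^ 2)"
    unfolding p_def p'_def q_param_2(2) by (rule \<phi>_invert'[OF \<tau>])
  have 3: "\<phi> (p ^ 4) = \<tau> ^ 4 / 16 * \<phi> p'"
  proof -
    have "p ^ 4 = q_param 1 (- 1 / (\<tau> / 2))" unfolding p_def q_param_2(3) by simp
    thus ?thesis unfolding p'_def q_param_2(1) using \<phi>_invert'[of "\<tau> / 2"] \<tau> by (simp add: power_divide)
  qed
  have 4: "\<phi> (- p) = \<tau> ^ 4 * \<phi> (- p')"
  proof -
    define z where "z = (\<tau> + 1) / 2"
    have i: "Im (- 1 / \<tau>) > 0" using Im_fricke_pos[of 1 \<tau>] \<tau> by simp
    have pp: "- p = q_param 1 ((- 1 / \<tau> + 1) / 2)" "- p' = q_param 1 z"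
      unfolding p_def p'_def z_def q_param_add_1(2)[symmetric] by (rule q_param_2(1))+
    have c: "of_int 2 * z + of_int (- 1) = \<tau>" by (simp add: z_def add_divide_distrib)
    \<comment> \<open>The matrix with rows (1, -1) and (2, -1) takes
      \<open>z = (\<tau> + 1) / 2\<close> to the corresponding point for
      \<open>- 1 / \<tau>\<close>, with automorphy factor \<open>2 z - 1 = \<tau>\<close>.\<close>
    have "(- 1 / \<tau> + 1) / 2 = (of_int 1 * z + of_int (- 1)) / \<tau>"
      using \<tau>0 by (simp add: z_def field_simps)
    moreover have "eisenstein 4 ((of_int 1 * z + of_int (- 1)) / \<tau>) = \<tau> ^ 4 * eisenstein 4 z"
      by (rule eisenstein_modular[of 1 "- 1" "- 1" 2 z 4, unfolded c]) (use \<tau>0 in simp_all)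
    ultimately have "eisenstein 4 ((- 1 / \<tau> + 1) / 2) = \<tau> ^ 4 * eisenstein 4 z" by (simp only:)
    moreover have "Im ((- 1 / \<tau> + 1) / 2) > 0" "Im z > 0" using i \<tau> by (simp_all add: z_def)
    ultimately show ?thesis unfolding pp by (simp only: eisenstein_\<phi>)
  qed
  have neg: "(- p) ^ 2 = p ^ 2" "(- p) ^ 4 = p ^ 4" by simp_all
  show "u4 (q_param 2 (- 1 / \<tau>)) = \<tau> ^ 4 * u4 (q_param 2 \<tau>)"
    "v4 (q_param 2 (- 1 / \<tau>)) = - (\<tau> ^ 4) * v4 (q_param 2 \<tau>)"
    "u4 (- q_param 2 (- 1 / \<tau>)) = \<tau> ^ 4 * ue (q_param 2 \<tau>)"
    "v4 (- q_param 2 (- 1 / \<tau>)) = \<tau> ^ 4 * ve (q_param 2 \<tau>)"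
    unfolding u4_def v4_def ue_def ve_def p_def[symmetric] p'_def[symmetric] neg 1 2 3 4
    by (simp_all add: field_simps)
qed

lemma theta_neg:
  assumes "f holomorphic_on ball 0 1" "norm p < 1"
  shows "theta (\<lambda>p. f (- p)) p = theta f (- p)"
proof -
  have "(f has_field_derivative deriv f (- p)) (at (- p))"
    using assms by (intro holomorphic_derivI[OF assms(1)]) auto
  hence "((\<lambda>p. f (- p)) has_field_derivative deriv f (- p) * (- 1)) (at p)"
    by (rule DERIV_chain2) (auto intro!: derivative_eq_intros)
  thus ?thesis by (simp add: theta_def DERIV_imp_deriv)
qed

lemma theta_theta_neg:
  assumes "f holomorphic_on ball 0 1" "norm p < 1"
  shows "theta (theta (\<lambda>p. f (- p))) p = theta (theta f) (- p)"
proof -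
  have "deriv (theta (\<lambda>p. f (- p))) p = deriv (\<lambda>p. theta f (- p)) p"
  proof (rule deriv_cong_ev)
    have "\<forall>\<^sub>F z in nhds p. z \<in> ball (0 :: complex) 1" using assms by (intro eventually_nhds_in_open) auto
    thus "\<forall>\<^sub>F z in nhds p. theta (\<lambda>p. f (- p)) z = theta f (- z)"
      by eventually_elim (use theta_neg[OF assms(1)] in simp)
  qed simp
  hence "theta (theta (\<lambda>p. f (- p))) p = theta (\<lambda>p. theta f (- p)) p" by (simp add: theta_def)
  also have "\<dots> = theta (theta f) (- p)" by (rule theta_neg[OF theta_holomorphic[OF assms(1)] assms(2)])
  finally show ?thesis .
qed

lemma Q_neg:
  assumes "u holomorphic_on ball 0 1" "v holomorphic_on ball 0 1" "norm p < 1"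
  shows "Q1 (\<lambda>p. u (- p)) (\<lambda>p. v (- p)) p = Q1 u v (- p)" "Q2 c (\<lambda>p. u (- p)) (\<lambda>p. v (- p)) p = Q2 c u v (- p)"
  unfolding Q1_def Q2_def theta_neg[OF assms(1,3)] theta_neg[OF assms(2,3)] theta_theta_neg[OF assms(1,3)] by simp_all

text \<open>\<open>v\<close> enters \<open>Q1\<close> and \<open>Q2\<close> only quadratically. As
  \<open>ve\<close> is odd and \<open>ue\<close> even, the forms at the cusp 1/2 are therefore even
  in \<open>p\<close>, as the criterion for the theta group demands.\<close>

lemma Q_even:
  assumes v: "v holomorphic_on ball 0 1" "norm p < 1"
  shows "Q1 u (\<lambda>p. - v p) p = Q1 u v p" "Q2 c u (\<lambda>p. - v p) p = Q2 c u v p"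
proof -
  have "deriv (\<lambda>p. - v p) p = - deriv v p"
    using holomorphic_on_imp_differentiable_at[OF v(1) open_ball, of p] v(2) by (intro deriv_minus) simp
  hence "theta (\<lambda>p. - v p) p = - theta v p" by (simp add: theta_def)
  thus "Q1 u (\<lambda>p. - v p) p = Q1 u v p"
    unfolding Q1_def by (simp add: power2_eq_square algebra_simps)
  show "Q2 c u (\<lambda>p. - v p) p = Q2 c u v p" unfolding Q2_def by simp
qed

lemma level_4: assumes q: "norm q < 1" shows "Q1 u4 v4 q = 0" "Q2 1 u4 v4 q = 0"
proof -
  obtain A where A: "u4 holomorphic_on ball 0 1" "u4 has_fps_expansion A" "fps_nth A 0 = 1" "fps_nth A 1 = 16"
    "fps_nth A 2 = 112" "fps_nth A 3 = 448" "fps_nth A 4 = 1136" using expands_fps[OF forms_expand_numeric(5)] by metis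
  obtain B where B: "v4 holomorphic_on ball 0 1" "v4 has_fps_expansion B" "fps_nth B 0 = 1" "fps_nth B 1 = - 16"
    "fps_nth B 2 = - 144" "fps_nth B 3 = - 448" "fps_nth B 4 = - 912" using expands_fps[OF forms_expand_numeric(6)] by metis
  have neg: "(\<lambda>p. f (- p)) holomorphic_on ball 0 1" if "f holomorphic_on ball 0 1" for f :: "complex \<Rightarrow> complex"
  proof -
    have "f \<circ> uminus holomorphic_on ball 0 1"
      by (intro holomorphic_on_compose_gen[OF _ that] holomorphic_intros) auto
    thus ?thesis by (simp add: o_def)
  qed
  define w :: "complex \<Rightarrow> complex" where "w = (\<lambda>\<tau>. - 1 / \<tau>)"
  have w: "Im (w \<tau>) > 0" "(w has_field_derivative 1 / \<tau>\<^sup>2) (at \<tau>)" if "Im \<tau> > 0" for \<tau>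
    using Im_fricke_pos[of 1 \<tau>] fricke_has_field_derivative[of 1 \<tau>] that by (simp_all add: w_def)
  have n2: "norm (q_param 2 \<tau>) < 1" if "Im \<tau> > 0" for \<tau> by (rule norm_q_param[OF _ that]) simp
  have lw: "u4 (q_param 2 (w \<tau>)) = \<tau> ^ 4 * u4 (q_param 2 \<tau>)" "v4 (q_param 2 (w \<tau>)) = - (\<tau> ^ 4) * v4 (q_param 2 \<tau>)"
    "u4 (- q_param 2 (w \<tau>)) = \<tau> ^ 4 * ue (q_param 2 \<tau>)" "v4 (- q_param 2 (w \<tau>)) = \<tau> ^ 4 * ve (q_param 2 \<tau>)"
    if "Im \<tau> > 0" for \<tau> unfolding w_def by (rule fricke_laws_4[OF that])+
  have cov1: "Q1 u4 v4 (q_param 2 (w \<tau>)) = \<tau> ^ 20 / 1 ^ 10 * Q1 u4 v4 (q_param 2 \<tau>)"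
    "Q2 1 u4 v4 (q_param 2 (w \<tau>)) = \<tau> ^ 12 / 1 ^ 6 * Q2 1 u4 v4 (q_param 2 \<tau>)" if "Im \<tau> > 0" for \<tau>
    by (rule Q_covariant[where s = "-1", OF w _ _ A(1) B(1) A(1) B(1) _ _ _ that]; simp add: lw)+
  have cov2: "Q1 u4 v4 (- q_param 2 (w \<tau>)) = \<tau> ^ 20 / 1 ^ 10 * Q1 ue ve (q_param 2 \<tau>)"
    "Q2 1 u4 v4 (- q_param 2 (w \<tau>)) = \<tau> ^ 12 / 1 ^ 6 * Q2 1 ue ve (q_param 2 \<tau>)" if "Im \<tau> > 0" for \<tau>
    unfolding Q_neg[OF A(1) B(1) n2[OF w(1)[OF that]], symmetric]
    by (rule Q_covariant[where s = 1, OF w _ _ neg[OF A(1)] neg[OF B(1)] ue_ve_holomorphic _ _ _ that]; simp add: lw)+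
  have even: "Q1 ue ve (- p) = Q1 ue ve p" "Q2 1 ue ve (- p) = Q2 1 ue ve p" if "norm p < 1" for p
  proof -
    have "(\<lambda>p. ue (- p)) = ue" "(\<lambda>p. ve (- p)) = (\<lambda>p. - ve p)"
      by (auto simp: ue_def ve_def fun_eq_iff field_simps)
    thus "Q1 ue ve (- p) = Q1 ue ve p" "Q2 1 ue ve (- p) = Q2 1 ue ve p"
      using Q_neg[OF ue_ve_holomorphic that] Q_even[OF ue_ve_holomorphic(2) that] by simp_all
  qed
  define S where "S = fps_const 4 * ((B * fps_theta A - A * fps_theta B) * (B * fps_theta A - A * fps_theta B))
           - A * ((A * A - B * B) * (A * A - B * B))"
  have "fps_nth S 0 = 0" "fps_nth S 1 = 0" "fps_nth S 2 = 0" "fps_nth S 3 = 0" "fps_nth S 4 = 0" "fps_nth S 5 = 0"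
    unfolding S_def by (simp_all add: fps_mult_nth_small fps_theta_nth A(3-) B(3-) del: One_nat_def)
  hence ord: "fps_nth S i = 0" if "i < 6" for i using less_6_cases[OF that] by auto
  show "Q1 u4 v4 q = 0"
  proof (rule theta_form_vanishes[OF Q_holomorphic(1)[OF A(1) B(1)] Q_has_fps_expansion(1)[OF A(2) B(2), folded S_def] ord
        Q_holomorphic(1)[OF ue_ve_holomorphic] even(1), where \<kappa> = 10 and ?y0.0 = "86/100"])
    show "norm (Q1 u4 v4 (q_param 2 (- 1 / \<tau>))) = ((norm \<tau>)\<^sup>2) ^ 10 * norm (Q1 u4 v4 (q_param 2 \<tau>))"
      "norm (Q1 u4 v4 (- q_param 2 (- 1 / \<tau>))) = ((norm \<tau>)\<^sup>2) ^ 10 * norm (Q1 ue ve (q_param 2 \<tau>))"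
      if "Im \<tau> > 0" for \<tau>
      using cov1(1)[OF that] cov2(1)[OF that] by (simp_all add: w_def norm_mult norm_power flip: power_mult)
    \<comment> \<open>The limit for \<open>y0\<close> is now that of the full modular group, sqrt
      (3/4), about 0.866.\<close>
    show "1 / 4 + (86 / 100)\<^sup>2 < (1 :: real)" by (simp add: power2_eq_square)
    show "real (3 * 10) * 2 < 2 * pi * real (2 * 6) * (86 / 100)" using pi_approx(1) by simp
  qed (use q in auto)
  define S' where "S' = fps_const 4 * (A * fps_theta (fps_theta A)) - fps_const 5 * (fps_theta A * fps_theta A)
           - fps_const 1 * ((A * A - B * B) * A)"
  have "fps_nth S' 0 = 0" "fps_nth S' 1 = 0" "fps_nth S' 2 = 0" "fps_nth S' 3 = 0"
    unfolding S'_def by (simp_all add: fps_mult_nth_small fps_theta_nth A(3-) B(3-) del: One_nat_def)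
  hence ord': "fps_nth S' i = 0" if "i < 4" for i using less_4_cases[OF that] by auto
  show "Q2 1 u4 v4 q = 0"
  proof (rule theta_form_vanishes[OF Q_holomorphic(2)[OF A(1) B(1)] Q_has_fps_expansion(2)[OF A(2) B(2), of 1, folded S'_def] ord'
        Q_holomorphic(2)[OF ue_ve_holomorphic] even(2), where \<kappa> = 6 and ?y0.0 = "86/100"])
    show "norm (Q2 1 u4 v4 (q_param 2 (- 1 / \<tau>))) = ((norm \<tau>)\<^sup>2) ^ 6 * norm (Q2 1 u4 v4 (q_param 2 \<tau>))"
      "norm (Q2 1 u4 v4 (- q_param 2 (- 1 / \<tau>))) = ((norm \<tau>)\<^sup>2) ^ 6 * norm (Q2 1 ue ve (q_param 2 \<tau>))"
      if "Im \<tau> > 0" for \<tau>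
      using cov1(2)[OF that] cov2(2)[OF that] by (simp_all add: w_def norm_mult norm_power flip: power_mult)
    show "1 / 4 + (86 / 100)\<^sup>2 < (1 :: real)" by (simp add: power2_eq_square)
    show "real (3 * 6) * 2 < 2 * pi * real (2 * 4) * (86 / 100)" using pi_approx(1) by simp
  qed (use q in auto)
qed

end

section \<open>Level 1\<close>

locale weight_6_series = weight_4_series +
  fixes \<beta> :: complex and s :: "complex \<Rightarrow> complex"
  assumes s_holomorphic: "s holomorphic_on ball 0 1"
    and eisenstein_6: "\<And>\<tau> q. Im \<tau> > 0 \<Longrightarrow> q = exp (2 * of_real pi * \<i> * \<tau>) \<Longrightarrow>
       eisenstein 6 \<tau> = 1 + \<beta> * (q + 33 * q ^ 2 + 244 * q ^ 3 + 1057 * q ^ 4) + q ^ 5 * s q"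
begin

definition \<psi> :: "complex \<Rightarrow> complex" where
  "\<psi> q = 1 + \<beta> * (q + 33 * q ^ 2 + 244 * q ^ 3 + 1057 * q ^ 4) + q ^ 5 * s q"

lemma eisenstein_\<psi>: "Im \<tau> > 0 \<Longrightarrow> eisenstein 6 \<tau> = \<psi> (q_param 1 \<tau>)"
  using eisenstein_6[OF _ refl] by (simp add: \<psi>_def q_param_def)

lemma \<psi>_invert: "Im w > 0 \<Longrightarrow> \<psi> (q_param 1 (- 1 / w)) = w ^ 6 * \<psi> (q_param 1 w)"
  using eisenstein_invert[of w 6] Im_fricke_pos[of 1 w] by (simp add: eisenstein_\<psi>)

text \<open>First and second Rankin-Cohen brackets of weight 12, combined with
  \<open>\<phi>^3 - \<psi>^2\<close> so that the coefficient of \<open>q\<close> cancels. That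
  coefficient is \<open>720 - 2 \<beta>\<close> for the first bracket and for
  \<open>\<phi>^3 - \<psi>^2\<close>, and 960 for the second bracket.\<close>

definition "K1 q = 3 * (\<psi> q * theta \<phi> q) - 2 * (\<phi> q * theta \<psi> q) - (\<phi> q * (\<phi> q * \<phi> q) - \<psi> q * \<psi> q)"
definition "K2 q = (720 - 2 * \<beta>) * (4 * (\<phi> q * theta (theta \<phi>) q) - 5 * (theta \<phi> q * theta \<phi> q))
  - 960 * (\<phi> q * (\<phi> q * \<phi> q) - \<psi> q * \<psi> q)"

lemma \<phi>_expands: "expands \<phi> 240 2160 6720 17520"
  unfolding expands_def \<phi>_def using r_holomorphic \<alpha>_eq by (intro exI[of _ r]) (auto simp: algebra_simps)

lemma \<psi>_expands: "expands \<psi> \<beta> (33 * \<beta>) (244 * \<beta>) (1057 * \<beta>)"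
  unfolding expands_def \<psi>_def using s_holomorphic by (intro exI[of _ s]) (auto simp: algebra_simps)

text \<open>A zero of order 2 at the cusp already makes both forms of weight 12 vanish, whatever
  \<beta> is; their coefficients at \<open>q^2\<close> then give two equations for \<beta>.\<close>

lemma level_1:
  assumes q: "norm q < 1"
  shows "3 * \<psi> q * theta \<phi> q - 2 * \<phi> q * theta \<psi> q = \<phi> q ^ 3 - (\<psi> q)\<^sup>2"
    "4 * \<phi> q * theta (theta \<phi>) q - 5 * (theta \<phi> q)\<^sup>2 = 5 / 9 * (\<phi> q ^ 3 - (\<psi> q)\<^sup>2)"
    and \<beta>_eq: "\<beta> = - 504"
proof -
  obtain A where A: "\<phi> holomorphic_on ball 0 1" "\<phi> has_fps_expansion A" "fps_nth A 0 = 1" "fps_nth A 1 = 240"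
    "fps_nth A 2 = 2160" using expands_fps[OF \<phi>_expands] by metis
  obtain B where B: "\<psi> holomorphic_on ball 0 1" "\<psi> has_fps_expansion B" "fps_nth B 0 = 1" "fps_nth B 1 = \<beta>"
    "fps_nth B 2 = 33 * \<beta>" using expands_fps[OF \<psi>_expands] by metis
  define S1 where "S1 = fps_const 3 * (B * fps_theta A) - fps_const 2 * (A * fps_theta B) - (A * (A * A) - B * B)"
  define S2 where "S2 = fps_const (720 - 2 * \<beta>) * (fps_const 4 * (A * fps_theta (fps_theta A)) - fps_const 5 * (fps_theta A * fps_theta A))
     - fps_const 960 * (A * (A * A) - B * B)"
  have e1: "K1 has_fps_expansion S1"
    unfolding K1_def[abs_def] S1_def by (intro fps_expansion_intros A B theta_has_fps_expansion)
  have e2: "K2 has_fps_expansion S2"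
    unfolding K2_def[abs_def] S2_def by (intro fps_expansion_intros A B theta_has_fps_expansion)
  have h: "K1 holomorphic_on ball 0 1" "K2 holomorphic_on ball 0 1"
    unfolding K1_def[abs_def] K2_def[abs_def] by (intro holomorphic_intros A B theta_holomorphic)+
  have "fps_nth S1 0 = 0" "fps_nth S1 1 = 0" "fps_nth S2 0 = 0" "fps_nth S2 1 = 0"
    unfolding S1_def S2_def by (simp_all add: fps_mult_nth_small fps_theta_nth A(3-) B(3-) algebra_simps del: One_nat_def)
  hence ord: "fps_nth S1 i = 0" "fps_nth S2 i = 0" if "i < 2" for i using less_2_cases[OF that] by auto
  define w :: "complex \<Rightarrow> complex" where "w = (\<lambda>\<tau>. - 1 / \<tau>)"
  have w: "Im (w \<tau>) > 0" "(w has_field_derivative 1 / \<tau>\<^sup>2) (at \<tau>)" if "Im \<tau> > 0" for \<tau>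
    using Im_fricke_pos[of 1 \<tau>] fricke_has_field_derivative[of 1 \<tau>] that by (simp_all add: w_def)
  define d where "d = 2 * of_real pi * \<i> / of_nat 1"
  have d: "d \<noteq> 0" by (simp add: d_def)
  have law: "\<phi> (q_param 1 (w \<tau>)) = \<tau> ^ 4 * \<phi> (q_param 1 \<tau>)" "\<psi> (q_param 1 (w \<tau>)) = \<tau> ^ 6 * \<psi> (q_param 1 \<tau>)"
    if "Im \<tau> > 0" for \<tau> using \<phi>_invert'[OF that] \<psi>_invert[OF that] by (simp_all add: w_def)
  have cov: "K1 (q_param 1 (w \<tau>)) = \<tau> ^ 12 * K1 (q_param 1 \<tau>)" "K2 (q_param 1 (w \<tau>)) = \<tau> ^ 12 * K2 (q_param 1 \<tau>)"
    if \<tau>: "Im \<tau> > 0" for \<tau>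
  proof -
    have "1 * (d * theta \<phi> (q_param 1 (w \<tau>))) = 1 * (4 * \<tau> ^ 5 * \<phi> (q_param 1 \<tau>) + \<tau> ^ 6 * (d * theta \<phi> (q_param 1 \<tau>)))"
      "1\<^sup>2 * (d\<^sup>2 * theta (theta \<phi>) (q_param 1 (w \<tau>))) =
       1 * (20 * \<tau> ^ 6 * \<phi> (q_param 1 \<tau>) + 10 * \<tau> ^ 7 * (d * theta \<phi> (q_param 1 \<tau>)) + \<tau> ^ 8 * (d\<^sup>2 * theta (theta \<phi>) (q_param 1 \<tau>)))"
      unfolding d_def by (rule weight4_derivs[OF w A(1) A(1) _ _ \<tau>]; simp add: law del: One_nat_def)+
    moreover have "1 * (d * theta \<psi> (q_param 1 (w \<tau>))) =
        1 * (of_nat 6 * \<tau> ^ (6 + 1) * \<psi> (q_param 1 \<tau>) + \<tau> ^ (6 + 2) * (d * theta \<psi> (q_param 1 \<tau>)))"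
      unfolding d_def
      by (rule weight_derivs[OF w, where F = "\<lambda>\<tau>. \<psi> (q_param 1 \<tau>)" and G = "\<lambda>\<tau>. \<psi> (q_param 1 \<tau>)"
            and ?F1.0 = "\<lambda>\<tau>. 2 * of_real pi * \<i> / of_nat 1 * theta \<psi> (q_param 1 \<tau>)"
            and ?G1.0 = "\<lambda>\<tau>. 2 * of_real pi * \<i> / of_nat 1 * theta \<psi> (q_param 1 \<tau>)"])
         (use q_param_deriv[OF B(1) zero_less_one] law \<tau> in auto)
    ultimately have t: "theta \<phi> (q_param 1 (w \<tau>)) = 4 * \<tau> ^ 5 * \<phi> (q_param 1 \<tau>) / d + \<tau> ^ 6 * theta \<phi> (q_param 1 \<tau>)"
      "theta (theta \<phi>) (q_param 1 (w \<tau>)) = 20 * \<tau> ^ 6 * \<phi> (q_param 1 \<tau>) / d\<^sup>2 + 10 * \<tau> ^ 7 * theta \<phi> (q_param 1 \<tau>) / d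
         + \<tau> ^ 8 * theta (theta \<phi>) (q_param 1 \<tau>)"
      "theta \<psi> (q_param 1 (w \<tau>)) = 6 * \<tau> ^ 7 * \<psi> (q_param 1 \<tau>) / d + \<tau> ^ 8 * theta \<psi> (q_param 1 \<tau>)"
      using d by (simp_all add: field_simps power2_eq_square)
    show "K1 (q_param 1 (w \<tau>)) = \<tau> ^ 12 * K1 (q_param 1 \<tau>)" "K2 (q_param 1 (w \<tau>)) = \<tau> ^ 12 * K2 (q_param 1 \<tau>)"
      unfolding K1_def K2_def t law[OF \<tau>] using d by (simp_all add: field_simps eval_nat_numeral)
  qed
  have zero: "K1 q = 0 \<and> K2 q = 0" if "norm q < 1" for q
  proof
    show "K1 q = 0"
    proof (rule form_vanishes[OF h(1) e1 ord(1), where N = 1 and \<kappa> = 6 and ?y0.0 = "86/100"])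
      show "norm (K1 (q_param 1 (- 1 / (of_real 1 * \<tau>)))) = (1 * (norm \<tau>)\<^sup>2) ^ 6 * norm (K1 (q_param 1 \<tau>))" if "Im \<tau> > 0" for \<tau>
        using cov(1)[OF that] by (simp add: w_def norm_mult norm_power flip: power_mult)
      show "1 * (1 / 4 + (86 / 100)\<^sup>2) < (1 :: real)" by (simp add: power2_eq_square)
      show "real 6 < 2 * pi * real 2 * (86 / 100)" using pi_approx(1) by simp
    qed (use that in auto)
    show "K2 q = 0"
    proof (rule form_vanishes[OF h(2) e2 ord(2), where N = 1 and \<kappa> = 6 and ?y0.0 = "86/100"])
      show "norm (K2 (q_param 1 (- 1 / (of_real 1 * \<tau>)))) = (1 * (norm \<tau>)\<^sup>2) ^ 6 * norm (K2 (q_param 1 \<tau>))" if "Im \<tau> > 0" for \<tau>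
        using cov(2)[OF that] by (simp add: w_def norm_mult norm_power flip: power_mult)
      show "1 * (1 / 4 + (86 / 100)\<^sup>2) < (1 :: real)" by (simp add: power2_eq_square)
      show "real 6 < 2 * pi * real 2 * (86 / 100)" using pi_approx(1) by simp
    qed (use that in auto)
  qed
  have ev: "\<forall>\<^sub>F q in nhds 0. K1 q = 0" "\<forall>\<^sub>F q in nhds 0. K2 q = 0"
  proof -
    have "\<forall>\<^sub>F q in nhds 0. q \<in> ball (0::complex) 1" by (intro eventually_nhds_in_open) auto
    thus "\<forall>\<^sub>F q in nhds 0. K1 q = 0" "\<forall>\<^sub>F q in nhds 0. K2 q = 0" by (eventually_elim, simp add: zero)+
  qed
  have "S1 = 0" "S2 = 0"
    using fps_expansion_unique_complex[OF e1, of 0] fps_expansion_unique_complex[OF e2, of 0] ev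
    by (simp_all add: has_fps_expansion_0_iff)
  hence "fps_nth S1 2 = 0" "fps_nth S2 2 = 0" by simp_all
  hence "\<beta> * \<beta> + 174 * \<beta> - 166320 = 0" "960 * (\<beta> * \<beta> + 114 * \<beta> - 196560) = 0"
    unfolding S1_def S2_def
    by (simp_all add: fps_mult_nth_small fps_theta_nth A(3-) B(3-) algebra_simps del: One_nat_def)
  hence eqs: "\<beta> * \<beta> + 174 * \<beta> - 166320 = 0" "\<beta> * \<beta> + 114 * \<beta> - 196560 = 0"
    by (metis mult_eq_0_iff zero_neq_numeral)+
  \<comment> \<open>The other roots of the two quadratics are 330 and 390; their difference isolates
    the common root -504.\<close>
  have "60 * (\<beta> + 504) = (\<beta> * \<beta> + 174 * \<beta> - 166320) - (\<beta> * \<beta> + 114 * \<beta> - 196560)" by (simp add: algebra_simps)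
  also have "\<dots> = 0" unfolding eqs by simp
  finally show \<beta>: "\<beta> = - 504" by (simp add: add_eq_0_iff2)
  show "3 * \<psi> q * theta \<phi> q - 2 * \<phi> q * theta \<psi> q = \<phi> q ^ 3 - (\<psi> q)\<^sup>2"
    using zero[OF q] unfolding K1_def by (simp add: power2_eq_square power3_eq_cube algebra_simps)
  have c: "720 - 2 * \<beta> = 1728" using \<beta> by simp
  define X Y where "X = 4 * \<phi> q * theta (theta \<phi>) q - 5 * (theta \<phi> q)\<^sup>2" and "Y = \<phi> q ^ 3 - (\<psi> q)\<^sup>2"
  have "1728 * X = 960 * Y"
    using zero[OF q] unfolding K2_def c X_def Y_def by (simp add: power2_eq_square power3_eq_cube algebra_simps)
  hence "X = 5 / 9 * Y" by (simp add: field_simps)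
  thus "4 * \<phi> q * theta (theta \<phi>) q - 5 * (theta \<phi> q)\<^sup>2 = 5 / 9 * (\<phi> q ^ 3 - (\<psi> q)\<^sup>2)"
    by (simp only: X_def Y_def)
qed

end

section \<open>Uniformization near the cusp\<close>

lemma theta_cong:
  assumes "open B" "q \<in> B" "\<And>z. z \<in> B \<Longrightarrow> f z = g z"
  shows "theta f q = theta g q"
proof -
  have "\<forall>\<^sub>F z in nhds q. z \<in> B" by (rule eventually_nhds_in_open[OF assms(1,2)])
  hence "\<forall>\<^sub>F z in nhds q. f z = g z" by eventually_elim (rule assms(3))
  thus ?thesis by (simp add: theta_def deriv_cong_ev)
qed

lemma theta_eqI: "(f has_field_derivative f') (at q) \<Longrightarrow> theta f q = q * f'"
  by (simp add: theta_def DERIV_imp_deriv)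

text \<open>At order \<open>n\<close> the left side contributes \<open>n^2\<close> times the
  coefficient of the difference of two solutions, and the right side only earlier coefficients
  because \<open>C\<close> has no constant term. The double exponent 0 thus leaves one power series
  for each constant term.\<close>

lemma regular_singular_unique:
  assumes W: "fps_nth W 0 = 1" and C: "fps_nth C 0 = 0"
    and eqs: "fps_theta (W * fps_theta Y) = C * Y" "fps_theta (W * fps_theta Z) = C * Z"
    and "fps_nth Y 0 = fps_nth Z 0"
  shows "Y = Z"
proof -
  define D where "D = Y - Z"
  have eq: "fps_theta (W * fps_theta D) = C * D"
    using eqs by (simp add: D_def fps_theta_def algebra_simps)
  have "fps_nth D n = 0" for n
  proof (induction n rule: less_induct)
    case (less n)
    show ?case
    proof (cases "n = 0")
      case True thus ?thesis using assms by (simp add: D_def)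
    next
      case False
      have "fps_nth (W * fps_theta D) n = (\<Sum>i=0..n. fps_nth W i * (of_nat (n - i) * fps_nth D (n - i)))"
        by (simp add: fps_mult_nth fps_theta_nth)
      also have "\<dots> = (\<Sum>i\<in>{0}. fps_nth W i * (of_nat (n - i) * fps_nth D (n - i)))"
        by (rule sum.mono_neutral_right) (use less in auto)
      finally have 1: "fps_nth (W * fps_theta D) n = of_nat n * fps_nth D n" using W by simp
      have "fps_nth (C * D) n = (\<Sum>i=0..n. fps_nth C i * fps_nth D (n - i))" by (simp add: fps_mult_nth)
      also have "\<dots> = (\<Sum>i\<in>{0}. fps_nth C i * fps_nth D (n - i))"
        by (rule sum.mono_neutral_right) (use less in auto)
      finally have 2: "fps_nth (C * D) n = 0" using C by simp
      have "of_nat n * (of_nat n * fps_nth D n) = 0"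
        using arg_cong[OF eq, of "\<lambda>F. fps_nth F n"] unfolding fps_theta_nth 1 2 .
      thus ?thesis using False by simp
    qed
  qed
  hence "D = 0" by (simp add: fps_eq_iff)
  thus ?thesis by (simp add: D_def)
qed

lemma simple_zero_factor:
  assumes T: "T holomorphic_on ball 0 \<rho>" "\<rho> > 0" "T 0 = 0" "deriv T 0 \<noteq> 0"
  obtains T1 where "T1 holomorphic_on ball 0 \<rho>" "T1 0 = deriv T 0" "\<And>q. q \<in> ball 0 \<rho> \<Longrightarrow> T q = q * T1 q"
proof -
  define T1 where "T1 = (\<lambda>z. if z = 0 then deriv T 0 else (T z - T 0) / (z - 0))"
  have "T1 holomorphic_on ball 0 \<rho>"
    unfolding T1_def by (rule pole_lemma[OF T(1)]) (use T in \<open>auto simp: interior_open\<close>)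
  thus ?thesis by (rule that) (auto simp: T1_def T)
qed

context gauss_hypergeometric
begin

text \<open>Let \<open>A\<close> be the fourth root of \<open>U\<close> and \<open>S\<close> the
  quotient \<open>\<theta> T / (T A^2)\<close>, a square root of \<open>1 - T\<close> by the
  first-order identity. With \<open>W = 1 / A^2\<close>, both \<open>A\<close> and
  \<open>f0 (T q)\<close> satisfy \<open>\<theta> (W \<theta> Y) = a b T A^2 Y\<close> and have
  constant term 1, so they agree. The claim is \<open>\<theta> T = T S A^2\<close> with
  \<open>S\<close> and \<open>A\<close> rewritten in terms of \<open>T\<close>.\<close>

lemma local_uniformization:
  assumes ab: "a + b = 1 / 2" and \<rho>: "\<rho> > 0"
    and U: "U holomorphic_on ball 0 \<rho>" "U 0 = 1"
    and T: "T holomorphic_on ball 0 \<rho>" "T 0 = 0" "deriv T 0 \<noteq> 0"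
    and first_order: "\<And>q. q \<in> ball 0 \<rho> \<Longrightarrow> (theta T q)\<^sup>2 = (T q)\<^sup>2 * U q * (1 - T q)"
    and second_order: "\<And>q. q \<in> ball 0 \<rho> \<Longrightarrow>
        4 * U q * theta (theta U) q - 5 * (theta U q)\<^sup>2 = 16 * (a * b) * T q * U q ^ 3"
  shows "\<forall>\<^sub>F q in at 0. theta T q = T q * (f0 (T q) * (1 - T q) powr \<sigma>)\<^sup>2"
proof -
  obtain T1 where T1: "T1 holomorphic_on ball 0 \<rho>" "T1 0 = deriv T 0" "\<And>q. q \<in> ball 0 \<rho> \<Longrightarrow> T q = q * T1 q"
    using simple_zero_factor[OF T(1) \<rho> T(2,3)] by blast
  have cont: "isCont f 0" if "f holomorphic_on ball 0 \<rho>" for f :: "complex \<Rightarrow> complex"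
    using that \<rho> holomorphic_on_imp_continuous_on[OF that] by (simp add: continuous_on_eq_continuous_at)
  have dT: "deriv T holomorphic_on ball 0 \<rho>" by (intro holomorphic_deriv T) auto
  have ev: "\<forall>\<^sub>F q in nhds 0. norm (f q - f 0) < e" if "isCont f 0" "e > 0" for f :: "complex \<Rightarrow> complex" and e
    using that unfolding continuous_at_eps_delta eventually_nhds_metric by (auto simp: dist_norm)
  have "\<forall>\<^sub>F q in nhds 0. norm (U q - 1) < 1 / 2 \<and> norm (T q - 0) < 1 / 2 \<and> norm (T1 q - T1 0) < norm (deriv T 0)
      \<and> q \<in> ball 0 \<rho>"
    using ev[OF cont[OF U(1)], of "1/2"] ev[OF cont[OF T(1)], of "1/2"] ev[OF cont[OF T1(1)], of "norm (deriv T 0)"]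
      eventually_nhds_in_open[OF open_ball, of 0 0 \<rho>] \<rho> T U
    unfolding eventually_conj_iff by (simp del: mem_ball mem_ball_0)
  then obtain e where e: "e > 0" "\<And>q. norm q < e \<Longrightarrow> norm (U q - 1) < 1 / 2 \<and> norm (T q - 0) < 1 / 2 \<and>
      norm (T1 q - T1 0) < norm (deriv T 0) \<and> q \<in> ball 0 \<rho>"
    unfolding eventually_nhds_metric by auto
  define B where "B = ball (0 :: complex) e"
  have B: "open B" "0 \<in> B" "B \<subseteq> ball 0 \<rho>" using e by (auto simp: B_def)
  have UB: "U holomorphic_on B" and TB: "T holomorphic_on B" and T1B: "T1 holomorphic_on B" and dTB: "deriv T holomorphic_on B"
    using U(1) T(1) T1(1) dT B(3) by (auto intro: holomorphic_on_subset)
  have Tn: "norm (T q) < 1" if "q \<in> B" for q using e(2)[of q] that by (simp add: B_def)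
  have T1n: "T1 q \<noteq> 0" if "q \<in> B" for q using e(2)[of q] that T1(2) by (auto simp: B_def)
  have Un: "U q \<notin> \<real>\<^sub>\<le>\<^sub>0" if "q \<in> B" for q
  proof -
    have "\<bar>Re (U q - 1)\<bar> < 1 / 2" using e(2)[of q] that abs_Re_le_cmod[of "U q - 1"] by (simp add: B_def)
    hence "Re (U q) > 0" unfolding abs_less_iff by simp
    thus ?thesis by (simp add: complex_nonpos_Reals_iff)
  qed
  define A where "A = (\<lambda>q. exp (Ln (U q) / 4))"
  have AB: "A holomorphic_on B"
    unfolding A_def by (intro holomorphic_intros UB) (use Un in auto)
  have An: "A q \<noteq> 0" for q by (simp add: A_def)
  have A4: "A q ^ 4 = U q" if "q \<in> B" for q
  proof -
    have "U q \<noteq> 0" using Un[OF that] by auto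
    thus ?thesis by (simp add: A_def exp_of_nat_mult[symmetric])
  qed
  have A0: "A 0 = 1" by (simp add: A_def U)
  \<comment> \<open>Cancelling \<open>q\<close> in \<open>\<theta> T / (T A^2)\<close> makes the
    quotient holomorphic at 0, with value 1.\<close>
  define S where "S = (\<lambda>q. deriv T q / (T1 q * (A q)\<^sup>2))"
  have SB: "S holomorphic_on B"
    unfolding S_def by (intro holomorphic_intros dTB T1B AB) (use An T1n in auto)
  have S0: "S 0 = 1" using T1(2) T(3) by (simp add: S_def A0)
  have thT: "theta T q = T q * S q * (A q)\<^sup>2" if "q \<in> B" for q
    using T1(3)[of q] T1n[OF that] An[of q] that B(3) by (auto simp: theta_def S_def)
  have S2: "(S q)\<^sup>2 = 1 - T q" if q: "q \<in> B" for q
  proof (cases "q = 0")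
    case True thus ?thesis by (simp add: S0 T)
  next
    case False
    have "T q \<noteq> 0" using T1(3)[of q] T1n[OF q] q B(3) False by auto
    moreover have "(T q * S q * (A q)\<^sup>2)\<^sup>2 = (T q)\<^sup>2 * A q ^ 4 * (1 - T q)"
      using first_order[of q] q B(3) thT[OF q] A4[OF q] by auto
    hence "((T q)\<^sup>2 * A q ^ 4) * (S q)\<^sup>2 = ((T q)\<^sup>2 * A q ^ 4) * (1 - T q)"
      by (simp add: power_mult_distrib mult_ac flip: power_mult)
    ultimately show ?thesis using An[of q] by simp
  qed
  have Sn: "S q \<noteq> 0" if "q \<in> B" for q
  proof
    assume "S q = 0"
    hence "T q = 1" using S2[OF that] by simp
    thus False using Tn[OF that] by simp
  qed
  have thA: "theta A holomorphic_on B"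
    unfolding theta_def[abs_def] by (intro holomorphic_intros AB B)
  have dA: "(A has_field_derivative deriv A q) (at q)" "(theta A has_field_derivative deriv (theta A) q) (at q)" if "q \<in> B" for q
    by (intro holomorphic_derivI[OF AB B(1) that] holomorphic_derivI[OF thA B(1) that])+
  have thU: "theta U q = 4 * A q ^ 3 * theta A q" if q: "q \<in> B" for q
  proof -
    have "theta U q = theta (\<lambda>q. A q ^ 4) q" by (rule theta_cong[OF B(1) q]) (simp add: A4)
    also have "\<dots> = q * (4 * A q ^ 3 * deriv A q)"
      by (rule theta_eqI) (auto intro!: derivative_eq_intros dA q)
    also have "\<dots> = 4 * A q ^ 3 * theta A q" by (simp only: theta_def mult_ac)
    finally show ?thesis .
  qed
  have thU2: "theta (theta U) q = 12 * (A q)\<^sup>2 * (theta A q)\<^sup>2 + 4 * A q ^ 3 * theta (theta A) q" if q: "q \<in> B" for q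
  proof -
    have "theta (theta U) q = theta (\<lambda>q. 4 * A q ^ 3 * theta A q) q" by (rule theta_cong[OF B(1) q]) (simp add: thU)
    also have "\<dots> = q * (4 * (3 * (A q)\<^sup>2 * deriv A q) * theta A q + 4 * A q ^ 3 * deriv (theta A) q)"
      by (rule theta_eqI) (auto intro!: derivative_eq_intros dA q)
    finally show ?thesis by (simp add: theta_def power2_eq_square algebra_simps)
  qed
  define W where "W = (\<lambda>q. 1 / (A q)\<^sup>2)"
  have WB: "W holomorphic_on B" unfolding W_def by (intro holomorphic_intros AB) (simp add: An)
  have eqA: "theta (\<lambda>q. W q * theta A q) q = a * b * T q * (A q)\<^sup>2 * A q" if q: "q \<in> B" for q
  proof -
    have "theta (\<lambda>q. W q * theta A q) q = q * (- 2 * deriv A q / A q ^ 3 * theta A q + deriv (theta A) q / (A q)\<^sup>2)"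
      unfolding W_def by (rule theta_eqI)
        (auto intro!: derivative_eq_intros dA q simp: An field_simps eval_nat_numeral)
    also have "\<dots> = (A q * theta (theta A) q - 2 * (theta A q)\<^sup>2) / A q ^ 3"
      using An[of q] by (simp add: theta_def field_simps eval_nat_numeral)
    finally have 1: "theta (\<lambda>q. W q * theta A q) q = (A q * theta (theta A) q - 2 * (theta A q)\<^sup>2) / A q ^ 3" .
    \<comment> \<open>With \<open>U = A^4\<close> the left side of the second-order identity becomes
      \<open>16 A^6 (A \<theta>^2 A - 2 (\<theta> A)^2)\<close>.\<close>
    have "4 * A q ^ 4 * (12 * (A q)\<^sup>2 * (theta A q)\<^sup>2 + 4 * A q ^ 3 * theta (theta A) q) - 5 * (4 * A q ^ 3 * theta A q)\<^sup>2
        = 16 * (a * b) * T q * (A q ^ 4) ^ 3"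
      using second_order[of q] q B(3) unfolding thU[OF q] thU2[OF q] A4[OF q] by auto
    hence "(16 * A q ^ 6) * (A q * theta (theta A) q - 2 * (theta A q)\<^sup>2) = (16 * A q ^ 6) * (a * b * T q * A q ^ 6)"
      by (simp add: algebra_simps eval_nat_numeral)
    hence "A q * theta (theta A) q - 2 * (theta A q)\<^sup>2 = a * b * T q * A q ^ 6" using An[of q] by simp
    thus ?thesis unfolding 1 using An[of q] by (simp add: field_simps eval_nat_numeral)
  qed
  define F where "F = (\<lambda>q. f0 (T q))"
  have dT': "(T has_field_derivative deriv T q) (at q)" if "q \<in> B" for q by (rule holomorphic_derivI[OF TB B(1) that])
  have dS: "(S has_field_derivative deriv S q) (at q)" if "q \<in> B" for q by (rule holomorphic_derivI[OF SB B(1) that])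
  have FB: "F holomorphic_on B"
  proof -
    have "f0 \<circ> T holomorphic_on B"
      by (rule holomorphic_on_compose_gen[OF TB f_holomorphic]) (use Tn in auto)
    thus ?thesis by (simp add: F_def o_def)
  qed
  have thF: "theta F q = f1 (T q) * theta T q" if q: "q \<in> B" for q
  proof -
    have "(F has_field_derivative f1 (T q) * deriv T q) (at q)"
      unfolding F_def by (rule DERIV_chain2[OF f_derivs(1)[OF Tn[OF q]] dT'[OF q]])
    from theta_eqI[OF this] show ?thesis by (simp only: theta_def mult_ac)
  qed
  have thS: "2 * theta S q = - T q * (A q)\<^sup>2" if q: "q \<in> B" for q
  proof -
    have "theta (\<lambda>q. (S q)\<^sup>2) q = theta (\<lambda>q. 1 - T q) q" by (rule theta_cong[OF B(1) q]) (simp add: S2)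
    moreover have "theta (\<lambda>q. (S q)\<^sup>2) q = q * (2 * S q * deriv S q)"
      by (rule theta_eqI) (auto intro!: derivative_eq_intros dS q)
    moreover have "theta (\<lambda>q. 1 - T q) q = q * (- deriv T q)"
      by (rule theta_eqI) (auto intro!: derivative_eq_intros dT' q)
    ultimately have "q * (2 * S q * deriv S q) = q * (- deriv T q)" by simp
    hence "S q * (2 * theta S q) = - theta T q" by (simp only: theta_def mult_ac mult_minus_right)
    also have "\<dots> = S q * (- T q * (A q)\<^sup>2)" by (simp add: thT[OF q])
    finally show ?thesis using Sn[OF q] by (metis mult_left_cancel)
  qed
  have eqF: "theta (\<lambda>q. W q * theta F q) q = a * b * T q * (A q)\<^sup>2 * F q" if q: "q \<in> B" for q
  proof -
    have "theta (\<lambda>q. W q * theta F q) q = theta (\<lambda>q. f1 (T q) * (T q * S q)) q"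
      by (rule theta_cong[OF B(1) q]) (simp add: W_def thF thT An)
    also have "\<dots> = q * (f2 (T q) * deriv T q * (T q * S q) + f1 (T q) * (deriv T q * S q + T q * deriv S q))"
      by (rule theta_eqI)
         (auto intro!: derivative_eq_intros DERIV_chain2[OF f_derivs(2)[OF Tn[OF q]] dT'[OF q]] dT' dS q)
    also have "\<dots> = f2 (T q) * theta T q * (T q * S q) + f1 (T q) * (theta T q * S q + T q * theta S q)"
      by (simp add: theta_def algebra_simps)
    also have "theta S q = - T q * (A q)\<^sup>2 / 2" using thS[OF q] by (simp add: field_simps)
    also have "f2 (T q) * theta T q * (T q * S q) + f1 (T q) * (theta T q * S q + T q * (- T q * (A q)\<^sup>2 / 2)) =
        (A q)\<^sup>2 * T q * (T q * (S q)\<^sup>2 * f2 (T q) + ((S q)\<^sup>2 - T q / 2) * f1 (T q))"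
      unfolding thT[OF q] by (simp add: algebra_simps power2_eq_square)
    \<comment> \<open>Here \<open>a + b = 1/2\<close> enters:
      \<open>S^2 - T / 2 = 1 - 3 T / 2\<close> is the coefficient \<open>1 - (a + b + 1) T\<close>
      of Gauss's equation.\<close>
    also have "\<dots> = (A q)\<^sup>2 * T q * (T q * (1 - T q) * f2 (T q) + (1 - (a + b + 1) * T q) * f1 (T q))"
      unfolding S2[OF q] ab by (simp add: algebra_simps)
    also have "T q * (1 - T q) * f2 (T q) + (1 - (a + b + 1) * T q) * f1 (T q) = a * b * f0 (T q)"
      using f_ode[OF Tn[OF q]] by simp
    finally show ?thesis by (simp add: F_def mult_ac)
  qed
  define fA fF fW fT where "fA = fps_expansion A 0" and "fF = fps_expansion F 0" and "fW = fps_expansion W 0" and "fT = fps_expansion T 0"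
  have ex: "A has_fps_expansion fA" "F has_fps_expansion fF" "W has_fps_expansion fW" "T has_fps_expansion fT"
    unfolding fA_def fF_def fW_def fT_def
    by (intro has_fps_expansion_fps_expansion[OF B(1,2)] AB FB WB TB)+
  have evB: "\<forall>\<^sub>F q in nhds 0. q \<in> B" by (rule eventually_nhds_in_open[OF B(1,2)])
  have fps_eq: "fps_theta (fW * fps_theta fY) = fps_const (a * b) * fT * (fA * fA) * fY"
    if "Y has_fps_expansion fY" "\<And>q. q \<in> B \<Longrightarrow> theta (\<lambda>q. W q * theta Y q) q = a * b * T q * (A q)\<^sup>2 * Y q" for Y fY
  proof (rule fps_expansion_unique_complex)
    show 1: "theta (\<lambda>q. W q * theta Y q) has_fps_expansion fps_theta (fW * fps_theta fY)"
      by (intro theta_has_fps_expansion fps_expansion_intros ex that)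
    have 2: "(\<lambda>q. a * b * T q * (A q * A q) * Y q) has_fps_expansion fps_const (a * b) * fT * (fA * fA) * fY"
      by (intro fps_expansion_intros ex that)
    have "\<forall>\<^sub>F q in nhds 0. a * b * T q * (A q * A q) * Y q = theta (\<lambda>q. W q * theta Y q) q"
      using evB by eventually_elim (use that(2) in \<open>simp add: power2_eq_square\<close>)
    thus "theta (\<lambda>q. W q * theta Y q) has_fps_expansion fps_const (a * b) * fT * (fA * fA) * fY"
      using 2 by (subst (asm) has_fps_expansion_cong) auto
  qed
  have z: "fps_nth fY 0 = Y 0" if "Y has_fps_expansion fY" for Y :: "complex \<Rightarrow> complex" and fY
    using fps_nth_fps_expansion[OF that, of 0] by simp
  have "f0 0 = 1"
    using z[OF f0_has_fps_expansion] by simp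
  hence "fA = fF"
    using z[OF ex(1)] z[OF ex(2)] z[OF ex(3)] z[OF ex(4)] A0 T(2)
    by (intro regular_singular_unique[OF _ _ fps_eq[OF ex(1) eqA] fps_eq[OF ex(2) eqF]])
       (simp_all add: W_def F_def)
  hence "(\<lambda>q. A q - F q) has_fps_expansion 0"
    using has_fps_expansion_diff[OF ex(1,2)] by simp
  hence AF: "\<forall>\<^sub>F q in nhds 0. A q - F q = 0" by (simp add: has_fps_expansion_0_iff)
  have "isCont S 0"
    using holomorphic_on_imp_continuous_on[OF SB] B by (simp add: continuous_on_eq_continuous_at)
  from ev[OF this, of 1] have "\<forall>\<^sub>F q in nhds 0. norm (S q - 1) < 1" by (simp add: S0)
  with evB AF have "\<forall>\<^sub>F q in nhds 0. theta T q = T q * (f0 (T q) * (1 - T q) powr \<sigma>)\<^sup>2"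
  proof eventually_elim
    case (elim q)
    have "\<bar>Re (S q - 1)\<bar> < 1" using elim(3) abs_Re_le_cmod[of "S q - 1"] by linarith
    hence "Re (S q) > 0" by simp
    hence "csqrt ((S q)\<^sup>2) = S q" by (simp add: csqrt_square)
    hence "S q = csqrt (1 - T q)" by (simp add: S2[OF elim(1)])
    \<comment> \<open>As \<open>\<sigma> = 1/4\<close>, the square of the power is the principal
      square root, and \<open>S\<close> is that root because its real part is positive.\<close>
    also have "\<dots> = ((1 - T q) powr \<sigma>)\<^sup>2"
    proof -
      have "1 - T q \<noteq> 0" using Tn[OF elim(1)] by auto
      hence "csqrt (1 - T q) = exp (Ln (1 - T q) / 2)" by (rule csqrt_exp_Ln)
      moreover have "((1 - T q) powr \<sigma>)\<^sup>2 = exp (of_nat 2 * (\<sigma> * Ln (1 - T q)))"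
        using \<open>1 - T q \<noteq> 0\<close> unfolding powr_def exp_of_nat_mult by simp
      moreover have "of_nat 2 * (\<sigma> * Ln (1 - T q)) = Ln (1 - T q) / 2" by (simp add: \<sigma>_def ab)
      ultimately show ?thesis by metis
    qed
    finally show ?case
      using thT[OF elim(1)] elim(2) by (simp add: F_def power_mult_distrib mult_ac)
  qed
  thus ?thesis by (simp add: eventually_nhds_conv_at)
qed

text \<open>The function \<open>(1 - t) powr (- a) * f (t / (t - 1))\<close>, with \<open>f\<close>
  for the parameters \<open>(a, 1 - b)\<close>, satisfies Gauss's equation for \<open>(a, b)\<close>
  and has constant term 1, so its expansion is the hypergeometric series.\<close>

lemma pfaff:
  assumes conv': "fps_conv_radius (fps_hypergeo [a, 1 - b] [1] 1) \<ge> 1"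
  shows "\<forall>\<^sub>F t in nhds 0. hyp_f a (1 - b) (t / (t - 1)) = (1 - t) powr a * hyp_f a b t"
proof -
  interpret g: gauss_hypergeometric a "1 - b" by unfold_locales (rule conv')
  define G where "G = (\<lambda>t. (1 - t) powr (- a) * g.f0 (t / (t - 1)))"
  \<comment> \<open>On this disc \<open>t / (t - 1)\<close> stays in the unit disc.\<close>
  define B where "B = ball (0 :: complex) (1 / 2)"
  have B: "open B" "0 \<in> B" by (auto simp: B_def)
  have Bt: "norm t < 1" "1 - t \<noteq> 0" "1 - t \<notin> \<real>\<^sub>\<le>\<^sub>0" "norm (t / (t - 1)) < 1" if "t \<in> B" for t
  proof -
    show 1: "norm t < 1" using that by (simp add: B_def)
    show "1 - t \<noteq> 0" "1 - t \<notin> \<real>\<^sub>\<le>\<^sub>0" using one_minus_not_nonpos[OF 1] by auto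
    have "norm (t - 1) \<ge> 1 - norm t" using norm_triangle_ineq2[of 1 t] by (simp add: norm_minus_commute)
    moreover have "norm t < 1 / 2" using that by (simp add: B_def)
    ultimately have "norm t < norm (t - 1)" "norm (t - 1) > 0" by linarith+
    thus "norm (t / (t - 1)) < 1" by (simp add: norm_divide)
  qed
  define p where "p = (\<lambda>t::complex. (1 - t) powr (- a))"
  have dp: "(p has_field_derivative a * p t / (1 - t)) (at t)" if "t \<in> B" for t
    unfolding p_def using Bt[OF that] by (auto intro!: derivative_eq_intros simp: powr_diff)
  have ds: "((\<lambda>t. t / (t - 1)) has_field_derivative - 1 / (1 - t)\<^sup>2) (at t)" if "t \<in> B" for t
  proof -
    have "t - 1 \<noteq> 0" using Bt(2)[OF that] by auto
    thus ?thesis by (auto intro!: derivative_eq_intros simp: power2_eq_square field_simps)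
  qed
  define G1 where "G1 = (\<lambda>t. a * p t / (1 - t) * g.f0 (t / (t - 1)) - p t * g.f1 (t / (t - 1)) / (1 - t)\<^sup>2)"
  define G2 where "G2 = (\<lambda>t. a * (a + 1) * p t / (1 - t)\<^sup>2 * g.f0 (t / (t - 1))
      - (2 * a + 2) * p t * g.f1 (t / (t - 1)) / (1 - t) ^ 3 + p t * g.f2 (t / (t - 1)) / (1 - t) ^ 4)"
  have d0: "((\<lambda>t. g.f0 (t / (t - 1))) has_field_derivative g.f1 (t / (t - 1)) * (- 1 / (1 - t)\<^sup>2)) (at t)"
    and d1: "((\<lambda>t. g.f1 (t / (t - 1))) has_field_derivative g.f2 (t / (t - 1)) * (- 1 / (1 - t)\<^sup>2)) (at t)" if "t \<in> B" for t
    by (rule DERIV_chain2[OF g.f_derivs(1)[OF Bt(4)[OF that]] ds[OF that]],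
        rule DERIV_chain2[OF g.f_derivs(2)[OF Bt(4)[OF that]] ds[OF that]])
  have dG: "(G has_field_derivative G1 t) (at t)" if "t \<in> B" for t
  proof -
    have "G1 t = a * p t / (1 - t) * g.f0 (t / (t - 1)) + g.f1 (t / (t - 1)) * (- 1 / (1 - t)\<^sup>2) * p t"
      by (simp add: G1_def)
    thus ?thesis unfolding G_def p_def[symmetric] using DERIV_mult[OF dp[OF that] d0[OF that]] by (simp add: p_def)
  qed
  have dG1: "(G1 has_field_derivative G2 t) (at t)" if t: "t \<in> B" for t
  proof -
    note w = Bt(2)[OF t]
    have d: "((\<lambda>t. 1 / (1 - t)) has_field_derivative 1 / (1 - t)\<^sup>2) (at t)"
      using w by (auto intro!: derivative_eq_intros simp: power2_eq_square)
    have "a * p t / (1 - t) * a * (1 / (1 - t)) + 1 / (1 - t)\<^sup>2 * (p t * a) = a * (a + 1) * p t / (1 - t)\<^sup>2"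
      by (simp add: power2_eq_square ring_distribs add_divide_distrib mult_ac)
    with DERIV_mult[OF DERIV_cmult_right[OF dp[OF t], of a] d]
    have e1: "((\<lambda>t. a * p t / (1 - t)) has_field_derivative a * (a + 1) * p t / (1 - t)\<^sup>2) (at t)"
      by (simp add: mult_ac)
    have "a * p t / (1 - t) * (1 / (1 - t) * (1 / (1 - t))) + (1 / (1 - t)\<^sup>2 * (1 / (1 - t)) + 1 / (1 - t)\<^sup>2 * (1 / (1 - t))) * p t
        = (a + 2) * p t / (1 - t) ^ 3"
      by (simp add: power2_eq_square eval_nat_numeral ring_distribs add_divide_distrib mult_ac)
    with DERIV_mult[OF dp[OF t] DERIV_mult[OF d d]]
    have e2: "((\<lambda>t. p t / (1 - t)\<^sup>2) has_field_derivative (a + 2) * p t / (1 - t) ^ 3) (at t)"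
      by (simp add: power2_eq_square)
    have G1': "G1 = (\<lambda>t. a * p t / (1 - t) * g.f0 (t / (t - 1)) - p t / (1 - t)\<^sup>2 * g.f1 (t / (t - 1)))"
      by (simp add: G1_def)
    define v where "v = 1 / (1 - t)"
    have frac: "x / (1 - t) ^ n = x * v ^ n" "x / (1 - t) = x * v" for x n
      by (simp_all add: v_def power_one_over divide_inverse power_inverse)
    have "G2 t = (a * (a + 1) * p t / (1 - t)\<^sup>2 * g.f0 (t / (t - 1)) + g.f1 (t / (t - 1)) * (- 1 / (1 - t)\<^sup>2) * (a * p t / (1 - t)))
      - ((a + 2) * p t / (1 - t) ^ 3 * g.f1 (t / (t - 1)) + g.f2 (t / (t - 1)) * (- 1 / (1 - t)\<^sup>2) * (p t / (1 - t)\<^sup>2))"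
      unfolding G2_def frac by algebra
    thus ?thesis unfolding G1'
      using DERIV_diff[OF DERIV_mult[OF e1 d0[OF t]] DERIV_mult[OF e2 d1[OF t]]] by (simp only:)
  qed
  have ode: "t * (1 - t) * G2 t + (1 - (a + b + 1) * t) * G1 t - a * b * G t = 0" if t: "t \<in> B" for t
  proof -
    define w where "w = 1 - t"
    have w: "w \<noteq> 0" and tw: "t = 1 - w" using Bt(2)[OF t] by (simp_all add: w_def)
    define F0 F1 F2 where "F0 = g.f0 (t / (t - 1))" and "F1 = g.f1 (t / (t - 1))" and "F2 = g.f2 (t / (t - 1))"
    have s: "t / (t - 1) = - t / w" by (simp add: w_def minus_divide_right)
    have "t / (t - 1) * (1 - t / (t - 1)) * F2 + (1 - (a + (1 - b) + 1) * (t / (t - 1))) * F1 - a * (1 - b) * F0 = 0"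
      using g.f_ode[OF Bt(4)[OF t]] by (simp only: F0_def F1_def F2_def)
    hence o: "- t * F2 + (w\<^sup>2 + (a + 2 - b) * t * w) * F1 - a * (1 - b) * w\<^sup>2 * F0 = 0"
      unfolding s using w by (simp add: tw divide_simps) (simp add: algebra_simps power2_eq_square)
    have G: "G t = p t * F0" by (simp add: G_def p_def F0_def)
    have G1: "w ^ 3 * G1 t = a * p t * F0 * w\<^sup>2 - p t * F1 * w"
      unfolding G1_def F0_def[symmetric] F1_def[symmetric] w_def[symmetric]
      using w by (simp add: field_simps eval_nat_numeral)
    have G2: "w ^ 4 * G2 t = a * (a + 1) * p t * F0 * w\<^sup>2 - (2 * a + 2) * p t * F1 * w + p t * F2"
      unfolding G2_def F0_def[symmetric] F1_def[symmetric] F2_def[symmetric] w_def[symmetric]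
      using w by (simp add: field_simps eval_nat_numeral)
    have "w ^ 3 * (t * w * G2 t + (1 - (a + b + 1) * t) * G1 t - a * b * G t) =
        t * (w ^ 4 * G2 t) + (1 - (a + b + 1) * t) * (w ^ 3 * G1 t) - a * b * w ^ 3 * G t"
      by (simp add: algebra_simps eval_nat_numeral)
    also have "\<dots> = - p t * (- t * F2 + (w\<^sup>2 + (a + 2 - b) * t * w) * F1 - a * (1 - b) * w\<^sup>2 * F0)"
      unfolding G G1 G2 unfolding tw by algebra
    also have "\<dots> = 0" unfolding o by simp
    finally show ?thesis using w by (simp add: w_def)
  qed
  have GB: "G holomorphic_on B"
    by (rule holomorphic_onI) (use dG in \<open>auto simp: field_differentiable_def intro: has_field_derivative_at_within\<close>)
  define fG where "fG = fps_expansion G 0"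
  have ex: "G has_fps_expansion fG" unfolding fG_def by (rule has_fps_expansion_fps_expansion[OF B GB])
  have evB: "\<forall>\<^sub>F t in nhds 0. t \<in> B" by (rule eventually_nhds_in_open[OF B])
  have der: "deriv G t = G1 t" if "t \<in> B" for t using dG[OF that] by (rule DERIV_imp_deriv)
  have der2: "deriv (deriv G) t = G2 t" if "t \<in> B" for t
  proof -
    have "deriv (deriv G) t = deriv G1 t"
      by (rule deriv_cong_ev) (use eventually_nhds_in_open[OF B(1) that] der in \<open>auto elim: eventually_mono\<close>)
    thus ?thesis using dG1[OF that] by (simp add: DERIV_imp_deriv)
  qed
  have "(\<lambda>t. t * (1 - t) * deriv (deriv G) t + (1 - (a + b + 1) * t) * deriv G t - a * b * G t) has_fps_expansion
      fps_X * (1 - fps_X) * fps_deriv (fps_deriv fG) + (1 - fps_const (a + b + 1) * fps_X) * fps_deriv fG - fps_const (a * b) * fG"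
    by (intro fps_expansion_intros ex)
  moreover have "(\<lambda>t. t * (1 - t) * deriv (deriv G) t + (1 - (a + b + 1) * t) * deriv G t - a * b * G t) has_fps_expansion 0"
    unfolding has_fps_expansion_0_iff using evB by eventually_elim (simp add: der der2 ode)
  ultimately have "hypergeometric_ode a b fG"
    unfolding hypergeometric_ode_def by (rule fps_expansion_unique_complex)
  moreover have "fps_nth fG 0 = 1"
    using fps_nth_fps_expansion[OF ex, of 0] fps_nth_fps_expansion[OF g.f0_has_fps_expansion, of 0] by (simp add: G_def)
  ultimately have "fG = fps_hypergeo [a, b] [1] 1"
    by (intro hypergeometric_ode_unique[OF _ hypergeometric_ode_fps_hypergeo]) simp_all
  hence "(\<lambda>t. G t - f0 t) has_fps_expansion 0"
    using has_fps_expansion_diff[OF ex f0_has_fps_expansion] by simp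
  hence "\<forall>\<^sub>F t in nhds 0. G t - f0 t = 0" by (simp add: has_fps_expansion_0_iff)
  with evB show ?thesis
  proof eventually_elim
    case (elim t)
    have "(1 - t) powr a * (1 - t) powr (- a) = 1"
      using Bt(2)[OF elim(1)] by (simp flip: powr_add)
    hence "g.f0 (t / (t - 1)) = (1 - t) powr a * G t" by (simp add: G_def mult.assoc[symmetric])
    thus ?case using elim(2) by (simp add: g.f0_def f0_def)
  qed
qed

end

section \<open>Moebius transformations\<close>

lemma matrix_mult_entry_2:
  fixes A B :: "real^2^2"
  shows "(A ** B) $ i $ j = A $ i $ 1 * B $ 1 $ j + A $ i $ 2 * B $ 2 $ j"
  by (simp add: matrix_matrix_mult_def sum_2)

lemma aut_factor_nonzero:
  assumes "det A = 1" "Im \<tau> > 0"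
  shows "aut_factor A \<tau> \<noteq> 0"
proof
  assume 0: "aut_factor A \<tau> = 0"
  hence "A $ 2 $ 1 * Im \<tau> = 0" by (simp add: aut_factor_def complex_eq_iff)
  hence "A $ 2 $ 1 = 0" using assms(2) by simp
  moreover from this 0 have "A $ 2 $ 2 = 0" by (simp add: aut_factor_def)
  ultimately show False using assms(1) by (simp add: det_2)
qed

lemma moebius_aut_factor: "moebius A \<tau> = (of_real (A $ 1 $ 1) * \<tau> + of_real (A $ 1 $ 2)) / aut_factor A \<tau>"
  by (simp add: moebius_def aut_factor_def)

lemma Im_moebius:
  assumes "det A = 1"
  shows "Im (moebius A \<tau>) = Im \<tau> / (norm (aut_factor A \<tau>))\<^sup>2"
proof -
  have "(A $ 1 $ 1 * Im \<tau>) * Re (aut_factor A \<tau>) - (A $ 1 $ 1 * Re \<tau> + A $ 1 $ 2) * Im (aut_factor A \<tau>) = det A * Im \<tau>"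
    by (simp add: aut_factor_def det_2 algebra_simps)
  thus ?thesis by (simp add: moebius_aut_factor Im_divide cmod_power2 assms)
qed

lemma Im_moebius_pos: "det A = 1 \<Longrightarrow> Im \<tau> > 0 \<Longrightarrow> Im (moebius A \<tau>) > 0"
  using aut_factor_nonzero[of A \<tau>] by (simp add: Im_moebius)

lemma moebius_mult:
  assumes "det B = 1" "Im \<tau> > 0"
  shows "moebius A (moebius B \<tau>) = moebius (A ** B) \<tau>"
proof -
  define j n where "j = aut_factor B \<tau>" and "n = of_real (B $ 1 $ 1) * \<tau> + of_real (B $ 1 $ 2)"
  have j: "j \<noteq> 0" using aut_factor_nonzero[OF assms] by (simp add: j_def)
  have "moebius A (moebius B \<tau>) = moebius A (n / j)" by (simp add: moebius_aut_factor[of B] j_def n_def)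
  also have "\<dots> = (of_real (A $ 1 $ 1) * n + of_real (A $ 1 $ 2) * j) / (of_real (A $ 2 $ 1) * n + of_real (A $ 2 $ 2) * j)"
  proof -
    have "x * (n / j) + y = (x * n + y * j) / j" for x y using j by (simp add: field_simps)
    thus ?thesis using j by (simp add: moebius_def)
  qed
  also have "\<dots> = moebius (A ** B) \<tau>"
    by (simp add: moebius_def matrix_mult_entry_2 j_def n_def aut_factor_def algebra_simps)
  finally show ?thesis .
qed

lemma moebius_mat_1: "moebius (mat 1) \<tau> = \<tau>"
  by (simp add: moebius_def mat_def)

lemma SL2R_group: "group SL2R"
proof (rule groupI)
  show "\<exists>B\<in>carrier SL2R. B \<otimes>\<^bsub>SL2R\<^esub> A = \<one>\<^bsub>SL2R\<^esub>" if "A \<in> carrier SL2R" for A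
  proof
    define B :: "real^2^2" where "B = vector [vector [A $ 2 $ 2, - A $ 1 $ 2], vector [- A $ 2 $ 1, A $ 1 $ 1]]"
    have A: "A $ 1 $ 1 * A $ 2 $ 2 - A $ 1 $ 2 * A $ 2 $ 1 = 1" using that by (simp add: SL2R_def det_2)
    thus "B \<otimes>\<^bsub>SL2R\<^esub> A = \<one>\<^bsub>SL2R\<^esub>" "B \<in> carrier SL2R"
      by (simp_all add: SL2R_def det_2 B_def vec_eq_iff forall_2 matrix_mult_entry_2 mat_def algebra_simps)
  qed
qed (auto simp: SL2R_def det_mul matrix_mul_assoc)

lemma det_atkin_lehner: "N > 0 \<Longrightarrow> det (atkin_lehner N) = 1"
  by (simp add: atkin_lehner_def det_2)

lemma det_Gamma0_star:
  assumes "N > 0" "\<gamma> \<in> Gamma0_star N"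
  shows "det \<gamma> = 1"
proof -
  have "insert (atkin_lehner N) (Gamma0 N) \<subseteq> carrier SL2R"
    using det_atkin_lehner[OF assms(1)] by (auto simp: SL2R_def Gamma0_def)
  from group.generate_in_carrier[OF SL2R_group this] assms(2)
  show ?thesis by (simp add: Gamma0_star_def SL2R_def)
qed

text \<open>Since the factor \<open>c\<close> may depend on \<tau>, the property passes to products
  and inverses with no cocycle condition to check, and the generators decide.\<close>

lemma Gamma0_star_projective:
  assumes N: "N > 0"
    and gen: "\<And>\<gamma> \<tau>. \<gamma> \<in> insert (atkin_lehner N) (Gamma0 N) \<Longrightarrow> Im \<tau> > 0 \<Longrightarrow>
      \<exists>c. c \<noteq> 0 \<and> A (moebius \<gamma> \<tau>) = c * A \<tau> \<and> B (moebius \<gamma> \<tau>) = c * (B \<tau> :: complex)"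
    and \<gamma>: "\<gamma> \<in> Gamma0_star N" and \<tau>: "Im \<tau> > 0"
  shows "\<exists>c. c \<noteq> 0 \<and> A (moebius \<gamma> \<tau>) = c * A \<tau> \<and> B (moebius \<gamma> \<tau>) = c * B \<tau>"
proof -
  interpret group SL2R by (rule SL2R_group)
  have gens: "insert (atkin_lehner N) (Gamma0 N) \<subseteq> carrier SL2R"
    using det_atkin_lehner[OF N] by (auto simp: SL2R_def Gamma0_def)
  have "\<forall>\<tau>. Im \<tau> > 0 \<longrightarrow> (\<exists>c. c \<noteq> 0 \<and> A (moebius \<gamma> \<tau>) = c * A \<tau> \<and> B (moebius \<gamma> \<tau>) = c * B \<tau>)"
    using \<gamma> unfolding Gamma0_star_def
  proof (induction rule: generate.induct)
    case one
    show ?case by (auto simp: SL2R_def moebius_mat_1 intro!: exI[of _ 1])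
  next
    case (incl h)
    thus ?case using gen by simp
  next
    case (inv h)
    hence h: "h \<in> carrier SL2R" using gens by auto
    hence h': "inv\<^bsub>SL2R\<^esub> h \<in> carrier SL2R" by simp
    hence d: "det (inv\<^bsub>SL2R\<^esub> h) = 1" by (simp add: SL2R_def)
    have hh: "h ** inv\<^bsub>SL2R\<^esub> h = mat 1" using r_inv[OF h] by (simp add: SL2R_def)
    show ?case
    proof (intro allI impI)
      fix \<tau> :: complex assume \<tau>: "Im \<tau> > 0"
      define w where "w = moebius (inv\<^bsub>SL2R\<^esub> h) \<tau>"
      have w: "Im w > 0" unfolding w_def by (rule Im_moebius_pos[OF d \<tau>])
      have hw: "moebius h w = \<tau>" unfolding w_def moebius_mult[OF d \<tau>] hh by (rule moebius_mat_1)
      obtain c where "c \<noteq> 0" "A \<tau> = c * A w" "B \<tau> = c * B w" using gen[OF inv w] unfolding hw by blast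
      thus "\<exists>c. c \<noteq> 0 \<and> A (moebius (inv\<^bsub>SL2R\<^esub> h) \<tau>) = c * A \<tau> \<and> B (moebius (inv\<^bsub>SL2R\<^esub> h) \<tau>) = c * B \<tau>"
        unfolding w_def[symmetric] by (intro exI[of _ "1 / c"]) auto
    qed
  next
    case (eng h1 h2)
    have d: "det h2 = 1" using generate_in_carrier[OF gens eng(2)] by (simp add: SL2R_def)
    show ?case
    proof (intro allI impI)
      fix \<tau> :: complex assume \<tau>: "Im \<tau> > 0"
      obtain c where c: "c \<noteq> 0" "A (moebius h2 \<tau>) = c * A \<tau>" "B (moebius h2 \<tau>) = c * B \<tau>"
        using eng.IH(2) \<tau> by blast
      obtain c' where c': "c' \<noteq> 0" "A (moebius h1 (moebius h2 \<tau>)) = c' * A (moebius h2 \<tau>)"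
         "B (moebius h1 (moebius h2 \<tau>)) = c' * B (moebius h2 \<tau>)"
        using eng.IH(1) Im_moebius_pos[OF d \<tau>] by blast
      have "h1 \<otimes>\<^bsub>SL2R\<^esub> h2 = h1 ** h2" by (simp add: SL2R_def)
      thus "\<exists>c. c \<noteq> 0 \<and> A (moebius (h1 \<otimes>\<^bsub>SL2R\<^esub> h2) \<tau>) = c * A \<tau> \<and> B (moebius (h1 \<otimes>\<^bsub>SL2R\<^esub> h2) \<tau>) = c * B \<tau>"
        using c c' by (intro exI[of _ "c' * c"]) (simp add: moebius_mult[OF d \<tau>, symmetric])
    qed
  qed
  thus ?thesis using \<tau> by blast
qed

lemma DERIV_moebius:
  assumes "det A = 1" "Im \<tau> > 0"
  shows "(moebius A has_field_derivative 1 / (aut_factor A \<tau>)\<^sup>2) (at \<tau>)"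
proof -
  define a b c d :: complex where abcd: "a = of_real (A $ 1 $ 1)" "b = of_real (A $ 1 $ 2)" "c = of_real (A $ 2 $ 1)" "d = of_real (A $ 2 $ 2)"
  have j: "c * \<tau> + d \<noteq> 0" using aut_factor_nonzero[OF assms] by (simp add: aut_factor_def abcd)
  have "a * d - b * c = of_real (det A)" by (simp add: abcd det_2)
  hence det: "a * d - b * c = 1" by (simp add: assms)
  have "((\<lambda>\<tau>. (a * \<tau> + b) / (c * \<tau> + d)) has_field_derivative (a * (c * \<tau> + d) - (a * \<tau> + b) * c) / ((c * \<tau> + d) * (c * \<tau> + d))) (at \<tau>)"
    using j by (auto intro!: derivative_eq_intros)
  also have "a * (c * \<tau> + d) - (a * \<tau> + b) * c = 1" using det by (simp add: algebra_simps)
  finally show ?thesis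
    by (simp add: moebius_def[abs_def] aut_factor_def abcd power2_eq_square)
qed

lemma moebius_inverse:
  assumes "det A = 1"
  obtains B :: "real^2^2" where "det B = 1" "\<And>\<tau>. Im \<tau> > 0 \<Longrightarrow> moebius A (moebius B \<tau>) = \<tau>"
    "\<And>\<tau>. Im \<tau> > 0 \<Longrightarrow> moebius B (moebius A \<tau>) = \<tau>"
proof -
  interpret group SL2R by (rule SL2R_group)
  have A: "A \<in> carrier SL2R" using assms by (simp add: SL2R_def)
  define B where "B = inv\<^bsub>SL2R\<^esub> A"
  have B: "det B = 1" using inv_closed[OF A] by (simp add: B_def SL2R_def)
  have AB: "A ** B = mat 1" "B ** A = mat 1" using r_inv[OF A] l_inv[OF A] by (simp_all add: B_def SL2R_def)
  show ?thesis
    by (rule that[OF B]) (simp_all add: moebius_mult B assms AB moebius_mat_1)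
qed

lemma open_upper_half: "open upper_half" and convex_upper_half: "convex upper_half"
  unfolding upper_half_def by (simp_all add: open_halfspace_Im_gt convex_halfspace_Im_gt)

lemma moebius_holomorphic: "det A = 1 \<Longrightarrow> moebius A holomorphic_on upper_half"
  by (rule holomorphic_onI)
     (auto simp: upper_half_def field_differentiable_def intro: has_field_derivative_at_within DERIV_moebius)

text \<open>A Moebius map is open and injective on the half-plane, so it matches punctured
  neighbourhoods; this lets \<open>remove_sings\<close> commute with it.\<close>

lemma filtermap_moebius_at:
  assumes A: "det A = 1" and \<tau>: "Im \<tau> > 0"
  shows "filtermap (moebius A) (at \<tau>) = at (moebius A \<tau>)"
proof (rule filtermap_nhds_eq_imp_filtermap_at_eq)
  obtain B where B: "\<And>\<tau>. Im \<tau> > 0 \<Longrightarrow> moebius B (moebius A \<tau>) = \<tau>" using moebius_inverse[OF A] by metis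
  have inj: "inj_on (moebius A) upper_half"
    by (rule inj_on_inverseI[of _ "moebius B"]) (simp add: upper_half_def B)
  have \<tau>': "\<tau> \<in> upper_half" using \<tau> by (simp add: upper_half_def)
  show "filtermap (moebius A) (nhds \<tau>) = nhds (moebius A \<tau>)"
  proof (rule filtermap_nhds_open_map'[OF _ open_upper_half \<tau>'])
    show "isCont (moebius A) \<tau>" using DERIV_moebius[OF A \<tau>] by (rule DERIV_isCont)
    show "open (moebius A ` S)" if "open S" "S \<subseteq> upper_half" for S
      by (rule open_mapping_thm3[OF _ that(1)])
         (use that inj moebius_holomorphic[OF A] in \<open>auto intro: holomorphic_on_subset inj_on_subset\<close>)
  qed
  have "\<forall>\<^sub>F x in at \<tau>. x \<in> upper_half"
    by (rule eventually_at_in_open'[OF open_upper_half \<tau>'])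
  thus "\<forall>\<^sub>F x in at \<tau>. moebius A x = moebius A \<tau> \<longrightarrow> x = \<tau>"
    by eventually_elim (use inj \<tau>' in \<open>auto dest: inj_onD\<close>)
qed

section \<open>The identity theorem in two variables\<close>

lemma holomorphic2_onI:
  assumes "\<And>p. p \<in> S \<Longrightarrow> (F has_derivative (\<lambda>v. A p * fst v + B p * snd v)) (at p)"
  shows "F holomorphic2_on S"
  unfolding holomorphic2_on_def
proof
  fix p assume "p \<in> S"
  from assms[OF this] show "\<exists>A B. (F has_derivative (\<lambda>(h, k). A * h + B * k)) (at p)"
    unfolding case_prod_unfold by (intro exI)
qed

lemma holomorphic2_onE:
  assumes "F holomorphic2_on S" "p \<in> S"
  obtains A B where "(F has_derivative (\<lambda>v. A * fst v + B * snd v)) (at p)"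
  using assms unfolding holomorphic2_on_def case_prod_unfold by blast

lemma holomorphic2_on_isCont:
  assumes "F holomorphic2_on S" "p \<in> S"
  shows "isCont F p"
  using holomorphic2_onE[OF assms] has_derivative_continuous by metis

lemma holomorphic2_on_mult:
  assumes "F holomorphic2_on S" "G holomorphic2_on S"
  shows "(\<lambda>p. F p * G p) holomorphic2_on S"
  unfolding holomorphic2_on_def case_prod_unfold
proof
  fix p assume p: "p \<in> S"
  obtain A B where F: "(F has_derivative (\<lambda>v. A * fst v + B * snd v)) (at p)" by (rule holomorphic2_onE[OF assms(1) p])
  obtain C D where G: "(G has_derivative (\<lambda>v. C * fst v + D * snd v)) (at p)" by (rule holomorphic2_onE[OF assms(2) p])
  have "(\<lambda>v. F p * (C * fst v + D * snd v) + (A * fst v + B * snd v) * G p) =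
      (\<lambda>v. (F p * C + A * G p) * fst v + (F p * D + B * G p) * snd v)"
    by (simp add: fun_eq_iff algebra_simps)
  with has_derivative_mult[OF F G]
  show "\<exists>A B. ((\<lambda>p. F p * G p) has_derivative (\<lambda>v. A * fst v + B * snd v)) (at p)" by metis
qed

lemma holomorphic2_on_add:
  assumes "F holomorphic2_on S" "G holomorphic2_on S"
  shows "(\<lambda>p. F p + G p) holomorphic2_on S"
  unfolding holomorphic2_on_def case_prod_unfold
proof
  fix p assume p: "p \<in> S"
  obtain A B where F: "(F has_derivative (\<lambda>v. A * fst v + B * snd v)) (at p)" by (rule holomorphic2_onE[OF assms(1) p])
  obtain C D where G: "(G has_derivative (\<lambda>v. C * fst v + D * snd v)) (at p)" by (rule holomorphic2_onE[OF assms(2) p])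
  have "(\<lambda>v. (A * fst v + B * snd v) + (C * fst v + D * snd v)) =
      (\<lambda>v. (A + C) * fst v + (B + D) * snd v)"
    by (simp add: fun_eq_iff algebra_simps)
  with has_derivative_add[OF F G]
  show "\<exists>A B. ((\<lambda>p. F p + G p) has_derivative (\<lambda>v. A * fst v + B * snd v)) (at p)" by metis
qed

lemma holomorphic2_on_fst_snd:
  assumes "open A" "f holomorphic_on A"
  shows "fst ` S \<subseteq> A \<Longrightarrow> (\<lambda>p. f (fst p)) holomorphic2_on S" "snd ` S \<subseteq> A \<Longrightarrow> (\<lambda>p. f (snd p)) holomorphic2_on S"
proof -
  have f: "(f has_derivative (*) (deriv f z)) (at z)" if "z \<in> A" for z
    using holomorphic_derivI[OF assms(2,1) that] by (simp add: has_field_derivative_def)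
  show "(\<lambda>p. f (fst p)) holomorphic2_on S" if "fst ` S \<subseteq> A"
  proof (rule holomorphic2_onI[where A = "\<lambda>p. deriv f (fst p)" and B = "\<lambda>_. 0"])
    fix p assume "p \<in> S"
    hence "fst p \<in> A" using that by auto
    from has_derivative_compose[OF has_derivative_fst[OF has_derivative_ident] f[OF this]]
    show "((\<lambda>p. f (fst p)) has_derivative (\<lambda>v. deriv f (fst p) * fst v + 0 * snd v)) (at p)" by simp
  qed
  show "(\<lambda>p. f (snd p)) holomorphic2_on S" if "snd ` S \<subseteq> A"
  proof (rule holomorphic2_onI[where B = "\<lambda>p. deriv f (snd p)" and A = "\<lambda>_. 0"])
    fix p assume "p \<in> S"
    hence "snd p \<in> A" using that by auto
    from has_derivative_compose[OF has_derivative_snd[OF has_derivative_ident] f[OF this]]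
    show "((\<lambda>p. f (snd p)) has_derivative (\<lambda>v. 0 * fst v + deriv f (snd p) * snd v)) (at p)" by simp
  qed
qed

lemma holomorphic2_on_compose_map_prod:
  assumes F: "F holomorphic2_on map_prod f g ` U" and U: "U \<subseteq> A \<times> B"
    and f: "open A" "f holomorphic_on A" and g: "open B" "g holomorphic_on B"
  shows "(\<lambda>p. F (map_prod f g p)) holomorphic2_on U"
  unfolding holomorphic2_on_def case_prod_unfold
proof
  fix p assume p: "p \<in> U"
  obtain C D where F': "(F has_derivative (\<lambda>v. C * fst v + D * snd v)) (at (map_prod f g p))"
    by (rule holomorphic2_onE[OF F imageI[OF p]])
  have "fst p \<in> A" "snd p \<in> B" using p U by auto
  hence "(f has_derivative (*) (deriv f (fst p))) (at (fst p))" "(g has_derivative (*) (deriv g (snd p))) (at (snd p))"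
    using holomorphic_derivI[OF f(2,1)] holomorphic_derivI[OF g(2,1)] by (simp_all add: has_field_derivative_def)
  hence "((\<lambda>p. (f (fst p), g (snd p))) has_derivative (\<lambda>v. (deriv f (fst p) * fst v, deriv g (snd p) * snd v))) (at p)"
    by (intro has_derivative_Pair has_derivative_compose[OF has_derivative_fst[OF has_derivative_ident]]
        has_derivative_compose[OF has_derivative_snd[OF has_derivative_ident]])
  from has_derivative_compose[OF this F'[unfolded map_prod_def case_prod_unfold]]
  have "((\<lambda>p. F (f (fst p), g (snd p))) has_derivative (\<lambda>v. C * (deriv f (fst p) * fst v) + D * (deriv g (snd p) * snd v))) (at p)"
    by simp
  thus "\<exists>C D. ((\<lambda>p. F (map_prod f g p)) has_derivative (\<lambda>v. C * fst v + D * snd v)) (at p)"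
    unfolding map_prod_def case_prod_unfold mult.assoc[symmetric] by blast
qed

lemma holomorphic2_on_complex_line:
  assumes F: "F holomorphic2_on S" and D: "\<And>l. l \<in> D \<Longrightarrow> (a + l * v, b + l * w) \<in> S"
  shows "(\<lambda>l. F (a + l * v, b + l * w)) holomorphic_on D"
proof (rule holomorphic_onI)
  fix l assume "l \<in> D"
  obtain A B where F': "(F has_derivative (\<lambda>v. A * fst v + B * snd v)) (at (a + l * v, b + l * w))"
    by (rule holomorphic2_onE[OF F D[OF \<open>l \<in> D\<close>]])
  have "((\<lambda>l. (a + l * v, b + l * w)) has_derivative (\<lambda>h. (h * v, h * w))) (at l)"
    by (auto intro!: derivative_eq_intros)
  from has_derivative_compose[OF this F']
  have "((\<lambda>l. F (a + l * v, b + l * w)) has_derivative (\<lambda>h. (A * v + B * w) * h)) (at l)"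
    by (simp add: algebra_simps)
  hence "((\<lambda>l. F (a + l * v, b + l * w)) has_field_derivative (A * v + B * w)) (at l)"
    by (simp add: has_field_derivative_def)
  thus "(\<lambda>l. F (a + l * v, b + l * w)) field_differentiable at l within D"
    by (meson field_differentiable_def has_field_derivative_at_within)
qed

text \<open>Inside a ball two points lie on a complex line whose trace in the ball is convex, so the
  identity theorem in one variable carries vanishing near \<open>x\<close> to every
  \<open>y\<close>; connectedness propagates it from ball to ball.\<close>

lemma holomorphic2_identity:
  assumes U: "open U" "connected U" and F: "F holomorphic2_on U"
    and a: "a \<in> U" "\<forall>\<^sub>F p in nhds a. F p = 0" and b: "b \<in> U"
  shows "F b = 0"
proof -
  have "\<forall>\<^sub>F p in nhds b. F p = 0"
  proof (rule connected_induction_simple[where P = "\<lambda>a. \<forall>\<^sub>F p in nhds a. F p = 0", OF U(2) a(1) b a(2)])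
    fix c assume "c \<in> U"
    then obtain e where e: "e > 0" "ball c e \<subseteq> U" using U(1) open_contains_ball by blast
    have "F y = 0" if x: "x \<in> ball c e" "\<forall>\<^sub>F p in nhds x. F p = 0" and y: "y \<in> ball c e" for x y
    proof -
      define L where "L = (\<lambda>l. (fst x + l * (fst y - fst x), snd x + l * (snd y - snd x)))"
      define D where "D = L -` ball c e"
      have L: "continuous_on UNIV L" unfolding L_def by (intro continuous_intros)
      have L01: "L 0 = x" "L 1 = y" by (simp_all add: L_def prod_eq_iff)
      have D: "open D" unfolding D_def by (rule open_vimage[OF open_ball L])
      have "convex D"
      proof (rule convexI)
        fix k l and s t :: real assume kl: "k \<in> D" "l \<in> D" "0 \<le> s" "0 \<le> t" "s + t = 1"
        have t: "t = 1 - s" using kl by simp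
        have "L (s *\<^sub>R k + t *\<^sub>R l) = s *\<^sub>R L k + t *\<^sub>R L l"
          unfolding t by (simp add: L_def prod_eq_iff scaleR_conv_of_real algebra_simps)
        thus "s *\<^sub>R k + t *\<^sub>R l \<in> D"
          unfolding D_def using convexD[OF convex_ball, of "L k" c e "L l" s t] kl by (simp add: D_def)
      qed
      have hol: "(\<lambda>l. F (L l)) holomorphic_on D"
        unfolding L_def by (rule holomorphic2_on_complex_line[OF F]) (use e in \<open>auto simp: D_def L_def\<close>)
      obtain V where V: "open V" "x \<in> V" "\<And>p. p \<in> V \<Longrightarrow> F p = 0" using x(2) unfolding eventually_nhds by blast
      have "F (L 1) = 0"
      proof (rule analytic_continuation_open[where s = "L -` V \<inter> D" and s' = D and g = "\<lambda>_. 0" and f = "\<lambda>l. F (L l)"])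
        show "open (L -` V \<inter> D)" by (intro open_Int D open_vimage[OF V(1) L])
        have "0 \<in> L -` V \<inter> D" using V x L01 by (simp add: D_def)
        thus "L -` V \<inter> D \<noteq> {}" by blast
        show "1 \<in> D" using L01 y by (simp add: D_def)
        show "connected D" by (rule convex_connected[OF \<open>convex D\<close>])
        show "F (L z) = 0" if "z \<in> L -` V \<inter> D" for z using that V(3) by blast
      qed (use D hol in auto)
      thus ?thesis by (simp add: L01)
    qed note zero = this
    show "\<exists>T. openin (top_of_set U) T \<and> c \<in> T \<and>
        (\<forall>x\<in>T. \<forall>y\<in>T. (\<forall>\<^sub>F p in nhds x. F p = 0) \<longrightarrow> (\<forall>\<^sub>F p in nhds y. F p = 0))"
    proof (intro exI[of _ "ball c e"] conjI ballI impI)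
      show "openin (top_of_set U) (ball c e)" using e U by (simp add: openin_open_eq)
      fix x y assume xy: "x \<in> ball c e" "y \<in> ball c e" "\<forall>\<^sub>F p in nhds x. F p = 0"
      have "\<forall>\<^sub>F p in nhds y. p \<in> ball c e" by (rule eventually_nhds_in_open[OF open_ball xy(2)])
      thus "\<forall>\<^sub>F p in nhds y. F p = 0" by eventually_elim (rule zero[OF xy(1,3)])
    qed (use e in simp)
  qed
  thus ?thesis by (rule eventually_nhds_x_imp_x)
qed

text \<open>From \<open>(P - Q) (P + Q) = 0\<close>: near a point where \<open>P\<close> and
  \<open>Q\<close> differ, \<open>P + Q\<close> vanishes, and then it does so everywhere by the
  identity theorem.\<close>

lemma holomorphic2_square_roots:
  assumes U: "open U" "connected U" and P: "P holomorphic2_on U" and Q: "Q holomorphic2_on U"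
    and eq: "\<And>p. p \<in> U \<Longrightarrow> P p ^ 2 = Q p ^ 2"
  shows "\<exists>\<zeta>. \<zeta> ^ 2 = 1 \<and> (\<forall>p\<in>U. P p = \<zeta> * Q p)"
proof (cases "\<forall>p\<in>U. P p = Q p")
  case True
  thus ?thesis by (intro exI[of _ 1]) auto
next
  case False
  then obtain a where a: "a \<in> U" "P a \<noteq> Q a" by blast
  have "isCont (\<lambda>p. P p - Q p) a"
    by (intro continuous_intros holomorphic2_on_isCont[OF P a(1)] holomorphic2_on_isCont[OF Q a(1)])
  hence "((\<lambda>p. P p - Q p) \<longlongrightarrow> P a - Q a) (nhds a)"
    unfolding isCont_def by (rule tendsto_at_iff_tendsto_nhds[THEN iffD1])
  hence "\<forall>\<^sub>F p in nhds a. P p - Q p \<noteq> 0"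
    by (rule tendsto_imp_eventually_ne) (use a(2) in simp)
  moreover have "\<forall>\<^sub>F p in nhds a. p \<in> U" by (rule eventually_nhds_in_open[OF U(1) a(1)])
  ultimately have "\<forall>\<^sub>F p in nhds a. P p + Q p = 0"
  proof eventually_elim
    case (elim p)
    have "(P p - Q p) * (P p + Q p) = 0" using eq[OF elim(2)] by (simp add: power2_eq_square algebra_simps)
    thus ?case using elim(1) by simp
  qed
  hence "P p + Q p = 0" if "p \<in> U" for p
    using holomorphic2_identity[OF U holomorphic2_on_add[OF P Q] a(1) _ that] by blast
  thus ?thesis by (intro exI[of _ "-1"]) (auto simp: add_eq_0_iff2)
qed

section \<open>Quotients of modular forms\<close>

text \<open>\<open>A\<close> and \<open>B\<close> stand for forms of the same weight. As only their
  quotient matters, the laws are stated up to a nonzero factor \<open>c\<close> depending on the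
  point, which absorbs every automorphy factor.\<close>

locale modular_quotient =
  fixes A B :: "complex \<Rightarrow> complex" and N M :: nat
  assumes N_pos: "N > 0" and M_pos: "M > 0"
    and holomorphic: "A holomorphic_on upper_half" "B holomorphic_on upper_half"
    and projective: "\<And>\<gamma> \<tau>. \<gamma> \<in> Gamma0_star N \<Longrightarrow> Im \<tau> > 0 \<Longrightarrow>
      \<exists>c. c \<noteq> 0 \<and> A (moebius \<gamma> \<tau>) = c * A \<tau> \<and> B (moebius \<gamma> \<tau>) = c * B \<tau>"
    and cusp: "\<And>\<sigma>. \<sigma> \<in> Gamma0 1 \<Longrightarrow> \<exists>A' B'. A' holomorphic_on ball 0 1 \<and> B' holomorphic_on ball 0 1 \<and>
      (\<forall>z. Im z > 0 \<longrightarrow> (\<exists>c. c \<noteq> 0 \<and> A (moebius \<sigma> z) = c * A' (q_param M z) \<and> B (moebius \<sigma> z) = c * B' (q_param M z)))"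
    and nonzero: "\<exists>\<tau>. Im \<tau> > 0 \<and> A \<tau> \<noteq> 0" "\<exists>\<tau>. Im \<tau> > 0 \<and> B \<tau> \<noteq> 0"
begin

definition t :: "complex \<Rightarrow> complex" where
  "t = remove_sings (\<lambda>\<tau>. A \<tau> / B \<tau>)"

text \<open>At zeros and at poles of \<open>t\<close> alike \<open>t \<tau> = 0\<close>, so that \<open>G \<tau> = 0\<close> by division by zero and the
  transformation law of \<open>G\<close> holds at every point.\<close>

definition G :: "complex \<Rightarrow> complex" where
  "G \<tau> = deriv t \<tau> / (2 * of_real pi * \<i> * t \<tau>)"

lemma eventually_upper_half: "Im \<tau> > 0 \<Longrightarrow> \<forall>\<^sub>F z in nhds \<tau>. Im z > 0"
  using eventually_nhds_in_open[OF open_upper_half, of \<tau>] by (simp add: upper_half_def)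

lemma holomorphic_analytic:
  assumes "f holomorphic_on upper_half" "Im \<tau> > 0"
  shows "f analytic_on {\<tau>}"
  using assms open_upper_half analytic_at unfolding upper_half_def by blast

lemma eventually_nonzero:
  assumes "f holomorphic_on upper_half" "\<exists>\<tau>. Im \<tau> > 0 \<and> f \<tau> \<noteq> 0" "Im \<tau> > 0"
  shows "\<forall>\<^sub>F z in at \<tau>. f z \<noteq> 0"
proof -
  obtain w where "Im w > 0" "f w \<noteq> 0" using assms(2) by blast
  thus ?thesis
    using non_zero_neighbour_alt[OF assms(1) open_upper_half convex_connected[OF convex_upper_half], of \<tau> w] assms(3)
    by (auto simp: upper_half_def elim: eventually_mono)
qed

lemma quotient_meromorphic: "(\<lambda>\<tau>. A \<tau> / B \<tau>) meromorphic_on upper_half"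
  using holomorphic open_upper_half
  by (intro meromorphic_intros analytic_on_imp_meromorphic_on) (simp_all add: analytic_on_open)

lemma t_nicely_meromorphic: "t nicely_meromorphic_on upper_half"
  unfolding t_def by (rule remove_sings_nicely_meromorphic[OF quotient_meromorphic])

lemma t_eq:
  assumes "Im \<tau> > 0" "B \<tau> \<noteq> 0"
  shows "t \<tau> = A \<tau> / B \<tau>"
  unfolding t_def
  by (intro remove_sings_at_analytic analytic_intros holomorphic_analytic holomorphic assms) (use assms in auto)

lemma eventually_t_eq:
  assumes "Im \<tau> > 0" "B \<tau> \<noteq> 0"
  shows "\<forall>\<^sub>F z in nhds \<tau>. t z = A z / B z"
proof -
  have "isCont B \<tau>" using holomorphic_analytic[OF holomorphic(2) assms(1)] by (rule analytic_at_imp_isCont)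
  hence "(B \<longlongrightarrow> B \<tau>) (nhds \<tau>)" unfolding isCont_def by (rule tendsto_at_iff_tendsto_nhds[THEN iffD1])
  hence "\<forall>\<^sub>F z in nhds \<tau>. B z \<noteq> 0" by (rule tendsto_imp_eventually_ne) (rule assms(2))
  with eventually_upper_half[OF assms(1)] show ?thesis by eventually_elim (rule t_eq)
qed

text \<open>The quotient \<open>A / B\<close> is invariant at every point, zeros of \<open>B\<close>
  included, because \<open>c \<noteq> 0\<close>; \<open>remove_sings\<close> depends only on
  punctured neighbourhoods and commutes with the Moebius map.\<close>

lemma t_invariant:
  assumes "\<gamma> \<in> Gamma0_star N" "Im \<tau> > 0"
  shows "t (moebius \<gamma> \<tau>) = t \<tau>"
proof -
  have d: "det \<gamma> = 1" by (rule det_Gamma0_star[OF N_pos assms(1)])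
  have "\<forall>\<^sub>F z in at \<tau>. Im z > 0"
    using eventually_upper_half[OF assms(2)] by (rule eventually_nhds_conv_at[THEN iffD1, THEN conjunct1])
  hence "\<forall>\<^sub>F z in at \<tau>. ((\<lambda>\<tau>. A \<tau> / B \<tau>) \<circ> moebius \<gamma>) z = A z / B z"
  proof eventually_elim
    case (elim z)
    obtain c where "c \<noteq> 0" "A (moebius \<gamma> z) = c * A z" "B (moebius \<gamma> z) = c * B z"
      using projective[OF assms(1) elim] by blast
    thus ?case by simp
  qed
  hence "remove_sings ((\<lambda>\<tau>. A \<tau> / B \<tau>) \<circ> moebius \<gamma>) \<tau> = t \<tau>"
    unfolding t_def by (rule remove_sings_cong) simp
  thus ?thesis unfolding remove_sings_compose[OF filtermap_moebius_at[OF d assms(2)]] t_def by simp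
qed

text \<open>Poles carry the value 0 by convention, so a nonzero value rules out a pole.\<close>

lemma t_analytic:
  assumes "Im \<tau> > 0" "t \<tau> \<noteq> 0"
  shows "t analytic_on {\<tau>}"
proof -
  have "\<tau> \<in> upper_half" using assms by (simp add: upper_half_def)
  moreover from this have "\<not> is_pole t \<tau>"
    using t_nicely_meromorphic assms(2) unfolding nicely_meromorphic_on_def
    by (metis not_tendsto_and_filterlim_at_infinity is_pole_def trivial_limit_at)
  ultimately show ?thesis by (rule nicely_meromorphic_on_imp_analytic_at[OF t_nicely_meromorphic])
qed

lemma G_covariant:
  assumes "\<gamma> \<in> Gamma0_star N" "Im \<tau> > 0"
  shows "G (moebius \<gamma> \<tau>) = (aut_factor \<gamma> \<tau>)\<^sup>2 * G \<tau>"
proof (cases "t \<tau> = 0")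
  case True
  thus ?thesis using t_invariant[OF assms] by (simp add: G_def)
next
  case False
  have d: "det \<gamma> = 1" by (rule det_Gamma0_star[OF N_pos assms(1)])
  note j = aut_factor_nonzero[OF d assms(2)] and i = Im_moebius_pos[OF d assms(2)]
  have "t analytic_on {moebius \<gamma> \<tau>}" by (rule t_analytic[OF i]) (use False in \<open>simp add: t_invariant[OF assms]\<close>)
  hence "(t has_field_derivative deriv t (moebius \<gamma> \<tau>)) (at (moebius \<gamma> \<tau>))"
    by (intro DERIV_deriv_iff_field_differentiable[THEN iffD2] analytic_on_imp_differentiable_at) auto
  from DERIV_chain2[OF this DERIV_moebius[OF d assms(2)]]
  have "((\<lambda>z. t (moebius \<gamma> z)) has_field_derivative deriv t (moebius \<gamma> \<tau>) * (1 / (aut_factor \<gamma> \<tau>)\<^sup>2)) (at \<tau>)" .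
  moreover have "\<forall>\<^sub>F z in nhds \<tau>. t (moebius \<gamma> z) = t z"
    using eventually_upper_half[OF assms(2)] by eventually_elim (rule t_invariant[OF assms(1)])
  ultimately have "(t has_field_derivative deriv t (moebius \<gamma> \<tau>) * (1 / (aut_factor \<gamma> \<tau>)\<^sup>2)) (at \<tau>)"
    by (subst (asm) DERIV_cong_ev[OF refl _ refl])
  hence "deriv t \<tau> = deriv t (moebius \<gamma> \<tau>) * (1 / (aut_factor \<gamma> \<tau>)\<^sup>2)" by (rule DERIV_imp_deriv)
  hence "deriv t (moebius \<gamma> \<tau>) = (aut_factor \<gamma> \<tau>)\<^sup>2 * deriv t \<tau>" using j by (simp add: field_simps)
  thus ?thesis by (simp add: G_def t_invariant[OF assms])
qed

lemma cusp_expansion: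
  assumes \<sigma>: "\<sigma> \<in> Gamma0 1"
  obtains g h A' B' where "A' holomorphic_on ball 0 1" "B' holomorphic_on ball 0 1"
    "\<exists>w\<in>ball 0 1. B' w \<noteq> 0"
    "\<And>z. Im z > 0 \<Longrightarrow> B' (q_param M z) \<noteq> 0 \<Longrightarrow> t (moebius \<sigma> z) = A' (q_param M z) / B' (q_param M z)"
    "g holomorphic_on ball 0 1" "h holomorphic_on ball 0 1" "\<exists>w\<in>ball 0 1. h w \<noteq> 0"
    "\<And>z. Im z > 0 \<Longrightarrow> h (q_param M z) \<noteq> 0 \<Longrightarrow>
       G (moebius \<sigma> z) = (aut_factor \<sigma> z)\<^sup>2 * (g (q_param M z) / h (q_param M z))"
proof -
  obtain A' B' where hol: "A' holomorphic_on ball 0 1" "B' holomorphic_on ball 0 1"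
    and eq: "\<And>z. Im z > 0 \<Longrightarrow> \<exists>c. c \<noteq> 0 \<and> A (moebius \<sigma> z) = c * A' (q_param M z) \<and> B (moebius \<sigma> z) = c * B' (q_param M z)"
    using cusp[OF \<sigma>] by blast
  have d: "det \<sigma> = 1" using \<sigma> by (simp add: Gamma0_def)
  have q: "q_param M z \<in> ball 0 1" if "Im z > 0" for z using norm_q_param[OF M_pos that] by simp
  have t\<sigma>: "t (moebius \<sigma> z) = A' (q_param M z) / B' (q_param M z)" if z: "Im z > 0" "B' (q_param M z) \<noteq> 0" for z
  proof -
    obtain c where "c \<noteq> 0" "A (moebius \<sigma> z) = c * A' (q_param M z)" "B (moebius \<sigma> z) = c * B' (q_param M z)"
      using eq[OF z(1)] by blast
    thus ?thesis using t_eq[OF Im_moebius_pos[OF d z(1)]] z(2) by simp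
  qed
  \<comment> \<open>\<open>g / h\<close> is the logarithmic \<open>q d/dq\<close> derivative of
    \<open>A' / B'\<close>, divided by \<open>M\<close>: the parameter of width \<open>M\<close> has
    derivative \<open>2 \<pi> \<i> / M\<close> times itself, and \<open>2 \<pi> \<i>\<close> cancels
    against the denominator of \<open>G\<close>.\<close>
  define g where "g = (\<lambda>q. q * (deriv A' q * B' q - A' q * deriv B' q) / of_nat M)"
  define h where "h = (\<lambda>q. A' q * B' q)"
  have g: "g holomorphic_on ball 0 1" and h: "h holomorphic_on ball 0 1"
    unfolding g_def h_def using M_pos by (auto intro!: holomorphic_intros hol)
  \<comment> \<open>A point where neither form vanishes, pulled back by \<open>\<sigma>\<close>,
    shows that neither expansion is identically zero.\<close>
  have "\<exists>w. Im w > 0 \<and> A w \<noteq> 0 \<and> B w \<noteq> 0"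
  proof -
    obtain \<tau> where \<tau>: "Im \<tau> > 0" using nonzero(1) by blast
    have "\<forall>\<^sub>F z in at \<tau>. Im z > 0"
      using eventually_upper_half[OF \<tau>] by (rule eventually_nhds_conv_at[THEN iffD1, THEN conjunct1])
    with eventually_nonzero[OF holomorphic(1) nonzero(1) \<tau>] eventually_nonzero[OF holomorphic(2) nonzero(2) \<tau>]
    have "\<forall>\<^sub>F z in at \<tau>. Im z > 0 \<and> A z \<noteq> 0 \<and> B z \<noteq> 0" by eventually_elim simp
    thus ?thesis using eventually_happens[of _ "at \<tau>"] by auto
  qed
  then obtain w where w: "Im w > 0" "A w \<noteq> 0" "B w \<noteq> 0" by blast
  obtain S :: "real^2^2" where S: "det S = 1" "\<And>\<tau>. Im \<tau> > 0 \<Longrightarrow> moebius \<sigma> (moebius S \<tau>) = \<tau>"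
    using moebius_inverse[OF d] by metis
  define z0 where "z0 = moebius S w"
  have z0: "Im z0 > 0" "moebius \<sigma> z0 = w" using S w by (simp_all add: z0_def Im_moebius_pos)
  have nz: "A' (q_param M z0) \<noteq> 0" "B' (q_param M z0) \<noteq> 0"
    using eq[OF z0(1)] w(2,3) unfolding z0(2) by auto
  have G\<sigma>: "G (moebius \<sigma> z) = (aut_factor \<sigma> z)\<^sup>2 * (g (q_param M z) / h (q_param M z))"
    if z: "Im z > 0" "h (q_param M z) \<noteq> 0" for z
  proof -
    have nz: "A' (q_param M z) \<noteq> 0" "B' (q_param M z) \<noteq> 0" using z(2) by (auto simp: h_def)
    note i = Im_moebius_pos[OF d z(1)]
    have tn: "t (moebius \<sigma> z) = A' (q_param M z) / B' (q_param M z)" by (rule t\<sigma>[OF z(1) nz(2)])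
    hence "t analytic_on {moebius \<sigma> z}" using nz by (intro t_analytic i) simp
    hence "(t has_field_derivative deriv t (moebius \<sigma> z)) (at (moebius \<sigma> z))"
      by (intro DERIV_deriv_iff_field_differentiable[THEN iffD2] analytic_on_imp_differentiable_at) auto
    from DERIV_chain2[OF this DERIV_moebius[OF d z(1)]]
    have 1: "((\<lambda>z. t (moebius \<sigma> z)) has_field_derivative deriv t (moebius \<sigma> z) * (1 / (aut_factor \<sigma> z)\<^sup>2)) (at z)" .
    have dA: "((\<lambda>z. A' (q_param M z)) has_field_derivative 2 * of_real pi * \<i> / of_nat M * theta A' (q_param M z)) (at z)"
      and dB: "((\<lambda>z. B' (q_param M z)) has_field_derivative 2 * of_real pi * \<i> / of_nat M * theta B' (q_param M z)) (at z)"
      by (rule q_param_deriv[OF hol(1) M_pos z(1)] q_param_deriv[OF hol(2) M_pos z(1)])+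
    define D where "D = 2 * of_real pi * \<i> * g (q_param M z) / (B' (q_param M z) * B' (q_param M z))"
    have 2: "((\<lambda>z. A' (q_param M z) / B' (q_param M z)) has_field_derivative D) (at z)"
      using DERIV_divide[OF dA dB nz(2)] M_pos by (simp add: D_def g_def theta_def field_simps)
    have "isCont (\<lambda>z. B' (q_param M z)) z" using dB by (rule DERIV_isCont)
    hence "((\<lambda>z. B' (q_param M z)) \<longlongrightarrow> B' (q_param M z)) (nhds z)"
      unfolding isCont_def by (rule tendsto_at_iff_tendsto_nhds[THEN iffD1])
    hence "\<forall>\<^sub>F z in nhds z. B' (q_param M z) \<noteq> 0" by (rule tendsto_imp_eventually_ne) (rule nz)
    with eventually_upper_half[OF z(1)]
    have "\<forall>\<^sub>F z in nhds z. t (moebius \<sigma> z) = A' (q_param M z) / B' (q_param M z)"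
      by eventually_elim (rule t\<sigma>)
    with 1 have "((\<lambda>z. A' (q_param M z) / B' (q_param M z)) has_field_derivative deriv t (moebius \<sigma> z) * (1 / (aut_factor \<sigma> z)\<^sup>2)) (at z)"
      by (subst (asm) DERIV_cong_ev[OF refl _ refl])
    hence "D = deriv t (moebius \<sigma> z) * (1 / (aut_factor \<sigma> z)\<^sup>2)" by (rule DERIV_unique[OF 2])
    hence "deriv t (moebius \<sigma> z) = (aut_factor \<sigma> z)\<^sup>2 * D"
      using aut_factor_nonzero[OF d z(1)] by (simp add: field_simps)
    thus ?thesis using nz by (simp add: G_def tn D_def h_def field_simps)
  qed
  show ?thesis
    by (rule that[OF hol _ t\<sigma> g h _ G\<sigma>]) (use nz q[OF z0(1)] in \<open>auto simp: h_def\<close>)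
qed

lemma chart_expansion:
  assumes "(\<kappa>, u, j) \<in> charts M"
  obtains V g h where "open V" "connected V" "0 \<in> V" "g holomorphic_on V" "h holomorphic_on V" "\<exists>w\<in>V. h w \<noteq> 0"
    "\<And>z. Im z > 0 \<Longrightarrow> u z \<in> V \<Longrightarrow> h (u z) \<noteq> 0 \<Longrightarrow> G (\<kappa> z) = (j z)\<^sup>2 * (g (u z) / h (u z))"
proof -
  from assms consider P where "\<kappa> = (\<lambda>z. z)" "u = (\<lambda>z. z - P)" "j = (\<lambda>z. 1)" "Im P > 0"
    | \<sigma> where "\<kappa> = moebius \<sigma>" "u = q_param M" "j = aut_factor \<sigma>" "\<sigma> \<in> Gamma0 1"
    by (auto simp: charts_def upper_half_def)
  thus ?thesis
  proof cases
    case 1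
    define V where "V = (\<lambda>w. w + P) -` upper_half"
    have V: "open V" unfolding V_def by (rule open_vimage[OF open_upper_half]) (intro continuous_intros)
    have "V = (\<lambda>z. z - P) ` upper_half" by (force simp: V_def image_iff)
    hence conn: "connected V"
      using convex_connected[OF convex_upper_half] by (auto intro!: connected_continuous_image continuous_intros)
    define g where "g = (\<lambda>w. (deriv A (w + P) * B (w + P) - A (w + P) * deriv B (w + P)) / (2 * of_real pi * \<i>))"
    define h where "h = (\<lambda>w. A (w + P) * B (w + P))"
    have comp: "(\<lambda>w. f (w + P)) holomorphic_on V" if "f holomorphic_on upper_half" for f
    proof -
      have "f \<circ> (\<lambda>w. w + P) holomorphic_on V"
        by (rule holomorphic_on_compose_gen[OF _ that]) (auto intro!: holomorphic_intros simp: V_def)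
      thus ?thesis by (simp add: o_def)
    qed
    have gh: "g holomorphic_on V" "h holomorphic_on V"
      unfolding g_def h_def using open_upper_half
      by (intro holomorphic_intros comp holomorphic holomorphic_deriv; simp)+
    show ?thesis
    proof (rule that[OF V conn _ gh])
      show "0 \<in> V" using 1 by (simp add: V_def upper_half_def)
      have "\<forall>\<^sub>F z in at P. Im z > 0"
        using eventually_upper_half[OF 1(4)] by (rule eventually_nhds_conv_at[THEN iffD1, THEN conjunct1])
      with eventually_nonzero[OF holomorphic(1) nonzero(1) 1(4)] eventually_nonzero[OF holomorphic(2) nonzero(2) 1(4)]
      have "\<forall>\<^sub>F z in at P. Im z > 0 \<and> A z \<noteq> 0 \<and> B z \<noteq> 0" by eventually_elim simp
      then obtain z where "Im z > 0" "A z \<noteq> 0" "B z \<noteq> 0" using eventually_happens[of _ "at P"] by auto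
      thus "\<exists>w\<in>V. h w \<noteq> 0" by (intro bexI[of _ "z - P"]) (simp_all add: h_def V_def upper_half_def)
      fix z assume z: "Im z > 0" "h (u z) \<noteq> 0"
      hence nz: "A z \<noteq> 0" "B z \<noteq> 0" by (auto simp: h_def 1)
      have "(A has_field_derivative deriv A z) (at z)" "(B has_field_derivative deriv B z) (at z)"
        using holomorphic_derivI[OF _ open_upper_half] holomorphic z(1) by (simp_all add: upper_half_def)
      from DERIV_divide[OF this nz(2)]
      have "((\<lambda>z. A z / B z) has_field_derivative (deriv A z * B z - A z * deriv B z) / (B z * B z)) (at z)" .
      with eventually_t_eq[OF z(1) nz(2)]
      have "(t has_field_derivative (deriv A z * B z - A z * deriv B z) / (B z * B z)) (at z)"
        by (subst DERIV_cong_ev[OF refl _ refl])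
      hence "deriv t z = (deriv A z * B z - A z * deriv B z) / (B z * B z)" by (rule DERIV_imp_deriv)
      thus "G (\<kappa> z) = (j z)\<^sup>2 * (g (u z) / h (u z))"
        using nz by (simp add: 1 G_def t_eq[OF z(1) nz(2)] g_def h_def field_simps)
    qed
  next
    case 2
    obtain g h where *: "g holomorphic_on ball 0 1" "h holomorphic_on ball 0 1" "\<exists>w\<in>ball 0 1. h w \<noteq> 0"
      "\<And>z. Im z > 0 \<Longrightarrow> h (q_param M z) \<noteq> 0 \<Longrightarrow>
       G (moebius \<sigma> z) = (aut_factor \<sigma> z)\<^sup>2 * (g (q_param M z) / h (q_param M z))"
      using cusp_expansion[OF 2(4)] by metis
    show ?thesis
      by (rule that[OF open_ball _ _ *(1-3)]) (simp_all add: 2 *(4))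
  qed
qed

text \<open>Near the cusp \<open>G\<close> will turn out to be the square of the one-variable factor
  of F, so this is \<open>F^2\<close> continued to all pairs of points.\<close>

definition \<Phi> :: "complex \<times> complex \<Rightarrow> complex" where
  "\<Phi> = (\<lambda>(\<tau>1, \<tau>2). G \<tau>1 * G \<tau>2)"

lemma \<Phi>_meromorphic: "meromorphic2_star 2 2 \<Phi>"
  unfolding meromorphic2_star_def
proof (intro exI[of _ M] conjI M_pos ballI, safe)
  fix \<kappa>1 u1 j1 \<kappa>2 u2 j2 assume c: "(\<kappa>1, u1, j1) \<in> charts M" "(\<kappa>2, u2, j2) \<in> charts M"
  obtain V g h where V: "open V" "connected V" "0 \<in> V" "g holomorphic_on V" "h holomorphic_on V" "\<exists>w\<in>V. h w \<noteq> 0"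
    "\<And>z. Im z > 0 \<Longrightarrow> u1 z \<in> V \<Longrightarrow> h (u1 z) \<noteq> 0 \<Longrightarrow> G (\<kappa>1 z) = (j1 z)\<^sup>2 * (g (u1 z) / h (u1 z))"
    using chart_expansion[OF c(1)] by metis
  obtain V' g' h' where V': "open V'" "connected V'" "0 \<in> V'" "g' holomorphic_on V'" "h' holomorphic_on V'" "\<exists>w\<in>V'. h' w \<noteq> 0"
    "\<And>z. Im z > 0 \<Longrightarrow> u2 z \<in> V' \<Longrightarrow> h' (u2 z) \<noteq> 0 \<Longrightarrow> G (\<kappa>2 z) = (j2 z)\<^sup>2 * (g' (u2 z) / h' (u2 z))"
    using chart_expansion[OF c(2)] by metis
  have prod: "(\<lambda>p. f (fst p) * f' (snd p)) holomorphic2_on V \<times> V'" if "f holomorphic_on V" "f' holomorphic_on V'" for f f'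
    by (intro holomorphic2_on_mult holomorphic2_on_fst_snd(1)[OF V(1) that(1)] holomorphic2_on_fst_snd(2)[OF V'(1) that(2)]) auto
  show "\<exists>W g h. open W \<and> connected W \<and> (0, 0) \<in> W \<and> g holomorphic2_on W \<and> h holomorphic2_on W \<and> (\<exists>w\<in>W. h w \<noteq> 0) \<and>
          (\<forall>z1\<in>upper_half. \<forall>z2\<in>upper_half. (u1 z1, u2 z2) \<in> W \<and> h (u1 z1, u2 z2) \<noteq> 0 \<longrightarrow>
             \<Phi> (\<kappa>1 z1, \<kappa>2 z2) = j1 z1 powi 2 * j2 z2 powi 2 * (g (u1 z1, u2 z2) / h (u1 z1, u2 z2)))"
  proof (intro exI conjI ballI impI)
    show "open (V \<times> V')" "connected (V \<times> V')" using V V' by (auto intro: open_Times connected_Times)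
    show "(0, 0) \<in> V \<times> V'" using V V' by simp
    show "(\<lambda>p. g (fst p) * g' (snd p)) holomorphic2_on V \<times> V'" "(\<lambda>p. h (fst p) * h' (snd p)) holomorphic2_on V \<times> V'"
      by (intro prod V V')+
    obtain w w' where "w \<in> V" "w' \<in> V'" "h w \<noteq> 0" "h' w' \<noteq> 0" using V(6) V'(6) by blast
    thus "\<exists>w\<in>V \<times> V'. h (fst w) * h' (snd w) \<noteq> 0" by (intro bexI[of _ "(w, w')"]) simp_all
    fix z1 z2 assume "z1 \<in> upper_half" "z2 \<in> upper_half"
      "(u1 z1, u2 z2) \<in> V \<times> V' \<and> h (fst (u1 z1, u2 z2)) * h' (snd (u1 z1, u2 z2)) \<noteq> 0"
    thus "\<Phi> (\<kappa>1 z1, \<kappa>2 z2) = j1 z1 powi 2 * j2 z2 powi 2 *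
        (g (fst (u1 z1, u2 z2)) * g' (snd (u1 z1, u2 z2)) / (h (fst (u1 z1, u2 z2)) * h' (snd (u1 z1, u2 z2))))"
      using V(7)[of z1] V'(7)[of z2] by (simp add: \<Phi>_def upper_half_def mult_ac)
  qed
qed

lemma t_modular_function: "modular_function (Gamma0_star N) t"
  unfolding modular_function_def
proof (intro conjI ballI t_nicely_meromorphic)
  fix \<gamma> \<tau> assume "\<gamma> \<in> Gamma0_star N" "\<tau> \<in> upper_half"
  thus "t (moebius \<gamma> \<tau>) = t \<tau>" by (intro t_invariant) (simp_all add: upper_half_def)
next
  fix \<sigma> assume \<sigma>: "\<sigma> \<in> Gamma0 1"
  obtain A' B' where hol: "A' holomorphic_on ball 0 1" "B' holomorphic_on ball 0 1" "\<exists>w\<in>ball 0 1. B' w \<noteq> 0"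
    and eq: "\<And>z. Im z > 0 \<Longrightarrow> B' (q_param M z) \<noteq> 0 \<Longrightarrow> t (moebius \<sigma> z) = A' (q_param M z) / B' (q_param M z)"
    using cusp_expansion[OF \<sigma>] by metis
  have "A' analytic_on {0}" "B' analytic_on {0}" using hol by (auto simp: analytic_at intro!: exI[of _ "ball 0 1"])
  hence mero: "(\<lambda>q. A' q / B' q) meromorphic_on {0}" by (intro meromorphic_intros analytic_on_imp_meromorphic_on)
  \<comment> \<open>\<open>B'\<close> may vanish at 0, where \<open>t\<close> can have its pole at
    the cusp, but it does not vanish at nearby points; and \<open>q_param\<close> never takes the
    value 0.\<close>
  obtain w where w: "w \<in> ball 0 1" "B' w \<noteq> 0" using hol by blast
  have "\<forall>\<^sub>F q in at 0. B' q \<noteq> 0"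
    using non_zero_neighbour_alt[OF hol(2) open_ball connected_ball, of 0 w] w by (auto elim: eventually_mono)
  then obtain e where e: "e > 0" "\<And>q. q \<noteq> 0 \<Longrightarrow> norm q < e \<Longrightarrow> B' q \<noteq> 0"
    unfolding eventually_at by (auto simp: dist_norm)
  obtain Y where Y: "\<And>z. Im z > Y \<Longrightarrow> norm (q_param M z) < e"
  proof
    fix z assume z: "Im z > - ln e * M / (2 * pi)"
    have "norm (q_param M z) = exp (- (2 * pi * Im z / M))" by (simp add: q_param_def)
    also have "\<dots> < exp (ln e)" using z M_pos by (simp add: field_simps)
    also have "\<dots> = e" using e by simp
    finally show "norm (q_param M z) < e" .
  qed
  have "t (moebius \<sigma> z) = A' (q_param M z) / B' (q_param M z)" if "Im z > Y" "z \<in> upper_half" for z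
    by (rule eq) (use that e(2) Y in \<open>simp_all add: upper_half_def q_param_def\<close>)
  thus "\<exists>M>0. \<exists>g Y. g meromorphic_on {0} \<and> (\<forall>z. Y < Im z \<and> z \<in> upper_half \<longrightarrow> t (moebius \<sigma> z) = g (q_param M z))"
    using mero M_pos by blast
qed

text \<open>By \<open>G_covariant\<close>, the pullback of \<open>\<psi>\<close> and the product of
  \<open>\<phi>\<close> with the automorphy factors have the same square, so they differ by a
  constant sign on the connected set \<open>U\<close>. That sign is the \<open>\<zeta>\<close> of
  the definition, and the character can be trivial.\<close>

lemma \<Phi>_modular_form: "modular_form2 2 1 1 (Gamma0_star N) (Gamma0_star N) (\<lambda>_ _. 1) \<Phi>"
  unfolding modular_form2_def Let_def
proof (intro conjI ballI allI impI)
  show "meromorphic2_star (int 2 * 1) (int 2 * 1) \<Phi>" using \<Phi>_meromorphic by simp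
  show "character_mod 2 (Gamma0_star N) (Gamma0_star N) (\<lambda>_ _. 1)"
    by (auto simp: character_mod_def intro: exI[of _ 1])
  fix \<gamma>1 \<gamma>2 U \<phi> \<psi>
  assume \<gamma>: "\<gamma>1 \<in> Gamma0_star N" "\<gamma>2 \<in> Gamma0_star N"
    and *: "open U \<and> connected U \<and> U \<subseteq> upper_half \<times> upper_half \<and> \<phi> holomorphic2_on U \<and> (\<forall>p\<in>U. \<phi> p ^ 2 = \<Phi> p) \<and>
      \<psi> holomorphic2_on map_prod (moebius \<gamma>1) (moebius \<gamma>2) ` U \<and>
      (\<forall>p\<in>map_prod (moebius \<gamma>1) (moebius \<gamma>2) ` U. \<psi> p ^ 2 = \<Phi> p)"
  have U: "open U" "connected U" "U \<subseteq> upper_half \<times> upper_half" and \<phi>: "\<phi> holomorphic2_on U" "\<And>p. p \<in> U \<Longrightarrow> \<phi> p ^ 2 = \<Phi> p"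
    and \<psi>: "\<psi> holomorphic2_on map_prod (moebius \<gamma>1) (moebius \<gamma>2) ` U"
      "\<And>p. p \<in> U \<Longrightarrow> \<psi> (map_prod (moebius \<gamma>1) (moebius \<gamma>2) p) ^ 2 = \<Phi> (map_prod (moebius \<gamma>1) (moebius \<gamma>2) p)"
    using * by auto
  have d: "det \<gamma>1 = 1" "det \<gamma>2 = 1" using det_Gamma0_star[OF N_pos] \<gamma> by auto
  have j: "aut_factor \<gamma> holomorphic_on upper_half" for \<gamma>
    unfolding aut_factor_def[abs_def] by (intro holomorphic_intros)
  have "(\<lambda>p. \<psi> (map_prod (moebius \<gamma>1) (moebius \<gamma>2) p)) holomorphic2_on U"
    by (rule holomorphic2_on_compose_map_prod[OF \<psi>(1) U(3) open_upper_half _ open_upper_half]) (intro moebius_holomorphic d)+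
  moreover have "(\<lambda>p. aut_factor \<gamma>1 (fst p) * aut_factor \<gamma>2 (snd p) * \<phi> p) holomorphic2_on U"
    using U(3) by (intro holomorphic2_on_mult \<phi>(1) holomorphic2_on_fst_snd[OF open_upper_half j]) auto
  moreover have "\<psi> (map_prod (moebius \<gamma>1) (moebius \<gamma>2) p) ^ 2 = (aut_factor \<gamma>1 (fst p) * aut_factor \<gamma>2 (snd p) * \<phi> p) ^ 2"
    if p: "p \<in> U" for p
  proof -
    have i: "Im (fst p) > 0" "Im (snd p) > 0" using p U(3) by (auto simp: upper_half_def)
    show ?thesis
      unfolding \<psi>(2)[OF p] power_mult_distrib \<phi>(2)[OF p]
      by (simp add: \<Phi>_def map_prod_def case_prod_unfold G_covariant \<gamma> i)
  qed
  ultimately obtain \<zeta> where "\<zeta> ^ 2 = 1"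
    "\<forall>p\<in>U. \<psi> (map_prod (moebius \<gamma>1) (moebius \<gamma>2) p) = \<zeta> * (aut_factor \<gamma>1 (fst p) * aut_factor \<gamma>2 (snd p) * \<phi> p)"
    using holomorphic2_square_roots[OF U(1,2)] by blast
  thus "\<exists>\<zeta>. \<zeta> ^ 2 = 1 \<and> (\<forall>(\<tau>1, \<tau>2)\<in>U. \<psi> (moebius \<gamma>1 \<tau>1, moebius \<gamma>2 \<tau>2) =
      \<zeta> * 1 * aut_factor \<gamma>1 \<tau>1 powi 1 * aut_factor \<gamma>2 \<tau>2 powi 1 * \<phi> (\<tau>1, \<tau>2))"
    by (intro exI[of _ \<zeta>]) (auto simp: mult.assoc)
qed simp

text \<open>In terms of \<open>q\<close>, \<open>uniform\<close> says that near the cusp the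
  logarithmic derivative \<open>G\<close> of \<open>t\<close> is the square of the one-variable
  factor of F. What remains is to choose a punctured disc on which all the local statements hold
  together.\<close>

lemma hypergeometric_modular_form:
  assumes \<rho>: "\<rho> > 0" and T: "T holomorphic_on ball 0 \<rho>" "T 0 = 0" "deriv T 0 \<noteq> 0"
    and AB: "\<And>\<tau>. Im \<tau> > 0 \<Longrightarrow> q_param 1 \<tau> \<in> ball 0 \<rho> \<Longrightarrow> B \<tau> \<noteq> 0 \<and> A \<tau> / B \<tau> = T (q_param 1 \<tau>)"
    and uniform: "\<forall>\<^sub>F q in at 0. theta T q = T q * (hyp_f a b (T q) * (1 - T q) powr ((a + b) / 2))\<^sup>2"
  shows "\<exists>t. modular_function (Gamma0_star N) t \<and> \<not> t constant_on upper_half \<and>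
       (\<exists>Y>0. \<exists>\<Phi> \<nu>.
          t holomorphic_on {\<tau>. Im \<tau> > Y} \<and> (\<forall>\<tau>. Im \<tau> > Y \<longrightarrow> norm (t \<tau>) < 1) \<and>
          (\<forall>\<tau>1 \<tau>2. Im \<tau>1 > Y \<and> Im \<tau>2 > Y \<longrightarrow> \<Phi> (\<tau>1, \<tau>2) = hyp_F a b (t \<tau>1) (t \<tau>2) ^ 2) \<and>
          modular_form2 2 1 1 (Gamma0_star N) (Gamma0_star N) \<nu> \<Phi>)"
proof -
  have cont: "isCont T 0"
    using \<rho> holomorphic_on_imp_continuous_on[OF T(1)] by (simp add: continuous_on_eq_continuous_at)
  have "\<forall>\<^sub>F q in at 0. q \<in> ball 0 \<rho>" by (rule eventually_at_in_open') (use \<rho> in auto)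
  moreover have "\<forall>\<^sub>F q in at 0. norm (T q) < 1"
  proof -
    have "((\<lambda>q. norm (T q)) \<longlongrightarrow> 0) (at 0)" using cont T(2) unfolding isCont_def by (simp add: tendsto_norm_zero)
    thus ?thesis by (rule order_tendstoD) simp
  qed
  moreover have "\<forall>\<^sub>F q in at 0. T q \<noteq> T 0"
  proof -
    have "(T has_field_derivative deriv T 0) (at 0)" by (rule holomorphic_derivI[OF T(1)]) (use \<rho> in auto)
    hence "\<forall>\<^sub>F q in at 0. (T q - T 0) / (q - 0) \<noteq> 0"
      unfolding has_field_derivative_iff by (rule tendsto_imp_eventually_ne) (rule T(3))
    thus ?thesis by eventually_elim auto
  qed
  moreover have "\<forall>\<^sub>F q in at 0. q \<in> ball (0 :: complex) 1" by (rule eventually_at_in_open') auto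
  ultimately have "\<forall>\<^sub>F q in at 0. q \<in> ball 0 \<rho> \<and> norm (T q) < 1 \<and> T q \<noteq> 0 \<and> norm q < 1 \<and>
      theta T q = T q * (hyp_f a b (T q) * (1 - T q) powr ((a + b) / 2))\<^sup>2"
    using uniform by eventually_elim (simp add: T(2))
  then obtain e where e: "e > 0" "\<And>q. q \<noteq> 0 \<Longrightarrow> norm q < e \<Longrightarrow> q \<in> ball 0 \<rho> \<and> norm (T q) < 1 \<and> T q \<noteq> 0 \<and> norm q < 1 \<and>
      theta T q = T q * (hyp_f a b (T q) * (1 - T q) powr ((a + b) / 2))\<^sup>2"
    unfolding eventually_at by (auto simp: dist_norm)
  \<comment> \<open>\<open>Im \<tau> > - ln e / (2 \<pi>)\<close> means \<open>norm q < e\<close>;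
    the maximum with 1 keeps \<open>Y\<close> positive even for large \<open>e\<close>.\<close>
  define Y where "Y = max 1 (- ln e / (2 * pi))"
  have Y: "Y > 0" by (simp add: Y_def)
  have q: "norm (q_param 1 \<tau>) < e" "q_param 1 \<tau> \<noteq> 0" if "Im \<tau> > Y" for \<tau>
  proof -
    have "norm (q_param 1 \<tau>) = exp (- (2 * pi * Im \<tau>))" by (simp add: q_param_def)
    also have "\<dots> < exp (ln e)" using that by (simp add: Y_def field_simps)
    also have "\<dots> = e" using e by simp
    finally show "norm (q_param 1 \<tau>) < e" .
  qed (simp add: q_param_def)
  have tT: "t \<tau> = T (q_param 1 \<tau>)" if "Im \<tau> > Y" for \<tau>
    using t_eq[of \<tau>] AB[of \<tau>] e(2)[OF q(2,1)[OF that]] that Y by simp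
  have ev: "\<forall>\<^sub>F z in nhds \<tau>. Im z > Y" if "Im \<tau> > Y" for \<tau>
    using eventually_nhds_in_open[OF open_halfspace_Im_gt, of \<tau> Y] that by simp
  have dt: "(t has_field_derivative 2 * of_real pi * \<i> * theta T (q_param 1 \<tau>)) (at \<tau>)" if \<tau>: "Im \<tau> > Y" for \<tau>
  proof -
    have "(T has_field_derivative deriv T (q_param 1 \<tau>)) (at (q_param 1 \<tau>))"
      by (rule holomorphic_derivI[OF T(1)]) (use e(2)[OF q(2,1)[OF \<tau>]] in auto)
    moreover have "(q_param 1 has_field_derivative 2 * of_real pi * \<i> * q_param 1 \<tau>) (at \<tau>)"
      unfolding q_param_def[abs_def] by (auto intro!: derivative_eq_intros)
    ultimately have "((\<lambda>\<tau>. T (q_param 1 \<tau>)) has_field_derivative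
        deriv T (q_param 1 \<tau>) * (2 * of_real pi * \<i> * q_param 1 \<tau>)) (at \<tau>)"
      by (rule DERIV_chain2)
    moreover have "\<forall>\<^sub>F z in nhds \<tau>. t z = T (q_param 1 z)" using ev[OF \<tau>] by eventually_elim (rule tT)
    ultimately have "(t has_field_derivative deriv T (q_param 1 \<tau>) * (2 * of_real pi * \<i> * q_param 1 \<tau>)) (at \<tau>)"
      by (subst DERIV_cong_ev[OF refl _ refl])
    thus ?thesis by (simp add: theta_def mult_ac)
  qed
  have G_eq: "G \<tau> = (hyp_f a b (t \<tau>) * (1 - t \<tau>) powr ((a + b) / 2))\<^sup>2" if \<tau>: "Im \<tau> > Y" for \<tau>
    using e(2)[OF q(2,1)[OF \<tau>]] by (simp add: G_def tT[OF \<tau>] DERIV_imp_deriv[OF dt[OF \<tau>]])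
  \<comment> \<open>A constant value would equal \<open>T 0 = 0\<close> by continuity, but the zero
    of \<open>T\<close> at 0 is isolated.\<close>
  have "\<not> t constant_on upper_half"
  proof
    assume "t constant_on upper_half"
    then obtain c where c: "\<And>\<tau>. Im \<tau> > 0 \<Longrightarrow> t \<tau> = c" by (auto simp: constant_on_def upper_half_def)
    have Tc: "T q = c" if q0: "q \<noteq> 0" "norm q < e" for q
    proof -
      note q = e(2)[OF q0]
      obtain \<tau> where \<tau>: "Im \<tau> > 0" "q_param 1 \<tau> = q" by (rule q_param_surj[of 1 q]) (use q q0 in auto)
      show ?thesis using t_eq[OF \<tau>(1)] AB[OF \<tau>(1)] q c[OF \<tau>(1)] \<tau>(2) by simp
    qed
    have "\<forall>\<^sub>F q in at 0. q \<in> ball 0 e" by (rule eventually_at_in_open') (use e in auto)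
    hence "\<forall>\<^sub>F q in at 0. T q = c"
      using eventually_neq_at_within[of 0 0 UNIV] by eventually_elim (use Tc in simp)
    hence "(T \<longlongrightarrow> c) (at 0)" by (rule tendsto_eventually)
    hence "c = 0" using cont T(2) tendsto_unique[of "at 0" T c 0] by (simp add: isCont_def)
    thus False using Tc[of "of_real (e / 2)"] e(2)[of "of_real (e / 2)"] e(1) by simp
  qed
  moreover have "t holomorphic_on {\<tau>. Im \<tau> > Y}"
    by (rule holomorphic_onI) (use dt in \<open>auto simp: field_differentiable_def intro: has_field_derivative_at_within\<close>)
  moreover have "norm (t \<tau>) < 1" if "Im \<tau> > Y" for \<tau> using e(2)[OF q(2,1)[OF that]] by (simp add: tT[OF that])
  moreover have "\<Phi> (\<tau>1, \<tau>2) = hyp_F a b (t \<tau>1) (t \<tau>2) ^ 2" if "Im \<tau>1 > Y" "Im \<tau>2 > Y" for \<tau>1 \<tau>2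
    by (simp add: \<Phi>_def G_eq that hyp_F_def power_mult_distrib mult_ac)
  ultimately show ?thesis using t_modular_function \<Phi>_modular_form Y by blast
qed

end

section \<open>The eight cases\<close>

lemma Gamma0_entries:
  fixes \<gamma> :: "real^2^2"
  assumes "\<gamma> \<in> Gamma0 N"
  obtains a b c d :: int where "\<gamma> $ 1 $ 1 = of_int a" "\<gamma> $ 1 $ 2 = of_int b" "\<gamma> $ 2 $ 1 = of_int (c * int N)" "\<gamma> $ 2 $ 2 = of_int d"
    "a * d - b * (c * int N) = 1"
proof -
  obtain c :: int where c: "\<gamma> $ 2 $ 1 = of_int c * real N" using assms by (auto simp: Gamma0_def)
  have "\<gamma> $ 1 $ 1 \<in> \<int>" "\<gamma> $ 1 $ 2 \<in> \<int>" "\<gamma> $ 2 $ 2 \<in> \<int>" using assms by (auto simp: Gamma0_def)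
  then obtain a b d :: int where abd: "\<gamma> $ 1 $ 1 = of_int a" "\<gamma> $ 1 $ 2 = of_int b" "\<gamma> $ 2 $ 2 = of_int d"
    by (auto elim!: Ints_cases)
  have "real_of_int (a * d - b * (c * int N)) = det \<gamma>" by (simp add: det_2 abd c)
  also have "\<dots> = real_of_int 1" using assms by (simp add: Gamma0_def)
  finally have "a * d - b * (c * int N) = 1" by (simp only: of_int_eq_iff)
  with abd c show ?thesis by (intro that) simp_all
qed

lemma moebius_int:
  fixes \<gamma> :: "real^2^2"
  assumes "\<gamma> $ 1 $ 1 = of_int a" "\<gamma> $ 1 $ 2 = of_int b" "\<gamma> $ 2 $ 1 = of_int c" "\<gamma> $ 2 $ 2 = of_int d"
  shows "moebius \<gamma> \<tau> = (of_int a * \<tau> + of_int b) / (of_int c * \<tau> + of_int d)" "aut_factor \<gamma> \<tau> = of_int c * \<tau> + of_int d"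
  by (simp_all add: moebius_def aut_factor_def assms)

text \<open>Conjugation by the diagonal matrix with entries \<open>n\<close> and 1 divides the lower
  left entry by \<open>n\<close>, and the result is still an integer because \<open>n\<close>
  divides \<open>N\<close>.\<close>

lemma eisenstein_Gamma0:
  assumes \<gamma>: "\<gamma> \<in> Gamma0 N" and n: "n dvd N" and \<tau>: "Im \<tau> > 0"
  shows "eisenstein k (of_nat n * moebius \<gamma> \<tau>) = aut_factor \<gamma> \<tau> ^ k * eisenstein k (of_nat n * \<tau>)"
proof -
  obtain m where m: "N = n * m" using n by blast
  obtain a b c d :: int where e: "\<gamma> $ 1 $ 1 = of_int a" "\<gamma> $ 1 $ 2 = of_int b" "\<gamma> $ 2 $ 1 = of_int (c * int N)" "\<gamma> $ 2 $ 2 = of_int d"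
    "a * d - b * (c * int N) = 1" by (rule Gamma0_entries[OF \<gamma>])
  have j: "aut_factor \<gamma> \<tau> = of_int (c * int m) * (of_nat n * \<tau>) + of_int d"
    by (simp add: moebius_int(2)[OF e(1-4)] m mult_ac)
  have "aut_factor \<gamma> \<tau> \<noteq> 0" using \<gamma> \<tau> by (intro aut_factor_nonzero) (auto simp: Gamma0_def)
  hence "eisenstein k ((of_int a * (of_nat n * \<tau>) + of_int (int n * b)) / (of_int (c * int m) * (of_nat n * \<tau>) + of_int d)) =
      (of_int (c * int m) * (of_nat n * \<tau>) + of_int d) ^ k * eisenstein k (of_nat n * \<tau>)"
    using e(5) by (intro eisenstein_modular) (simp_all add: j m mult_ac)
  moreover have "(of_int a * (of_nat n * \<tau>) + of_int (int n * b)) / aut_factor \<gamma> \<tau> = of_nat n * moebius \<gamma> \<tau>"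
    by (simp add: moebius_aut_factor e(1,2) algebra_simps)
  ultimately show ?thesis unfolding j[symmetric] by simp
qed

text \<open>The matrix of \<open>z \<mapsto> n \<sigma> z\<close> is brought into Hermite normal form, which replaces \<open>n \<sigma> z\<close> by the
  equivalent point \<open>(g z + B) / D\<close> with \<open>g * D = n\<close>.\<close>

lemma eisenstein_cusp:
  assumes M: "M > 0" "n dvd M" and \<phi>: "\<phi> holomorphic_on ball 0 1" "\<And>\<tau>. Im \<tau> > 0 \<Longrightarrow> eisenstein k \<tau> = \<phi> (q_param 1 \<tau>)"
    and \<sigma>: "\<sigma> \<in> Gamma0 1"
  shows "\<exists>E. E holomorphic_on ball 0 1 \<and>
    (\<forall>z. Im z > 0 \<longrightarrow> eisenstein k (of_nat n * moebius \<sigma> z) = aut_factor \<sigma> z ^ k * E (q_param M z))"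
proof -
  have n: "n > 0" using M dvd_pos_nat by blast
  obtain a b c d :: int where e: "\<sigma> $ 1 $ 1 = of_int a" "\<sigma> $ 1 $ 2 = of_int b" "\<sigma> $ 2 $ 1 = of_int c" "\<sigma> $ 2 $ 2 = of_int d"
    and abcd: "a * d - b * c = 1" by (rule Gamma0_entries[OF \<sigma>]) (simp add: mult_ac)
  define g where "g = gcd (int n * a) c"
  have g: "g > 0" using n abcd by (auto simp: g_def gcd_pos_int intro!: Nat.gr0I)
  obtain a' c' where ac: "int n * a = g * a'" "c = g * c'" by (metis g_def gcd_dvd1 gcd_dvd2 dvdE)
  have "g = gcd (g * a') (g * c')" unfolding ac[symmetric] by (rule g_def)
  hence "g * gcd a' c' = g * 1" using g by (simp add: gcd_mult_left)
  hence "gcd a' c' = 1" using g by simp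
  then obtain y x' where "y * a' + x' * c' = 1" using bezout_int[of a' c'] by metis
  \<comment> \<open>The primitive column \<open>(a', c')\<close> is completed by
    \<open>(x, y)\<close> to a unimodular matrix.\<close>
  then obtain x where xy: "y * a' - x * c' = 1" by (metis diff_minus_eq_add mult_minus_left)
  \<comment> \<open>\<open>g\<close> divides \<open>n a\<close> and \<open>c\<close>, hence also
    \<open>n (a d - b c) = n\<close>.\<close>
  have "g dvd int n * (a * d - b * c)"
    using ac by (metis dvd_diff dvd_mult dvd_mult2 dvd_triv_left mult.assoc mult.left_commute right_diff_distrib)
  hence "g dvd int n" by (simp add: abcd)
  then obtain D where D: "int n = g * D" by blast
  have D0: "D > 0" using D g n by (metis of_nat_0_less_iff zero_less_mult_pos)
  \<comment> \<open>Chosen so that the matrix with rows \<open>(a', x)\<close>,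
    \<open>(c', y)\<close> times the one with rows \<open>(g, B)\<close>, \<open>(0, D)\<close> has
    rows \<open>(n a, n b)\<close>, \<open>(c, d)\<close>.\<close>
  define B where "B = y * int n * b - x * d"
  define G D' where "G = nat g" and "D' = nat D"
  have G: "g = int G" "G > 0" and D': "D = int D'" "D' > 0" using g D0 by (simp_all add: G_def D'_def)
  have "D' dvd M" using M(2) D G(1) D'(1) by (metis dvd_mult_right dvd_trans of_nat_eq_iff of_nat_mult dvd_triv_right)
  \<comment> \<open>As \<open>D\<close> divides \<open>M\<close>, the parameter of width 1 at
    \<open>(g z + B) / D\<close> is a root of unity times a power of the parameter of width
    \<open>M\<close> at \<open>z\<close>.\<close>
  then obtain l where l: "M = D' * l" by blast
  have l0: "l > 0" using l M by (cases l) auto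
  define \<zeta> where "\<zeta> = q_param D' (of_int B)"
  have norm\<zeta>: "norm \<zeta> = 1" by (simp add: \<zeta>_def q_param_def)
  define E where "E = (\<lambda>q. \<phi> (\<zeta> * q ^ (G * l)) / of_nat D' ^ k)"
  show ?thesis
  proof (intro exI[of _ E] conjI allI impI)
    have "norm (\<zeta> * q ^ (G * l)) < 1" if "norm q < 1" for q :: complex
      using that G(2) l0 by (simp add: norm_mult norm\<zeta> norm_power power_less_one_iff)
    hence "\<phi> \<circ> (\<lambda>q. \<zeta> * q ^ (G * l)) holomorphic_on ball 0 1"
      by (intro holomorphic_on_compose_gen[OF _ \<phi>(1)] holomorphic_intros) auto
    thus "E holomorphic_on ball 0 1" unfolding E_def o_def using D'(2) by (intro holomorphic_intros) auto
    fix z :: complex assume z: "Im z > 0"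
    define w where "w = (of_int g * z + of_int B) / of_int D"
    have w_eq: "w = of_real (real_of_int g / real_of_int D) * z + of_real (real_of_int B / real_of_int D)"
      by (simp add: w_def add_divide_distrib)
    have w: "Im w > 0" unfolding w_eq using z g D0 by simp
    have "q_param 1 w = \<zeta> * q_param M z ^ (G * l)"
    proof -
      have "of_nat (G * l) * (2 * of_real pi * \<i> * z / of_nat M) = 2 * of_real pi * \<i> * (of_nat G * z / of_nat D')"
        using l0 D'(2) by (simp add: l field_simps)
      hence "q_param M z ^ (G * l) = exp (2 * of_real pi * \<i> * (of_nat G * z / of_nat D'))"
        by (simp only: q_param_def exp_of_nat_mult[symmetric])
      moreover have "\<zeta> = exp (2 * of_real pi * \<i> * (of_int B / of_nat D'))" by (simp add: \<zeta>_def q_param_def)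
      moreover have "w = of_nat G * z / of_nat D' + of_int B / of_nat D'" by (simp add: w_def G D' add_divide_distrib)
      ultimately show ?thesis by (simp add: q_param_def ring_distribs exp_add)
    qed
    note \<phi>w = \<phi>(2)[OF w, unfolded this]
    have "g * (c' * B + y * D) = g * d" "g * (a' * B + x * D) = g * (int n * b)"
      using abcd xy ac D unfolding B_def by algebra+
    hence i: "c' * B + y * D = d" "a' * B + x * D = int n * b" using g by simp_all
    have Dc: "of_int D \<noteq> (0 :: complex)" using D0 by simp
    have "of_int c' * w + of_int y = (of_int (g * c') * z + of_int (c' * B + y * D)) / of_int D"
      using Dc by (simp add: w_def field_simps)
    hence j: "of_int c' * w + of_int y = aut_factor \<sigma> z / of_int D"
      unfolding i ac(2)[symmetric] moebius_int(2)[OF e] .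
    have "of_int a' * w + of_int x = (of_int (g * a') * z + of_int (a' * B + x * D)) / of_int D"
      using Dc by (simp add: w_def field_simps)
    hence num: "of_int a' * w + of_int x = of_nat n * (of_int a * z + of_int b) / of_int D"
      unfolding i ac(1)[symmetric] by (simp add: algebra_simps)
    have "aut_factor \<sigma> z \<noteq> 0" using \<sigma> z by (intro aut_factor_nonzero) (auto simp: Gamma0_def)
    hence "of_int c' * w + of_int y \<noteq> 0" unfolding j using Dc by simp
    moreover have "a' * y - x * c' = 1" using xy by (simp add: mult.commute)
    ultimately have "eisenstein k ((of_int a' * w + of_int x) / (of_int c' * w + of_int y)) = (of_int c' * w + of_int y) ^ k * eisenstein k w"
      by (intro eisenstein_modular)
    moreover have "(of_int a' * w + of_int x) / (of_int c' * w + of_int y) = of_nat n * moebius \<sigma> z"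
      unfolding num j using Dc by (simp add: moebius_aut_factor e)
    ultimately show "eisenstein k (of_nat n * moebius \<sigma> z) = aut_factor \<sigma> z ^ k * E (q_param M z)"
      unfolding j \<phi>w E_def D' by (simp add: power_divide)
  qed
qed

text \<open>The involution is kept out, since it may change the sign of a form; \<open>M\<close> is
  one width for all cusps, and 12 serves at every level from 1 to 4.\<close>

definition weight_form :: "nat \<Rightarrow> nat \<Rightarrow> nat \<Rightarrow> (complex \<Rightarrow> complex) \<Rightarrow> bool" where
  "weight_form M N k A \<longleftrightarrow> A holomorphic_on upper_half \<and>
     (\<forall>\<gamma>\<in>Gamma0 N. \<forall>\<tau>. Im \<tau> > 0 \<longrightarrow> A (moebius \<gamma> \<tau>) = aut_factor \<gamma> \<tau> ^ k * A \<tau>) \<and>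
     (\<forall>\<sigma>\<in>Gamma0 1. \<exists>E. E holomorphic_on ball 0 1 \<and>
        (\<forall>z. Im z > 0 \<longrightarrow> A (moebius \<sigma> z) = aut_factor \<sigma> z ^ k * E (q_param M z)))"

lemma weight_form_mult:
  assumes "weight_form M N k A" "weight_form M N l B"
  shows "weight_form M N (k + l) (\<lambda>\<tau>. A \<tau> * B \<tau>)"
  unfolding weight_form_def
proof (intro conjI ballI allI impI)
  show "(\<lambda>\<tau>. A \<tau> * B \<tau>) holomorphic_on upper_half" using assms by (auto simp: weight_form_def intro: holomorphic_intros)
  show "A (moebius \<gamma> \<tau>) * B (moebius \<gamma> \<tau>) = aut_factor \<gamma> \<tau> ^ (k + l) * (A \<tau> * B \<tau>)" if "\<gamma> \<in> Gamma0 N" "Im \<tau> > 0" for \<gamma> \<tau>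
    using assms that by (simp add: weight_form_def power_add)
  fix \<sigma> assume "\<sigma> \<in> Gamma0 1"
  then obtain E F where E: "E holomorphic_on ball 0 1" "\<And>z. Im z > 0 \<Longrightarrow> A (moebius \<sigma> z) = aut_factor \<sigma> z ^ k * E (q_param M z)"
    and F: "F holomorphic_on ball 0 1" "\<And>z. Im z > 0 \<Longrightarrow> B (moebius \<sigma> z) = aut_factor \<sigma> z ^ l * F (q_param M z)"
    using assms unfolding weight_form_def by metis
  show "\<exists>E. E holomorphic_on ball 0 1 \<and>
        (\<forall>z. Im z > 0 \<longrightarrow> A (moebius \<sigma> z) * B (moebius \<sigma> z) = aut_factor \<sigma> z ^ (k + l) * E (q_param M z))"
    by (intro exI[of _ "\<lambda>q. E q * F q"] conjI holomorphic_intros E F allI impI) (simp add: E F power_add)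
qed

lemma weight_form_lincomb:
  assumes "weight_form M N k A" "weight_form M N k B"
  shows "weight_form M N k (\<lambda>\<tau>. c * A \<tau> + d * B \<tau>)"
  unfolding weight_form_def
proof (intro conjI ballI allI impI)
  show "(\<lambda>\<tau>. c * A \<tau> + d * B \<tau>) holomorphic_on upper_half" using assms by (auto simp: weight_form_def intro!: holomorphic_intros)
  show "c * A (moebius \<gamma> \<tau>) + d * B (moebius \<gamma> \<tau>) = aut_factor \<gamma> \<tau> ^ k * (c * A \<tau> + d * B \<tau>)"
    if "\<gamma> \<in> Gamma0 N" "Im \<tau> > 0" for \<gamma> \<tau>
    using assms that by (simp add: weight_form_def ring_distribs)
  fix \<sigma> assume "\<sigma> \<in> Gamma0 1"
  then obtain E F where E: "E holomorphic_on ball 0 1" "\<And>z. Im z > 0 \<Longrightarrow> A (moebius \<sigma> z) = aut_factor \<sigma> z ^ k * E (q_param M z)"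
    and F: "F holomorphic_on ball 0 1" "\<And>z. Im z > 0 \<Longrightarrow> B (moebius \<sigma> z) = aut_factor \<sigma> z ^ k * F (q_param M z)"
    using assms unfolding weight_form_def by metis
  show "\<exists>E. E holomorphic_on ball 0 1 \<and>
        (\<forall>z. Im z > 0 \<longrightarrow> c * A (moebius \<sigma> z) + d * B (moebius \<sigma> z) = aut_factor \<sigma> z ^ k * E (q_param M z))"
    by (intro exI[of _ "\<lambda>q. c * E q + d * F q"] conjI holomorphic_intros E F allI impI) (simp add: E F ring_distribs)
qed

lemma weight_form_eisenstein:
  assumes \<phi>: "\<phi> holomorphic_on ball 0 1" "\<And>\<tau>. Im \<tau> > 0 \<Longrightarrow> eisenstein k \<tau> = \<phi> (q_param 1 \<tau>)"
    and M: "M > 0" "n dvd M" and n: "n dvd N"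
  shows "weight_form M N k (\<lambda>\<tau>. \<phi> (q_param 1 \<tau> ^ n))"
proof -
  have n0: "n > 0" using M by (auto intro!: Nat.gr0I)
  have eq: "\<phi> (q_param 1 \<tau> ^ n) = eisenstein k (of_nat n * \<tau>)" if "Im \<tau> > 0" for \<tau>
    unfolding q_param_power[OF zero_less_one] by (rule \<phi>(2)[symmetric]) (use that n0 in simp)
  have det: "det \<sigma> = 1" if "\<sigma> \<in> Gamma0 L" for \<sigma> L using that by (simp add: Gamma0_def)
  show ?thesis
    unfolding weight_form_def
  proof (intro conjI ballI allI impI)
    have "norm (q_param 1 \<tau> ^ n) < 1" if "Im \<tau> > 0" for \<tau>
      using norm_q_param[of 1 \<tau>] that n0 by (simp add: norm_power power_less_one_iff)
    hence "\<phi> \<circ> (\<lambda>\<tau>. q_param 1 \<tau> ^ n) holomorphic_on upper_half"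
      unfolding q_param_def
      by (intro holomorphic_on_compose_gen[OF _ \<phi>(1)] holomorphic_intros) (auto simp: upper_half_def)
    thus "(\<lambda>\<tau>. \<phi> (q_param 1 \<tau> ^ n)) holomorphic_on upper_half" by (simp add: o_def)
    show "\<phi> (q_param 1 (moebius \<gamma> \<tau>) ^ n) = aut_factor \<gamma> \<tau> ^ k * \<phi> (q_param 1 \<tau> ^ n)" if "\<gamma> \<in> Gamma0 N" "Im \<tau> > 0" for \<gamma> \<tau>
      using eisenstein_Gamma0[OF that(1) n that(2)] Im_moebius_pos[OF det[OF that(1)] that(2)] that(2) by (simp add: eq del: One_nat_def)
    fix \<sigma> assume \<sigma>: "\<sigma> \<in> Gamma0 1"
    obtain E where "E holomorphic_on ball 0 1"
      "\<And>z. Im z > 0 \<Longrightarrow> eisenstein k (of_nat n * moebius \<sigma> z) = aut_factor \<sigma> z ^ k * E (q_param M z)"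
      using eisenstein_cusp[OF M \<phi> \<sigma>] by blast
    thus "\<exists>E. E holomorphic_on ball 0 1 \<and>
        (\<forall>z. Im z > 0 \<longrightarrow> \<phi> (q_param 1 (moebius \<sigma> z) ^ n) = aut_factor \<sigma> z ^ k * E (q_param M z))"
      using Im_moebius_pos[OF det[OF \<sigma>]] by (intro exI[of _ E]) (simp add: eq del: One_nat_def)
  qed
qed

lemma moebius_atkin_lehner:
  assumes "N > 0"
  shows "moebius (atkin_lehner N) \<tau> = - 1 / (of_nat N * \<tau>)"
proof -
  define r where "r = complex_of_real (sqrt (real N))"
  have r: "r \<noteq> 0" "r * r = of_nat N" using assms by (simp_all add: r_def flip: of_real_mult)
  have "moebius (atkin_lehner N) \<tau> = (- 1 / r) / (r * r / r * \<tau>)"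
    by (simp add: moebius_def atkin_lehner_def r(2)) (simp add: r_def)
  also have "\<dots> = - 1 / (r * r * \<tau>)" using r(1) by simp
  finally show ?thesis unfolding r(2) .
qed

text \<open>The automorphy factors of \<open>Gamma0 N\<close> and at the cusps are common to both
  forms and become the factor \<open>c\<close>; for the involution such a factor is supplied by
  \<open>law\<close>.\<close>

lemma modular_quotientI:
  assumes N: "N > 0" and M: "M > 0" and A: "weight_form M N k A" and B: "weight_form M N k B"
    and law: "\<And>\<tau>. Im \<tau> > 0 \<Longrightarrow> \<exists>c. c \<noteq> 0 \<and> A (- 1 / (of_nat N * \<tau>)) = c * A \<tau> \<and> B (- 1 / (of_nat N * \<tau>)) = c * B \<tau>"
    and nonzero: "\<exists>\<tau>. Im \<tau> > 0 \<and> A \<tau> \<noteq> 0" "\<exists>\<tau>. Im \<tau> > 0 \<and> B \<tau> \<noteq> 0"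
  shows "modular_quotient A B N M"
proof
  show "A holomorphic_on upper_half" "B holomorphic_on upper_half" using A B by (auto simp: weight_form_def)
  show "\<exists>c. c \<noteq> 0 \<and> A (moebius \<gamma> \<tau>) = c * A \<tau> \<and> B (moebius \<gamma> \<tau>) = c * B \<tau>" if "\<gamma> \<in> Gamma0_star N" "Im \<tau> > 0" for \<gamma> \<tau>
  proof (rule Gamma0_star_projective[OF N _ that])
    fix \<gamma> \<tau> assume \<gamma>: "\<gamma> \<in> insert (atkin_lehner N) (Gamma0 N)" and \<tau>: "Im \<tau> > 0"
    show "\<exists>c. c \<noteq> 0 \<and> A (moebius \<gamma> \<tau>) = c * A \<tau> \<and> B (moebius \<gamma> \<tau>) = c * B \<tau>"
    proof (cases "\<gamma> = atkin_lehner N")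
      case True thus ?thesis using law[OF \<tau>] by (simp add: moebius_atkin_lehner[OF N])
    next
      case False
      hence \<gamma>: "\<gamma> \<in> Gamma0 N" using \<gamma> by simp
      hence "aut_factor \<gamma> \<tau> \<noteq> 0" using \<tau> by (intro aut_factor_nonzero) (auto simp: Gamma0_def)
      thus ?thesis using A B \<gamma> \<tau> unfolding weight_form_def by (intro exI[of _ "aut_factor \<gamma> \<tau> ^ k"]) auto
    qed
  qed
  fix \<sigma> assume \<sigma>: "\<sigma> \<in> Gamma0 1"
  then obtain E F where E: "E holomorphic_on ball 0 1" "\<And>z. Im z > 0 \<Longrightarrow> A (moebius \<sigma> z) = aut_factor \<sigma> z ^ k * E (q_param M z)"
    and F: "F holomorphic_on ball 0 1" "\<And>z. Im z > 0 \<Longrightarrow> B (moebius \<sigma> z) = aut_factor \<sigma> z ^ k * F (q_param M z)"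
    using A B unfolding weight_form_def by metis
  have "aut_factor \<sigma> z \<noteq> 0" if "Im z > 0" for z using that \<sigma> by (intro aut_factor_nonzero) (auto simp: Gamma0_def)
  hence "\<exists>c. c \<noteq> 0 \<and> A (moebius \<sigma> z) = c * E (q_param M z) \<and> B (moebius \<sigma> z) = c * F (q_param M z)" if "Im z > 0" for z
    using that by (intro exI[of _ "aut_factor \<sigma> z ^ k"]) (simp add: E F)
  thus "\<exists>A' B'. A' holomorphic_on ball 0 1 \<and> B' holomorphic_on ball 0 1 \<and>
      (\<forall>z. Im z > 0 \<longrightarrow> (\<exists>c. c \<noteq> 0 \<and> A (moebius \<sigma> z) = c * A' (q_param M z) \<and> B (moebius \<sigma> z) = c * B' (q_param M z)))"
    using E(1) F(1) by (intro exI[of _ E] exI[of _ F]) simp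
qed (rule N M nonzero)+

definition hypergeometric_modular :: "complex \<Rightarrow> complex \<Rightarrow> nat \<Rightarrow> bool" where
  "hypergeometric_modular a b N \<longleftrightarrow>
    (\<exists>t. modular_function (Gamma0_star N) t \<and> \<not> t constant_on upper_half \<and>
       (\<exists>Y>0. \<exists>\<Phi> \<nu>.
          t holomorphic_on {\<tau>. Im \<tau> > Y} \<and> (\<forall>\<tau>. Im \<tau> > Y \<longrightarrow> norm (t \<tau>) < 1) \<and>
          (\<forall>\<tau>1 \<tau>2. Im \<tau>1 > Y \<and> Im \<tau>2 > Y \<longrightarrow> \<Phi> (\<tau>1, \<tau>2) = hyp_F a b (t \<tau>1) (t \<tau>2) ^ 2) \<and>
          modular_form2 2 1 1 (Gamma0_star N) (Gamma0_star N) \<nu> \<Phi>))"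

lemma inverse_powr_complex: "(w :: complex) \<notin> \<real>\<^sub>\<le>\<^sub>0 \<Longrightarrow> (1 / w) powr c = w powr (- c)"
proof -
  assume w: "w \<notin> \<real>\<^sub>\<le>\<^sub>0"
  hence "w \<noteq> 0" by auto
  thus ?thesis unfolding inverse_eq_divide[symmetric] using Ln_inverse[OF w] by (simp add: powr_def)
qed

text \<open>Write \<open>w = 1 - T\<close>. The logarithmic derivative of \<open>T / (T - 1)\<close>
  is that of \<open>T\<close> divided by \<open>w\<close>, and on the other side the powers from
  Pfaff's formula and from F combine to \<open>w powr (a + b - 1)\<close>, which accounts for the
  same \<open>1 / w\<close>.\<close>

lemma pfaff_uniformization:
  fixes T :: "complex \<Rightarrow> complex"
  assumes conv_ab: "fps_conv_radius (fps_hypergeo [a, b] [1] 1) \<ge> 1"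
    and conv_ab': "fps_conv_radius (fps_hypergeo [a, 1 - b] [1] 1) \<ge> 1"
    and \<rho>: "\<rho> > 0" and T: "T holomorphic_on ball 0 \<rho>" "T 0 = 0" "\<And>q. q \<in> ball 0 \<rho> \<Longrightarrow> norm (T q) < 1"
    and uniform: "\<forall>\<^sub>F q in at 0. theta T q = T q * (hyp_f a b (T q) * (1 - T q) powr ((a + b) / 2))\<^sup>2"
  shows "\<forall>\<^sub>F q in at 0. theta (\<lambda>q. T q / (T q - 1)) q = T q / (T q - 1) *
      (hyp_f a (1 - b) (T q / (T q - 1)) * (1 - T q / (T q - 1)) powr ((a + (1 - b)) / 2))\<^sup>2"
proof -
  interpret gauss_hypergeometric a b by unfold_locales (rule conv_ab)
  have "isCont T 0"
    using \<rho> holomorphic_on_imp_continuous_on[OF T(1)] by (simp add: continuous_on_eq_continuous_at)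
  hence "filterlim T (nhds 0) (at 0)" by (simp add: isCont_def T(2))
  from eventually_compose_filterlim[OF pfaff[OF conv_ab'] this]
  have pf: "\<forall>\<^sub>F q in at 0. hyp_f a (1 - b) (T q / (T q - 1)) = (1 - T q) powr a * hyp_f a b (T q)" .
  have "\<forall>\<^sub>F q in at 0. q \<in> ball 0 \<rho>" by (rule eventually_at_in_open') (use \<rho> in auto)
  with pf uniform show ?thesis
  proof eventually_elim
    case (elim q)
    define w where "w = 1 - T q"
    have w: "w \<noteq> 0" "w \<notin> \<real>\<^sub>\<le>\<^sub>0" using one_minus_not_nonpos[OF T(3)[OF elim(3)]] by (auto simp: w_def)
    have Tq: "T q = 1 - w" "T q - 1 = - w" by (simp_all add: w_def)
    have "(T has_field_derivative deriv T q) (at q)" using holomorphic_derivI[OF T(1) open_ball elim(3)] .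
    hence "((\<lambda>q. T q / (T q - 1)) has_field_derivative (deriv T q * (T q - 1) - T q * deriv T q) / ((T q - 1) * (T q - 1))) (at q)"
      using w(1) by (auto intro!: derivative_eq_intros simp: Tq)
    from theta_eqI[OF this] have "theta (\<lambda>q. T q / (T q - 1)) q = - theta T q / (w * w)"
      by (simp add: theta_def Tq algebra_simps)
    moreover have "1 - T q / (T q - 1) = 1 / w" using w(1) by (simp add: Tq field_simps)
    moreover have "(w powr a * hyp_f a b (T q) * (1 / w) powr ((a + (1 - b)) / 2))\<^sup>2 =
        (hyp_f a b (T q) * w powr ((a + b) / 2))\<^sup>2 / w"
    proof -
      have "(w powr a * (1 / w) powr ((a + (1 - b)) / 2))\<^sup>2 = (w powr (a - (a + (1 - b)) / 2))\<^sup>2"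
        by (simp only: inverse_powr_complex[OF w(2)] diff_conv_add_uminus powr_add)
      also have "\<dots> = w powr (a - (a + (1 - b)) / 2 + (a - (a + (1 - b)) / 2))"
        by (simp only: power2_eq_square powr_add)
      also have "a - (a + (1 - b)) / 2 + (a - (a + (1 - b)) / 2) = a + b - 1" by (simp add: field_simps)
      also have "w powr (a + b - 1) = (w powr ((a + b) / 2))\<^sup>2 / w"
      proof -
        have e: "a + b - 1 = (a + b) / 2 + (a + b) / 2 - 1" by (simp add: field_simps)
        have "w powr (a + b - 1) = w powr ((a + b) / 2) * w powr ((a + b) / 2) / w powr 1"
          unfolding e by (simp only: powr_diff powr_add)
        thus ?thesis using w(1) by (simp add: power2_eq_square)
      qed
      finally have 1: "(w powr a * (1 / w) powr ((a + (1 - b)) / 2))\<^sup>2 = (w powr ((a + b) / 2))\<^sup>2 / w" .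
      have "(w powr a * hyp_f a b (T q) * (1 / w) powr ((a + (1 - b)) / 2))\<^sup>2 =
          (hyp_f a b (T q))\<^sup>2 * (w powr a * (1 / w) powr ((a + (1 - b)) / 2))\<^sup>2"
        by (simp add: power_mult_distrib)
      thus ?thesis unfolding 1 by (simp add: power_mult_distrib)
    qed
    ultimately show ?case
      unfolding elim(1) using elim(2) w(1) by (simp add: w_def[symmetric] Tq(2))
  qed
qed

text \<open>If \<open>t = A / B\<close>, then \<open>t / (t - 1) = A / (A - B)\<close> is again a
  quotient of forms of the same weight, so both parameter pairs fit one construction.\<close>

lemma hypergeometric_families:
  assumes N: "N > 0" and M: "M > 0" and A: "weight_form M N k A" and B: "weight_form M N k B"
    and law: "\<And>\<tau>. Im \<tau> > 0 \<Longrightarrow> \<exists>c. c \<noteq> 0 \<and> A (- 1 / (of_nat N * \<tau>)) = c * A \<tau> \<and> B (- 1 / (of_nat N * \<tau>)) = c * B \<tau>"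
    and \<rho>: "\<rho> > 0" and U: "U holomorphic_on ball 0 \<rho>" "U 0 = 1"
    and T: "T holomorphic_on ball 0 \<rho>" "T 0 = 0" "deriv T 0 \<noteq> 0"
    and AB: "\<And>\<tau>. Im \<tau> > 0 \<Longrightarrow> q_param 1 \<tau> \<in> ball 0 \<rho> \<Longrightarrow> B \<tau> \<noteq> 0 \<and> A \<tau> / B \<tau> = T (q_param 1 \<tau>)"
    and ab: "a + b = 1 / 2"
    and conv_ab: "fps_conv_radius (fps_hypergeo [a, b] [1] 1) \<ge> 1"
    and conv_ab': "fps_conv_radius (fps_hypergeo [a, 1 - b] [1] 1) \<ge> 1"
    and first_order: "\<And>q. q \<in> ball 0 \<rho> \<Longrightarrow> (theta T q)\<^sup>2 = (T q)\<^sup>2 * U q * (1 - T q)"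
    and second_order: "\<And>q. q \<in> ball 0 \<rho> \<Longrightarrow>
        4 * U q * theta (theta U) q - 5 * (theta U q)\<^sup>2 = 16 * (a * b) * T q * U q ^ 3"
  shows "hypergeometric_modular a b N" "hypergeometric_modular a (1 - b) N"
proof -
  interpret gauss_hypergeometric a b by unfold_locales (rule conv_ab)
  have uniform: "\<forall>\<^sub>F q in at 0. theta T q = T q * (hyp_f a b (T q) * (1 - T q) powr ((a + b) / 2))\<^sup>2"
    using local_uniformization[OF ab \<rho> U T first_order second_order] by (simp add: f0_def \<sigma>_def)
  have cont: "isCont T 0"
    using \<rho> holomorphic_on_imp_continuous_on[OF T(1)] by (simp add: continuous_on_eq_continuous_at)
  have small: "\<forall>\<^sub>F q in at 0. norm (T q) < 1"
  proof -
    have "((\<lambda>q. norm (T q)) \<longlongrightarrow> 0) (at 0)" using cont T(2) unfolding isCont_def by (simp add: tendsto_norm_zero)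
    thus ?thesis by (rule order_tendstoD) simp
  qed
  then obtain e where e: "e > 0" "\<And>q. q \<noteq> 0 \<Longrightarrow> norm q < e \<Longrightarrow> norm (T q) < 1"
    unfolding eventually_at by (auto simp: dist_norm)
  \<comment> \<open>Inside this disc \<open>norm (T q) < 1\<close>, so that \<open>T - 1\<close> has
    no zeros and the second quotient is defined.\<close>
  define r where "r = min \<rho> (min e 1)"
  have r: "r > 0" "ball 0 r \<subseteq> ball (0::complex) \<rho>" using \<rho> e by (auto simp: r_def)
  have r': "norm q < 1" "q \<in> ball 0 \<rho>" if "q \<in> ball 0 r" for q :: complex using that by (auto simp: r_def)
  have Tr: "norm (T q) < 1" if "q \<in> ball 0 r" for q
    using e(2)[of q] that T(2) by (cases "q = 0") (auto simp: r_def)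
  have Tn: "T q \<noteq> 1" if "q \<in> ball 0 r" for q using Tr[OF that] by auto
  have "(T has_field_derivative deriv T 0) (at 0)" by (rule holomorphic_derivI[OF T(1)]) (use \<rho> in auto)
  hence "\<forall>\<^sub>F q in at 0. (T q - T 0) / (q - 0) \<noteq> 0"
    unfolding has_field_derivative_iff by (rule tendsto_imp_eventually_ne) (rule T(3))
  moreover have "\<forall>\<^sub>F q in at 0. q \<in> ball 0 r" by (rule eventually_at_in_open') (use r in auto)
  ultimately have "\<forall>\<^sub>F q in at 0. T q \<noteq> 0 \<and> q \<noteq> 0 \<and> q \<in> ball 0 r" by eventually_elim (auto simp: T(2))
  then obtain q0 where q0: "T q0 \<noteq> 0" "q0 \<noteq> 0" "q0 \<in> ball 0 r"
    using eventually_happens[of _ "at (0::complex)"] by auto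
  obtain \<tau>0 where \<tau>0: "Im \<tau>0 > 0" "q_param 1 \<tau>0 = q0"
    by (rule q_param_surj[of 1 q0]) (use q0(2) r'[OF q0(3)] in auto)
  have *: "B \<tau>0 \<noteq> 0" "A \<tau>0 / B \<tau>0 = T q0" using AB[OF \<tau>0(1)] r'(2)[OF q0(3)] unfolding \<tau>0(2) by auto
  have "A \<tau>0 \<noteq> 0" using q0(1) *(2) by fastforce
  hence nz_A: "\<exists>\<tau>. Im \<tau> > 0 \<and> A \<tau> \<noteq> 0" using \<tau>0(1) by blast
  have nz_B: "\<exists>\<tau>. Im \<tau> > 0 \<and> B \<tau> \<noteq> 0" using \<tau>0(1) *(1) by blast
  have "A \<tau>0 - B \<tau>0 \<noteq> 0"
  proof
    assume "A \<tau>0 - B \<tau>0 = 0"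
    hence "A \<tau>0 / B \<tau>0 = 1" using *(1) by simp
    thus False using Tn[OF q0(3)] *(2) by metis
  qed
  hence nz_AB: "\<exists>\<tau>. Im \<tau> > 0 \<and> A \<tau> - B \<tau> \<noteq> 0" using \<tau>0(1) by blast
  have mq: "modular_quotient A B N M"
    by (rule modular_quotientI[OF N M A B law nz_A nz_B])
  show "hypergeometric_modular a b N"
    unfolding hypergeometric_modular_def
    by (rule modular_quotient.hypergeometric_modular_form[OF mq \<rho> T AB uniform])
  have AB': "weight_form M N k (\<lambda>\<tau>. A \<tau> - B \<tau>)" using weight_form_lincomb[OF A B, of 1 "-1"] by simp
  have mq': "modular_quotient A (\<lambda>\<tau>. A \<tau> - B \<tau>) N M"
  proof (rule modular_quotientI[OF N M A AB'])
    fix \<tau> :: complex assume "Im \<tau> > 0"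
    then obtain c where "c \<noteq> 0" "A (- 1 / (of_nat N * \<tau>)) = c * A \<tau>" "B (- 1 / (of_nat N * \<tau>)) = c * B \<tau>"
      using law by blast
    thus "\<exists>c. c \<noteq> 0 \<and> A (- 1 / (of_nat N * \<tau>)) = c * A \<tau> \<and>
        A (- 1 / (of_nat N * \<tau>)) - B (- 1 / (of_nat N * \<tau>)) = c * (A \<tau> - B \<tau>)"
      by (intro exI[of _ c]) (simp add: right_diff_distrib)
  qed (rule nz_A nz_AB)+
  have Thol: "T holomorphic_on ball 0 r" using T(1) r(2) by (rule holomorphic_on_subset)
  show "hypergeometric_modular a (1 - b) N"
    unfolding hypergeometric_modular_def
  proof (rule modular_quotient.hypergeometric_modular_form[OF mq' r(1), where T = "\<lambda>q. T q / (T q - 1)"])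
    show "(\<lambda>q. T q / (T q - 1)) holomorphic_on ball 0 r"
      by (intro holomorphic_intros Thol) (use Tn in auto)
    show "T 0 / (T 0 - 1) = 0" using T(2) by simp
    have "((\<lambda>q. T q / (T q - 1)) has_field_derivative - deriv T 0) (at 0)"
      using \<open>(T has_field_derivative deriv T 0) (at 0)\<close> T(2) by (auto intro!: derivative_eq_intros)
    thus "deriv (\<lambda>q. T q / (T q - 1)) 0 \<noteq> 0" using T(3) by (simp add: DERIV_imp_deriv)
    show "\<forall>\<^sub>F q in at 0. theta (\<lambda>q. T q / (T q - 1)) q = T q / (T q - 1) *
      (hyp_f a (1 - b) (T q / (T q - 1)) * (1 - T q / (T q - 1)) powr ((a + (1 - b)) / 2))\<^sup>2"
      by (rule pfaff_uniformization[OF conv_ab conv_ab' r(1) Thol T(2) Tr uniform])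
    fix \<tau> assume \<tau>: "Im \<tau> > 0" "q_param 1 \<tau> \<in> ball 0 r"
    define c where "c = T (q_param 1 \<tau>)"
    have *: "B \<tau> \<noteq> 0" "A \<tau> / B \<tau> = c" using AB[OF \<tau>(1) r'(2)[OF \<tau>(2)]] by (simp_all add: c_def)
    have 1: "A \<tau> = c * B \<tau>" using *(1) unfolding *(2)[symmetric] by simp
    have 2: "A \<tau> - B \<tau> = (c - 1) * B \<tau>" unfolding 1 by (simp only: left_diff_distrib mult_1_left)
    have 3: "c \<noteq> 1" using Tn[OF \<tau>(2)] by (simp only: c_def not_False_eq_True)
    show "A \<tau> - B \<tau> \<noteq> 0 \<and> A \<tau> / (A \<tau> - B \<tau>) = T (q_param 1 \<tau>) / (T (q_param 1 \<tau>) - 1)"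
      unfolding 2 c_def[symmetric] unfolding 1 using 3 *(1) by simp
  qed
qed

lemma nonzero_near_origin:
  assumes "f holomorphic_on ball 0 1" "f 0 = (1 :: complex)"
  obtains \<rho> where "\<rho> > 0" "\<rho> \<le> 1" "\<And>q. q \<in> ball 0 \<rho> \<Longrightarrow> f q \<noteq> 0"
proof -
  have "isCont f 0"
    using holomorphic_on_imp_continuous_on[OF assms(1)] by (simp add: continuous_on_eq_continuous_at)
  from continuous_at_avoid[OF this, of 0] assms(2)
  obtain e where e: "e > 0" "\<And>q. dist 0 q < e \<Longrightarrow> f q \<noteq> 0" by auto
  show ?thesis by (rule that[of "min e 1"]) (use e in auto)
qed

lemma expands_deriv:
  assumes "expands f c1 c2 c3 c4"
  shows "f holomorphic_on ball 0 1" "f 0 = 1" "deriv f 0 = c1"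
proof -
  obtain A where A: "f holomorphic_on ball 0 1" "f has_fps_expansion A" "fps_nth A 0 = 1" "fps_nth A 1 = c1"
    using expands_fps[OF assms] by metis
  show "f holomorphic_on ball 0 1" by (rule A)
  show "f 0 = 1" "deriv f 0 = c1"
    using fps_nth_fps_expansion[OF A(2), of 0] fps_nth_fps_expansion[OF A(2), of 1] A(3,4) by simp_all
qed

text \<open>The involution fixes \<open>t = 1 - v^2 / u^2\<close> although it acts on
  \<open>u\<close> and \<open>v\<close> with opposite signs. The vanishing of \<open>Q1\<close> and
  \<open>Q2\<close> becomes the two differential equations once powers of \<open>u\<close> are
  divided out, which is possible near the cusp.\<close>

lemma level_families:
  assumes N: "N > 0" and wf: "weight_form 12 N 4 (\<lambda>\<tau>. u (q_param 1 \<tau>))" "weight_form 12 N 4 (\<lambda>\<tau>. v (q_param 1 \<tau>))"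
    and law: "\<And>\<tau>. Im \<tau> > 0 \<Longrightarrow> u (q_param 1 (- 1 / (of_nat N * \<tau>))) = (of_nat N)\<^sup>2 * \<tau> ^ 4 * u (q_param 1 \<tau>)"
      "\<And>\<tau>. Im \<tau> > 0 \<Longrightarrow> v (q_param 1 (- 1 / (of_nat N * \<tau>))) = - ((of_nat N)\<^sup>2 * \<tau> ^ 4 * v (q_param 1 \<tau>))"
    and ex: "expands u c1 c2 c3 c4" "expands v d1 d2 d3 d4" "c1 \<noteq> d1"
    and Q: "\<And>q. norm q < 1 \<Longrightarrow> Q1 u v q = 0" "\<And>q. norm q < 1 \<Longrightarrow> Q2 (16 * (a * b)) u v q = 0"
    and ab: "a + b = 1 / 2"
    and conv: "fps_conv_radius (fps_hypergeo [a, b] [1] 1) \<ge> 1" "fps_conv_radius (fps_hypergeo [a, 1 - b] [1] 1) \<ge> 1"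
  shows "hypergeometric_modular a b N \<and> hypergeometric_modular a (1 - b) N"
proof -
  note u = expands_deriv[OF ex(1)] and v = expands_deriv[OF ex(2)]
  obtain \<rho> where \<rho>: "\<rho> > 0" "\<rho> \<le> 1" "\<And>q. q \<in> ball 0 \<rho> \<Longrightarrow> u q \<noteq> 0" using nonzero_near_origin[OF u(1,2)] by metis
  have sub: "ball 0 \<rho> \<subseteq> ball (0 :: complex) 1" using \<rho> by auto
  have uv: "u holomorphic_on ball 0 \<rho>" "v holomorphic_on ball 0 \<rho>" using u v sub by (auto intro: holomorphic_on_subset)
  define T where "T = (\<lambda>q. 1 - (v q)\<^sup>2 / (u q)\<^sup>2)"
  have T: "T holomorphic_on ball 0 \<rho>" unfolding T_def by (intro holomorphic_intros uv) (simp add: \<rho>)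
  have dT: "(T has_field_derivative 2 * v q * (v q * deriv u q - u q * deriv v q) / u q ^ 3) (at q)" if q: "q \<in> ball 0 \<rho>" for q
  proof -
    have d: "(u has_field_derivative deriv u q) (at q)" "(v has_field_derivative deriv v q) (at q)"
      by (rule holomorphic_derivI[OF uv(1) open_ball q] holomorphic_derivI[OF uv(2) open_ball q])+
    have nz: "u q \<noteq> 0" by (rule \<rho>(3)[OF q])
    have "(T has_field_derivative 0 - ((2 * v q * deriv v q) * (u q)\<^sup>2 - (v q)\<^sup>2 * (2 * u q * deriv u q)) / ((u q)\<^sup>2 * (u q)\<^sup>2)) (at q)"
      unfolding T_def using nz by (auto intro!: derivative_eq_intros d)
    also have "0 - ((2 * v q * deriv v q) * (u q)\<^sup>2 - (v q)\<^sup>2 * (2 * u q * deriv u q)) / ((u q)\<^sup>2 * (u q)\<^sup>2) =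
        2 * v q * (v q * deriv u q - u q * deriv v q) / u q ^ 3"
      using nz by (simp add: divide_simps) (simp add: algebra_simps eval_nat_numeral)
    finally show ?thesis .
  qed
  have thT: "theta T q = 2 * v q * (v q * theta u q - u q * theta v q) / u q ^ 3" if q: "q \<in> ball 0 \<rho>" for q
    using theta_eqI[OF dT[OF q]] by (simp add: theta_def algebra_simps)
  have TU: "T q * (u q)\<^sup>2 = (u q)\<^sup>2 - (v q)\<^sup>2" if q: "q \<in> ball 0 \<rho>" for q
    using \<rho>(3)[OF q] by (simp add: T_def field_simps)
  have first: "(theta T q)\<^sup>2 = (T q)\<^sup>2 * u q * (1 - T q)" if q: "q \<in> ball 0 \<rho>" for q
  proof -
    note nz = \<rho>(3)[OF q]
    define X where "X = v q * theta u q - u q * theta v q"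
    have X: "4 * X\<^sup>2 = u q * ((u q)\<^sup>2 - (v q)\<^sup>2)\<^sup>2" using Q(1)[of q] q sub by (auto simp: Q1_def X_def)
    have "(theta T q)\<^sup>2 = (v q)\<^sup>2 * (4 * X\<^sup>2) / u q ^ 6"
      unfolding thT[OF q] X_def[symmetric] by (simp add: power_divide power_mult_distrib flip: power_mult)
    also have "\<dots> = (v q)\<^sup>2 / (u q)\<^sup>2 * u q * (T q)\<^sup>2"
      unfolding X TU[OF q, symmetric] using nz by (simp add: divide_simps)
    finally show ?thesis by (simp add: T_def mult_ac)
  qed
  have second: "4 * u q * theta (theta u) q - 5 * (theta u q)\<^sup>2 = 16 * (a * b) * T q * u q ^ 3" if q: "q \<in> ball 0 \<rho>" for q
  proof -
    have "4 * u q * theta (theta u) q - 5 * (theta u q)\<^sup>2 = 16 * (a * b) * ((u q)\<^sup>2 - (v q)\<^sup>2) * u q"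
      using Q(2)[of q] q sub by (auto simp: Q2_def)
    thus ?thesis unfolding TU[OF q, symmetric] by (simp add: power2_eq_square power3_eq_cube mult_ac)
  qed
  have T0: "T 0 = 0" by (simp add: T_def u v)
  \<comment> \<open>The derivative is \<open>2 (c1 - d1)\<close>.\<close>
  have "deriv T 0 \<noteq> 0" using DERIV_imp_deriv[OF dT[of 0]] \<rho>(1) ex(3) by (simp add: u v)
  note T' = T T0 this
  have B: "weight_form 12 N (4 + 4) (\<lambda>\<tau>. u (q_param 1 \<tau>) * u (q_param 1 \<tau>))"
    by (rule weight_form_mult[OF wf(1) wf(1)])
  have A: "weight_form 12 N (4 + 4) (\<lambda>\<tau>. 1 * (u (q_param 1 \<tau>) * u (q_param 1 \<tau>)) + (- 1) * (v (q_param 1 \<tau>) * v (q_param 1 \<tau>)))"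
    by (rule weight_form_lincomb[OF B weight_form_mult[OF wf(2) wf(2)]])
  have law': "\<exists>c. c \<noteq> 0 \<and>
      1 * (u (q_param 1 (- 1 / (of_nat N * \<tau>))) * u (q_param 1 (- 1 / (of_nat N * \<tau>)))) +
        (- 1) * (v (q_param 1 (- 1 / (of_nat N * \<tau>))) * v (q_param 1 (- 1 / (of_nat N * \<tau>)))) =
        c * (1 * (u (q_param 1 \<tau>) * u (q_param 1 \<tau>)) + (- 1) * (v (q_param 1 \<tau>) * v (q_param 1 \<tau>))) \<and>
      u (q_param 1 (- 1 / (of_nat N * \<tau>))) * u (q_param 1 (- 1 / (of_nat N * \<tau>))) = c * (u (q_param 1 \<tau>) * u (q_param 1 \<tau>))"
    if \<tau>: "Im \<tau> > 0" for \<tau>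
  proof -
    have "\<tau> \<noteq> 0" using \<tau> by auto
    thus ?thesis unfolding law[OF \<tau>] using N
      by (intro exI[of _ "((of_nat N)\<^sup>2 * \<tau> ^ 4)\<^sup>2"]) (simp add: power2_eq_square algebra_simps)
  qed
  have AB: "u (q_param 1 \<tau>) * u (q_param 1 \<tau>) \<noteq> 0 \<and>
      (1 * (u (q_param 1 \<tau>) * u (q_param 1 \<tau>)) + (- 1) * (v (q_param 1 \<tau>) * v (q_param 1 \<tau>))) / (u (q_param 1 \<tau>) * u (q_param 1 \<tau>)) =
      T (q_param 1 \<tau>)" if "Im \<tau> > 0" "q_param 1 \<tau> \<in> ball 0 \<rho>" for \<tau>
    using \<rho>(3)[OF that(2)] by (simp add: T_def power2_eq_square diff_divide_distrib)
  from hypergeometric_families[OF N zero_less_numeral A B law' \<rho>(1) uv(1) u(2) T' AB ab conv first second]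
  show ?thesis by blast
qed

context weight_6_series
begin

text \<open>Here \<open>t = 1728 / j\<close>. The first bracket gives
  \<open>\<theta> t = t \<psi> / \<phi>\<close>, and squaring yields the first-order equation
  because \<open>1 - t = \<psi>^2 / \<phi>^3\<close>.\<close>

lemma level_1_families:
  assumes conv: "fps_conv_radius (fps_hypergeo [1/12 :: complex, 5/12] [1] 1) \<ge> 1" "fps_conv_radius (fps_hypergeo [1/12 :: complex, 1 - 5/12] [1] 1) \<ge> 1"
  shows "hypergeometric_modular (1/12) (5/12) 1 \<and> hypergeometric_modular (1/12) (1 - 5/12) 1"
proof -
  note u = expands_deriv[OF \<phi>_expands] and v = expands_deriv[OF \<psi>_expands]
  obtain \<rho> where \<rho>: "\<rho> > 0" "\<rho> \<le> 1" "\<And>q. q \<in> ball 0 \<rho> \<Longrightarrow> \<phi> q \<noteq> 0" using nonzero_near_origin[OF u(1,2)] by metis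
  have sub: "ball 0 \<rho> \<subseteq> ball (0 :: complex) 1" using \<rho> by auto
  have uv: "\<phi> holomorphic_on ball 0 \<rho>" "\<psi> holomorphic_on ball 0 \<rho>" using u v sub by (auto intro: holomorphic_on_subset)
  define T where "T = (\<lambda>q. 1 - (\<psi> q)\<^sup>2 / \<phi> q ^ 3)"
  have T: "T holomorphic_on ball 0 \<rho>" unfolding T_def by (intro holomorphic_intros uv) (simp add: \<rho>)
  have dT: "(T has_field_derivative \<psi> q * (3 * \<psi> q * deriv \<phi> q - 2 * \<phi> q * deriv \<psi> q) / \<phi> q ^ 4) (at q)" if q: "q \<in> ball 0 \<rho>" for q
  proof -
    have d: "(\<phi> has_field_derivative deriv \<phi> q) (at q)" "(\<psi> has_field_derivative deriv \<psi> q) (at q)"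
      by (rule holomorphic_derivI[OF uv(1) open_ball q] holomorphic_derivI[OF uv(2) open_ball q])+
    have nz: "\<phi> q \<noteq> 0" by (rule \<rho>(3)[OF q])
    have "(T has_field_derivative 0 - ((2 * \<psi> q * deriv \<psi> q) * \<phi> q ^ 3 - (\<psi> q)\<^sup>2 * (3 * (\<phi> q)\<^sup>2 * deriv \<phi> q)) / (\<phi> q ^ 3 * \<phi> q ^ 3)) (at q)"
      unfolding T_def using nz by (auto intro!: derivative_eq_intros d)
    also have "0 - ((2 * \<psi> q * deriv \<psi> q) * \<phi> q ^ 3 - (\<psi> q)\<^sup>2 * (3 * (\<phi> q)\<^sup>2 * deriv \<phi> q)) / (\<phi> q ^ 3 * \<phi> q ^ 3) =
        \<psi> q * (3 * \<psi> q * deriv \<phi> q - 2 * \<phi> q * deriv \<psi> q) / \<phi> q ^ 4"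
      using nz by (simp add: divide_simps) (simp add: algebra_simps eval_nat_numeral)
    finally show ?thesis .
  qed
  have TU: "T q * \<phi> q ^ 3 = \<phi> q ^ 3 - (\<psi> q)\<^sup>2" if q: "q \<in> ball 0 \<rho>" for q
    using \<rho>(3)[OF q] by (simp add: T_def field_simps)
  have thT: "theta T q = \<psi> q * T q / \<phi> q" if q: "q \<in> ball 0 \<rho>" for q
  proof -
    have "theta T q = \<psi> q * (3 * \<psi> q * theta \<phi> q - 2 * \<phi> q * theta \<psi> q) / \<phi> q ^ 4"
      using theta_eqI[OF dT[OF q]] by (simp add: theta_def algebra_simps)
    also have "3 * \<psi> q * theta \<phi> q - 2 * \<phi> q * theta \<psi> q = \<phi> q ^ 3 - (\<psi> q)\<^sup>2" using level_1(1)[of q] q sub by auto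
    also have "\<dots> = T q * \<phi> q ^ 3" by (rule TU[OF q, symmetric])
    finally show ?thesis using \<rho>(3)[OF q] by (simp add: field_simps eval_nat_numeral)
  qed
  have first: "(theta T q)\<^sup>2 = (T q)\<^sup>2 * \<phi> q * (1 - T q)" if q: "q \<in> ball 0 \<rho>" for q
  proof -
    have "(theta T q)\<^sup>2 = (T q)\<^sup>2 * \<phi> q * ((\<psi> q)\<^sup>2 / \<phi> q ^ 3)"
      unfolding thT[OF q] using \<rho>(3)[OF q] by (simp add: field_simps eval_nat_numeral)
    thus ?thesis by (simp add: T_def)
  qed
  have second: "4 * \<phi> q * theta (theta \<phi>) q - 5 * (theta \<phi> q)\<^sup>2 = 16 * (1/12 * (5/12)) * T q * \<phi> q ^ 3" if q: "q \<in> ball 0 \<rho>" for q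
  proof -
    have "4 * \<phi> q * theta (theta \<phi>) q - 5 * (theta \<phi> q)\<^sup>2 = 5/9 * (T q * \<phi> q ^ 3)"
      unfolding TU[OF q] by (rule level_1(2)) (use q sub in auto)
    thus ?thesis by simp
  qed
  have T0: "T 0 = 0" by (simp add: T_def u v)
  have "\<beta> = - 504" by (rule \<beta>_eq[of 0]) simp
  hence "720 - 2 * \<beta> \<noteq> 0" by (simp only:) simp
  moreover have "deriv T 0 = 720 - 2 * \<beta>" using DERIV_imp_deriv[OF dT[of 0]] \<rho>(1) by (simp add: u v)
  ultimately have "deriv T 0 \<noteq> 0" by metis
  note T' = T T0 this
  have wf: "weight_form 12 1 4 (\<lambda>\<tau>. \<phi> (q_param 1 \<tau>))" "weight_form 12 1 6 (\<lambda>\<tau>. \<psi> (q_param 1 \<tau>))"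
    using weight_form_eisenstein[OF u(1) eisenstein_\<phi>, of 12 1 1] weight_form_eisenstein[OF v(1) eisenstein_\<psi>, of 12 1 1] by simp_all
  have B: "weight_form 12 1 12 (\<lambda>\<tau>. \<phi> (q_param 1 \<tau>) * (\<phi> (q_param 1 \<tau>) * \<phi> (q_param 1 \<tau>)))"
    using weight_form_mult[OF wf(1) weight_form_mult[OF wf(1) wf(1)]] by simp
  have "weight_form 12 1 12 (\<lambda>\<tau>. \<psi> (q_param 1 \<tau>) * \<psi> (q_param 1 \<tau>))" using weight_form_mult[OF wf(2) wf(2)] by simp
  note A = weight_form_lincomb[OF B this, of 1 "- 1"]
  have law: "\<exists>c. c \<noteq> 0 \<and>
      1 * (\<phi> (q_param 1 (- 1 / (of_nat 1 * \<tau>))) * (\<phi> (q_param 1 (- 1 / (of_nat 1 * \<tau>))) * \<phi> (q_param 1 (- 1 / (of_nat 1 * \<tau>))))) +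
        (- 1) * (\<psi> (q_param 1 (- 1 / (of_nat 1 * \<tau>))) * \<psi> (q_param 1 (- 1 / (of_nat 1 * \<tau>)))) =
        c * (1 * (\<phi> (q_param 1 \<tau>) * (\<phi> (q_param 1 \<tau>) * \<phi> (q_param 1 \<tau>))) + (- 1) * (\<psi> (q_param 1 \<tau>) * \<psi> (q_param 1 \<tau>))) \<and>
      \<phi> (q_param 1 (- 1 / (of_nat 1 * \<tau>))) * (\<phi> (q_param 1 (- 1 / (of_nat 1 * \<tau>))) * \<phi> (q_param 1 (- 1 / (of_nat 1 * \<tau>)))) =
        c * (\<phi> (q_param 1 \<tau>) * (\<phi> (q_param 1 \<tau>) * \<phi> (q_param 1 \<tau>)))"
    if \<tau>: "Im \<tau> > 0" for \<tau>
  proof -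
    have "\<tau> \<noteq> 0" using \<tau> by auto
    thus ?thesis unfolding of_nat_1 mult_1_left \<phi>_invert'[OF \<tau>] \<psi>_invert[OF \<tau>]
      by (intro exI[of _ "\<tau> ^ 12"]) (simp add: algebra_simps eval_nat_numeral)
  qed
  have AB: "\<phi> (q_param 1 \<tau>) * (\<phi> (q_param 1 \<tau>) * \<phi> (q_param 1 \<tau>)) \<noteq> 0 \<and>
      (1 * (\<phi> (q_param 1 \<tau>) * (\<phi> (q_param 1 \<tau>) * \<phi> (q_param 1 \<tau>))) + (- 1) * (\<psi> (q_param 1 \<tau>) * \<psi> (q_param 1 \<tau>))) /
        (\<phi> (q_param 1 \<tau>) * (\<phi> (q_param 1 \<tau>) * \<phi> (q_param 1 \<tau>))) =
      T (q_param 1 \<tau>)" if "Im \<tau> > 0" "q_param 1 \<tau> \<in> ball 0 \<rho>" for \<tau>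
    using \<rho>(3)[OF that(2)] by (simp add: T_def power2_eq_square power3_eq_cube diff_divide_distrib)
  have "1/12 + 5/12 = (1/2 :: complex)" by simp
  from hypergeometric_families[OF zero_less_one zero_less_numeral A B law \<rho>(1) uv(1) u(2) T' AB this conv first second]
  show ?thesis by blast
qed

lemma weight_form_linear:
  assumes "i dvd N" "j dvd N" "i dvd 12" "j dvd 12"
  shows "weight_form 12 N 4 (\<lambda>\<tau>. c * \<phi> (q_param 1 \<tau> ^ i) + d * \<phi> (q_param 1 \<tau> ^ j))"
  using assms by (intro weight_form_lincomb weight_form_eisenstein[OF \<phi>_holomorphic eisenstein_\<phi>]) simp_all

lemma level_2_families:
  assumes conv: "fps_conv_radius (fps_hypergeo [1/8 :: complex, 3/8] [1] 1) \<ge> 1" "fps_conv_radius (fps_hypergeo [1/8 :: complex, 1 - 3/8] [1] 1) \<ge> 1"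
  shows "hypergeometric_modular (1/8) (3/8) 2 \<and> hypergeometric_modular (1/8) (1 - 3/8) 2"
proof (rule level_families[where u = u2 and v = v2, OF _ _ _ _ _ forms_expand_numeric(1,2) _ Q1_level_2 _ _ conv])
  show "weight_form 12 2 4 (\<lambda>\<tau>. u2 (q_param 1 \<tau>))" "weight_form 12 2 4 (\<lambda>\<tau>. v2 (q_param 1 \<tau>))"
    using weight_form_linear[of 1 2 2 "1/5" "4/5"] weight_form_linear[of 1 2 2 "-1/3" "4/3"]
    by (simp_all add: u2_def v2_def add_divide_distrib diff_divide_distrib del: One_nat_def)
qed (use fricke_laws_2 Q2_level_2 in \<open>simp_all del: One_nat_def\<close>)

lemma level_3_families:
  assumes conv: "fps_conv_radius (fps_hypergeo [1/6 :: complex, 1/3] [1] 1) \<ge> 1" "fps_conv_radius (fps_hypergeo [1/6 :: complex, 1 - 1/3] [1] 1) \<ge> 1"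
  shows "hypergeometric_modular (1/6) (1/3) 3 \<and> hypergeometric_modular (1/6) (1 - 1/3) 3"
proof (rule level_families[where u = u3 and v = v3, OF _ _ _ _ _ forms_expand_numeric(3,4) _ level_3(1) _ _ conv])
  show "weight_form 12 3 4 (\<lambda>\<tau>. u3 (q_param 1 \<tau>))" "weight_form 12 3 4 (\<lambda>\<tau>. v3 (q_param 1 \<tau>))"
    using weight_form_linear[of 1 3 3 "1/10" "9/10"] weight_form_linear[of 1 3 3 "-1/8" "9/8"]
    by (simp_all add: u3_def v3_def add_divide_distrib diff_divide_distrib del: One_nat_def)
qed (use fricke_laws_3 level_3(2) in \<open>simp_all del: One_nat_def\<close>)

lemma level_4_families:
  assumes conv: "fps_conv_radius (fps_hypergeo [1/4 :: complex, 1/4] [1] 1) \<ge> 1" "fps_conv_radius (fps_hypergeo [1/4 :: complex, 1 - 1/4] [1] 1) \<ge> 1"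
  shows "hypergeometric_modular (1/4) (1/4) 4 \<and> hypergeometric_modular (1/4) (1 - 1/4) 4"
proof (rule level_families[where u = u4 and v = v4, OF _ _ _ _ _ forms_expand_numeric(5,6) _ level_4(1) _ _ conv])
  show "weight_form 12 4 4 (\<lambda>\<tau>. u4 (q_param 1 \<tau>))" "weight_form 12 4 4 (\<lambda>\<tau>. v4 (q_param 1 \<tau>))"
    using weight_form_lincomb[OF weight_form_linear[of 1 4 4 "1/15" "16/15"] weight_form_linear[of 2 4 2 "-2/15" 0], of 1 1]
      weight_form_linear[of 1 4 4 "-1/15" "16/15"]
    by (simp_all add: u4_def v4_def add_divide_distrib diff_divide_distrib del: One_nat_def)
  fix \<tau> :: complex assume \<tau>: "Im \<tau> > 0"
  \<comment> \<open>This undoes the rescaling: inversion at \<open>2 \<tau>\<close> in the parameter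
    of width 2 is the involution of level 4 at \<tau>.\<close>
  have "q_param 1 \<tau> = q_param 2 (2 * \<tau>)" "q_param 1 (- 1 / (of_nat 4 * \<tau>)) = q_param 2 (- 1 / (2 * \<tau>))"
    by (simp_all add: q_param_def mult_ac)
  thus "u4 (q_param 1 (- 1 / (of_nat 4 * \<tau>))) = (of_nat 4)\<^sup>2 * \<tau> ^ 4 * u4 (q_param 1 \<tau>)"
    "v4 (q_param 1 (- 1 / (of_nat 4 * \<tau>))) = - ((of_nat 4)\<^sup>2 * \<tau> ^ 4 * v4 (q_param 1 \<tau>))"
    using fricke_laws_4(1,2)[of "2 * \<tau>"] \<tau> by (simp_all add: power_mult_distrib del: One_nat_def)
qed (use level_4(2) in \<open>simp_all del: One_nat_def\<close>)

end

lemma fps_conv_radius_hypergeo_unit_interval: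
  assumes "Im a = 0" "0 \<le> Re a" "Re a \<le> 1" "Im b = 0" "0 \<le> Re b" "Re b \<le> 1"
  shows "fps_conv_radius (fps_hypergeo [a, b] [1] 1) \<ge> 1"
proof -
  have "a = complex_of_real (Re a)" "b = complex_of_real (Re b)" using assms by (auto simp: complex_eq_iff)
  thus ?thesis using fps_conv_radius_hypergeo[of "Re a" "Re b"] assms by metis
qed

theorem theorem5p2:
  fixes a b :: complex and N :: nat
  assumes "(a, b, N) \<in>
    {(1/12, 5/12, 1), (1/12, 7/12, 1), (1/8, 3/8, 2), (1/8, 5/8, 2),
     (1/6, 1/3, 3), (1/6, 2/3, 3), (1/4, 1/4, 4), (1/4, 3/4, 4)}"
  shows "solves_system a b (hyp_F_xy a b) \<and>
    (\<exists>t. modular_function (Gamma0_star N) t \<and> \<not> t constant_on upper_half \<and>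
       (\<exists>Y>0. \<exists>\<Phi> \<nu>.
          t holomorphic_on {\<tau>. Im \<tau> > Y} \<and> (\<forall>\<tau>. Im \<tau> > Y \<longrightarrow> norm (t \<tau>) < 1) \<and>
          (\<forall>\<tau>1 \<tau>2. Im \<tau>1 > Y \<and> Im \<tau>2 > Y \<longrightarrow> \<Phi> (\<tau>1, \<tau>2) = hyp_F a b (t \<tau>1) (t \<tau>2) ^ 2) \<and>
          modular_form2 2 1 1 (Gamma0_star N) (Gamma0_star N) \<nu> \<Phi>))"
proof -
  have "fps_conv_radius (fps_hypergeo [a, b] [1] 1) \<ge> 1"
    using assms unfolding insert_iff prod.inject empty_iff
    by (elim disjE conjE FalseE; hypsubst; intro fps_conv_radius_hypergeo_unit_interval; simp)
  then interpret gauss_hypergeometric a b by unfold_locales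
  obtain \<alpha> r where 4: "\<alpha> \<noteq> 0" "r holomorphic_on ball 0 1"
    "\<And>\<tau> q. Im \<tau> > 0 \<Longrightarrow> q = exp (2 * of_real pi * \<i> * \<tau>) \<Longrightarrow>
       eisenstein 4 \<tau> = 1 + \<alpha> * (q + 9 * q ^ 2 + 28 * q ^ 3 + 73 * q ^ 4) + q ^ 5 * r q"
    by (rule eisenstein_4_expansion) blast
  obtain \<beta> s where 6: "s holomorphic_on ball 0 1"
    "\<And>\<tau> q. Im \<tau> > 0 \<Longrightarrow> q = exp (2 * of_real pi * \<i> * \<tau>) \<Longrightarrow>
       eisenstein 6 \<tau> = 1 + \<beta> * (q + 33 * q ^ 2 + 244 * q ^ 3 + 1057 * q ^ 4) + q ^ 5 * s q"
    by (rule eisenstein_6_expansion) blast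
  interpret e: weight_6_series \<alpha> r \<beta> s by unfold_locales (fact 4 6)+
  note families = e.level_1_families e.level_2_families e.level_3_families e.level_4_families
  have complements: "1 - 5/12 = (7/12 :: complex)" "1 - 3/8 = (5/8 :: complex)" "1 - 1/3 = (2/3 :: complex)"
    "1 - 1/4 = (3/4 :: complex)" by simp_all
  have "hypergeometric_modular (1/12) (5/12) 1 \<and> hypergeometric_modular (1/12) (7/12) 1"
    "hypergeometric_modular (1/8) (3/8) 2 \<and> hypergeometric_modular (1/8) (5/8) 2"
    "hypergeometric_modular (1/6) (1/3) 3 \<and> hypergeometric_modular (1/6) (2/3) 3"
    "hypergeometric_modular (1/4) (1/4) 4 \<and> hypergeometric_modular (1/4) (3/4) 4"
    by (rule families[unfolded complements]; intro fps_conv_radius_hypergeo_unit_interval; simp)+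
  hence "hypergeometric_modular a b N"
    using assms unfolding insert_iff prod.inject empty_iff by metis
  thus ?thesis using solves_system_hyp_F_xy unfolding hypergeometric_modular_def by blast
qed

end
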